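(* Let $n\ge 3$ be odd and let $i,j$ be integers with $1\le i,j\le n$ and $j-i\ge 2$. With the notation of the context (in particular $\Delta^v_{i,j}$, $p_i$, $y_i$, $z_i$, $o_{i,j}$, $e_{i,j}$, $A_{i,j}$), the following hold. (a) If $j$ is even, then $$\Delta^v_{i,j}=\Delta^v_{i,j-1}y_j-v^{A_{i,j}}\Delta^v_{i,j-3}p_{j-2}z_{j+1}$$ $$=v^{-(|y_j|,o_{i,j-1})}y_j\Delta^v_{i,j-1}-v^{-A_{i,j}-(|y_j|+|y_{j-2}|,o_{i,j-3})-(|y_{j-1}|,e_{i,j-4})}z_{j+1}p_{j-2}\Delta^v_{i,j-3}.$$ If $j$ is odd, then $$\Delta^v_{i,j}=y_j\Delta^v_{i,j-1}-v^{A_{i,j}}z_{j+1}p_{j-2}\Delta^v_{i,j-3}$$ $$=v^{-(|y_j|,e_{i,j-1})}\Delta^v_{i,j-1}y_j-v^{-A_{i,j}-(|y_j|+|y_{j-2}|,e_{i,j-3})-(|y_{j-1}|,o_{i,j-4})}\Delta^v_{i,j-3}p_{j-2}z_{j+1}.$$ (b) If $j$ is even, then $$\Delta^v_{i,j}z_j=\Delta^v_{i,j-1}p_j+v^{1-(|y_{j-1}|,e_{i,j-2})}\Delta^v_{i,j-2}p_{j-1}z_{j+1}.$$ If $j$ is odd, then $$\Delta^v_{i,j}z_j=v^{-(|y_j|,e_{i,j-1})}\Delta^v_{i,j-1}p_j+v^{-1-(|y_j|,e_{i,j-1})}\Delta^v_{i,j-2}p_{j-1}z_{j+1}.$$ (c)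 Suppose $j+1\le n$. If $j$ is even, then $$y_{j+1}\Delta^v_{i,j}=v^{-(|y_{j+1}|,e_{i,j})}\Delta^v_{i,j}y_{j+1}+v^{-1-(|y_{j-1}|,e_{i,j-2})}(v^{-1}-v)\Delta^v_{i,j-2}p_{j-1}z_{j+2}.$$ If $j$ is odd, then $$y_{j+1}\Delta^v_{i,j}=v\Delta^v_{i,j}y_{j+1}+v^{1-(|y_j|,e_{i,j-3})}(v-v^{-1})\Delta^v_{i,j-2}p_{j-1}z_{j+2}.$$ (d) Suppose $j+2\le n$. If $j$ is even, then $\Delta^v_{i,j}y_{j+2}=v^{-1}y_{j+2}\Delta^v_{i,j}$; if $j$ is odd, then $\Delta^v_{i,j}y_{j+2}=v\,y_{j+2}\Delta^v_{i,j}$.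
   Context: Quantum group. $n\ge3$ is a fixed odd integer and $v$ an indeterminate. Put $a_{ij}=2$ if $i=j$, $a_{ij}=-1$ if $|i-j|=1$, $a_{ij}=0$ otherwise ($1\le i,j\le n$). $R=\bigoplus_{i=1}^n\mathbb{Z}\alpha_i$ carries the symmetric bilinear form with $(\alpha_i,\alpha_j)=a_{ij}$. $U_v(\mathfrak g)$, $\mathfrak g=\mathfrak{sl}_{n+1}$, is the $\mathbb{Q}(v)$-algebra generated by $E_i,F_i,K_i^{\pm1}$ ($1\le i\le n$) with relations $K_iK_j=K_jK_i$, $K_iK_i^{-1}=K_i^{-1}K_i=1$, $K_iE_jK_i^{-1}=v^{a_{ij}}E_j$, $K_iF_jK_i^{-1}=v^{-a_{ij}}F_j$, $E_iF_j-F_jE_i=\delta_{ij}\frac{K_i-K_i^{-1}}{v-v^{-1}}$; $E_i^2E_j-(v+v^{-1})E_iE_jE_i+E_jE_i^2=0$ and likewise for the $F$'s if $|i-j|=1$; $E_iE_j=E_jE_i$, $F_iF_j=F_jF_i$ if $|i-j|\ge2$. $U_v(\mathfrak n)$ is the subalgebra generated by the $E_i$; it is $R$-graded with $\deg E_i=\alpha_i$, and $|A|$ denotes the degree of a homogeneous $A$. $\sigma$ is the $\mathbb{Q}$-linear antiautomorphism of $U_v(\mathfrak n)$ with $\sigma(v)=v^{-1}$, $\sigma(E_i)=E_i$. Automorphisms. $T_i$ ($1\le i\le n$) is the $\mathbb{Q}(v)$-algebra automorphism of $U_v(\mathfrak g)$ with $T_i(E_i)=-K_i^{-1}F_i$,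 $T_i(F_i)=-E_iK_i$; $T_i(E_j)=E_jE_i-v^{-1}E_iE_j$, $T_i(F_j)=F_iF_j-vF_jF_i$ if $|i-j|=1$; $T_i(E_j)=E_j$, $T_i(F_j)=F_j$ if $|i-j|\ge2$; $T_i(K_j)=K_jK_i^{-a_{ij}}$. Convention: $T_k=\mathrm{id}$ for $k\notin\{1,\dots,n\}$. Generators. For odd $i$ in $[1,n]$: $u_i=E_i$, $w_i=T_{i-2}T_iT_{i+2}T_{i-1}T_{i+1}(E_i)$. For even $i$ in $[2,n-1]$: $v_i=T_{i-1}T_{i+1}(E_i)$, $x_i=T_{i-3}T_{i-1}T_{i+1}T_{i+3}T_{i-2}T_iT_{i+2}T_{i-1}T_{i+1}(E_i)$. These lie in $U_v(\mathfrak n)$. Denote by $E(\beta_1),\dots,E(\beta_{2n})$ the list $u_1,u_3,\dots,u_n,v_2,v_4,\dots,v_{n-1},w_1,w_3,\dots,w_n,x_2,x_4,\dots,x_{n-1}$ in this order, where $\beta_k$ is the degree of the $k$-th element. (They are the root vectors for the reduced expression $w=s_1s_3\cdots s_n s_2s_4\cdots s_{n-1}s_1s_3\cdots s_ns_2s_4\cdots s_{n-1}$.) For $\mathbf a\in\mathbb{N}^{2n}$ put $E[\mathbf a]=\prod_{k=1}^{2n}\frac{1}{[a_k]!}E(\beta_k)^{a_k}$ (ordered by increasing $k$), $[m]=\frac{v^m-v^{-m}}{v-v^{-1}}$, $[m]!=[m]\cdots[1]$. The $E[\mathbf a]$ form a $\mathbb{Q}(v)$-basis of a subalgebra $U_v^+(w)\subset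 U_v(\mathfrak n)$. Duals. Kashiwara's form $(\cdot,\cdot)$ on $U_v(\mathfrak n)$ is the nondegenerate symmetric bilinear form with $(1,1)=1$ and $(E_i'(x),y)=(x,E_iy)$, where $E'_i$ is the linear operator with $E_i'(E_j)=\delta_{ij}$ and $E_i'(xy)=E_i'(x)y+v^{(\alpha_i,|x|)}xE_i'(y)$ for homogeneous $x,y$. The $E[\mathbf a]$ are orthogonal. $E^*(\beta_k)$, $E[\mathbf a]^*$ are the scalar multiples of $E(\beta_k)$, $E[\mathbf a]$ with $(E(\beta_k),E^*(\beta_k))=1$, $(E[\mathbf a],E[\mathbf a]^* )=1$; explicitly $E^*(\beta_k)=(1-v^{-2})^{-(h-1)}E(\beta_k)$ with $h$ the number of simple roots in $\beta_k$, and $E[\mathbf a]^*=v^{-\sum_k\binom{a_k}{2}}E^*(\beta_1)^{a_1}\cdots E^*(\beta_{2n})^{a_{2n}}$. Write $u_i^*$ etc. for the duals and put $y_i=u_i^*$, $z_i=w_i^*$ for $i$ odd, $z_i=v_i^*$, $y_i=x_i^*$ for $i$ even; $z_0=z_{n+1}=1$. Dual canonical basis. For $1\le i\le n$ let $\mathbf v_i\in\mathbb{Z}^{2n}$ be the vector with entry $1$ at the positions of $y_i$ and $z_i$, $-1$ at the positions of $z_{i-1}$ and $z_{i+1}$ (ignoring $z_0,z_{n+1}$), $0$ elsewhere. Let $S(\mathbf a)=\{\mathbf b\in\mathbb{N}^{2n}:\mathbf b\ne\mathbf a,\ \mathbf a-\mathbf b\in\bigoplus_i\mathbb{N}\mathbf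 v_i\}$. For $\gamma=\sum d_i\alpha_i$ put $N(\gamma)=\frac12(\gamma,\gamma)-\sum d_i$, and $N(\mathbf a)=N(\sum_k a_k\beta_k)$. The dual canonical basis $\mathcal B^*=\{B[\mathbf a]^*\}$ consists of the unique elements with $B[\mathbf a]^*-E[\mathbf a]^*\in\bigoplus_{\mathbf b\in S(\mathbf a)}v^{-1}\mathbb{Z}[v^{-1}]E[\mathbf b]^*$ and $\sigma(B[\mathbf a]^* )=v^{N(\mathbf a)}B[\mathbf a]^*$; $E[\mathbf a]^*$ is the leading term of $B[\mathbf a]^*$. Special elements. $p_i=y_iz_i-v^{-1}z_{i-1}z_{i+1}$ for $i$ odd, $p_i=z_iy_i-v^{-1}z_{i-1}z_{i+1}$ for $i$ even ($1\le i\le n$). For $1\le i\le j\le n$, $\Delta^v_{i,j}\in\mathcal B^*$ is the dual canonical basis element with leading term $\prod_{i\le r\le j,\ r\text{ odd}}y_r\prod_{i\le r\le j,\ r\text{ even}}y_r$; convention $\Delta^v_{i,i-1}=1$. Put $o_{i,j}=\sum_{i\le s\le j,\ s\text{ odd}}|y_s|$, $e_{i,j}=\sum_{i\le s\le j,\ s\text{ even}}|y_s|$ (empty sums are $0$). For $j-i\ge2$ put $A_{i,j}=-1$ if $j-i\le3$ and $A_{i,j}=-2$ if $j-i\ge4$. In exponents $(\cdot,\cdot)$ is the form on $R$. *)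

theory Defs
  imports "HOL-Computational_Algebra.Computational_Algebra" "HOL-Library.Poly_Mapping"
    "HOL-Library.Cardinality"
begin

section \<open>The base field and the root lattice\<close>

type_synonym qv = "rat poly fract"

definition qvar :: qv where
  "qvar = Fract [:0, 1:] 1"

definition qint :: "nat \<Rightarrow> qv" where
  "qint m = (qvar ^ m - inverse qvar ^ m) / (qvar - inverse qvar)"

definition qfact :: "nat \<Rightarrow> qv" where
  "qfact m = (\<Prod>k = 1..m. qint k)"

text \<open>The set \<open>v\<^sup>-\<^sup>1\<int>[v\<^sup>-\<^sup>1]\<close>.\<close>

definition inv_v_int_polys :: "qv set" where
  "inv_v_int_polys = {inverse qvar * poly (map_poly of_int p) (inverse qvar) | p :: int poly. True}"

definition cartan :: "int \<Rightarrow> int \<Rightarrow> int" where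
  "cartan i j = (if i = j then 2 else if \<bar>i - j\<bar> = 1 then -1 else 0)"

text \<open>The root lattice \<open>R\<close> sits in here as the elements supported in \<open>{1..n}\<close>.\<close>

type_synonym root_lattice = "int \<Rightarrow>\<^sub>0 int"

definition simple_root :: "int \<Rightarrow> root_lattice" where
  "simple_root i = Poly_Mapping.single i 1"

definition rform :: "root_lattice \<Rightarrow> root_lattice \<Rightarrow> int" where
  "rform \<gamma> \<delta> =
     (\<Sum>i \<in> Poly_Mapping.keys \<gamma>. \<Sum>j \<in> Poly_Mapping.keys \<delta>.
        Poly_Mapping.lookup \<gamma> i * Poly_Mapping.lookup \<delta> j * cartan i j)"

definition height :: "root_lattice \<Rightarrow> int" where
  "height \<gamma> = (\<Sum>i \<in> Poly_Mapping.keys \<gamma>. Poly_Mapping.lookup \<gamma> i)"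

text \<open>\<open>(\<gamma>, \<gamma>)\<close> is always even, so the integer division is exact.\<close>

definition Nweight :: "root_lattice \<Rightarrow> int" where
  "Nweight \<gamma> = rform \<gamma> \<gamma> div 2 - height \<gamma>"


section \<open>The quantized enveloping algebra\<close>

text \<open>
  Words form a free monoid (written additively, as required by the convolution product on
  \<open>\<Rightarrow>\<^sub>0\<close>), so \<open>word \<Rightarrow>\<^sub>0 qv\<close> is the free associative unital algebra on the letters.
\<close>

datatype letter = LE int | LF int | LK int | LKinv int

datatype word = Word "letter list"

instantiation word :: monoid_add
begin

definition zero_word :: word where "zero_word = Word []"

fun plus_word :: "word \<Rightarrow> word \<Rightarrow> word" where
  "plus_word (Word a) (Word b) = Word (a @ b)"

instance
proof
  fix a b c :: word
  show "a + b + c = a + (b + c)" by (cases a; cases b; cases c) simp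
  show "0 + a = a" by (cases a) (simp add: zero_word_def)
  show "a + 0 = a" by (cases a) (simp add: zero_word_def)
qed

end

type_synonym free_alg = "word \<Rightarrow>\<^sub>0 qv"

abbreviation fgen :: "letter \<Rightarrow> free_alg" where
  "fgen l \<equiv> Poly_Mapping.single (Word [l]) 1"

abbreviation fconst :: "qv \<Rightarrow> free_alg" where
  "fconst c \<equiv> Poly_Mapping.single 0 c"

text \<open>
  Letters are indexed by all integers; those with index outside \<open>{1..n}\<close> are set to zero, which
  leaves exactly the presentation on the generators with index in \<open>{1..n}\<close>.
\<close>

inductive_set relators :: "int \<Rightarrow> free_alg set" for n :: int where
  KK: "\<lbrakk>i \<in> {1..n}; j \<in> {1..n}\<rbrakk> \<Longrightarrow>
    fgen (LK i) * fgen (LK j) - fgen (LK j) * fgen (LK i) \<in> relators n"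
| K_Kinv: "i \<in> {1..n} \<Longrightarrow> fgen (LK i) * fgen (LKinv i) - 1 \<in> relators n"
| Kinv_K: "i \<in> {1..n} \<Longrightarrow> fgen (LKinv i) * fgen (LK i) - 1 \<in> relators n"
| K_E: "\<lbrakk>i \<in> {1..n}; j \<in> {1..n}\<rbrakk> \<Longrightarrow>
    fgen (LK i) * fgen (LE j) * fgen (LKinv i)
      - fconst (qvar powi cartan i j) * fgen (LE j) \<in> relators n"
| K_F: "\<lbrakk>i \<in> {1..n}; j \<in> {1..n}\<rbrakk> \<Longrightarrow>
    fgen (LK i) * fgen (LF j) * fgen (LKinv i)
      - fconst (qvar powi (- cartan i j)) * fgen (LF j) \<in> relators n"
| E_F: "\<lbrakk>i \<in> {1..n}; j \<in> {1..n}\<rbrakk> \<Longrightarrow>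
    fgen (LE i) * fgen (LF j) - fgen (LF j) * fgen (LE i)
      - (if i = j then fconst (1 / (qvar - inverse qvar)) * (fgen (LK i) - fgen (LKinv i)) else 0)
    \<in> relators n"
| serre_E: "\<lbrakk>i \<in> {1..n}; j \<in> {1..n}; \<bar>i - j\<bar> = 1\<rbrakk> \<Longrightarrow>
    fgen (LE i) ^ 2 * fgen (LE j)
      - fconst (qvar + inverse qvar) * (fgen (LE i) * fgen (LE j) * fgen (LE i))
      + fgen (LE j) * fgen (LE i) ^ 2 \<in> relators n"
| serre_F: "\<lbrakk>i \<in> {1..n}; j \<in> {1..n}; \<bar>i - j\<bar> = 1\<rbrakk> \<Longrightarrow>
    fgen (LF i) ^ 2 * fgen (LF j)
      - fconst (qvar + inverse qvar) * (fgen (LF i) * fgen (LF j) * fgen (LF i))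
      + fgen (LF j) * fgen (LF i) ^ 2 \<in> relators n"
| comm_E: "\<lbrakk>i \<in> {1..n}; j \<in> {1..n}; \<bar>i - j\<bar> \<ge> 2\<rbrakk> \<Longrightarrow>
    fgen (LE i) * fgen (LE j) - fgen (LE j) * fgen (LE i) \<in> relators n"
| comm_F: "\<lbrakk>i \<in> {1..n}; j \<in> {1..n}; \<bar>i - j\<bar> \<ge> 2\<rbrakk> \<Longrightarrow>
    fgen (LF i) * fgen (LF j) - fgen (LF j) * fgen (LF i) \<in> relators n"
| out_of_range: "\<lbrakk>i \<notin> {1..n}; l \<in> {LE i, LF i, LK i, LKinv i}\<rbrakk> \<Longrightarrow> fgen l \<in> relators n"

text \<open>The two-sided ideal generated by the relators.\<close>

inductive_set rel_ideal :: "int \<Rightarrow> free_alg set" for n :: int where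
  zero: "0 \<in> rel_ideal n"
| base: "r \<in> relators n \<Longrightarrow> r \<in> rel_ideal n"
| add: "\<lbrakk>x \<in> rel_ideal n; y \<in> rel_ideal n\<rbrakk> \<Longrightarrow> x + y \<in> rel_ideal n"
| mult_left: "x \<in> rel_ideal n \<Longrightarrow> a * x \<in> rel_ideal n"
| mult_right: "x \<in> rel_ideal n \<Longrightarrow> x * a \<in> rel_ideal n"

lemma rel_ideal_uminus: "x \<in> rel_ideal n \<Longrightarrow> - x \<in> rel_ideal n"
  using rel_ideal.mult_left[of x n "- 1"] by simp

lemma rel_ideal_diff: "\<lbrakk>x \<in> rel_ideal n; y \<in> rel_ideal n\<rbrakk> \<Longrightarrow> x - y \<in> rel_ideal n"
  using rel_ideal.add[of x n "- y"] rel_ideal_uminus[of y n] by simp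

text \<open>
  The type \<open>'n uq\<close> is \<open>U\<^sub>v(sl\<^sub>n\<^sub>+\<^sub>1)\<close> with \<open>n = CARD('n)\<close>; the type parameter serves
  only to carry the rank.
\<close>

quotient_type 'n uq = "free_alg" / "\<lambda>x y :: free_alg. x - y \<in> rel_ideal (int CARD('n))"
proof (rule equivpI)
  show "reflp (\<lambda>x y :: free_alg. x - y \<in> rel_ideal (int CARD('n)))"
    by (simp add: reflp_def rel_ideal.zero)
  show "symp (\<lambda>x y :: free_alg. x - y \<in> rel_ideal (int CARD('n)))"
    by (rule sympI) (metis minus_diff_eq rel_ideal_uminus)
  show "transp (\<lambda>x y :: free_alg. x - y \<in> rel_ideal (int CARD('n)))"
  proof (rule transpI)
    fix x y z :: free_alg
    assume "x - y \<in> rel_ideal (int CARD('n))" "y - z \<in> rel_ideal (int CARD('n))"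
    from rel_ideal.add[OF this] show "x - z \<in> rel_ideal (int CARD('n))" by simp
  qed
qed

text \<open>
  The counit: \<open>E\<^sub>i, F\<^sub>i \<mapsto> 0\<close> and \<open>K\<^sub>i \<mapsto> 1\<close> for \<open>i\<close> in range. It shows that the ideal is proper.
\<close>

fun counit_letter :: "int \<Rightarrow> letter \<Rightarrow> qv" where
  "counit_letter n (LE i) = 0"
| "counit_letter n (LF i) = 0"
| "counit_letter n (LK i) = (if i \<in> {1..n} then 1 else 0)"
| "counit_letter n (LKinv i) = (if i \<in> {1..n} then 1 else 0)"

fun counit_word :: "int \<Rightarrow> word \<Rightarrow> qv" where
  "counit_word n (Word ls) = prod_list (map (counit_letter n) ls)"

lemma counit_word_add: "counit_word n (a + b) = counit_word n a * counit_word n b"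
  by (cases a; cases b) simp

definition counit :: "int \<Rightarrow> free_alg \<Rightarrow> qv" where
  "counit n f = Sum_any (\<lambda>w. Poly_Mapping.lookup f w * counit_word n w)"

lemma counit_add: "counit n (f + g) = counit n f + counit n g"
proof -
  have fin: "finite {w. Poly_Mapping.lookup h w * counit_word n w \<noteq> 0}" for h :: free_alg
    by (rule finite_subset[OF _ finite_lookup[of h]]) auto
  show ?thesis
    unfolding counit_def lookup_add ring_distribs by (rule Sum_any.distrib[OF fin fin])
qed

lemma counit_single: "counit n (Poly_Mapping.single w c) = c * counit_word n w"
proof -
  have "Poly_Mapping.lookup (Poly_Mapping.single w c) u * counit_word n u
      = (c * counit_word n w when u = w)" for u
    by (simp add: lookup_single when_def)
  then show ?thesis by (simp add: counit_def)
qed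

lemma counit_zero: "counit n 0 = 0"
  by (simp add: counit_def)

lemma free_alg_induct [case_names single sum]:
  fixes f :: free_alg
  assumes "\<And>w c. P (Poly_Mapping.single w c)" and "\<And>f g. \<lbrakk>P f; P g\<rbrakk> \<Longrightarrow> P (f + g)"
  shows "P f"
proof (induction f rule: update_induct)
  case const
  show ?case using assms(1)[of 0 0] by simp
next
  case (update f w c)
  have "Poly_Mapping.update w c f = f + Poly_Mapping.single w c"
    by (rule poly_mapping_eqI)
      (use update.hyps in \<open>auto simp: lookup_update lookup_add lookup_single when_def in_keys_iff\<close>)
  with update.IH show ?case by (simp add: assms)
qed

lemma counit_mult: "counit n (f * g) = counit n f * counit n g"
proof (induction f rule: free_alg_induct)
  case (single w c)
  show ?case
  proof (induction g rule: free_alg_induct)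
    case (single u d)
    show ?case by (simp add: mult_single counit_single counit_word_add)
  next
    case (sum g h)
    then show ?case by (simp add: counit_add ring_distribs)
  qed
next
  case (sum f h)
  then show ?case by (simp add: counit_add ring_distribs)
qed

lemma counit_uminus: "counit n (- f) = - counit n f"
  using counit_add[of n f "- f"] by (simp add: counit_zero eq_neg_iff_add_eq_0 add.commute)

lemma counit_diff: "counit n (f - g) = counit n f - counit n g"
  using counit_add[of n f "- g"] by (simp add: counit_uminus)

lemma counit_one: "counit n 1 = 1"
  unfolding single_one[symmetric] counit_single by (simp add: zero_word_def)

lemma counit_relators: "r \<in> relators n \<Longrightarrow> counit n r = 0"
  by (induction rule: relators.induct)
     (auto simp: counit_add counit_diff counit_mult counit_single counit_one counit_zero
        power2_eq_square)

lemma counit_rel_ideal: "r \<in> rel_ideal n \<Longrightarrow> counit n r = 0"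
  by (induction rule: rel_ideal.induct)
     (auto simp: counit_add counit_mult counit_zero counit_relators)

instantiation uq :: (type) ring_1
begin

lift_definition zero_uq :: "'a uq" is "0 :: free_alg" .

lift_definition one_uq :: "'a uq" is "1 :: free_alg" .

lift_definition plus_uq :: "'a uq \<Rightarrow> 'a uq \<Rightarrow> 'a uq" is "(+) :: free_alg \<Rightarrow> _"
  by (metis add_diff_add rel_ideal.add)

lift_definition uminus_uq :: "'a uq \<Rightarrow> 'a uq" is "uminus :: free_alg \<Rightarrow> _"
  by (metis minus_diff_minus rel_ideal_uminus)

lift_definition minus_uq :: "'a uq \<Rightarrow> 'a uq \<Rightarrow> 'a uq" is "(-) :: free_alg \<Rightarrow> _"
proof -
  fix a b c d :: free_alg
  assume "a - b \<in> rel_ideal (int CARD('a))" "c - d \<in> rel_ideal (int CARD('a))"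
  from rel_ideal_diff[OF this] show "a - c - (b - d) \<in> rel_ideal (int CARD('a))"
    by (simp add: algebra_simps)
qed

lift_definition times_uq :: "'a uq \<Rightarrow> 'a uq \<Rightarrow> 'a uq" is "(*) :: free_alg \<Rightarrow> _"
proof -
  fix a b c d :: free_alg
  assume *: "a - b \<in> rel_ideal (int CARD('a))" "c - d \<in> rel_ideal (int CARD('a))"
  have "a * c - b * d = (a - b) * c + b * (c - d)" by (simp add: algebra_simps)
  with * show "a * c - b * d \<in> rel_ideal (int CARD('a))"
    by (simp add: rel_ideal.add rel_ideal.mult_left rel_ideal.mult_right)
qed

instance
proof
  fix a b c :: "'a uq"
  show "a + b + c = a + (b + c)" by transfer (simp add: algebra_simps rel_ideal.zero)
  show "a + b = b + a" by transfer (simp add: algebra_simps rel_ideal.zero)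
  show "0 + a = a" by transfer (simp add: rel_ideal.zero)
  show "- a + a = 0" by transfer (simp add: rel_ideal.zero)
  show "a - b = a + - b" by transfer (simp add: rel_ideal.zero)
  show "a * b * c = a * (b * c)" by transfer (simp add: mult.assoc rel_ideal.zero)
  show "(a + b) * c = a * c + b * c" by transfer (simp add: algebra_simps rel_ideal.zero)
  show "a * (b + c) = a * b + a * c" by transfer (simp add: algebra_simps rel_ideal.zero)
  show "1 * a = a" by transfer (simp add: rel_ideal.zero)
  show "a * 1 = a" by transfer (simp add: rel_ideal.zero)
  show "(0 :: 'a uq) \<noteq> 1"
    by transfer (auto dest!: counit_rel_ideal simp: counit_uminus counit_one)
qed

end

text \<open>The structure of a \<open>\<rat>(v)\<close>-algebra.\<close>

lift_definition qscale :: "qv \<Rightarrow> 'n uq \<Rightarrow> 'n uq" (infixr "*\<^sub>q" 69)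
  is "\<lambda>c x. fconst c * x"
  by (metis rel_ideal.mult_left right_diff_distrib)

global_interpretation uq: vector_space "qscale :: qv \<Rightarrow> 'n uq \<Rightarrow> 'n uq"
proof
  fix a b :: qv and x y :: "'n uq"
  show "a *\<^sub>q (x + y) = (a *\<^sub>q x) + (a *\<^sub>q y)"
    by transfer (simp add: algebra_simps rel_ideal.zero)
  show "(a + b) *\<^sub>q x = (a *\<^sub>q x) + (b *\<^sub>q x)"
    by transfer (simp add: single_add algebra_simps rel_ideal.zero)
  show "a *\<^sub>q b *\<^sub>q x = a * b *\<^sub>q x"
    by transfer (simp add: mult_single rel_ideal.zero flip: mult.assoc)
  show "1 *\<^sub>q x = x"
    by transfer (simp add: rel_ideal.zero)
qed

lift_definition gE :: "int \<Rightarrow> 'n uq" is "\<lambda>i. fgen (LE i)" .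
lift_definition gF :: "int \<Rightarrow> 'n uq" is "\<lambda>i. fgen (LF i)" .
lift_definition gK :: "int \<Rightarrow> 'n uq" is "\<lambda>i. fgen (LK i)" .
lift_definition gKinv :: "int \<Rightarrow> 'n uq" is "\<lambda>i. fgen (LKinv i)" .

definition gKpow :: "int \<Rightarrow> int \<Rightarrow> 'n uq" where
  "gKpow i m = (if m \<ge> 0 then gK i ^ nat m else gKinv i ^ nat (- m))"

text \<open>The rank \<open>n\<close> belonging to the type \<open>'n\<close>.\<close>

abbreviation rank :: "'n itself \<Rightarrow> int" where
  "rank t \<equiv> int CARD('n)"


section \<open>The positive part\<close>

inductive_set uplus :: "'n uq set" where
  gen: "i \<in> {1..rank TYPE('n)} \<Longrightarrow> (gE i :: 'n uq) \<in> uplus"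
| one: "1 \<in> uplus"
| scale: "x \<in> uplus \<Longrightarrow> c *\<^sub>q x \<in> uplus"
| add: "\<lbrakk>x \<in> uplus; y \<in> uplus\<rbrakk> \<Longrightarrow> x + y \<in> uplus"
| mult: "\<lbrakk>x \<in> uplus; y \<in> uplus\<rbrakk> \<Longrightarrow> x * y \<in> uplus"

definition uplus_comp :: "root_lattice \<Rightarrow> 'n uq set" where
  "uplus_comp \<gamma> = uq.span {prod_list (map gE is) | is.
     set is \<subseteq> {1..rank TYPE('n)} \<and> sum_list (map simple_root is) = \<gamma>}"

text \<open>The degree \<open>|x|\<close> of a nonzero homogeneous element \<open>x\<close>.\<close>

definition udeg :: "'n uq \<Rightarrow> root_lattice" where
  "udeg x = (THE \<gamma>. x \<in> uplus_comp \<gamma>)"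

text \<open>As \<open>\<sigma>\<close> is only \<open>\<rat>\<close>-linear, \<open>\<sigma>(v) = v\<^sup>-\<^sup>1\<close> is a condition on the scalar element \<open>v \<cdot> 1\<close>.\<close>

definition is_sigma :: "('n uq \<Rightarrow> 'n uq) \<Rightarrow> bool" where
  "is_sigma \<sigma> \<longleftrightarrow>
     bij_betw \<sigma> uplus uplus \<and> \<sigma> 1 = 1 \<and>
     (\<forall>x \<in> uplus. \<forall>y \<in> uplus. \<sigma> (x + y) = \<sigma> x + \<sigma> y \<and> \<sigma> (x * y) = \<sigma> y * \<sigma> x) \<and>
     (\<forall>r :: rat. \<forall>x \<in> uplus. \<sigma> (of_rat r *\<^sub>q x) = of_rat r *\<^sub>q \<sigma> x) \<and>
     \<sigma> (qvar *\<^sub>q 1) = inverse qvar *\<^sub>q 1 \<and>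
     (\<forall>i \<in> {1..rank TYPE('n)}. \<sigma> (gE i) = gE i)"

text \<open>The operators \<open>E\<^sub>i'\<close>.\<close>

definition is_skew_derivations :: "(int \<Rightarrow> 'n uq \<Rightarrow> 'n uq) \<Rightarrow> bool" where
  "is_skew_derivations D \<longleftrightarrow> (\<forall>i \<in> {1..rank TYPE('n)}.
     D i ` uplus \<subseteq> uplus \<and>
     (\<forall>x \<in> uplus. \<forall>y \<in> uplus. \<forall>c. D i (x + y) = D i x + D i y \<and> D i (c *\<^sub>q x) = c *\<^sub>q D i x) \<and>
     (\<forall>j \<in> {1..rank TYPE('n)}. D i (gE j) = (if i = j then 1 else 0)) \<and>
     (\<forall>\<gamma> \<delta>. \<forall>x \<in> uplus_comp \<gamma>. \<forall>y \<in> uplus_comp \<delta>.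
        D i (x * y) = D i x * y + (qvar powi rform (simple_root i) \<gamma> *\<^sub>q x * D i y)))"

definition is_kashiwara_form ::
    "(int \<Rightarrow> 'n uq \<Rightarrow> 'n uq) \<Rightarrow> ('n uq \<Rightarrow> 'n uq \<Rightarrow> qv) \<Rightarrow> bool" where
  "is_kashiwara_form D form \<longleftrightarrow>
     (\<forall>x \<in> uplus. \<forall>y \<in> uplus. \<forall>z \<in> uplus. \<forall>c.
        form (x + y) z = form x z + form y z \<and> form (c *\<^sub>q x) z = c * form x z) \<and>
     (\<forall>x \<in> uplus. \<forall>y \<in> uplus. form x y = form y x) \<and>
     (\<forall>x \<in> uplus. (\<forall>y \<in> uplus. form x y = 0) \<longrightarrow> x = 0) \<and>
     form 1 1 = 1 \<and>
     (\<forall>i \<in> {1..rank TYPE('n)}. \<forall>x \<in> uplus. \<forall>y \<in> uplus. form (D i x) y = form x (gE i * y))"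


section \<open>Automorphisms and root vectors\<close>

definition algebra_automorphism :: "('n uq \<Rightarrow> 'n uq) \<Rightarrow> bool" where
  "algebra_automorphism f \<longleftrightarrow>
     bij f \<and> f 1 = 1 \<and> (\<forall>x y. f (x + y) = f x + f y \<and> f (x * y) = f x * f y) \<and>
     (\<forall>c x. f (c *\<^sub>q x) = c *\<^sub>q f x)"

definition is_braid_automorphisms :: "(int \<Rightarrow> 'n uq \<Rightarrow> 'n uq) \<Rightarrow> bool" where
  "is_braid_automorphisms T \<longleftrightarrow>
     (\<forall>i. i \<notin> {1..rank TYPE('n)} \<longrightarrow> T i = id) \<and>
     (\<forall>i \<in> {1..rank TYPE('n)}.
        algebra_automorphism (T i) \<and>
        T i (gE i) = - (gKinv i * gF i) \<and>
        T i (gF i) = - (gE i * gK i) \<and>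
        (\<forall>j \<in> {1..rank TYPE('n)}. \<bar>i - j\<bar> = 1 \<longrightarrow>
           T i (gE j) = gE j * gE i - (inverse qvar *\<^sub>q gE i * gE j) \<and>
           T i (gF j) = gF i * gF j - (qvar *\<^sub>q gF j * gF i)) \<and>
        (\<forall>j \<in> {1..rank TYPE('n)}. \<bar>i - j\<bar> \<ge> 2 \<longrightarrow> T i (gE j) = gE j \<and> T i (gF j) = gF j) \<and>
        (\<forall>j \<in> {1..rank TYPE('n)}. T i (gK j) = gK j * gKpow i (- cartan i j)))"

text \<open>Labels of the root vectors \<open>u\<^sub>i, v\<^sub>i, w\<^sub>i, x\<^sub>i\<close>.\<close>

datatype rlabel = U int | V int | W int | X int

primrec root_vector :: "(int \<Rightarrow> 'n uq \<Rightarrow> 'n uq) \<Rightarrow> rlabel \<Rightarrow> 'n uq" where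
  "root_vector T (U i) = gE i"
| "root_vector T (V i) = T (i - 1) (T (i + 1) (gE i))"
| "root_vector T (W i) = T (i - 2) (T i (T (i + 2) (T (i - 1) (T (i + 1) (gE i)))))"
| "root_vector T (X i) =
     T (i - 3) (T (i - 1) (T (i + 1) (T (i + 3) (T (i - 2) (T i (T (i + 2)
       (T (i - 1) (T (i + 1) (gE i)))))))))"

text \<open>The ordered list of the \<open>2n\<close> labels \<open>\<beta>\<^sub>1, \<dots>, \<beta>\<^sub>2\<^sub>n\<close>.\<close>

definition rlabels :: "int \<Rightarrow> rlabel list" where
  "rlabels n =
     map U (filter odd [1..n]) @ map V (filter even [1..n]) @
     map W (filter odd [1..n]) @ map X (filter even [1..n])"

text \<open>Exponent vectors in \<open>\<nat>\<^sup>2\<^sup>n\<close>, with the positions addressed by their labels.\<close>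

definition exponents :: "int \<Rightarrow> (rlabel \<Rightarrow> nat) set" where
  "exponents n = {a. \<forall>k. k \<notin> set (rlabels n) \<longrightarrow> a k = 0}"

definition pbw :: "(int \<Rightarrow> 'n uq \<Rightarrow> 'n uq) \<Rightarrow> (rlabel \<Rightarrow> nat) \<Rightarrow> 'n uq" where
  "pbw T a = prod_list (map (\<lambda>k. 1 / qfact (a k) *\<^sub>q root_vector T k ^ a k) (rlabels (rank TYPE('n))))"


section \<open>Duals and the dual canonical basis\<close>

definition dual_elt :: "('n uq \<Rightarrow> 'n uq \<Rightarrow> qv) \<Rightarrow> 'n uq \<Rightarrow> 'n uq" where
  "dual_elt form x = (THE y. (\<exists>c. y = c *\<^sub>q x) \<and> form x y = 1)"

abbreviation pbw_dual ::
    "(int \<Rightarrow> 'n uq \<Rightarrow> 'n uq) \<Rightarrow> ('n uq \<Rightarrow> 'n uq \<Rightarrow> qv) \<Rightarrow> (rlabel \<Rightarrow> nat) \<Rightarrow> 'n uq" where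
  "pbw_dual T form a \<equiv> dual_elt form (pbw T a)"

definition ylabel :: "int \<Rightarrow> rlabel" where
  "ylabel i = (if odd i then U i else X i)"

definition zlabel :: "int \<Rightarrow> rlabel" where
  "zlabel i = (if odd i then W i else V i)"

definition yelt :: "(int \<Rightarrow> 'n uq \<Rightarrow> 'n uq) \<Rightarrow> ('n uq \<Rightarrow> 'n uq \<Rightarrow> qv) \<Rightarrow> int \<Rightarrow> 'n uq" where
  "yelt T form i = dual_elt form (root_vector T (ylabel i))"

text \<open>\<open>z\<^sub>0 = z\<^sub>n\<^sub>+\<^sub>1 = 1\<close> by convention.\<close>

definition zelt :: "(int \<Rightarrow> 'n uq \<Rightarrow> 'n uq) \<Rightarrow> ('n uq \<Rightarrow> 'n uq \<Rightarrow> qv) \<Rightarrow> int \<Rightarrow> 'n uq" where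
  "zelt T form i =
     (if i = 0 \<or> i = rank TYPE('n) + 1 then 1 else dual_elt form (root_vector T (zlabel i)))"

definition vvec :: "int \<Rightarrow> int \<Rightarrow> rlabel \<Rightarrow> int" where
  "vvec n i k =
     (if k \<in> {ylabel i, zlabel i} then 1
      else if k \<in> {zlabel (i - 1), zlabel (i + 1)} \<and> k \<in> set (rlabels n) then -1 else 0)"

definition Sset :: "int \<Rightarrow> (rlabel \<Rightarrow> nat) \<Rightarrow> (rlabel \<Rightarrow> nat) set" where
  "Sset n a = {b \<in> exponents n. b \<noteq> a \<and>
     (\<exists>c :: int \<Rightarrow> nat. \<forall>k. int (a k) - int (b k) = (\<Sum>i = 1..n. int (c i) * vvec n i k))}"

definition exp_degree :: "(int \<Rightarrow> 'n uq \<Rightarrow> 'n uq) \<Rightarrow> (rlabel \<Rightarrow> nat) \<Rightarrow> root_lattice" where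
  "exp_degree T a =
     (\<Sum>k \<in> set (rlabels (rank TYPE('n))). frag_cmul (int (a k)) (udeg (root_vector T k)))"

text \<open>
  \<open>B a\<close> is the unique element with the two defining properties of \<open>B[a]\<^sup>*\<close>. The first of them
  puts \<open>x\<close> into \<^const>\<open>uplus\<close>, the domain of \<open>\<sigma>\<close>. Values of \<open>B\<close> outside \<^const>\<open>exponents\<close> are irrelevant.
\<close>

definition is_dual_canonical_basis ::
    "(int \<Rightarrow> 'n uq \<Rightarrow> 'n uq) \<Rightarrow> ('n uq \<Rightarrow> 'n uq) \<Rightarrow> ('n uq \<Rightarrow> 'n uq \<Rightarrow> qv) \<Rightarrow>
     ((rlabel \<Rightarrow> nat) \<Rightarrow> 'n uq) \<Rightarrow> bool" where
  "is_dual_canonical_basis T \<sigma> form B \<longleftrightarrow>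
     (\<forall>a \<in> exponents (rank TYPE('n)). \<forall>x.
        (\<exists>c. finite {b. c b \<noteq> 0} \<and> {b. c b \<noteq> 0} \<subseteq> Sset (rank TYPE('n)) a \<and>
             range c \<subseteq> inv_v_int_polys \<and>
             x - pbw_dual T form a = (\<Sum>b | c b \<noteq> 0. c b *\<^sub>q pbw_dual T form b)) \<and>
        \<sigma> x = (qvar powi Nweight (exp_degree T a) *\<^sub>q x)
        \<longleftrightarrow> x = B a)"

definition pelt :: "(int \<Rightarrow> 'n uq \<Rightarrow> 'n uq) \<Rightarrow> ('n uq \<Rightarrow> 'n uq \<Rightarrow> qv) \<Rightarrow> int \<Rightarrow> 'n uq" where
  "pelt T form i =
     (if odd i then yelt T form i * zelt T form i else zelt T form i * yelt T form i)
       - (inverse qvar *\<^sub>q zelt T form (i - 1) * zelt T form (i + 1))"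

text \<open>
  The exponent vector here is the one for which \<open>E[a]\<^sup>*\<close> is the product of the \<open>y\<^sub>r\<close>, \<open>i \<le> r \<le> j\<close>,
  odd indices before even ones.
\<close>

definition Delta :: "((rlabel \<Rightarrow> nat) \<Rightarrow> 'n uq) \<Rightarrow> int \<Rightarrow> int \<Rightarrow> 'n uq" where
  "Delta B i j = (if j = i - 1 then 1 else B (\<lambda>k. if k \<in> ylabel ` {i..j} then 1 else 0))"

definition odd_degree_sum ::
    "(int \<Rightarrow> 'n uq \<Rightarrow> 'n uq) \<Rightarrow> ('n uq \<Rightarrow> 'n uq \<Rightarrow> qv) \<Rightarrow> int \<Rightarrow> int \<Rightarrow> root_lattice" where
  "odd_degree_sum T form i j = (\<Sum>s | s \<in> {i..j} \<and> odd s. udeg (yelt T form s))"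

definition even_degree_sum ::
    "(int \<Rightarrow> 'n uq \<Rightarrow> 'n uq) \<Rightarrow> ('n uq \<Rightarrow> 'n uq \<Rightarrow> qv) \<Rightarrow> int \<Rightarrow> int \<Rightarrow> root_lattice" where
  "even_degree_sum T form i j = (\<Sum>s | s \<in> {i..j} \<and> even s. udeg (yelt T form s))"

definition Aexp :: "int \<Rightarrow> int \<Rightarrow> int" where
  "Aexp i j = (if j - i \<le> 3 then -1 else -2)"

end

theory Submission
  imports Defs
begin

text \<open>
  All elements of the theorem can be computed explicitly, and the proof consists in doing so with as
  few computations as possible.

  \<^emph>\<open>Root vectors.\<close> The reduced expression alternates between the odd and the even simple reflections, so
  each root vector arises from a letter \<open>E\<^sub>i\<close> by applying in turn the product \<open>Phi False\<close> of all odd \<open>T\<^sub>k\<close>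
  and the product \<open>Phi True\<close> of all even ones. Such a product turns a \<^emph>\<open>fence\<close>, an iterated \<open>q\<close>-bracket of
  \<open>E\<^sub>a, \<dots>, E\<^sub>b\<close> in the bipartite orientation, into a fence of the opposite orientation. Hence all root
  vectors are fences (\<open>root_vector_fen\<close>), and a relation between two of them becomes, once the common
  automorphisms are removed, a relation between a fence and one letter, where only the Serre relation
  is needed. The outcome: the \<open>y\<^sub>i\<close> and \<open>z\<^sub>i\<close> \<open>q\<close>-commute with each other, except for the two families
  of exchange relations between \<open>y\<^sub>i, z\<^sub>i\<close> and between \<open>y\<^sub>i, y\<^sub>i\<^sub>+\<^sub>1\<close>.

  \<^emph>\<open>Duals.\<close> The adjoint of left multiplication by a fence is a composition of Kashiwara's operators along
  the fence. On products of root vectors that come later in the convex order this composition is a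
  skew derivation which sees a single root vector only (\<open>root_vector_adjoint\<close>). This gives the norms of
  the PBW basis (\<open>norm_PBW\<close>) and shows that the dual PBW basis consists of monomials in the \<open>y\<^sub>i\<close> and \<open>z\<^sub>i\<close>
  (\<open>pbw_dual_eq\<close>).

  \<^emph>\<open>Quantum minors.\<close> Take the first recursion in (a) as the definition of elements \<open>minor a j\<close>. For these
  the other recursion, the exchange identity (b) and the commutation rule (c) follow by a joint
  induction (\<open>minor_identities\<close>): commuting \<open>y\<^sub>k\<close> past the recursion for \<open>k - 1\<close> produces
  \<open>\<Delta>\<^sub>a\<^sub>,\<^sub>k\<^sub>-\<^sub>2 z\<^sub>k\<^sub>-\<^sub>2\<close>, which the exchange identity rewrites; commutation moves \<open>y\<^sub>j\<close> to the other side
  of the recursion; and the recursion multiplied by \<open>z\<^sub>j\<close> gives the next exchange identity.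

  \<^emph>\<open>Identification.\<close> It remains to see that \<open>minor a j\<close> has the two properties that characterise the dual
  canonical basis element. The antiautomorphism \<open>\<sigma>\<close> interchanges the two recursions of (a), which makes
  \<open>minor a j\<close> an eigenvector (\<open>eig_minor\<close>). In the expansion of the recursion every monomial is multiplied
  by one generator at a time, on a side where it only has to pass generators with which it
  \<open>q\<close>-commutes, so dual PBW elements go to dual PBW elements times a power of \<open>v\<close>; the exponents are
  negative because the monomials that occur satisfy two simple degree bounds (\<open>minor_expansion\<close>). By
  uniqueness \<open>\<Delta>\<^sub>a\<^sub>,\<^sub>j\<close> equals \<open>minor a j\<close> (\<open>Delta_eq_minor\<close>), and (a) to (d) are the identities for minors with the
  exponents of \<open>v\<close> written as pairings of degrees.
\<close>

section \<open>Powers of \<open>v\<close> as scalars\<close>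

lemma qvar_power: "qvar ^ k = Fract ([:0, 1:] ^ k) 1"
  by (induction k) (simp_all add: qvar_def One_fract_def)

lemma qvar_nonzero [simp]: "qvar \<noteq> 0"
  by (simp add: qvar_def Zero_fract_def eq_fract)

lemma qvar_power_neq_1: "k > 0 \<Longrightarrow> qvar ^ k \<noteq> 1"
proof
  assume k: "k > 0" "qvar ^ k = 1"
  then have "[:0, 1:] ^ k = (1 :: rat poly)"
    by (simp add: qvar_power One_fract_def eq_fract)
  then have "degree ([:0, 1:] ^ k :: rat poly) = 0" by simp
  with k show False by (simp add: degree_power_eq)
qed

lemma qvar_powi_neq_1: assumes "e \<noteq> 0" shows "qvar powi e \<noteq> 1"
proof (cases "e > 0")
  case True
  then show ?thesis
    using qvar_power_neq_1[of "nat e"] by (simp add: power_int_def)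
next
  case False
  then show ?thesis
    using assms qvar_power_neq_1[of "nat (- e)"]
    by (simp add: power_int_def power_inverse)
qed

lemma qvar_powi_add [simp]: "qvar powi a * qvar powi b = qvar powi (a + b)"
  by (simp add: power_int_add)

lemma qvar_minus_inverse: "qvar - inverse qvar \<noteq> 0"
proof
  assume "qvar - inverse qvar = 0"
  then have "qvar * qvar = 1" by (metis eq_iff_diff_eq_0 qvar_nonzero right_inverse)
  then show False using qvar_power_neq_1[of 2] by (simp add: power2_eq_square)
qed

lemma qvar_plus_inverse: "qvar + inverse qvar \<noteq> 0"
proof
  assume "qvar + inverse qvar = 0"
  then have "qvar * qvar = -1"
    by (metis add.inverse_inverse add_eq_0_iff mult_minus_right qvar_nonzero right_inverse)
  then have "qvar ^ 4 = 1" by (simp add: power4_eq_xxxx)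
  then show False using qvar_power_neq_1[of 4] by simp
qed

lemma one_minus_vm2: "1 - qvar powi (-2) \<noteq> 0"
  using qvar_powi_neq_1[of "-2"] by simp

text \<open>
  Every computation below moves powers of \<open>v\<close> around, so they get a multiplication of their own in
  which exponents are integers that the simplifier adds up.
\<close>

definition vs :: "int \<Rightarrow> 'n uq \<Rightarrow> 'n uq" where
  "vs e x = qvar powi e *\<^sub>q x"

lemma qscale_mult_left [simp]: "(c *\<^sub>q x) * y = c *\<^sub>q (x * y)"
  by transfer (simp add: rel_ideal.zero mult.assoc)

lemma fconst_central: "fconst c * f = f * fconst c"
proof (induction f rule: free_alg_induct)
  case (single w d)
  show ?case by (simp add: mult_single mult.commute)
next
  case (sum f g)
  then show ?case by (simp add: ring_distribs)
qed

lemma qscale_mult_right [simp]: "x * (c *\<^sub>q y) = c *\<^sub>q (x * y)"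
proof (transfer)
  fix x c and y :: free_alg
  have "x * (fconst c * y) = fconst c * (x * y)"
    unfolding fconst_central[of c "x * y"] fconst_central[of c y] by (simp only: mult.assoc)
  then show "x * (fconst c * y) - fconst c * (x * y) \<in> rel_ideal (int CARD('n))"
    by (simp add: rel_ideal.zero)
qed

lemma vs_0 [simp]: "vs 0 x = x" by (simp add: vs_def)
lemma vs_vs [simp]: "vs a (vs b x) = vs (a + b) x" by (simp add: vs_def)
lemma vs_mult_left [simp]: "vs a x * y = vs a (x * y)" by (simp add: vs_def)
lemma vs_mult_right [simp]: "x * vs a y = vs a (x * y)" by (simp add: vs_def)
lemma vs_add [simp]: "vs a (x + y) = vs a x + vs a y" by (simp add: vs_def uq.scale_right_distrib)
lemma vs_diff [simp]: "vs a (x - y) = vs a x - vs a y" by (simp add: vs_def uq.scale_right_diff_distrib)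
lemma vs_minus [simp]: "vs a (- x) = - vs a x" by (simp add: vs_def)
lemma vs_zero [simp]: "vs a 0 = 0" by (simp add: vs_def)
lemma vs_qscale: "vs a (c *\<^sub>q x) = c *\<^sub>q vs a x" by (simp add: vs_def mult.commute)
lemma vs_cancel [simp]: "vs a x = vs a y \<longleftrightarrow> x = y"
  by (metis add.right_inverse add.commute vs_0 vs_vs)

section \<open>The relations of the quantized enveloping algebra\<close>

lemma gK_gKinv: "i \<in> {1..rank TYPE('n)} \<Longrightarrow> gK i * gKinv i = (1 :: 'n uq)"
  by transfer (simp add: rel_ideal.base relators.K_Kinv)

lemma gKinv_gK: "i \<in> {1..rank TYPE('n)} \<Longrightarrow> gKinv i * gK i = (1 :: 'n uq)"
  by transfer (simp add: rel_ideal.base relators.Kinv_K)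

lemma gK_gE_gKinv:
  "\<lbrakk>i \<in> {1..rank TYPE('n)}; j \<in> {1..rank TYPE('n)}\<rbrakk> \<Longrightarrow>
    gK i * gE j * gKinv i = (vs (cartan i j) (gE j) :: 'n uq)"
  unfolding vs_def by transfer (simp add: rel_ideal.base relators.K_E)

lemma gK_gE:
  assumes "i \<in> {1..rank TYPE('n)}" "j \<in> {1..rank TYPE('n)}"
  shows "gK i * gE j = (vs (cartan i j) (gE j * gK i) :: 'n uq)"
proof -
  have "gK i * gE j = gK i * gE j * gKinv i * (gK i :: 'n uq)"
    using assms by (simp add: mult.assoc gKinv_gK)
  then show ?thesis using assms by (simp add: gK_gE_gKinv)
qed

lemma gKinv_gE:
  assumes "i \<in> {1..rank TYPE('n)}" "j \<in> {1..rank TYPE('n)}"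
  shows "gKinv i * gE j = (vs (- cartan i j) (gE j * gKinv i) :: 'n uq)"
proof -
  have "gE j * gKinv i = (gKinv i * (gK i * gE j) * gKinv i :: 'n uq)"
    using assms by (simp add: mult.assoc[symmetric] gKinv_gK)
  also have "\<dots> = vs (cartan i j) (gKinv i * gE j)"
    using assms by (simp add: gK_gE mult.assoc gK_gKinv)
  finally show ?thesis by simp
qed

lemma gE_gF_same:
  assumes "i \<in> {1..rank TYPE('n)}"
  shows "gE i * gF i - gF i * gE i
    = (1 / (qvar - inverse qvar) *\<^sub>q (gK i - gKinv i) :: 'n uq)"
proof -
  define c where "c = 1 / (qvar - inverse qvar)"
  have r: "fgen (LE i) * fgen (LF i) - fgen (LF i) * fgen (LE i)
      - fconst c * (fgen (LK i) - fgen (LKinv i)) \<in> rel_ideal (int CARD('n))"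
    using rel_ideal.base[OF relators.E_F[OF assms assms]] by (simp add: c_def)
  have "gE i * gF i - gF i * gE i = (c *\<^sub>q (gK i - gKinv i) :: 'n uq)"
    by (transfer fixing: c i) (rule r)
  then show ?thesis by (simp only: c_def)
qed

lemma gE_gF_diff:
  assumes "i \<in> {1..rank TYPE('n)}" "j \<in> {1..rank TYPE('n)}" "i \<noteq> j"
  shows "gE i * gF j = (gF j * gE i :: 'n uq)"
  using assms
proof transfer
  fix i j assume *: "i \<in> {1..int CARD('n)}" "j \<in> {1..int CARD('n)}" "i \<noteq> j"
  from relators.E_F[OF *(1,2)] *(3)
  show "fgen (LE i) * fgen (LF j) - fgen (LF j) * fgen (LE i) \<in> rel_ideal (int CARD('n))"
    by (simp add: rel_ideal.base)
qed

lemma gE_out: "i \<notin> {1..rank TYPE('n)} \<Longrightarrow> gE i = (0 :: 'n uq)"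
proof transfer
  fix i assume "i \<notin> {1..int CARD('n)}"
  from relators.out_of_range[OF this, of "LE i"]
  show "fgen (LE i) - 0 \<in> rel_ideal (int CARD('n))" by (simp add: rel_ideal.base)
qed

lemma gE_commute:
  assumes "\<bar>i - j\<bar> \<ge> 2"
  shows "gE i * gE j = (gE j * gE i :: 'n uq)"
proof (cases "i \<in> {1..rank TYPE('n)} \<and> j \<in> {1..rank TYPE('n)}")
  case True
  with assms show ?thesis
  proof transfer
    fix i j assume "\<bar>i - j\<bar> \<ge> 2" "i \<in> {1..int CARD('n)} \<and> j \<in> {1..int CARD('n)}"
    then show "fgen (LE i) * fgen (LE j) - fgen (LE j) * fgen (LE i) \<in> rel_ideal (int CARD('n))"
      by (intro rel_ideal.base relators.comm_E) auto
  qed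
next
  case False
  then have "gE i = (0 :: 'n uq) \<or> gE j = (0 :: 'n uq)" using gE_out by blast
  then show ?thesis by auto
qed

lemma gE_serre:
  assumes "\<bar>i - j\<bar> = 1"
  shows "gE i * gE i * gE j - vs 1 (gE i * gE j * gE i) - vs (-1) (gE i * gE j * gE i)
    + gE j * gE i * gE i = (0 :: 'n uq)"
proof (cases "i \<in> {1..rank TYPE('n)} \<and> j \<in> {1..rank TYPE('n)}")
  case True
  define c where "c = qvar + inverse qvar"
  have r: "fgen (LE i) ^ 2 * fgen (LE j) - fconst c * (fgen (LE i) * fgen (LE j) * fgen (LE i))
      + fgen (LE j) * fgen (LE i) ^ 2 - 0 \<in> rel_ideal (int CARD('n))"
    using rel_ideal.base[OF relators.serre_E] assms True by (simp add: c_def)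
  have "gE i ^ 2 * gE j - (c *\<^sub>q (gE i * gE j * gE i)) + gE j * gE i ^ 2 = (0 :: 'n uq)"
    by (transfer fixing: c i j) (rule r)
  moreover have "vs 1 x + vs (-1) x = (c *\<^sub>q x)" for x :: "'n uq"
    by (simp add: c_def vs_def uq.scale_left_distrib power_int_minus)
  ultimately show ?thesis by (simp only: power2_eq_square mult.assoc diff_diff_eq)
next
  case False
  then have "gE i = (0 :: 'n uq) \<or> gE j = (0 :: 'n uq)" using gE_out by blast
  then show ?thesis by auto
qed

section \<open>Fences\<close>

definition qbr :: "'n uq \<Rightarrow> 'n uq \<Rightarrow> 'n uq" where
  "qbr x y = x * y - vs (-1) (y * x)"

text \<open>
  Nested brackets with commuting outer letters can be taken in either order. Each of the two letters
  may stand on either side of its bracket.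
\<close>

lemma qbr_outer_left_left:
  assumes "c * x = x * c" shows "qbr c (qbr x y) = qbr x (qbr c y)"
proof -
  have *: "c * (x * w) = x * (c * w)" for w using assms by (metis mult.assoc)
  show ?thesis by (simp add: qbr_def algebra_simps assms *)
qed

lemma qbr_outer_left_right:
  assumes "c * x = x * c" shows "qbr c (qbr y x) = qbr (qbr c y) x"
proof -
  have *: "c * (x * w) = x * (c * w)" for w using assms by (metis mult.assoc)
  show ?thesis by (simp add: qbr_def algebra_simps assms *)
qed

lemma qbr_outer_right_left:
  assumes "c * x = x * c" shows "qbr (qbr x y) c = qbr x (qbr y c)"
  by (rule qbr_outer_left_right[symmetric]) (simp add: assms)

lemma qbr_outer_right_right:
  assumes "c * x = x * c" shows "qbr (qbr y x) c = qbr (qbr y c) x"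
proof -
  have *: "c * (x * w) = x * (c * w)" for w using assms by (metis mult.assoc)
  show ?thesis by (simp add: qbr_def algebra_simps assms *)
qed

lemma qbr_commute:
  assumes "c * x = x * c" "c * y = y * c" shows "c * qbr x y = qbr x y * c"
proof -
  have *: "c * (x * w) = x * (c * w)" "c * (y * w) = y * (c * w)" for w
    using assms by (metis mult.assoc)+
  show ?thesis by (simp add: qbr_def algebra_simps assms *)
qed

text \<open>
  \<open>fence e a m\<close> is the root vector of \<open>\<alpha>\<^sub>a + \<dots> + \<alpha>\<^sub>a\<^sub>+\<^sub>m\<close> for the bipartite orientation in which the
  letters \<open>E\<^sub>k\<close> with \<open>even k = e\<close> are sources: in each \<open>q\<close>-bracket the side containing the neighbouring source
  comes first.
\<close>

fun fence :: "bool \<Rightarrow> int \<Rightarrow> nat \<Rightarrow> 'n uq" where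
  "fence e a 0 = gE a"
| "fence e a (Suc m) = (if even (a + int m + 1) = e then qbr (gE (a + int m + 1)) (fence e a m)
     else qbr (fence e a m) (gE (a + int m + 1)))"

definition fen :: "bool \<Rightarrow> int \<Rightarrow> int \<Rightarrow> 'n uq" where
  "fen e a b = fence e a (nat (b - a))"

lemma fen_same [simp]: "fen e a a = gE a" by (simp add: fen_def)

lemma fen_step:
  assumes "a \<le> b"
  shows "fen e a (b + 1) = (if even (b + 1) = e then qbr (gE (b + 1)) (fen e a b)
     else qbr (fen e a b) (gE (b + 1)))"
proof -
  have "nat (b + 1 - a) = Suc (nat (b - a))" using assms by simp
  then show ?thesis using assms by (simp add: fen_def)
qed

lemma fen_induct [consumes 1, case_names base step]:
  assumes "a \<le> (b :: int)" "P a" "\<And>b. a \<le> b \<Longrightarrow> P b \<Longrightarrow> P (b + 1)"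
  shows "P b"
  using assms(1) by (induction rule: int_ge_induct) (use assms in auto)

lemma fen_commute_gen:
  assumes "a \<le> b" "\<And>k. a \<le> k \<Longrightarrow> k \<le> b \<Longrightarrow> c * gE k = gE k * c"
  shows "c * fen e a b = fen e a b * c"
  using assms
proof (induction rule: fen_induct)
  case (step b)
  then show ?case by (auto simp: fen_step intro!: qbr_commute)
qed simp

lemma fen_commute_gE:
  assumes "a \<le> b" "i < a - 1 \<or> i > b + 1"
  shows "gE i * fen e a b = fen e a b * gE i"
  using assms by (intro fen_commute_gen gE_commute) auto

lemma fen_commute_fen:
  assumes "a \<le> b" "c \<le> d" "b + 1 < c"
  shows "fen e a b * fen e' c d = fen e' c d * fen e a b"
  using assms by (intro fen_commute_gen fen_commute_gE[symmetric]) auto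

text \<open>
  The letters beyond the cut commute with everything before it, so that the bracket across the cut can
  be taken last.
\<close>

lemma fen_split:
  assumes "a \<le> k" "k < b"
  shows "fen e a b = (if even k = e then qbr (fen e a k) (fen e (k + 1) b)
     else qbr (fen e (k + 1) b) (fen e a k))"
proof -
  from assms have "k + 1 \<le> b" by simp
  then show ?thesis
  proof (induction rule: fen_induct)
    case base
    show ?case using assms by (simp add: fen_step)
  next
    case (step b)
    have c: "gE (b + 1) * fen e a k = fen e a k * gE (b + 1)"
      using assms step by (intro fen_commute_gE) auto
    have c2: "a \<le> b" using step assms by simp
    show ?case using step(2)
      by (simp add: fen_step[OF c2] fen_step[OF step(1)]
          qbr_outer_left_left[OF c] qbr_outer_left_right[OF c] qbr_outer_right_left[OF c]
          qbr_outer_right_right[OF c] split: if_splits)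
  qed
qed

lemma fen_first:
  assumes "a < b"
  shows "fen e a b = (if even a = e then qbr (gE a) (fen e (a + 1) b)
     else qbr (fen e (a + 1) b) (gE a))"
  by (subst fen_split[of a a b e]) (use assms in simp_all)

text \<open>The quantum Serre relation, read as a \<open>q\<close>-commutation.\<close>

lemma qbr_serre:
  assumes "\<bar>i - j\<bar> = 1"
  shows "qbr (gE j) (gE i) * gE i = vs 1 (gE i * qbr (gE j) (gE i))"
proof -
  have "gE j * gE i * gE i - vs (-1) (gE i * gE j * gE i)
      - (vs 1 (gE i * gE j * gE i) - gE i * gE i * gE j) = (0 :: 'a uq)"
    using gE_serre[OF assms, where 'n='a] by (simp add: algebra_simps)
  then show ?thesis by (simp add: qbr_def algebra_simps)
qed

lemma qbr_qcommute:
  assumes "C * x = vs k (x * C)" "H * x = vs l (x * H)"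
  shows "qbr C H * x = vs (k + l) (x * qbr C H)"
proof -
  have "C * (x * u) = vs k (x * (C * u))" "H * (x * u) = vs l (x * (H * u))" for u
    using assms by (metis mult.assoc vs_mult_left)+
  then show ?thesis by (simp add: qbr_def algebra_simps assms)
qed

lemma qbr_qcommute_comm:
  assumes "C * x = vs k (x * C)" "x * H = H * x"
  shows "qbr C H * x = vs k (x * qbr C H)"
  using qbr_qcommute[of C x k H 0] assms by simp

text \<open>
  The sink \<open>E\<^sub>i\<close> only notices the last two letters of the fence. After reordering the brackets these two
  form a bracket to which the Serre relation applies.
\<close>

lemma fen_end_right:
  assumes "a < i" "even i \<noteq> e"
  shows "fen e a i * gE i = vs 1 (gE i * fen e a i)"
proof -
  have 1: "fen e a i = qbr (fen e a (i - 1)) (gE i)"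
    using assms fen_step[of a "i - 1" e] by simp
  show ?thesis
  proof (cases "a = i - 1")
    case True
    show ?thesis unfolding 1 by (simp add: True qbr_serre)
  next
    case False
    have 2: "fen e a (i - 1) = qbr (gE (i - 1)) (fen e a (i - 2))"
      using assms False fen_step[of a "i - 2" e] by auto
    have c: "gE i * fen e a (i - 2) = fen e a (i - 2) * gE i"
      using assms False by (intro fen_commute_gE) auto
    have 3: "fen e a i = qbr (qbr (gE (i - 1)) (gE i)) (fen e a (i - 2))"
      unfolding 1 2 by (rule qbr_outer_right_right[OF c])
    show ?thesis unfolding 3 by (rule qbr_qcommute_comm[OF qbr_serre c]) simp
  qed
qed

lemma fen_end_left:
  assumes "i < b" "even i \<noteq> e"
  shows "fen e i b * gE i = vs 1 (gE i * fen e i b)"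
proof -
  have 1: "fen e i b = qbr (fen e (i + 1) b) (gE i)"
    using assms fen_first[of i b e] by simp
  show ?thesis
  proof (cases "b = i + 1")
    case True
    show ?thesis unfolding 1 by (simp add: True qbr_serre)
  next
    case False
    have 2: "fen e (i + 1) b = qbr (gE (i + 1)) (fen e (i + 2) b)"
      using assms False fen_first[of "i + 1" b e] by (auto simp: add.commute)
    have c: "gE i * fen e (i + 2) b = fen e (i + 2) b * gE i"
      using assms False by (intro fen_commute_gE) auto
    have 3: "fen e i b = qbr (qbr (gE (i + 1)) (gE i)) (fen e (i + 2) b)"
      unfolding 1 2 by (rule qbr_outer_right_right[OF c])
    show ?thesis unfolding 3 by (rule qbr_qcommute_comm[OF qbr_serre c]) simp
  qed
qed

lemma diff_eq_diff_imp_add: "a - b = c - d \<Longrightarrow> a + d = c + (b :: 'a :: ab_group_add)"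
  by (metis add_diff_eq diff_add_eq diff_eq_eq)

lemma uq_double_cancel:
  assumes "vs 1 x + vs (-1) x = vs 1 y + vs (-1) (y :: 'n uq)"
  shows "x = y"
proof -
  have "((qvar + inverse qvar) *\<^sub>q x) = ((qvar + inverse qvar) *\<^sub>q y)"
    using assms by (simp add: vs_def uq.scale_left_distrib power_int_minus)
  then show ?thesis using qvar_plus_inverse by simp
qed

lemma qbr_middle_half:
  assumes A: "qbr M E * E = vs 1 (E * qbr M E)"
  shows "qbr Y (qbr M E) * E = E * qbr Y (qbr M E)
    + vs 1 (qbr Y E * qbr M E) - vs (-1) (qbr M E * qbr Y E)"
proof -
  define C where "C = qbr M E"
  define G where "G = qbr Y E"
  have CE: "C * E = vs 1 (E * C)" "C * (E * u) = vs 1 (E * (C * u))" for u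
    using A by (simp_all add: C_def) (metis mult.assoc vs_mult_left)
  have YE: "Y * E = G + vs (-1) (E * Y)" "Y * (E * u) = G * u + vs (-1) (E * (Y * u))" for u
    by (simp_all add: G_def qbr_def algebra_simps)
  show ?thesis unfolding C_def[symmetric] G_def[symmetric]
    by (simp add: qbr_def[of Y C] algebra_simps CE YE)
qed

text \<open>
  The element \<open>[Y, [M, E]] = [M, [Y, E]]\<close> can be expanded in two ways, which give the same relation with
  the two factors of the correction term exchanged. Hence these factors commute.
\<close>

lemma qbr_middle:
  assumes "M * Y = Y * M"
    and "qbr M E * E = vs 1 (E * qbr M E)" "qbr Y E * E = vs 1 (E * qbr Y E)"
  shows "qbr M E * qbr Y E = qbr Y E * qbr M E"
    and "qbr Y (qbr M E) * E = E * qbr Y (qbr M E)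
      + vs 1 (qbr M E * qbr Y E) - vs (-1) (qbr M E * qbr Y E)"
proof -
  have "qbr Y (qbr M E) = qbr M (qbr Y E)" by (rule qbr_outer_left_left) (simp add: assms)
  then have "vs 1 (qbr Y E * qbr M E) - vs (-1) (qbr M E * qbr Y E)
    = vs 1 (qbr M E * qbr Y E) - vs (-1) (qbr Y E * qbr M E)"
    using qbr_middle_half[OF assms(2), of Y] qbr_middle_half[OF assms(3), of M]
    by (metis add_diff_eq add_left_cancel)
  then show *: "qbr M E * qbr Y E = qbr Y E * qbr M E"
    by (rule uq_double_cancel[OF diff_eq_diff_imp_add, symmetric])
  show "qbr Y (qbr M E) * E = E * qbr Y (qbr M E)
      + vs 1 (qbr M E * qbr Y E) - vs (-1) (qbr M E * qbr Y E)"
    using qbr_middle_half[OF assms(2), of Y] * by simp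
qed

text \<open>
  A fence cut at an inner sink \<open>i\<close> is a bracket of two fences that both end in \<open>E\<^sub>i\<close>.
\<close>

lemma
  assumes "a < i" "i < b" "even i \<noteq> e"
  shows fen_commute_at_sink: "fen e a i * fen e i b = (fen e i b * fen e a i :: 'a uq)"
    and fen_interior: "fen e a b * gE i = gE i * (fen e a b :: 'a uq)
      + vs 1 (fen e a i * fen e i b) - vs (-1) (fen e a i * fen e i b)"
proof -
  have a: "fen e a i = qbr (fen e a (i - 1)) (gE i)"
    using assms fen_step[of a "i - 1" e] by simp
  have b: "fen e i b = qbr (fen e (i + 1) b) (gE i)"
    using assms fen_first[of i b e] by simp
  have ab: "fen e a b = qbr (fen e (i + 1) b) (fen e a i)"
    using assms fen_split[of a i b e] by simp
  have c: "fen e a (i - 1) * fen e (i + 1) b = fen e (i + 1) b * fen e a (i - 1)"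
    using assms by (intro fen_commute_fen) auto
  note q = qbr_middle[OF c fen_end_right[of a i e, unfolded a] fen_end_left[of i b e, unfolded b]]
  show "fen e a i * fen e i b = fen e i b * fen e a i"
    unfolding a b by (rule q(1)) (use assms in auto)
  show "fen e a b * gE i = gE i * fen e a b
      + vs 1 (fen e a i * fen e i b) - vs (-1) (fen e a i * fen e i b)"
    unfolding ab a b by (rule q(2)) (use assms in auto)
qed

lemma fen_adjacent_left:
  assumes "a \<le> b" "even a = e"
  shows "fen e a b * gE (a - 1) = vs (-1) (gE (a - 1) * fen e a b) + fen e (a - 1) b"
  by (subst (2) fen_first) (use assms in \<open>simp_all add: qbr_def\<close>)

lemma fen_adjacent_right:
  assumes "a \<le> b" "even b = e"
  shows "fen e a b * gE (b + 1) = vs (-1) (gE (b + 1) * fen e a b) + fen e a (b + 1)"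
  using assms by (simp add: fen_step qbr_def)

section \<open>The braid automorphisms on fences\<close>

definition alg_hom :: "('n uq \<Rightarrow> 'n uq) \<Rightarrow> bool" where
  "alg_hom f \<longleftrightarrow> f 1 = 1 \<and> (\<forall>x y. f (x + y) = f x + f y \<and> f (x * y) = f x * f y) \<and>
     (\<forall>c x. f (c *\<^sub>q x) = c *\<^sub>q f x)"

lemma alg_hom_simps:
  assumes "alg_hom f"
  shows "f 1 = 1" "f (x + y) = f x + f y" "f (x * y) = f x * f y" "f (c *\<^sub>q x) = c *\<^sub>q f x"
    "f (- x) = - f x" "f (x - y) = f x - f y" "f (vs a x) = vs a (f x)"
    "f (qbr x y) = qbr (f x) (f y)"
proof -
  show 1: "f 1 = 1" "f (x + y) = f x + f y" "f (x * y) = f x * f y" "f (c *\<^sub>q x) = c *\<^sub>q f x"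
    for x y c using assms by (simp_all add: alg_hom_def)
  show 2: "f (- x) = - f x" for x using 1(4)[of "-1" x] by simp
  show 3: "f (x - y) = f x - f y" for x y using 1(2)[of x "- y"] 2 by simp
  show 4: "f (vs a x) = vs a (f x)" for a x by (simp add: vs_def 1)
  show "f (qbr x y) = qbr (f x) (f y)" by (simp add: qbr_def 1 3 4)
qed

context
  fixes T :: "int \<Rightarrow> 'n uq \<Rightarrow> 'n uq"
  assumes T: "is_braid_automorphisms T"
begin

lemma alg_hom_T: "alg_hom (T k)"
proof (cases "k \<in> {1..rank TYPE('n)}")
  case True
  then show ?thesis using T by (simp add: is_braid_automorphisms_def algebra_automorphism_def alg_hom_def)
next
  case False
  then show ?thesis using T by (simp add: is_braid_automorphisms_def alg_hom_def)
qed

lemma T_out: "k \<notin> {1..rank TYPE('n)} \<Longrightarrow> T k = id"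
  using T by (simp add: is_braid_automorphisms_def)

lemma T_far: "\<bar>k - l\<bar> \<ge> 2 \<Longrightarrow> T k (gE l) = gE l"
proof -
  assume a: "\<bar>k - l\<bar> \<ge> 2"
  consider "k \<notin> {1..rank TYPE('n)}" | "l \<notin> {1..rank TYPE('n)}"
    | "k \<in> {1..rank TYPE('n)}" "l \<in> {1..rank TYPE('n)}" by blast
  then show ?thesis
  proof cases
    case 1
    then show ?thesis using T_out by simp
  next
    case 2
    then show ?thesis
      using alg_hom_simps(4)[OF alg_hom_T, of k 0 0] by (simp add: gE_out[where 'n='n])
  next
    case 3
    then show ?thesis using T a by (auto simp: is_braid_automorphisms_def)
  qed
qed

lemma T_near:
  assumes "k \<in> {1..rank TYPE('n)}" "l \<in> {1..rank TYPE('n)}" "\<bar>k - l\<bar> = 1"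
  shows "T k (gE l) = qbr (gE l) (gE k)"
  using assms T by (simp add: is_braid_automorphisms_def qbr_def vs_def power_int_minus)

lemma T_self: "k \<in> {1..rank TYPE('n)} \<Longrightarrow> T k (gE k) = - (gKinv k * gF k)"
  using T by (simp add: is_braid_automorphisms_def)

text \<open>
  This is the only place where the whole algebra is needed and not just its positive part. Since \<open>T\<^sub>k\<close> maps
  \<open>E\<^sub>k\<close> to a multiple of \<open>F\<^sub>k\<close>, it strips the letter \<open>E\<^sub>k\<close> from the bracket.
\<close>

lemma T_qbr:
  assumes k: "k \<in> {1..rank TYPE('n)}" and l: "l \<in> {1..rank TYPE('n)}" and kl: "\<bar>k - l\<bar> = 1"
  shows "T k (qbr (gE k) (gE l)) = gE l"
proof -
  define A where "A = qbr (gE l) (gE k :: 'n uq)"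
  define w where "w = qvar - inverse qvar"
  have w: "w \<noteq> 0" using qvar_minus_inverse by (simp add: w_def)
  have c: "cartan k l = -1" "cartan k k = 2" using kl by (auto simp: cartan_def)
  have Ki: "gKinv k * gE l = vs 1 (gE l * (gKinv k :: 'n uq))" "gKinv k * gE k = vs (-2) (gE k * (gKinv k :: 'n uq))"
    "gK k * gE l = vs (-1) (gE l * gK k :: 'n uq)"
    using k l by (simp_all add: gKinv_gE gK_gE c)
  have Ki': "gKinv k * (gE l * u) = vs 1 (gE l * (gKinv k * u))"
    "gKinv k * (gE k * u) = vs (-2) (gE k * (gKinv k * u))"
    "gK k * (gE l * u) = vs (-1) (gE l * (gK k * u))" for u :: "'n uq"
    by (simp_all add: mult.assoc[symmetric] Ki)
  have AK: "A * gKinv k = vs 1 (gKinv k * A)"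
    by (simp add: A_def qbr_def algebra_simps Ki Ki')
  have EF: "gE k * gF k = gF k * gE k + (1 / w *\<^sub>q (gK k - gKinv k :: 'n uq))"
    using gE_gF_same[OF k] by (simp add: w_def algebra_simps)
  have EF': "gE k * (gF k * u) = gF k * (gE k * u) + (1 / w *\<^sub>q ((gK k - gKinv k) * u))" for u :: "'n uq"
    by (simp add: mult.assoc[symmetric] EF distrib_right)
  have lF: "gE l * gF k = (gF k * gE l :: 'n uq)" using k l kl by (intro gE_gF_diff) auto
  have lF': "gE l * (gF k * u) = gF k * (gE l * u)" for u :: "'n uq"
    by (simp add: mult.assoc[symmetric] lF)
  have "A * gF k - gF k * A = (1 / w *\<^sub>q (gE l * gK k - vs (-2) (gE l * gK k)))"
    by (simp add: A_def qbr_def algebra_simps EF EF' lF lF' Ki vs_qscale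
        uq.scale_right_distrib uq.scale_right_diff_distrib)
  also have "gE l * gK k - vs (-2) (gE l * gK k) = w *\<^sub>q vs (-1) (gE l * gK k)"
    by (simp add: w_def vs_def uq.scale_left_diff_distrib power_int_minus power2_eq_square
        left_diff_distrib)
  finally have AF: "A * gF k - gF k * A = vs (-1) (gE l * gK k)"
    using w by (simp add: mult.assoc)
  have AF': "A * gF k = gF k * A + vs (-1) (gE l * gK k)"
    using AF by (simp add: algebra_simps)
  have "T k (qbr (gE k) (gE l)) = qbr (- (gKinv k * gF k)) A"
    by (simp add: alg_hom_simps[OF alg_hom_T] T_self[OF k] T_near[OF k l kl] A_def)
  also have "\<dots> = vs (-1) (A * gKinv k * gF k) - gKinv k * gF k * A"
    by (simp add: qbr_def mult.assoc)
  also have "\<dots> = gKinv k * (A * gF k - gF k * A)"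
    by (simp add: AK algebra_simps)
  also have "\<dots> = gE l"
    by (simp add: AF' Ki' gKinv_gK[OF k])
  finally show ?thesis .
qed

lemma T_fen_fixed:
  assumes "a \<le> b" "k < a - 1 \<or> k > b + 1"
  shows "T k (fen e a b) = fen e a b"
  using assms
proof (induction rule: fen_induct)
  case base
  then show ?case by (auto simp: T_far)
next
  case (step b)
  then show ?case by (auto simp: fen_step alg_hom_simps[OF alg_hom_T] T_far)
qed

end

section \<open>Root vectors as fences\<close>

definition compT :: "(int \<Rightarrow> 'n uq \<Rightarrow> 'n uq) \<Rightarrow> int list \<Rightarrow> 'n uq \<Rightarrow> 'n uq" where
  "compT T ks = foldr (\<lambda>k f. T k \<circ> f) ks id"

lemma compT_simps [simp]: "compT T [] x = x" "compT T (k # ks) x = T k (compT T ks x)"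
  by (simp_all add: compT_def)

lemma compT_append: "compT T (xs @ ys) x = compT T xs (compT T ys x)"
  by (induction xs) simp_all

lemma compT_fixed: "(\<And>k. k \<in> set ks \<Longrightarrow> T k x = x) \<Longrightarrow> compT T ks x = x"
  by (induction ks) simp_all

lemma alg_hom_compT: "(\<And>k. alg_hom (T k)) \<Longrightarrow> alg_hom (compT T ks)"
  by (induction ks) (simp_all add: alg_hom_def)

lemma inj_compT: "(\<And>k. inj (T k)) \<Longrightarrow> inj (compT T ks)"
  by (induction ks) (auto simp: compT_def intro!: inj_compose)

locale braid =
  fixes T :: "int \<Rightarrow> 'n uq \<Rightarrow> 'n uq" and n :: int
  assumes T: "is_braid_automorphisms T" and n: "n = rank TYPE('n)" and n3: "n \<ge> 3" and n_odd: "odd n"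
begin

lemmas fen_split = fen_split[where 'a = 'n] and fen_step = fen_step[where 'a = 'n]
  and fen_first = fen_first[where 'a = 'n]

lemmas T_out = T_out[OF T, folded n] and T_far = T_far[OF T] and T_near = T_near[OF T, folded n]
  and T_qbr = T_qbr[OF T, folded n] and alg_hom_T = alg_hom_T[OF T] and T_fen_fixed = T_fen_fixed[OF T]

lemma inj_T: "inj (T k)"
proof (cases "k \<in> {1..n}")
  case True
  then show ?thesis using T n by (auto simp: is_braid_automorphisms_def algebra_automorphism_def bij_def)
next
  case False
  then show ?thesis using T_out by simp
qed

text \<open>
  The product of all \<open>T\<^sub>k\<close> with \<open>k\<close> of one parity. The range is padded by indices for which \<open>T\<^sub>k\<close>
  is the identity, so that windows around a boundary index need no separate treatment.
\<close>

definition Phi :: "bool \<Rightarrow> 'n uq \<Rightarrow> 'n uq" where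
  "Phi e = compT T (filter (\<lambda>k. even k = e) [-2..n + 3])"

lemma alg_hom_Phi: "alg_hom (Phi e)"
  unfolding Phi_def by (intro alg_hom_compT alg_hom_T)

lemmas Phi_simps = alg_hom_simps[OF alg_hom_Phi]

lemma Phi_split:
  assumes "-2 \<le> lo" "lo \<le> hi" "hi \<le> n + 3"
  shows "Phi e x = compT T (filter (\<lambda>k. even k = e) [-2..lo - 1])
    (compT T (filter (\<lambda>k. even k = e) [lo..hi]) (compT T (filter (\<lambda>k. even k = e) [hi + 1..n + 3]) x))"
proof -
  have "[-2..n + 3] = [-2..lo - 1] @ [lo..hi] @ [hi + 1..n + 3]"
    using assms upto_split1[of "-2" lo "n + 3"] upto_split2[of lo hi "n + 3"] by simp
  then show ?thesis by (simp add: Phi_def compT_append)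
qed

text \<open>
  The factors of \<open>Phi\<close> beyond a window drop out if they fix the argument on one side and the result on the
  other. The converse, by which the words \<open>T\<^sub>k \<cdots>\<close> in the definition of the root vectors become values of
  \<open>Phi\<close>, uses injectivity to strip the factors that act last.
\<close>

lemma Phi_window:
  assumes "-2 \<le> lo" "lo \<le> hi" "hi \<le> n + 3"
    and hi: "\<And>k. k > hi \<Longrightarrow> even k = e \<Longrightarrow> T k x = x"
    and lo: "\<And>k. k < lo \<Longrightarrow> even k = e \<Longrightarrow> T k y = y"
    and y: "compT T (filter (\<lambda>k. even k = e) [lo..hi]) x = y"
  shows "Phi e x = y"
proof -
  have "compT T (filter (\<lambda>k. even k = e) [hi + 1..n + 3]) x = x"
    by (rule compT_fixed) (use hi in auto)
  moreover have "compT T (filter (\<lambda>k. even k = e) [-2..lo - 1]) y = y"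
    by (rule compT_fixed) (use lo in auto)
  ultimately show ?thesis by (simp add: Phi_split[OF assms(1-3)] y)
qed

lemma Phi_window_conv:
  assumes "-2 \<le> lo" "lo \<le> hi" "hi \<le> n + 3"
    and hi: "\<And>k. k > hi \<Longrightarrow> even k = e \<Longrightarrow> T k x = x"
    and lo: "\<And>k. k < lo \<Longrightarrow> even k = e \<Longrightarrow> T k y = y"
    and y: "Phi e x = y"
  shows "compT T (filter (\<lambda>k. even k = e) [lo..hi]) x = y"
proof -
  have 1: "compT T (filter (\<lambda>k. even k = e) [hi + 1..n + 3]) x = x"
    by (rule compT_fixed) (use hi in auto)
  have "compT T (filter (\<lambda>k. even k = e) [-2..lo - 1]) y = y"
    by (rule compT_fixed) (use lo in auto)
  also have "y = compT T (filter (\<lambda>k. even k = e) [-2..lo - 1])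
      (compT T (filter (\<lambda>k. even k = e) [lo..hi]) x)"
    using y by (simp add: Phi_split[OF assms(1-3)] 1)
  finally show ?thesis by (metis injD inj_compT inj_T)
qed

lemma window3: "filter (\<lambda>k. even k = e) [j - 1..j + 1] = (if even j = e then [j] else [j - 1, j + 1])"
  for j :: int
proof -
  have "[j - 1..j + 1] = [j - 1, j, j + 1]" by (simp add: upto_rec1)
  then show ?thesis by auto
qed

lemma window5: "even i \<noteq> e \<Longrightarrow> filter (\<lambda>k. even k = (\<not> e)) [i - 2..i + 2] = [i - 2, i, i + 2]"
  for i :: int
proof -
  assume "even i \<noteq> e"
  moreover have "[i - 2..i + 2] = [i - 2, i - 1, i, i + 1, i + 2]" by (simp add: upto_rec1)
  ultimately show ?thesis by auto
qed

lemma window7: "even i = e \<Longrightarrow> filter (\<lambda>k. even k = (\<not> e)) [i - 3..i + 3] = [i - 3, i - 1, i + 1, i + 3]"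
  for i :: int
proof -
  assume "even i = e"
  moreover have "[i - 3..i + 3] = [i - 3, i - 2, i - 1, i, i + 1, i + 2, i + 3]" by (simp add: upto_rec1)
  ultimately show ?thesis by auto
qed

text \<open>The ends of a fence, cut off at the boundary of the Dynkin diagram.\<close>

definition lob :: "int \<Rightarrow> int" where "lob a = max 1 a"
definition hib :: "int \<Rightarrow> int" where "hib b = min n b"

lemma fen_pair: "(fen e j (j + 1) :: 'n uq) = (if even j = e then qbr (gE j) (gE (j + 1)) else qbr (gE (j + 1)) (gE j))"
  using fen_step[of j j e] by (auto)

lemma fen_pair': "(fen e (j - 1) j :: 'n uq) = (if even j = e then qbr (gE j) (gE (j - 1)) else qbr (gE (j - 1)) (gE j))"
  using fen_pair[of e "j - 1"] by (auto)

lemma T_neighbours: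
  assumes j: "j \<in> {1..n}"
  shows "T (j - 1) (T (j + 1) (gE j)) = fen (even j) (lob (j - 1)) (hib (j + 1))"
proof -
  have up: "T (j + 1) (gE j) = fen (even j) j (hib (j + 1))"
  proof (cases "j + 1 \<le> n")
    case True
    then show ?thesis using j T_near[of "j + 1" j] by (simp add: hib_def fen_pair)
  next
    case False
    then have "hib (j + 1) = j" using j by (simp add: hib_def)
    then show ?thesis using False j T_out[of "j + 1"] by simp
  qed
  show ?thesis
  proof (cases "1 \<le> j - 1")
    case True
    have dn: "T (j - 1) (gE j) = qbr (gE j) (gE (j - 1))" using T_near[of "j - 1" j] True j by simp
    show ?thesis
    proof (cases "j + 1 \<le> n")
      case True2: True
      have "T (j - 1) (T (j + 1) (gE j)) = qbr (qbr (gE j) (gE (j - 1))) (gE (j + 1))"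
        using T_near[of "j + 1" j] True True2 j
        by (simp add: alg_hom_simps[OF alg_hom_T] dn T_far)
      also have "\<dots> = fen (even j) (j - 1) (j + 1)"
        by (simp add: fen_step[of "j - 1" j] fen_pair')
      finally show ?thesis using True True2 by (simp add: lob_def hib_def)
    next
      case False
      then have "hib (j + 1) = j" using j by (simp add: hib_def)
      then show ?thesis using True j by (simp add: up lob_def dn fen_pair')
    qed
  next
    case False
    then have "j = 1" using j by simp
    then show ?thesis using up T_out[of 0] by (simp add: lob_def)
  qed
qed

lemma lob_hib:
  assumes "j \<in> {1..n}"
  shows "lob (j - 1) \<le> j" "j - 1 \<le> lob (j - 1)" "j \<le> hib (j + 1)" "hib (j + 1) \<le> j + 1"
  using assms by (auto simp: lob_def hib_def)

lemma Phi_gE: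
  assumes j: "j \<in> {1..n}" "e = (\<not> even j)"
  shows "Phi e (gE j) = fen (even j) (lob (j - 1)) (hib (j + 1))"
proof (rule Phi_window[where lo = "j - 1" and hi = "j + 1"])
  show "compT T (filter (\<lambda>k. even k = e) [j - 1..j + 1]) (gE j)
      = fen (even j) (lob (j - 1)) (hib (j + 1))"
    using j by (simp add: window3 T_neighbours)
  show "T k (fen (even j) (lob (j - 1)) (hib (j + 1))) = fen (even j) (lob (j - 1)) (hib (j + 1))"
    if "k < j - 1" "even k = e" for k
  proof (rule T_fen_fixed)
    have "k \<noteq> j - 2" using that j by auto
    then show "k < lob (j - 1) - 1 \<or> k > hib (j + 1) + 1" using that lob_hib[OF j(1)] by auto
  qed (use lob_hib[OF j(1)] in auto)
qed (use j in \<open>auto simp: T_far\<close>)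

text \<open>
  The letter \<open>E\<^sub>j\<^sub>-\<^sub>1\<close> is stripped by \<open>T\<^sub>j\<^sub>-\<^sub>1\<close>, while \<open>T\<^sub>j\<^sub>+\<^sub>1\<close> attaches \<open>E\<^sub>j\<^sub>+\<^sub>1\<close>.
\<close>

lemma Phi_up:
  assumes j: "j \<in> {1..n}" "j - 1 \<ge> 1" "e = (\<not> even j)"
  shows "Phi e (qbr (gE (j - 1)) (gE j)) = fen (even j) j (hib (j + 1))"
proof (rule Phi_window[where lo = "j - 1" and hi = "j + 1"])
  have "T (j - 1) (T (j + 1) (qbr (gE (j - 1)) (gE j))) = fen (even j) j (hib (j + 1))"
  proof (cases "j + 1 \<le> n")
    case True
    have c: "gE (j + 1) * gE (j - 1) = gE (j - 1) * gE (j + 1)" by (rule gE_commute) simp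
    have "T (j + 1) (qbr (gE (j - 1)) (gE j)) = qbr (gE (j - 1)) (qbr (gE j) (gE (j + 1)))"
      using T_near[of "j + 1" j] True j by (simp add: alg_hom_simps[OF alg_hom_T] T_far)
    also have "\<dots> = qbr (qbr (gE (j - 1)) (gE j)) (gE (j + 1))"
      by (simp add: qbr_outer_right_left[OF c])
    also have "T (j - 1) \<dots> = qbr (gE j) (gE (j + 1))"
      using T_qbr[of "j - 1" j] True j by (simp add: alg_hom_simps(8)[OF alg_hom_T] T_far)
    finally show ?thesis using True by (simp add: hib_def fen_pair)
  next
    case False
    then have "hib (j + 1) = j" using j by (simp add: hib_def)
    then show ?thesis using False T_qbr[of "j - 1" j] j T_out[of "j + 1"] by simp
  qed
  then show "compT T (filter (\<lambda>k. even k = e) [j - 1..j + 1]) (qbr (gE (j - 1)) (gE j))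
      = fen (even j) j (hib (j + 1))"
    using j by (simp add: window3)
  show "T k (fen (even j) j (hib (j + 1))) = fen (even j) j (hib (j + 1))"
    if "k < j - 1" "even k = e" for k
    by (rule T_fen_fixed) (use that lob_hib[OF j(1)] in auto)
  show "T k (qbr (gE (j - 1)) (gE j)) = qbr (gE (j - 1)) (gE j)" if "k > j + 1" "even k = e" for k
    using that by (simp add: alg_hom_simps[OF alg_hom_T] T_far)
qed (use j in auto)

lemma Phi_down:
  assumes j: "j \<in> {1..n}" "j + 1 \<le> n" "e = (\<not> even j)"
  shows "Phi e (qbr (gE (j + 1)) (gE j)) = fen (even j) (lob (j - 1)) j"
proof (rule Phi_window[where lo = "j - 1" and hi = "j + 1"])
  have "T (j - 1) (T (j + 1) (qbr (gE (j + 1)) (gE j))) = fen (even j) (lob (j - 1)) j"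
  proof (cases "1 \<le> j - 1")
    case True
    then show ?thesis using T_near[of "j - 1" j] T_qbr[of "j + 1" j] j
      by (simp add: lob_def fen_pair')
  next
    case False
    then show ?thesis using T_qbr[of "j + 1" j] j T_out[of "j - 1"] by (simp add: lob_def)
  qed
  then show "compT T (filter (\<lambda>k. even k = e) [j - 1..j + 1]) (qbr (gE (j + 1)) (gE j))
      = fen (even j) (lob (j - 1)) j"
    using j by (simp add: window3)
  show "T k (fen (even j) (lob (j - 1)) j) = fen (even j) (lob (j - 1)) j"
    if "k < j - 1" "even k = e" for k
  proof (rule T_fen_fixed)
    have "k \<noteq> j - 2" using that j by auto
    then show "k < lob (j - 1) - 1 \<or> k > j + 1" using that lob_hib[OF j(1)] by auto
  qed (use lob_hib[OF j(1)] in auto)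
  show "T k (qbr (gE (j + 1)) (gE j)) = qbr (gE (j + 1)) (gE j)" if "k > j + 1" "even k = e" for k
  proof -
    have "k \<noteq> j + 2" using that j by auto
    then show ?thesis using that by (simp add: alg_hom_simps[OF alg_hom_T] T_far)
  qed
qed (use j in auto)

lemma Phi_fen3:
  assumes "e = even j" "j - 1 \<ge> 1" "j + 1 \<le> n"
  shows "Phi e (fen e (j - 1) (j + 1)) = fen (\<not> e) (lob (j - 2)) (hib (j + 2))"
proof -
  have 1: "(fen e (j - 1) (j + 1) :: 'n uq) = qbr (qbr (gE j) (gE (j - 1))) (gE (j + 1))"
    using assms by (simp add: fen_step[of "j - 1" j] fen_pair')
  have 2: "Phi e (qbr (gE j) (gE (j - 1))) = fen (\<not> e) (lob (j - 2)) (j - 1)"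
    using Phi_down[of "j - 1" e] assms by simp
  have 3: "Phi e (gE (j + 1)) = fen (\<not> e) j (hib (j + 2))"
    using Phi_gE[of "j + 1" e] assms by (simp add: lob_def add.commute)
  have "lob (j - 2) \<le> j - 1" "j - 1 < hib (j + 2)" using assms by (auto simp: lob_def hib_def)
  from fen_split[OF this, of "\<not> e"] show ?thesis
    using assms(1) unfolding 1 Phi_simps(8)[where y = "gE (j + 1)"] 2 3 by simp
qed

text \<open>
  The ends of the interval of simple roots in the degree of a root vector. An end that would leave
  \<open>{1..n}\<close> is reflected back: at the lower boundary \<open>k\<close> becomes \<open>1 - k\<close>, at the upper one \<open>2 n + 1 - k\<close>.
\<close>

fun rlo :: "rlabel \<Rightarrow> int" where
  "rlo (U i) = i"
| "rlo (V i) = i - 1"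
| "rlo (W i) = (if i = 1 then 2 else i - 2)"
| "rlo (X i) = (if i = 2 then 2 else i - 3)"

fun rhi :: "rlabel \<Rightarrow> int" where
  "rhi (U i) = i"
| "rhi (V i) = i + 1"
| "rhi (W i) = (if i = n then n - 1 else i + 2)"
| "rhi (X i) = (if i = n - 1 then n - 1 else i + 3)"

text \<open>
  In the interior each letter or pair of letters is extended by its neighbours. If the fence reaches the
  boundary, its last letter has no outer neighbour and is stripped instead, whence the reflection.
\<close>

lemma Phi_odd_fen_w:
  assumes j: "odd j" "j \<in> {1..n}"
  shows "Phi False (fen False (lob (j - 1)) (hib (j + 1))) = fen True (rlo (W j)) (rhi (W j))"
proof -
  consider "j = 1" | "j = n" "n \<noteq> 1" | "j - 2 \<ge> 1" "j + 2 \<le> n"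
  proof -
    have "j \<noteq> 2" "j + 1 \<noteq> n" using j n_odd by auto
    then show ?thesis using that j by fastforce
  qed
  then show ?thesis
  proof cases
    case 1
    then show ?thesis using Phi_up[of 2 False] n3
      by (simp add: lob_def hib_def fen_pair[of False 1, simplified])
  next
    case 2
    have "even (n - 1)" using n_odd by simp
    then show ?thesis using Phi_down[of "n - 1" False] n3 2
      by (simp add: lob_def hib_def fen_pair' n_odd)
  next
    case 3
    have l: "lob (j - 1) = j - 1" "hib (j + 1) = j + 1" using 3 by (auto simp: lob_def hib_def)
    have 1: "(fen False (j - 1) (j + 1) :: 'n uq) = qbr (qbr (gE j) (gE (j - 1))) (gE (j + 1))"
      using j by (simp add: fen_step[of "j - 1" j] fen_pair')
    have 2: "Phi False (qbr (gE j) (gE (j - 1))) = fen True (j - 2) (j - 1)"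
      using Phi_down[of "j - 1" False] 3 j by (simp add: lob_def)
    have 4: "Phi False (gE (j + 1)) = fen True j (j + 2)"
      using Phi_gE[of "j + 1" False] 3 j by (simp add: lob_def hib_def add.commute)
    show ?thesis using 3 fen_split[of "j - 2" "j - 1" "j + 2" True] j
      by (simp add: l 1 Phi_simps(8)[where y = "gE (j + 1)"] 2 4)
  qed
qed

lemma Phi_odd_fen_x:
  assumes j: "even j" "j \<in> {1..n}"
  shows "Phi False (fen False (lob (j - 2)) (hib (j + 2))) = fen True (rlo (X j)) (rhi (X j))"
proof -
  have j2: "j \<ge> 2" "j \<le> n - 1" "j - 1 \<ge> 1" "odd (j - 1)" "odd (j + 1)" using j n_odd by (auto simp: le_less)
  have jn: "j \<noteq> n - 2" "j \<noteq> 3" using j n_odd by auto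
  have low: "Phi False (fen False (j - 2) (j - 1)) = fen True (j - 3) (j - 2)" if "j \<noteq> 2"
    using Phi_down[of "j - 2" False] that j2 j jn
    by (auto simp: fen_pair'[of False "j - 1", simplified] lob_def)
  have mid: "Phi False (gE j) = fen True (j - 1) (j + 1)"
    using Phi_gE[of j False] j j2 by (simp add: lob_def hib_def)
  have left: "Phi False (fen False (lob (j - 2)) j) = fen True (rlo (X j)) (j + 1)"
  proof (cases "j = 2")
    case True
    then show ?thesis using Phi_up[of 2 False] n3
      by (simp add: lob_def hib_def fen_pair[of False 1, simplified])
  next
    case False
    have f: "(fen False (j - 2) j :: 'n uq) = qbr (fen False (j - 2) (j - 1)) (gE j)"
      using fen_step[of "j - 2" "j - 1" False] j by simp
    then show ?thesis using low[OF False] mid False j2 j jn fen_split[of "j - 3" "j - 2" "j + 1" True]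
      by (simp add: f lob_def Phi_simps)
  qed
  show ?thesis
  proof (cases "j = n - 1")
    case False
    have "fen False (j + 1) (j + 2) = (qbr (gE (j + 1)) (gE (j + 2)) :: 'n uq)"
      using fen_pair[of False "j + 1"] j by (simp add: algebra_simps)
    then have right: "Phi False (fen False (j + 1) (j + 2)) = fen True (j + 2) (j + 3)"
      using Phi_up[of "j + 2" False] False j2 j jn by (simp add: hib_def algebra_simps)
    have h: "hib (j + 2) = j + 2" "lob (j - 2) \<le> j" "rlo (X j) \<le> j + 1"
      using False j2 jn by (auto simp: hib_def lob_def)
    have f: "(fen False (lob (j - 2)) (j + 2) :: 'n uq) = qbr (fen False (j + 1) (j + 2)) (fen False (lob (j - 2)) j)"
      using fen_split[OF h(2), of "j + 2" False] j by simp
    have g: "fen True (rlo (X j)) (j + 3) = (qbr (fen True (j + 2) (j + 3)) (fen True (rlo (X j)) (j + 1)) :: 'n uq)"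
      using fen_split[OF h(3), of "j + 3" True] j by (simp add: algebra_simps del: rlo.simps)
    have "rhi (X j) = j + 3" using False by simp
    then show ?thesis by (simp add: g f h Phi_simps left right del: rlo.simps rhi.simps)
  next
    case True
    have h: "hib (j + 2) = n" using True by (simp add: hib_def)
    show ?thesis
    proof (cases "n = 3")
      case n3': True
      then have j: "j = 2" using True by simp
      have f: "(fen False 1 3 :: 'n uq) = qbr (gE 1) (qbr (gE 3) (gE 2))"
        using fen_first[of 1 3 False] fen_pair[of False 2] by simp
      have "Phi False (fen False 1 3) = gE 2"
      proof (rule Phi_window[where lo = 1 and hi = 3])
        show "compT T (filter (\<lambda>k. even k = False) [1..3]) (fen False 1 3) = gE 2"
          using window3[of False 2] n3' T_qbr[of 3 2] T_qbr[of 1 2]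
          by (simp add: f alg_hom_simps(8)[OF alg_hom_T] T_far)
        show "T k (fen False 1 3) = fen False 1 3" if "3 < k" "even k = False" for k
        proof (rule T_fen_fixed)
          have "k \<noteq> 4" using that by auto
          then show "k < 1 - 1 \<or> k > 3 + 1" using that by auto
        qed simp
      qed (use n3' in \<open>auto simp: T_far\<close>)
      moreover have "rhi (X j) = j" using True by simp
      moreover have "lob (j - 2) = 1" "rlo (X j) = 2" using j by (simp_all add: lob_def)
      ultimately show ?thesis unfolding h using j n3' by (simp only: fen_same)
    next
      case False
      have "n \<noteq> 4" using n_odd by auto
      then have j4: "j \<ge> 4" using True False n3 by simp
      have "(fen False j (j + 1) :: 'n uq) = qbr (gE (j + 1)) (gE j)"
        using fen_pair[of False j] j by simp
      then have right: "Phi False (fen False j (j + 1)) = fen True (j - 1) j"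
        using Phi_down[of j False] True j2 j by (simp add: lob_def)
      have f: "(fen False (j - 2) (j + 1) :: 'n uq) = qbr (fen False (j - 2) (j - 1)) (fen False j (j + 1))"
        using fen_split[of "j - 2" "j - 1" "j + 1" False] j by simp
      have r: "rhi (X j) = j" "rlo (X j) = j - 3" "lob (j - 2) = j - 2" "hib (j + 2) = j + 1"
        using True j4 by (simp_all add: lob_def hib_def)
      have "Phi False (fen False (j - 2) (j + 1)) = fen True (j - 3) j"
        using fen_split[of "j - 3" "j - 2" j True] j j4 low
        by (simp add: f Phi_simps(8) right)
      then show ?thesis unfolding r .
    qed
  qed
qed

text \<open>
  A word in the \<open>T\<^sub>k\<close> that occurs in the definition of a root vector contains all factors that matter for
  its argument, so it may be completed to a product of values of \<open>Phi\<close>.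
\<close>

lemma V_Phi: "even j \<Longrightarrow> j \<in> {1..n} \<Longrightarrow> root_vector T (V j) = Phi False (gE j)"
  using T_neighbours[of j] Phi_gE[of j False] by simp

lemma W_Phi:
  assumes j: "odd j" "j \<in> {1..n}"
  shows "root_vector T (W j) = Phi False (Phi True (gE j))"
proof -
  have 1: "Phi True (gE j) = fen False (lob (j - 1)) (hib (j + 1))"
    "T (j - 1) (T (j + 1) (gE j)) = fen False (lob (j - 1)) (hib (j + 1))"
    using j Phi_gE[of j True] T_neighbours[of j] by auto
  have jn: "j + 1 \<noteq> n" using j n_odd by auto
  have "compT T (filter (\<lambda>k. even k = False) [j - 2..j + 2]) (fen False (lob (j - 1)) (hib (j + 1)))
      = fen True (rlo (W j)) (rhi (W j))"
  proof (rule Phi_window_conv)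
    show "T k (fen False (lob (j - 1)) (hib (j + 1))) = fen False (lob (j - 1)) (hib (j + 1))"
      if "k > j + 2" for k
      by (rule T_fen_fixed) (use that lob_hib[OF j(2)] in auto)
    show "T k (fen True (rlo (W j)) (rhi (W j))) = fen True (rlo (W j)) (rhi (W j))"
      if "k < j - 2" "even k = False" for k
    proof (rule T_fen_fixed)
      have "k \<noteq> j - 3" using that j by auto
      then show "k < rlo (W j) - 1 \<or> k > rhi (W j) + 1" using that by auto
      show "rlo (W j) \<le> rhi (W j)" using n3 j jn by auto
    qed
  qed (use j Phi_odd_fen_w[OF j] in auto)
  then show ?thesis using window5[of j True] j by (simp add: 1 Phi_odd_fen_w[OF j])
qed

lemma Phi_Phi_gE_even:
  assumes "even j" "j \<in> {1..n}"
  shows "Phi True (Phi False (gE j)) = fen False (lob (j - 2)) (hib (j + 2))"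
proof -
  have "j \<noteq> n" "j \<noteq> 1" using assms n_odd by auto
  then show ?thesis
    using Phi_gE[of j False] Phi_fen3[of True j] assms by (simp add: lob_def hib_def)
qed

lemma X_Phi:
  assumes j: "even j" "j \<in> {1..n}"
  shows "root_vector T (X j) = Phi False (Phi True (Phi False (gE j)))"
proof -
  have jn: "j \<noteq> n" "j \<noteq> 1" "j \<noteq> n - 2" "j \<noteq> 3" using j n_odd by auto
  have 1: "Phi False (gE j) = fen True (j - 1) (j + 1)"
    "T (j - 1) (T (j + 1) (gE j)) = fen True (j - 1) (j + 1)"
    using j jn Phi_gE[of j False] T_neighbours[of j] by (auto simp: lob_def hib_def)
  have b: "j - 2 \<le> lob (j - 2)" "lob (j - 2) \<le> j" "j \<le> hib (j + 2)" "hib (j + 2) \<le> j + 2"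
    using j jn by (auto simp: lob_def hib_def)
  have 2: "compT T (filter (\<lambda>k. even k = True) [j - 2..j + 2]) (fen True (j - 1) (j + 1))
      = fen False (lob (j - 2)) (hib (j + 2))"
  proof (rule Phi_window_conv)
    show "T k (fen True (j - 1) (j + 1)) = fen True (j - 1) (j + 1)" if "k > j + 2" for k
      by (rule T_fen_fixed) (use that in auto)
    show "T k (fen False (lob (j - 2)) (hib (j + 2))) = fen False (lob (j - 2)) (hib (j + 2))"
      if "k < j - 2" "even k = True" for k
    proof (rule T_fen_fixed)
      have "k \<noteq> j - 3" using that j by auto
      then show "k < lob (j - 2) - 1 \<or> k > hib (j + 2) + 1" using that b by auto
    qed (use b in auto)
  qed (use j jn Phi_Phi_gE_even[OF j] 1 in auto)
  have 3: "compT T (filter (\<lambda>k. even k = False) [j - 3..j + 3]) (fen False (lob (j - 2)) (hib (j + 2)))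
      = fen True (rlo (X j)) (rhi (X j))"
  proof (rule Phi_window_conv)
    show "T k (fen False (lob (j - 2)) (hib (j + 2))) = fen False (lob (j - 2)) (hib (j + 2))"
      if "k > j + 3" for k
      by (rule T_fen_fixed) (use that b in auto)
    show "T k (fen True (rlo (X j)) (rhi (X j))) = fen True (rlo (X j)) (rhi (X j))"
      if "k < j - 3" "even k = False" for k
    proof (rule T_fen_fixed)
      have "k \<noteq> j - 4" using that j by auto
      then show "k < rlo (X j) - 1 \<or> k > rhi (X j) + 1" using that by auto
      show "rlo (X j) \<le> rhi (X j)" using n3 j jn by auto
    qed
  qed (use j jn Phi_odd_fen_x[OF j] in auto)
  show ?thesis using 2 3 window5[of j False] window7[of j True] j
    by (simp add: 1 Phi_fen3[of True j] Phi_Phi_gE_even[OF j, unfolded 1] Phi_odd_fen_x[OF j])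
qed

lemma in_rlabels:
  "U j \<in> set (rlabels n) \<longleftrightarrow> odd j \<and> j \<in> {1..n}" "V j \<in> set (rlabels n) \<longleftrightarrow> even j \<and> j \<in> {1..n}"
  "W j \<in> set (rlabels n) \<longleftrightarrow> odd j \<and> j \<in> {1..n}" "X j \<in> set (rlabels n) \<longleftrightarrow> even j \<and> j \<in> {1..n}"
  by (auto simp: rlabels_def)

lemma root_vector_fen:
  assumes "k \<in> set (rlabels n)"
  shows "root_vector T k = fen True (rlo k) (rhi k)"
proof (cases k)
  case (U j)
  then show ?thesis by simp
next
  case (V j)
  then have "even j" "j \<in> {1..n}" using assms in_rlabels by auto
  moreover have "j \<noteq> n" "j \<noteq> 1" using calculation n_odd by auto
  ultimately show ?thesis using V V_Phi[of j] Phi_gE[of j False]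
    by (simp add: lob_def hib_def del: root_vector.simps)
next
  case (W j)
  then have "odd j" "j \<in> {1..n}" using assms in_rlabels by auto
  then show ?thesis using W W_Phi[of j] Phi_gE[of j True] Phi_odd_fen_w[of j]
    by (simp del: root_vector.simps rlo.simps rhi.simps)
next
  case (X j)
  then have "even j" "j \<in> {1..n}" using assms in_rlabels by auto
  then show ?thesis using X X_Phi[of j] Phi_Phi_gE_even[of j] Phi_odd_fen_x[of j]
    by (simp del: root_vector.simps rlo.simps rhi.simps)
qed

section \<open>Straightening relations between root vectors\<close>

definition yv :: "int \<Rightarrow> 'n uq" where "yv i = root_vector T (ylabel i)"

definition zv :: "int \<Rightarrow> 'n uq" where
  "zv i = (if i = 0 \<or> i = n + 1 then 1 else root_vector T (zlabel i))"

lemma yz_labels: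
  assumes "i \<in> {1..n}"
  shows "ylabel i \<in> set (rlabels n)" "zlabel i \<in> set (rlabels n)"
  using assms by (auto simp: ylabel_def zlabel_def in_rlabels)

lemma even_range: "even i \<Longrightarrow> i \<in> {1..n} \<Longrightarrow> 2 \<le> i \<and> i \<le> n - 1 \<and> i \<noteq> 3 \<and> i \<noteq> n - 2"
  using n_odd by (auto simp: le_less)

lemma odd_range: "odd i \<Longrightarrow> i \<in> {1..n} \<Longrightarrow> i \<noteq> 2 \<and> i \<noteq> n - 1"
  using n_odd by auto

lemma yv_odd: "odd i \<Longrightarrow> yv i = gE i"
  by (simp add: yv_def ylabel_def)

lemma zv_even: "even i \<Longrightarrow> i \<in> {1..n} \<Longrightarrow> zv i = Phi False (gE i)"
  by (simp add: zv_def zlabel_def V_Phi del: root_vector.simps)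

lemma zv_odd: "odd i \<Longrightarrow> i \<in> {1..n} \<Longrightarrow> zv i = Phi False (Phi True (gE i))"
  by (simp add: zv_def zlabel_def W_Phi del: root_vector.simps)

lemma yv_even: "even i \<Longrightarrow> i \<in> {1..n} \<Longrightarrow> yv i = Phi False (Phi True (Phi False (gE i)))"
  by (simp add: yv_def ylabel_def X_Phi del: root_vector.simps)

lemma yv_fen: "i \<in> {1..n} \<Longrightarrow> yv i = fen True (rlo (ylabel i)) (rhi (ylabel i))"
  by (simp add: yv_def root_vector_fen yz_labels)

lemma zv_fen: "i \<in> {1..n} \<Longrightarrow> zv i = fen True (rlo (zlabel i)) (rhi (zlabel i))"
  by (simp add: zv_def root_vector_fen yz_labels)

lemma PT_odd: "odd i \<Longrightarrow> i \<in> {1..n} \<Longrightarrow> Phi True (gE i) = fen False (lob (i - 1)) (hib (i + 1))"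
  using Phi_gE[of i True] by simp

lemma PF_even: "even i \<Longrightarrow> i \<in> {1..n} \<Longrightarrow> Phi False (gE i) = fen True (i - 1) (i + 1)"
  using Phi_gE[of i False] even_range[of i] by (simp add: lob_def hib_def)

text \<open>The two root vectors are images of commuting letters under the same automorphism.\<close>

lemma yv_commute_same:
  assumes "i \<in> {1..n}" "j \<in> {1..n}" "even i = even j"
  shows "yv i * yv j = yv j * yv i"
proof -
  have "gE i * gE j = (gE j * gE i :: 'n uq)"
  proof (cases "i = j")
    case False
    then have "\<bar>i - j\<bar> \<ge> 2" using assms(3) by presburger
    then show ?thesis by (rule gE_commute)
  qed simp
  then show ?thesis using assms
    by (cases "even i") (simp_all add: yv_odd yv_even flip: Phi_simps(3))
qed

lemma zv_commute_same:
  assumes "i \<in> {1..n}" "j \<in> {1..n}" "even i = even j"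
  shows "zv i * zv j = zv j * zv i"
proof -
  have "gE i * gE j = (gE j * gE i :: 'n uq)"
  proof (cases "i = j")
    case False
    then have "\<bar>i - j\<bar> \<ge> 2" using assms(3) by presburger
    then show ?thesis by (rule gE_commute)
  qed simp
  then show ?thesis using assms
    by (cases "even i") (simp_all add: zv_odd zv_even flip: Phi_simps(3))
qed

text \<open>
  The only positions of a sink \<open>E\<^sub>i\<close> that are excluded are those strictly inside the fence and next to it.
\<close>

lemma fen_qcommute:
  assumes "a < b" "even i \<noteq> e" "k = 1 \<and> (i = a \<or> i = b) \<or> k = 0 \<and> (i < a - 1 \<or> i > b + 1)"
  shows "fen e a b * gE i = vs k (gE i * (fen e a b :: 'n uq))"
proof -
  consider "i = a" "k = 1" | "i = b" "k = 1" | "i < a - 1 \<or> i > b + 1" "k = 0" using assms(3) by blast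
  then show ?thesis
  proof cases
    case 1
    then show ?thesis using assms fen_end_left[of i b e, where 'a = 'n] by simp
  next
    case 2
    then show ?thesis using assms fen_end_right[of a i e, where 'a = 'n] by simp
  next
    case 3
    then show ?thesis using assms fen_commute_gE[of a b i e, where 'a = 'n] by auto
  qed
qed

lemma Phi_qcommute:
  assumes "x * y = vs k (y * x)" shows "Phi e x * Phi e y = vs k (Phi e y * Phi e x)"
  using assms by (metis Phi_simps(3,7))

definition near :: "int \<Rightarrow> int \<Rightarrow> int \<Rightarrow> int" where
  "near d i j = (if \<bar>i - j\<bar> = d then 1 else 0)"

text \<open>
  In each of the following relations the automorphisms that both factors have in common are removed; what
  remains is a relation between a fence and a letter.
\<close>

lemma zv_even_yv_odd:
  assumes "odd i" "i \<in> {1..n}" "even j" "j \<in> {1..n}"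
  shows "zv j * yv i = vs (near 1 i j) (yv i * zv j)"
proof -
  have "i \<noteq> j" "i \<noteq> j - 2" "i \<noteq> j + 2" using assms by auto
  then have "fen True (j - 1) (j + 1) * gE i = vs (near 1 i j) (gE i * (fen True (j - 1) (j + 1) :: 'n uq))"
    using assms by (intro fen_qcommute) (auto simp: near_def)
  then show ?thesis using assms by (simp add: yv_odd zv_even PF_even)
qed

lemma zv_odd_yv_odd:
  assumes "odd i" "i \<in> {1..n}" "odd j" "j \<in> {1..n}" "i \<noteq> j"
  shows "zv j * yv i = vs (near 2 i j) (yv i * zv j)"
proof -
  have d: "\<bar>i - j\<bar> = 2 \<or> \<bar>i - j\<bar> \<ge> 4" using assms by presburger
  have jn: "j \<noteq> n - 1" "j \<noteq> 2" using assms n_odd by auto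
  have "fen True (rlo (W j)) (rhi (W j)) * gE i
      = vs (near 2 i j) (gE i * (fen True (rlo (W j)) (rhi (W j)) :: 'n uq))"
    using d jn assms n3 by (intro fen_qcommute) (auto simp: near_def split: if_splits)
  then show ?thesis using assms by (simp add: yv_odd zv_fen zlabel_def del: rlo.simps rhi.simps)
qed

lemma yv_even_yv_odd:
  assumes "odd i" "i \<in> {1..n}" "even j" "j \<in> {1..n}" "\<bar>i - j\<bar> \<noteq> 1"
  shows "yv j * yv i = vs (near 3 i j) (yv i * yv j)"
proof -
  have d: "\<bar>i - j\<bar> = 3 \<or> \<bar>i - j\<bar> \<ge> 5" using assms by presburger
  have jn: "2 \<le> j" "j \<le> n - 1" "j \<noteq> 3" "j \<noteq> n - 2" using assms even_range by auto
  have "fen True (rlo (X j)) (rhi (X j)) * gE i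
      = vs (near 3 i j) (gE i * (fen True (rlo (X j)) (rhi (X j)) :: 'n uq))"
    using d jn assms n3 by (intro fen_qcommute) (auto simp: near_def split: if_splits)
  then show ?thesis using assms by (simp add: yv_odd yv_fen ylabel_def del: rlo.simps rhi.simps)
qed

lemma zv_odd_zv_even:
  assumes "even i" "i \<in> {1..n}" "odd j" "j \<in> {1..n}"
  shows "zv j * zv i = vs (near 1 i j) (zv i * zv j)"
proof -
  have d: "\<bar>i - j\<bar> = 1 \<or> \<bar>i - j\<bar> \<ge> 3" using assms by presburger
  have jn: "2 \<le> i" "i \<le> n - 1" using assms even_range by auto
  have "fen False (lob (j - 1)) (hib (j + 1)) * gE i
      = vs (near 1 i j) (gE i * (fen False (lob (j - 1)) (hib (j + 1)) :: 'n uq))"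
    using d jn assms n3 by (intro fen_qcommute) (auto simp: near_def lob_def hib_def)
  then have "Phi True (gE j) * gE i = vs (near 1 i j) (gE i * Phi True (gE j))"
    using assms by (simp add: PT_odd)
  from Phi_qcommute[OF this, of False] show ?thesis using assms by (simp add: zv_odd zv_even)
qed

lemma yv_even_zv_even:
  assumes "even i" "i \<in> {1..n}" "even j" "j \<in> {1..n}" "i \<noteq> j"
  shows "yv j * zv i = vs (near 2 i j) (zv i * yv j)"
proof -
  have d: "\<bar>i - j\<bar> = 2 \<or> \<bar>i - j\<bar> \<ge> 4" using assms by presburger
  have jn: "2 \<le> i" "i \<le> n - 1" "2 \<le> j" "j \<le> n - 1" using assms even_range by auto
  have "fen False (lob (j - 2)) (hib (j + 2)) * gE i
      = vs (near 2 i j) (gE i * (fen False (lob (j - 2)) (hib (j + 2)) :: 'n uq))"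
    using d jn assms n3 by (intro fen_qcommute) (auto simp: near_def lob_def hib_def)
  then have "Phi True (Phi False (gE j)) * gE i = vs (near 2 i j) (gE i * Phi True (Phi False (gE j)))"
    using assms by (simp add: Phi_Phi_gE_even)
  from Phi_qcommute[OF this, of False] show ?thesis using assms by (simp add: yv_even zv_even)
qed

lemma yv_even_zv_odd:
  assumes "odd i" "i \<in> {1..n}" "even j" "j \<in> {1..n}"
  shows "yv j * zv i = vs (near 1 i j) (zv i * yv j)"
proof -
  have "i \<noteq> j" "i \<noteq> j - 2" "i \<noteq> j + 2" using assms by auto
  then have "fen True (j - 1) (j + 1) * gE i = vs (near 1 i j) (gE i * (fen True (j - 1) (j + 1) :: 'n uq))"
    using assms by (intro fen_qcommute) (auto simp: near_def)
  then have "Phi False (gE j) * gE i = vs (near 1 i j) (gE i * Phi False (gE j))"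
    using assms by (simp add: PF_even)
  from Phi_qcommute[OF Phi_qcommute[OF this], of False True]
  show ?thesis using assms by (simp add: yv_even zv_odd)
qed

text \<open>
  For the remaining pairs the letter lies strictly inside the fence, or next to it if the fence is
  reflected at the boundary. These pairs do not \<open>q\<close>-commute.
\<close>

lemmas fen_interior = fen_interior[where 'a = 'n]

lemma zv_yv_odd_interior:
  assumes "odd i" "1 < i" "i < n"
  shows "zv i * yv i = yv i * zv i + vs 1 (zv (i - 1) * zv (i + 1)) - vs (-1) (zv (i - 1) * zv (i + 1))"
proof -
  have "zv i = fen True (i - 2) (i + 2)" using assms zv_fen[of i] by (simp add: zlabel_def)
  moreover have "zv (i - 1) = fen True (i - 2) i" "zv (i + 1) = fen True i (i + 2)"
    using assms by (simp_all add: zv_even PF_even add.commute)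
  ultimately show ?thesis using assms fen_interior[of "i - 2" i "i + 2" True] by (simp add: yv_odd)
qed

lemma zv_yv_first: "zv 1 * yv 1 = vs (-1) (yv 1 * zv 1) + zv 2"
proof -
  have "zv 1 = fen True 2 3" "zv 2 = fen True 1 3"
    using n3 zv_fen[of 1] by (simp_all add: zlabel_def zv_even PF_even)
  then show ?thesis using fen_adjacent_left[of 2 3 True] by (simp add: yv_odd)
qed

lemma zv_yv_last: "zv n * yv n = vs (-1) (yv n * zv n) + zv (n - 1)"
proof -
  have "zv n = fen True (n - 2) (n - 1)" "zv (n - 1) = fen True (n - 2) n"
    using n3 n_odd zv_fen[of n] by (simp_all add: zlabel_def zv_even PF_even)
  then show ?thesis using fen_adjacent_right[of "n - 2" "n - 1" True] n_odd by (simp add: yv_odd)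
qed

lemma yv_zv_even:
  assumes "even i" "i \<in> {1..n}"
  shows "yv i * zv i = zv i * yv i + vs 1 (zv (i - 1) * zv (i + 1)) - vs (-1) (zv (i - 1) * zv (i + 1))"
proof -
  have i: "2 \<le> i" "i \<le> n - 1" using assms even_range by auto
  have "lob (i - 2) < i" "i < hib (i + 2)" using i by (auto simp: lob_def hib_def)
  from fen_interior[OF this, of False]
  have "Phi True (Phi False (gE i)) * gE i = gE i * Phi True (Phi False (gE i))
      + vs 1 (Phi True (gE (i - 1)) * Phi True (gE (i + 1)))
      - vs (-1) (Phi True (gE (i - 1)) * Phi True (gE (i + 1)))"
  proof -
    have "Phi True (gE (i - 1)) = fen False (lob (i - 2)) i" "Phi True (gE (i + 1)) = fen False i (hib (i + 2))"
      using assms i PT_odd[of "i - 1"] PT_odd[of "i + 1"] by (auto simp: lob_def hib_def add.commute)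
    then show ?thesis using fen_interior[OF \<open>lob (i - 2) < i\<close> \<open>i < hib (i + 2)\<close>, of False] assms
      by (simp add: Phi_Phi_gE_even)
  qed
  then have "Phi False (Phi True (Phi False (gE i)) * gE i) = Phi False (gE i * Phi True (Phi False (gE i))
      + vs 1 (Phi True (gE (i - 1)) * Phi True (gE (i + 1)))
      - vs (-1) (Phi True (gE (i - 1)) * Phi True (gE (i + 1))))" by (rule arg_cong)
  then show ?thesis using assms i by (simp add: yv_even zv_even zv_odd Phi_simps(2,3,6,7))
qed

lemma yv_even_yv_odd_interior:
  assumes "odd i" "even j" "j \<in> {1..n}" "\<bar>i - j\<bar> = 1" "1 < i" "i < n"
  shows "yv j * yv i = yv i * yv j + vs 1 (zv (min i j - 1) * zv (max i j + 1))
    - vs (-1) (zv (min i j - 1) * zv (max i j + 1))"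
proof -
  have j: "2 \<le> j" "j \<le> n - 1" "j \<noteq> 3" "j \<noteq> n - 2" using assms even_range by auto
  have lh: "rlo (X j) < i" "i < rhi (X j)" using assms j by auto
  have yj: "yv j = fen True (rlo (X j)) (rhi (X j))" using assms by (simp add: yv_fen ylabel_def)
  note fi = fen_interior[OF lh, of True] fen_commute_at_sink[OF lh, of True, where 'a = 'n]
  consider "i = j + 1" | "i = j - 1" using assms by linarith
  then show ?thesis
  proof cases
    case 1
    have "zv (j - 1) = fen True (rlo (X j)) i" "zv (i + 1) = fen True i (rhi (X j))"
      using assms j 1 zv_fen[of "j - 1"] zv_fen[of "j + 2"] PF_even[of "i + 1"]
      by (auto simp: zlabel_def zv_even add.commute)
    then show ?thesis using fi(1) assms 1 by (simp add: yv_odd yj del: rlo.simps rhi.simps)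
  next
    case 2
    have "zv (i - 1) = fen True (rlo (X j)) i" "zv (j + 1) = fen True i (rhi (X j))"
      using assms j 2 zv_fen[of "j + 1"] PF_even[of "i - 1"]
      by (auto simp: zlabel_def zv_even add.commute)
    then show ?thesis using fi(1) assms 2 by (simp add: yv_odd yj del: rlo.simps rhi.simps)
  qed
qed

lemma yv_2_yv_1: "yv 2 * yv 1 = vs (-1) (yv 1 * yv 2) + zv 3"
proof -
  have "zv 3 = fen True 1 (rhi (X 2))" "yv 2 = fen True 2 (rhi (X 2))"
    using n3 n_odd zv_fen[of 3] yv_fen[of 2] by (auto simp: zlabel_def ylabel_def)
  moreover have "2 \<le> rhi (X 2)" using n3 by auto
  ultimately show ?thesis using fen_adjacent_left[of 2 "rhi (X 2)" True, where 'a = 'n] by (simp add: yv_odd)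
qed

lemma yv_nm1_yv_n: "yv (n - 1) * yv n = vs (-1) (yv n * yv (n - 1)) + zv (n - 2)"
proof -
  have "zv (n - 2) = fen True (rlo (X (n - 1))) n" "yv (n - 1) = fen True (rlo (X (n - 1))) (n - 1)"
    using n3 n_odd zv_fen[of "n - 2"] yv_fen[of "n - 1"] by (auto simp: zlabel_def ylabel_def)
  moreover have "rlo (X (n - 1)) \<le> n - 1" using n3 by auto
  ultimately show ?thesis
    using fen_adjacent_right[of "rlo (X (n - 1))" "n - 1" True, where 'a = 'n] n_odd by (simp add: yv_odd)
qed

end

section \<open>The form on the root lattice\<close>

lemma rform_superset:
  assumes "finite A" "finite B" "Poly_Mapping.keys \<gamma> \<subseteq> A" "Poly_Mapping.keys \<delta> \<subseteq> B"
  shows "rform \<gamma> \<delta> = (\<Sum>i\<in>A. \<Sum>j\<in>B. Poly_Mapping.lookup \<gamma> i * Poly_Mapping.lookup \<delta> j * cartan i j)"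
proof -
  have "rform \<gamma> \<delta> = (\<Sum>i\<in>Poly_Mapping.keys \<gamma>. \<Sum>j\<in>B. Poly_Mapping.lookup \<gamma> i * Poly_Mapping.lookup \<delta> j * cartan i j)"
    unfolding rform_def
    by (intro sum.cong sum.mono_neutral_left) (use assms in \<open>auto simp: in_keys_iff\<close>)
  also have "\<dots> = (\<Sum>i\<in>A. \<Sum>j\<in>B. Poly_Mapping.lookup \<gamma> i * Poly_Mapping.lookup \<delta> j * cartan i j)"
    by (intro sum.mono_neutral_left) (use assms in \<open>auto simp: in_keys_iff\<close>)
  finally show ?thesis .
qed

lemma rform_sym: "rform \<gamma> \<delta> = rform \<delta> \<gamma>"
proof -
  have c: "cartan i j = cartan j i" for i j by (auto simp: cartan_def)
  show ?thesis
    unfolding rform_def by (subst sum.swap) (intro sum.cong refl, simp add: c[of _ "_ :: int"] mult.commute mult.left_commute)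
qed

lemma rform_add_left: "rform (\<gamma> + \<gamma>') \<delta> = rform \<gamma> \<delta> + rform \<gamma>' \<delta>"
proof -
  let ?A = "Poly_Mapping.keys \<gamma> \<union> Poly_Mapping.keys \<gamma>'"
  have "Poly_Mapping.keys (\<gamma> + \<gamma>') \<subseteq> ?A" by (rule keys_add)
  then show ?thesis
    by (simp add: rform_superset[of ?A "Poly_Mapping.keys \<delta>"] lookup_add ring_distribs sum.distrib)
qed

lemma rform_add_right: "rform \<gamma> (\<delta> + \<delta>') = rform \<gamma> \<delta> + rform \<gamma> \<delta>'"
  using rform_add_left[of \<delta> \<delta>' \<gamma>] by (simp add: rform_sym)

lemma rform_zero [simp]: "rform 0 \<gamma> = 0" "rform \<gamma> 0 = 0"
  by (simp_all add: rform_def)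

lemma rform_sum_left: "rform (sum f A) \<delta> = (\<Sum>x\<in>A. rform (f x) \<delta>)"
  by (induction A rule: infinite_finite_induct) (simp_all add: rform_add_left)

lemma rform_sum_right: "rform \<delta> (sum f A) = (\<Sum>x\<in>A. rform \<delta> (f x))"
  by (induction A rule: infinite_finite_induct) (simp_all add: rform_add_right)

lemma rform_simple: "rform (simple_root i) (simple_root j) = cartan i j"
  by (simp add: rform_def simple_root_def)

lemma rform_self_even: "even (rform \<gamma> \<gamma>)"
proof (induction \<gamma> rule: update_induct)
  case (update f a b)
  have *: "Poly_Mapping.update a b f = f + Poly_Mapping.single a b"
    by (rule poly_mapping_eqI)
      (use update.hyps in \<open>auto simp: lookup_update lookup_add lookup_single when_def in_keys_iff\<close>)
  have "rform (Poly_Mapping.single a b) (Poly_Mapping.single a b) = b * b * 2"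
    by (cases "b = 0") (simp_all add: rform_def cartan_def)
  then show ?case using update.IH rform_sym[of "Poly_Mapping.single a b" f]
    by (simp add: * rform_add_left rform_add_right)
qed simp

lemma height_superset:
  assumes "finite A" "Poly_Mapping.keys \<gamma> \<subseteq> A"
  shows "height \<gamma> = (\<Sum>i\<in>A. Poly_Mapping.lookup \<gamma> i)"
  unfolding height_def by (intro sum.mono_neutral_left) (use assms in \<open>auto simp: in_keys_iff\<close>)

lemma height_add: "height (\<gamma> + \<delta>) = height \<gamma> + height \<delta>"
proof -
  let ?A = "Poly_Mapping.keys \<gamma> \<union> Poly_Mapping.keys \<delta>"
  have "Poly_Mapping.keys (\<gamma> + \<delta>) \<subseteq> ?A" by (rule keys_add)
  then show ?thesis by (simp add: height_superset[of ?A] lookup_add sum.distrib)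
qed

lemma Nweight_add: "Nweight (\<gamma> + \<delta>) = Nweight \<gamma> + Nweight \<delta> + rform \<gamma> \<delta>"
proof -
  have "rform (\<gamma> + \<delta>) (\<gamma> + \<delta>) = rform \<gamma> \<gamma> + rform \<delta> \<delta> + 2 * rform \<gamma> \<delta>"
    by (simp add: rform_add_left rform_add_right rform_sym[of \<delta> \<gamma>])
  moreover obtain a b where "rform \<gamma> \<gamma> = 2 * a" "rform \<delta> \<delta> = 2 * b"
    using rform_self_even by (metis evenE)
  ultimately show ?thesis by (simp add: Nweight_def height_add)
qed

lemma Nweight_zero [simp]: "Nweight 0 = 0"
  by (simp add: Nweight_def height_def)

definition rint :: "int \<Rightarrow> int \<Rightarrow> root_lattice" where
  "rint a b = (\<Sum>k\<in>{a..b}. simple_root k)"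

lemma rint_same [simp]: "rint a a = simple_root a" by (simp add: rint_def)

lemma rint_empty: "b < a \<Longrightarrow> rint a b = 0" by (simp add: rint_def)

lemma rint_step: "a \<le> b + 1 \<Longrightarrow> rint a (b + 1) = rint a b + simple_root (b + 1)"
proof -
  assume "a \<le> b + 1"
  then have "{a..b + 1} = insert (b + 1) {a..b}" by auto
  then show ?thesis by (simp add: rint_def)
qed

lemma rform_simple_rint:
  assumes "a \<le> b"
  shows "rform (simple_root k) (rint a b) = (if k = a then 1 else 0) + (if k = b then 1 else 0)
    - (if k = a - 1 then 1 else 0) - (if k = b + 1 then 1 else 0)"
  using assms
proof (induction rule: fen_induct)
  case base
  then show ?case by (auto simp: rform_simple cartan_def)
next
  case (step b)
  then show ?case by (auto simp: rint_step rform_add_right rform_simple cartan_def)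
qed

lemma rform_rint_rint:
  assumes "a \<le> b" "c \<le> d"
  shows "rform (rint a b) (rint c d) = (if a \<le> c \<and> c \<le> b then 1 else 0) + (if a \<le> d \<and> d \<le> b then 1 else 0)
    - (if a \<le> c - 1 \<and> c - 1 \<le> b then 1 else 0) - (if a \<le> d + 1 \<and> d + 1 \<le> b then 1 else 0)"
proof -
  have "rform (rint a b) (rint c d) = (\<Sum>k\<in>{a..b}. rform (simple_root k) (rint c d))"
    by (subst rint_def) (rule rform_sum_left)
  then show ?thesis
    by (simp add: rform_simple_rint[OF assms(2)] sum.distrib sum_subtractf sum.delta)
qed

section \<open>The grading of the positive part\<close>

abbreviation gEw :: "int list \<Rightarrow> 'n uq" where "gEw ws \<equiv> prod_list (map gE ws)"

lemma comp_word: "set ws \<subseteq> {1..rank TYPE('n)} \<Longrightarrow> (gEw ws :: 'n uq) \<in> uplus_comp (sum_list (map simple_root ws))"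
  unfolding uplus_comp_def by (rule uq.span_base) blast

lemma comp_induct [consumes 1, case_names zero add word]:
  assumes "x \<in> uplus_comp \<gamma>" "P 0" "\<And>x y c. x \<in> uplus_comp \<gamma> \<Longrightarrow> y \<in> uplus_comp \<gamma> \<Longrightarrow> P x \<Longrightarrow> P y \<Longrightarrow> P ((c *\<^sub>q x) + y)"
    "\<And>ws. set ws \<subseteq> {1..rank TYPE('n)} \<Longrightarrow> sum_list (map simple_root ws) = \<gamma> \<Longrightarrow> P (gEw ws)"
  shows "P (x :: 'n uq)"
proof -
  have "x \<in> uplus_comp \<gamma> \<and> P x"
    using assms(1) unfolding uplus_comp_def
  proof (induction rule: uq.span_induct_alt)
    case base
    then show ?case using assms(2) by (simp add: uq.span_zero)
  next
    case (step c x y)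
    then have "x \<in> uplus_comp \<gamma>" "P x" using assms(4) by (auto simp: uplus_comp_def intro: uq.span_base)
    with step assms(3)[of x y c] show ?case
      by (auto simp: uplus_comp_def intro: uq.span_add uq.span_scale)
  qed
  then show ?thesis ..
qed

lemma comp_zero [simp]: "0 \<in> uplus_comp \<gamma>" by (simp add: uplus_comp_def uq.span_zero)
lemma comp_add: "x \<in> uplus_comp \<gamma> \<Longrightarrow> y \<in> uplus_comp \<gamma> \<Longrightarrow> x + y \<in> uplus_comp \<gamma>"
  unfolding uplus_comp_def by (rule uq.span_add)
lemma comp_diff: "x \<in> uplus_comp \<gamma> \<Longrightarrow> y \<in> uplus_comp \<gamma> \<Longrightarrow> x - y \<in> uplus_comp \<gamma>"
  unfolding uplus_comp_def by (rule uq.span_diff)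
lemma comp_scale: "x \<in> uplus_comp \<gamma> \<Longrightarrow> c *\<^sub>q x \<in> uplus_comp \<gamma>"
  unfolding uplus_comp_def by (rule uq.span_scale)
lemma comp_vs: "x \<in> uplus_comp \<gamma> \<Longrightarrow> vs a x \<in> uplus_comp \<gamma>"
  unfolding vs_def by (rule comp_scale)
lemma comp_one: "1 \<in> uplus_comp 0" using comp_word[of "[]"] by simp
lemma comp_gE: "i \<in> {1..rank TYPE('n)} \<Longrightarrow> (gE i :: 'n uq) \<in> uplus_comp (simple_root i)"
  using comp_word[of "[i]", where 'n = 'n] by simp

lemma comp_mult:
  fixes x y :: "'n uq"
  assumes "x \<in> uplus_comp \<gamma>" "y \<in> uplus_comp \<delta>"
  shows "x * y \<in> uplus_comp (\<gamma> + \<delta>)"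
  using assms(1)
proof (induction rule: comp_induct)
  case (word ws)
  show ?case using assms(2)
  proof (induction rule: comp_induct)
    case (word js)
    then show ?case using comp_word[of "ws @ js", where 'n = 'n] \<open>set ws \<subseteq> _\<close> \<open>sum_list _ = \<gamma>\<close> by simp
  next
    case (add x y c)
    then show ?case by (simp add: distrib_left comp_add comp_scale)
  qed simp
next
  case (add x y c)
  then show ?case by (simp add: distrib_right comp_add comp_scale)
qed simp

lemma uplus_zero: "0 \<in> uplus"
  using uplus.scale[OF uplus.one, of 0] by simp

lemma uplus_diff: "x \<in> uplus \<Longrightarrow> y \<in> uplus \<Longrightarrow> x - y \<in> uplus"
  using uplus.add[of x "-1 *\<^sub>q y"] uplus.scale[of y "-1"] by simp

lemma uplus_vs: "x \<in> uplus \<Longrightarrow> vs a x \<in> uplus" unfolding vs_def by (rule uplus.scale)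

lemma uplus_word: "set ws \<subseteq> {1..rank TYPE('n)} \<Longrightarrow> (gEw ws :: 'n uq) \<in> uplus"
  by (induction "ws") (simp_all add: uplus.one uplus.mult uplus.gen)

lemma comp_uplus: "x \<in> uplus_comp \<gamma> \<Longrightarrow> x \<in> uplus"
  by (induction rule: comp_induct) (simp_all add: uplus_zero uplus.add uplus.scale uplus_word)

lemma uplus_span_words:
  "x \<in> uplus \<Longrightarrow> x \<in> uq.span {gEw ws | ws. set ws \<subseteq> {1..rank TYPE('n)}}"
  for x :: "'n uq"
proof (induction rule: uplus.induct)
  case (gen i)
  then have "gE i = gEw [i] \<and> set [i] \<subseteq> {1..rank TYPE('n)}" by simp
  then show ?case by (intro uq.span_base) blast
next
  case one
  have "1 = gEw [] \<and> set [] \<subseteq> {1..rank TYPE('n)}" by simp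
  then show ?case by (intro uq.span_base) blast
next
  case (scale x c)
  show ?case by (rule uq.span_scale) (rule scale.IH)
next
  case (add x y)
  then show ?case by (intro uq.span_add)
next
  case (mult x y)
  let ?S = "{gEw ws | ws. set ws \<subseteq> {1..rank TYPE('n)}} :: 'n uq set"
  have w: "gEw ws * y \<in> uq.span ?S" if "set ws \<subseteq> {1..rank TYPE('n)}" for "ws"
    using mult.IH(2)
  proof (induction rule: uq.span_induct_alt)
    case base
    then show ?case by (simp add: uq.span_zero)
  next
    case (step c u y)
    then obtain js where js: "u = gEw js" "set js \<subseteq> {1..rank TYPE('n)}" by blast
    have "gEw ws * gEw js = (gEw (ws @ js) :: 'n uq)" by simp
    then have "gEw ws * u \<in> ?S" using js that by (metis (mono_tags, lifting) mem_Collect_eq set_append Un_least)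
    then show ?case using step by (simp add: distrib_left uq.span_add uq.span_scale uq.span_base)
  qed
  from mult.IH(1) show ?case
  proof (induction rule: uq.span_induct_alt)
    case base
    then show ?case by (simp add: uq.span_zero)
  next
    case (step c u x)
    then show ?case using w by (auto simp: distrib_right uq.span_add uq.span_scale)
  qed
qed

lemma comp_fen:
  assumes "1 \<le> a" "a \<le> b" "b \<le> rank TYPE('n)"
  shows "(fen e a b :: 'n uq) \<in> uplus_comp (rint a b)"
  using assms(2,1,3)
proof (induction rule: fen_induct)
  case base
  then show ?case by (simp add: comp_gE)
next
  case (step b)
  have E: "(gE (b + 1) :: 'n uq) \<in> uplus_comp (simple_root (b + 1))" using step by (intro comp_gE) simp
  have F: "(fen e a b :: 'n uq) \<in> uplus_comp (rint a b)" using step by simp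
  have EF: "gE (b + 1) * (fen e a b :: 'n uq) \<in> uplus_comp (rint a (b + 1))"
    "(fen e a b :: 'n uq) * gE (b + 1) \<in> uplus_comp (rint a (b + 1))"
    using step(1) comp_mult[OF E F] comp_mult[OF F E]
    by (simp_all add: rint_step add.commute[of "simple_root _"])
  show ?case unfolding fen_step[OF step(1)] qbr_def
    by (simp add: EF comp_diff comp_vs)
qed

section \<open>Kashiwara's operators on fences\<close>

locale kashiwara = braid T n
  for T :: "int \<Rightarrow> 'n uq \<Rightarrow> 'n uq" and n +
  fixes D :: "int \<Rightarrow> 'n uq \<Rightarrow> 'n uq" and form :: "'n uq \<Rightarrow> 'n uq \<Rightarrow> qv"
  assumes D: "is_skew_derivations D" and form: "is_kashiwara_form D form"
begin

lemma D_uplus: "i \<in> {1..n} \<Longrightarrow> x \<in> uplus \<Longrightarrow> D i x \<in> uplus"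
  using D unfolding is_skew_derivations_def n by blast

lemma D_add: "i \<in> {1..n} \<Longrightarrow> x \<in> uplus \<Longrightarrow> y \<in> uplus \<Longrightarrow> D i (x + y) = D i x + D i y"
  using D unfolding is_skew_derivations_def n by blast

lemma D_scale: "i \<in> {1..n} \<Longrightarrow> x \<in> uplus \<Longrightarrow> D i (c *\<^sub>q x) = c *\<^sub>q D i x"
  using D unfolding is_skew_derivations_def n by blast

lemma D_gE: "i \<in> {1..n} \<Longrightarrow> j \<in> {1..n} \<Longrightarrow> D i (gE j) = (if i = j then 1 else 0)"
  using D unfolding is_skew_derivations_def n by blast

lemma D_mult: "i \<in> {1..n} \<Longrightarrow> x \<in> uplus_comp \<gamma> \<Longrightarrow> y \<in> uplus_comp \<delta> \<Longrightarrow>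
    D i (x * y) = D i x * y + vs (rform (simple_root i) \<gamma>) (x * D i y)"
  using D unfolding is_skew_derivations_def n by (simp add: vs_def)

lemma D_zero: "i \<in> {1..n} \<Longrightarrow> D i 0 = 0"
  using D_scale[of i 0 0] uplus_zero by simp

lemma D_vs: "i \<in> {1..n} \<Longrightarrow> x \<in> uplus \<Longrightarrow> D i (vs a x) = vs a (D i x)"
  by (simp add: vs_def D_scale)

lemma D_diff: "i \<in> {1..n} \<Longrightarrow> x \<in> uplus \<Longrightarrow> y \<in> uplus \<Longrightarrow> D i (x - y) = D i x - D i y"
  using D_add[of i x "-1 *\<^sub>q y"] D_scale[of i y "-1"] uplus.scale[of y "-1"] by simp

lemma D_one: "i \<in> {1..n} \<Longrightarrow> D i 1 = 0"
  using D_mult[of i 1 0 1 0] comp_one[where 'a = 'n] by simp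

lemmas form_axioms = form[unfolded is_kashiwara_form_def]

lemma form_add: "x \<in> uplus \<Longrightarrow> y \<in> uplus \<Longrightarrow> z \<in> uplus \<Longrightarrow> form (x + y) z = form x z + form y z"
  by (rule form_axioms[THEN conjunct1, rule_format, THEN conjunct1])

lemma form_scale: "x \<in> uplus \<Longrightarrow> z \<in> uplus \<Longrightarrow> form (c *\<^sub>q x) z = c * form x z"
  by (rule form_axioms[THEN conjunct1, rule_format, THEN conjunct2, OF _ uplus_zero])

lemma form_sym: "x \<in> uplus \<Longrightarrow> y \<in> uplus \<Longrightarrow> form x y = form y x"
  by (rule form_axioms[THEN conjunct2, THEN conjunct1, rule_format])

lemma form_nondeg: "x \<in> uplus \<Longrightarrow> (\<And>y. y \<in> uplus \<Longrightarrow> form x y = 0) \<Longrightarrow> x = 0"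
  by (rule form_axioms[THEN conjunct2, THEN conjunct2, THEN conjunct1, rule_format])

lemma form_one: "form 1 1 = 1"
  using form_axioms by (elim conjE)

lemma gE_uplus: "i \<in> {1..n} \<Longrightarrow> gE i \<in> (uplus :: 'n uq set)"
  using n by (auto intro: uplus.gen)

lemma form_gE:
  assumes "i \<in> {1..n}" "x \<in> uplus" "y \<in> uplus" shows "form (gE i * x) y = form x (D i y)"
proof -
  have "form (gE i * x) y = form y (gE i * x)"
    using assms by (intro form_sym uplus.mult gE_uplus)
  also have "\<dots> = form (D i y) x"
    using form_axioms[THEN conjunct2, THEN conjunct2, THEN conjunct2, THEN conjunct2, rule_format, folded n,
      OF assms(1,3,2)] by simp
  also have "\<dots> = form x (D i y)" using assms by (intro form_sym D_uplus)
  finally show ?thesis .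
qed

lemma form_scale_right: "x \<in> uplus \<Longrightarrow> z \<in> uplus \<Longrightarrow> form x (c *\<^sub>q z) = c * form x z"
  using form_scale[of z x c] form_sym[of x "c *\<^sub>q z"] form_sym[of x z] uplus.scale[of z c] by simp

lemma form_zero: "x \<in> uplus \<Longrightarrow> form 0 x = 0" "x \<in> uplus \<Longrightarrow> form x 0 = 0"
  using form_scale[of 0 x 0] form_scale_right[of x 0 0] uplus_zero by simp_all

lemma form_diff: "x \<in> uplus \<Longrightarrow> y \<in> uplus \<Longrightarrow> z \<in> uplus \<Longrightarrow> form (x - y) z = form x z - form y z"
  using form_add[of x "-1 *\<^sub>q y" z] form_scale[of y z "-1"] uplus.scale[of y "-1"] by simp

text \<open>
  The operators are adjoint to left multiplications by commuting letters, and the form is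
  nondegenerate.
\<close>

lemma D_commute:
  assumes i: "i \<in> {1..n}" and j: "j \<in> {1..n}" and ij: "\<bar>i - j\<bar> \<ge> 2" and x: "x \<in> uplus"
  shows "D i (D j x) = D j (D i x)"
proof -
  have "D i (D j x) - D j (D i x) = 0"
  proof (rule form_nondeg)
    show "D i (D j x) - D j (D i x) \<in> uplus" using assms by (intro uplus_diff D_uplus)
    fix y :: "'n uq" assume y: "y \<in> uplus"
    have "form y (D i (D j x)) = form (gE j * (gE i * y)) x"
      using assms y by (simp add: form_gE D_uplus uplus.mult gE_uplus)
    also have "gE j * (gE i * y) = gE i * (gE j * y)"
      using gE_commute[of i j, where 'n = 'n] ij by (simp add: mult.assoc[symmetric])
    also have "form \<dots> x = form y (D j (D i x))"
      using assms y by (simp add: form_gE D_uplus uplus.mult gE_uplus)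
    finally show "form (D i (D j x) - D j (D i x)) y = 0"
      using assms y by (simp add: form_diff form_sym[of _ y] D_uplus)
  qed
  then show ?thesis by simp
qed

lemma D_comp:
  assumes i: "i \<in> {1..n}" and x: "x \<in> uplus_comp \<gamma>"
  shows "D i x \<in> uplus_comp (\<gamma> - simple_root i)"
  using x
proof (induction rule: comp_induct)
  case zero
  show ?case by (simp add: D_zero[OF i])
next
  case (add x y c)
  then show ?case using i comp_uplus[OF add(1)] comp_uplus[OF add(2)]
    by (simp add: D_add D_scale uplus.scale comp_add comp_scale)
next
  case (word ws)
  then have "D i (gEw ws) \<in> uplus_comp (sum_list (map simple_root ws) - simple_root i)"
  proof (induction ws arbitrary: \<gamma>)
    case Nil
    show ?case by (simp add: D_one[OF i])
  next
    case (Cons k ws)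
    have k: "k \<in> {1..n}" "set ws \<subseteq> {1..rank TYPE('n)}" using Cons.prems n by auto
    have ck: "(gE k :: 'n uq) \<in> uplus_comp (simple_root k)" using k n by (intro comp_gE) simp
    have cw: "(gEw ws :: 'n uq) \<in> uplus_comp (sum_list (map simple_root ws))" using k by (intro comp_word)
    have dw: "D i (gEw ws) \<in> uplus_comp (sum_list (map simple_root ws) - simple_root i)"
      using Cons.IH[OF k(2) refl] .
    have "D i (gEw (k # ws)) = (if i = k then gEw ws else 0)
      + vs (rform (simple_root i) (simple_root k)) (gE k * D i (gEw ws))"
      using D_mult[OF i ck cw] i k by (simp add: D_gE)
    moreover have "gE k * D i (gEw ws) \<in> uplus_comp (sum_list (map simple_root (k # ws)) - simple_root i)"
      using comp_mult[OF ck dw] by (simp add: add_diff_eq)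
    moreover have "(if i = k then gEw ws else 0 :: 'n uq) \<in> uplus_comp (sum_list (map simple_root (k # ws)) - simple_root i)"
      using cw by simp
    ultimately show ?case by (simp only: comp_add comp_vs)
  qed
  then show ?case using word by simp
qed

text \<open>
  The dual root vectors: the factor \<open>1 / (1 - v\<^sup>-\<^sup>2)\<close> per bracket cancels the one that Kashiwara's
  operators produce. The value on empty intervals lets a fence fall apart at its ends as well.
\<close>

definition R :: "int \<Rightarrow> int \<Rightarrow> 'n uq" where
  "R a b = (if b < a then 1 else (1 / (1 - qvar powi (-2))) ^ nat (b - a) *\<^sub>q fen True a b)"

lemma R_same [simp]: "R a a = gE a" by (simp add: R_def)
lemma R_empty: "b < a \<Longrightarrow> R a b = 1" by (simp add: R_def)

lemma R_step:
  assumes "a \<le> b"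
  shows "R a (b + 1) = 1 / (1 - qvar powi (-2)) *\<^sub>q
    (if even (b + 1) then qbr (gE (b + 1)) (R a b) else qbr (R a b) (gE (b + 1)))"
proof -
  have "nat (b + 1 - a) = Suc (nat (b - a))" using assms by simp
  moreover have q: "qbr (c *\<^sub>q x) y = c *\<^sub>q qbr x y" "qbr y (c *\<^sub>q x) = c *\<^sub>q qbr y x" for c and x y :: "'n uq"
    by (simp_all add: qbr_def vs_qscale uq.scale_right_diff_distrib)
  ultimately show ?thesis using assms by (simp add: R_def fen_step)
qed

lemma R_comp:
  assumes "1 \<le> a" "b \<le> n"
  shows "R a b \<in> uplus_comp (rint a b)"
  using assms n comp_fen[of a b True, where 'n = 'n] comp_one[where 'a = 'n]
  by (auto simp: R_def comp_scale rint_empty)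

lemma R_commute_gE:
  assumes "i < a - 1 \<or> i > b + 1"
  shows "gE i * R a b = R a b * gE i"
  using fen_commute_gE[of a b i True, where 'a = 'n] assms by (simp add: R_def)

lemma vm2: "x - vs (-2) x = (1 - qvar powi (-2)) *\<^sub>q x"
  by (simp add: vs_def uq.scale_left_diff_distrib)

lemma vm2_cancel: "1 / (1 - qvar powi (-2)) *\<^sub>q (x - vs (-2) x) = x"
  using one_minus_vm2 by (simp only: vm2 uq.scale_scale) simp

text \<open>
  An operator can only remove a source, and doing so cuts the fence in two. For a sink the two terms of
  its bracket cancel.
\<close>

lemma D_R:
  assumes "i \<in> {1..n}" "1 \<le> c" "c \<le> d" "d \<le> n"
  shows "D i (R c d) = (if c \<le> i \<and> i \<le> d then
    (if even i then R c (i - 1) * R (i + 1) d else if c = d then 1 else 0) else 0)"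
  using assms(3,4)
proof (induction rule: fen_induct)
  case base
  then show ?case using assms by (simp add: D_gE R_empty)
next
  case (step d)
  let ?E = "gE (d + 1) :: 'n uq"
  note i = assms(1)
  have cE: "?E \<in> uplus_comp (simple_root (d + 1))" using step n assms by (intro comp_gE) simp
  have cR: "R c d \<in> uplus_comp (rint c d)" using step assms by (intro R_comp) auto
  have DE: "D i ?E = (if i = d + 1 then 1 else 0)" using step assms by (intro D_gE) auto
  have IH: "D i (R c d) = (if c \<le> i \<and> i \<le> d then
    (if even i then R c (i - 1) * R (i + 1) d else if c = d then 1 else 0) else 0)"
    using step by simp
  have ER: "D i (?E * R c d) = (if i = d + 1 then R c d else 0)
      + vs (cartan i (d + 1)) (?E * D i (R c d))"
    using D_mult[OF i cE cR] by (simp add: DE rform_simple)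
  have RE: "D i (R c d * ?E) = D i (R c d) * ?E + (if i = d + 1 then vs (-1) (R c d) else 0)"
    using D_mult[OF i cR cE] step(1) by (simp add: DE rform_simple_rint)
  have u: "?E * R c d \<in> uplus" "R c d * ?E \<in> uplus"
    using comp_uplus[OF cE] comp_uplus[OF cR] by (simp_all add: uplus.mult)
  have k: "cartan i (d + 1) = (if i = d + 1 then 2 else if i = d then -1 else 0)" if "i \<le> d + 1"
    using that by (auto simp: cartan_def)
  show ?case
  proof (cases "even (d + 1)")
    case True
    have *: "D i (R c (d + 1)) = 1 / (1 - qvar powi (-2)) *\<^sub>q (D i (?E * R c d) - vs (-1) (D i (R c d * ?E)))"
      using u i unfolding R_step[OF step(1)] if_P[OF True] by (simp add: qbr_def D_scale D_diff D_vs uplus_diff uplus_vs)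
    consider "i = d + 1" | "i = d" | "i < d" "even i" "c \<le> i" | "i < d" "odd i \<or> i < c" | "i > d + 1"
      by fastforce
    then show ?thesis
    proof cases
      case 1
      show ?thesis unfolding * ER RE using 1 step(1) True IH by (simp add: vm2_cancel R_empty)
    next
      case 2
      show ?thesis unfolding * ER RE using 2 step(1) True IH by (simp add: cartan_def)
    next
      case 3
      have a: "?E * R c (i - 1) = R c (i - 1) * ?E" using 3 by (intro R_commute_gE) simp
      have b: "?E * (R c (i - 1) * u) = R c (i - 1) * (?E * u)" for u
        by (simp add: mult.assoc[symmetric] a)
      have r: "R (i + 1) (d + 1) = 1 / (1 - qvar powi (-2)) *\<^sub>q qbr ?E (R (i + 1) d)"
        using R_step[of "i + 1" d] True 3 by simp
      show ?thesis unfolding * ER RE using 3 True IH by (simp add: r k b qbr_def mult.assoc right_diff_distrib)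
    next
      case 4
      show ?thesis unfolding * ER RE using 4 step(1) IH by (auto simp: k)
    next
      case 5
      show ?thesis unfolding * ER RE using 5 step(1) IH by auto
    qed
  next
    case False
    have *: "D i (R c (d + 1)) = 1 / (1 - qvar powi (-2)) *\<^sub>q (D i (R c d * ?E) - vs (-1) (D i (?E * R c d)))"
      using u i unfolding R_step[OF step(1)] if_not_P[OF False] by (simp add: qbr_def D_scale D_diff D_vs uplus_diff uplus_vs)
    consider "i = d + 1" | "i = d" | "i < d" "even i" "c \<le> i" | "i < d" "odd i \<or> i < c" | "i > d + 1"
      by fastforce
    then show ?thesis
    proof cases
      case 1
      show ?thesis unfolding * ER RE using 1 step(1) False IH by simp
    next
      case 2
      have a: "?E * R c (d - 1) = R c (d - 1) * ?E" by (intro R_commute_gE) simp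
      show ?thesis unfolding * ER RE using 2 step(1) False IH
        by (simp add: cartan_def R_empty a vm2_cancel)
    next
      case 3
      have a: "?E * R c (i - 1) = R c (i - 1) * ?E" using 3 by (intro R_commute_gE) simp
      have b: "?E * (R c (i - 1) * u) = R c (i - 1) * (?E * u)" for u
        by (simp add: mult.assoc[symmetric] a)
      have r: "R (i + 1) (d + 1) = 1 / (1 - qvar powi (-2)) *\<^sub>q qbr (R (i + 1) d) ?E"
        using R_step[of "i + 1" d] False 3 by simp
      show ?thesis unfolding * ER RE using 3 False IH by (simp add: r k b qbr_def mult.assoc right_diff_distrib)
    next
      case 4
      show ?thesis unfolding * ER RE using 4 step(1) IH False by (auto simp: k)
    next
      case 5
      show ?thesis unfolding * ER RE using 5 step(1) IH by auto
    qed
  qed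
qed

end

section \<open>Adjoints of left multiplication by root vectors\<close>

text \<open>
  The letters of a fence \<open>p, p + s, \<dots>, p + 2 m s\<close> in the order in which operators remove it from its far
  end: repeatedly a source and then the sink behind it, and finally \<open>p\<close> itself. The flag \<open>t\<close> tells whether
  \<open>p\<close> belongs to the fence; it does not if the fence starts with a source.
\<close>

fun path :: "bool \<Rightarrow> int \<Rightarrow> int \<Rightarrow> nat \<Rightarrow> int list" where
  "path t p s 0 = (if t then [p] else [])"
| "path t p s (Suc m) = (p + (2 * int m + 1) * s) # (p + (2 * int m + 2) * s) # path t p s m"

lemma path_nonempty: "t \<or> m > 0 \<Longrightarrow> path t p s m \<noteq> []"
  by (cases m) auto

lemma set_path:
  "k \<in> set (path t p s m) \<Longrightarrow> \<exists>r. k = p + r * s \<and> (if t then 0 else 1) \<le> r \<and> r \<le> 2 * int m"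
proof (induction m)
  case 0
  then show ?case by (intro exI[of _ 0]) (auto split: if_splits)
next
  case (Suc m)
  then consider "k = p + (2 * int m + 1) * s" | "k = p + (2 * int m + 2) * s" | "k \<in> set (path t p s m)"
    by auto
  then show ?case
  proof cases
    case 1
    then show ?thesis by (intro exI[of _ "2 * int m + 1"]) auto
  next
    case 2
    then show ?thesis by (intro exI[of _ "2 * int m + 2"]) auto
  next
    case 3
    then obtain r where "k = p + r * s \<and> (if t then 0 else 1) \<le> r \<and> r \<le> 2 * int m" using Suc.IH by blast
    then show ?thesis by (intro exI[of _ r]) auto
  qed
qed

lemma path_member:
  assumes "(if t then 0 else 1) \<le> r" "r \<le> 2 * int m"
  shows "p + r * s \<in> set (path t p s m)"
  using assms
proof (induction m)
  case 0
  then show ?case by (auto split: if_splits)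
next
  case (Suc m)
  then consider "r = 2 * int m + 1" | "r = 2 * int m + 2" | "r \<le> 2 * int m" by fastforce
  then show ?case
  proof cases
    case 3
    then show ?thesis using Suc by auto
  qed simp_all
qed

text \<open>The fence of a path, built from the brackets of its pairs of a source and a sink.\<close>

fun pfen :: "bool \<Rightarrow> int \<Rightarrow> int \<Rightarrow> nat \<Rightarrow> 'n uq" where
  "pfen t p s 0 = (if t then gE p else 1)"
| "pfen t p s (Suc m) = (if t \<or> m > 0
     then qbr (qbr (gE (p + (2 * int m + 1) * s)) (gE (p + (2 * int m + 2) * s))) (pfen t p s m)
     else qbr (gE (p + (2 * int m + 1) * s)) (gE (p + (2 * int m + 2) * s)))"

context kashiwara
begin

fun dw :: "int list \<Rightarrow> 'n uq \<Rightarrow> 'n uq" where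
  "dw [] x = x"
| "dw (k # ks) x = dw ks (D k x)"

lemma dw_zero: "set ks \<subseteq> {1..n} \<Longrightarrow> dw ks 0 = 0"
  by (induction ks) (use D_zero in auto)

lemma dw_one: "set ks \<subseteq> {1..n} \<Longrightarrow> ks \<noteq> [] \<Longrightarrow> dw ks 1 = 0"
  using D_one by (cases ks) (auto simp: dw_zero)

lemma dw_add: "set ks \<subseteq> {1..n} \<Longrightarrow> x \<in> uplus \<Longrightarrow> y \<in> uplus \<Longrightarrow> dw ks (x + y) = dw ks x + dw ks y"
  by (induction ks arbitrary: x y) (use D_add D_uplus in auto)

lemma dw_vs: "set ks \<subseteq> {1..n} \<Longrightarrow> x \<in> uplus \<Longrightarrow> dw ks (vs a x) = vs a (dw ks x)"
  by (induction ks arbitrary: x) (use D_vs D_uplus in auto)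

lemma dw_D_commute:
  assumes "k \<in> {1..n}" "set ks \<subseteq> {1..n}" "\<And>l. l \<in> set ks \<Longrightarrow> \<bar>l - k\<bar> \<ge> 2" "x \<in> uplus"
  shows "dw ks (D k x) = D k (dw ks x)"
  using assms(2-4)
proof (induction ks arbitrary: x)
  case (Cons l ks)
  then have "D l (D k x) = D k (D l x)" using D_commute[of l k x] assms(1) by simp
  then show ?case using Cons D_uplus[of l x] by simp
qed simp

text \<open>
  Elements annihilated by the operators of all proper subpaths. On these elements the operator of
  the whole path is a skew derivation, and it is adjoint to left multiplication by the fence.
\<close>

definition kill :: "bool \<Rightarrow> int \<Rightarrow> int \<Rightarrow> nat \<Rightarrow> 'n uq \<Rightarrow> bool" where
  "kill t p s m y \<longleftrightarrow> (\<forall>j m'. j + m' \<le> m \<and> (j, m') \<noteq> (0, m) \<and> (t \<or> j > 0 \<or> m' > 0)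
     \<longrightarrow> dw (path (t \<or> j > 0) (p + 2 * int j * s) s m') y = 0)"

lemma killD: "kill t p s m y \<Longrightarrow> j + m' \<le> m \<Longrightarrow> (j, m') \<noteq> (0, m) \<Longrightarrow> t \<or> j > 0 \<or> m' > 0 \<Longrightarrow>
   dw (path (t \<or> j > 0) (p + 2 * int j * s) s m') y = 0"
  by (simp add: kill_def)

lemma kill_mono: "kill t p s (Suc m) y \<Longrightarrow> kill t p s m y"
  by (auto simp: kill_def)

lemma subpath_subset:
  assumes "j + m' \<le> m"
  shows "set (path (t \<or> j > 0) (p + 2 * int j * s) s m') \<subseteq> set (path t p s m)"
proof
  fix k assume "k \<in> set (path (t \<or> j > 0) (p + 2 * int j * s) s m')"
  then obtain r where r: "k = p + 2 * int j * s + r * s" "(if t \<or> j > 0 then 0 else 1) \<le> r" "r \<le> 2 * int m'"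
    using set_path by blast
  have "p + (2 * int j + r) * s \<in> set (path t p s m)"
    by (rule path_member) (use r assms in \<open>auto split: if_splits\<close>)
  then show "k \<in> set (path t p s m)" using r by (simp add: algebra_simps)
qed

text \<open>
  A subpath that ends where the removed pair begins becomes, together with this pair, a subpath of the
  longer path. The letters of every other subpath are so far from the pair that the operators commute.
\<close>

lemma kill_step:
  assumes s: "\<bar>s\<bar> = 1" and P: "set (path t p s (Suc m)) \<subseteq> {1..n}" and y: "y \<in> uplus"
    and k: "kill t p s (Suc m) y"
  shows "kill t p s m (D (p + (2 * int m + 2) * s) (D (p + (2 * int m + 1) * s) y))"
  unfolding kill_def
proof (intro allI impI, elim conjE)
  fix j m' assume jm: "j + m' \<le> m" "(j, m') \<noteq> (0, m)" "t \<or> j > 0 \<or> m' > 0"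
  let ?e = "p + (2 * int m + 1) * s" and ?o = "p + (2 * int m + 2) * s"
  let ?Q = "path (t \<or> j > 0) (p + 2 * int j * s) s m'"
  show "dw ?Q (D ?o (D ?e y)) = 0"
  proof (cases "j + m' = m")
    case True
    then have m: "int m = int j + int m'" by simp
    have "dw (path (t \<or> j > 0) (p + 2 * int j * s) s (Suc m')) y = 0"
      by (rule killD[OF k]) (use jm in auto)
    moreover have "p + 2 * int j * s + (2 * int m' + 1) * s = ?e" "p + 2 * int j * s + (2 * int m' + 2) * s = ?o"
      by (simp_all add: m algebra_simps)
    ultimately show ?thesis by simp
  next
    case False
    have Q: "set ?Q \<subseteq> {1..n}" using subpath_subset[of j m' "Suc m" t p s] jm P by auto
    have far: "\<bar>l - ?e\<bar> \<ge> 2 \<and> \<bar>l - ?o\<bar> \<ge> 2" if l: "l \<in> set ?Q" for l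
    proof -
      obtain r where r: "l = p + 2 * int j * s + r * s" "r \<le> 2 * int m'"
        using set_path[OF l] by auto
      have "?e - l = (2 * int m + 1 - 2 * int j - r) * s" "?o - l = (2 * int m + 2 - 2 * int j - r) * s"
        by (simp_all add: r algebra_simps)
      then have "\<bar>?e - l\<bar> = \<bar>2 * int m + 1 - 2 * int j - r\<bar>" "\<bar>?o - l\<bar> = \<bar>2 * int m + 2 - 2 * int j - r\<bar>"
        using s by (simp_all add: abs_mult)
      moreover have "2 * int m - 2 * int j - r \<ge> 2" using r(2) jm(1) False by linarith
      ultimately have "\<bar>?e - l\<bar> \<ge> 2" "\<bar>?o - l\<bar> \<ge> 2" by simp_all
      then show ?thesis by (simp only: abs_minus_commute[of l])
    qed
    have eo: "?e \<in> {1..n}" "?o \<in> {1..n}" using P by auto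
    have "dw ?Q (D ?o (D ?e y)) = D ?o (D ?e (dw ?Q y))"
      using dw_D_commute[OF eo(2) Q _ D_uplus[OF eo(1) y]] dw_D_commute[OF eo(1) Q _ y] far by simp
    also have "dw ?Q y = 0" using killD[OF kill_mono[OF k] jm] .
    finally show ?thesis using D_zero eo by simp
  qed
qed

lemma kill_last:
  assumes "kill t p s (Suc m) y"
  shows "D (p + (2 * int m + 2) * s) y = 0"
proof -
  have "p + 2 * int (Suc m) * s = p + (2 * int m + 2) * s" by (simp add: algebra_simps)
  then show ?thesis using killD[OF assms, of "Suc m" 0] by (simp only: path.simps dw.simps) simp
qed

text \<open>
  When the operators along the path are distributed over the two factors, every mixed term has a factor
  to which the operators of a proper subpath are applied.
\<close>

lemma dw_skew_derivation:
  assumes s: "\<bar>s\<bar> = 1" and P: "set (path t p s m) \<subseteq> {1..n}" and ne: "t \<or> m > 0"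
    and x: "x \<in> uplus_comp \<gamma>" and y: "y \<in> uplus_comp \<delta>" and k: "kill t p s m x" "kill t p s m y"
  shows "dw (path t p s m) (x * y) = dw (path t p s m) x * y
    + vs (rform (sum_list (map simple_root (path t p s m))) \<gamma>) (x * dw (path t p s m) y)"
  using P ne x y k
proof (induction m arbitrary: x y \<gamma> \<delta>)
  case 0
  then show ?case using D_mult[of p x \<gamma> y \<delta>] by simp
next
  case (Suc m)
  let ?e = "p + (2 * int m + 1) * s" and ?o = "p + (2 * int m + 2) * s"
  let ?Q = "path t p s m"
  have eo: "?e \<in> {1..n}" "?o \<in> {1..n}" and Q: "set ?Q \<subseteq> {1..n}" using Suc.prems(1) by auto
  note last = kill_last[OF Suc.prems(5)] kill_last[OF Suc.prems(6)]
  have xy: "x \<in> uplus" "y \<in> uplus" using Suc.prems comp_uplus by auto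
  have De: "D ?e x \<in> uplus_comp (\<gamma> - simple_root ?e)" "D ?e y \<in> uplus_comp (\<delta> - simple_root ?e)"
    using D_comp[OF eo(1)] Suc.prems by auto
  have Do: "D ?o (D ?e x) \<in> uplus_comp (\<gamma> - simple_root ?e - simple_root ?o)"
    "D ?o (D ?e y) \<in> uplus_comp (\<delta> - simple_root ?e - simple_root ?o)"
    using D_comp[OF eo(2)] De by auto
  note u = comp_uplus[OF Do(1)] comp_uplus[OF Do(2)] comp_uplus[OF De(1)] comp_uplus[OF De(2)] xy
  let ?c = "rform (simple_root ?e) \<gamma> + rform (simple_root ?o) \<gamma>"
  have "D ?e (x * y) = D ?e x * y + vs (rform (simple_root ?e) \<gamma>) (x * D ?e y)"
    using D_mult[OF eo(1)] Suc.prems by blast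
  moreover have "D ?o (D ?e x * y) = D ?o (D ?e x) * y"
    using D_mult[OF eo(2) De(1) Suc.prems(4)] last by simp
  moreover have "D ?o (x * D ?e y) = vs (rform (simple_root ?o) \<gamma>) (x * D ?o (D ?e y))"
    using D_mult[OF eo(2) Suc.prems(3) De(2)] last by simp
  ultimately have d: "D ?o (D ?e (x * y)) = D ?o (D ?e x) * y + vs ?c (x * D ?o (D ?e y))"
    using eo u by (simp add: D_add D_vs uplus.mult uplus_vs)
  show ?case
  proof (cases "t \<or> m > 0")
    case True
    have IH1: "dw ?Q (D ?o (D ?e x) * y) = dw ?Q (D ?o (D ?e x)) * y"
    proof -
      have "dw ?Q y = 0" using killD[OF Suc.prems(6), of 0 m] True by simp
      then show ?thesis
        using Suc.IH[OF Q True Do(1) Suc.prems(4)] kill_mono[OF Suc.prems(6)]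
          kill_step[OF s Suc.prems(1) xy(1) Suc.prems(5)] by simp
    qed
    have IH2: "dw ?Q (x * D ?o (D ?e y)) = vs (rform (sum_list (map simple_root ?Q)) \<gamma>) (x * dw ?Q (D ?o (D ?e y)))"
    proof -
      have "dw ?Q x = 0" using killD[OF Suc.prems(5), of 0 m] True by simp
      then show ?thesis
        using Suc.IH[OF Q True Suc.prems(3) Do(2)] kill_mono[OF Suc.prems(5)]
          kill_step[OF s Suc.prems(1) xy(2) Suc.prems(6)] by simp
    qed
    show ?thesis using Q u
      by (simp add: d dw_add dw_vs uplus.mult uplus_vs IH1 IH2 rform_add_left add.assoc)
  next
    case False
    then show ?thesis using d by (simp add: rform_add_left)
  qed
qed

lemma qbr_uplus: "x \<in> uplus \<Longrightarrow> y \<in> uplus \<Longrightarrow> qbr x y \<in> uplus"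
  by (simp add: qbr_def uplus_diff uplus.mult uplus_vs)

lemma form_qbr:
  assumes "x \<in> uplus" "y \<in> uplus" "z \<in> uplus" "w \<in> uplus"
  shows "form (qbr x y * z) w = form (x * (y * z)) w - qvar powi (-1) * form (y * (x * z)) w"
  using assms by (simp add: qbr_def left_diff_distrib mult.assoc form_diff uplus.mult uplus_vs)
    (simp add: vs_def form_scale uplus.mult)

lemma pfen_uplus: "set (path t p s m) \<subseteq> {1..n} \<Longrightarrow> pfen t p s m \<in> (uplus :: 'n uq set)"
  by (induction m) (use n in \<open>auto intro!: qbr_uplus uplus.gen uplus.one\<close>)

text \<open>
  Expanding the brackets of the fence gives one term with the operators in the order of the path. In all
  others a proper subpath acts first and annihilates \<open>y\<close>.
\<close>

lemma dw_adjoint: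
  assumes s: "\<bar>s\<bar> = 1" and P: "set (path t p s m) \<subseteq> {1..n}" and ne: "t \<or> m > 0"
    and x: "x \<in> uplus" and y: "y \<in> uplus" and k: "kill t p s m y"
  shows "form (pfen t p s m * x) y = form x (dw (path t p s m) y)"
  using P ne x y k
proof (induction m arbitrary: x y)
  case 0
  then show ?case using form_gE[of p x y] by simp
next
  case (Suc m)
  let ?e = "p + (2 * int m + 1) * s" and ?o = "p + (2 * int m + 2) * s"
  let ?Q = "path t p s m" and ?F = "pfen t p s m :: 'n uq"
  have eo: "?e \<in> {1..n}" "?o \<in> {1..n}" and Q: "set ?Q \<subseteq> {1..n}" using Suc.prems(1) by auto
  note gu = gE_uplus[OF eo(1)] gE_uplus[OF eo(2)] and xy = Suc.prems(3,4)
  have q: "form (qbr (gE ?e) (gE ?o) * z) y = form z (D ?o (D ?e y))" if z: "z \<in> uplus" for z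
    using eo xy z gu kill_last[OF Suc.prems(5)]
    by (simp add: form_qbr form_gE uplus.mult D_uplus D_zero[OF eo(1)] form_zero)
  show ?case
  proof (cases "t \<or> m > 0")
    case True
    have F: "?F \<in> uplus" using Q by (rule pfen_uplus)
    let ?q = "qbr (gE ?e) (gE ?o) :: 'n uq"
    have "form (?q * (?F * x)) y = form (?F * x) (D ?o (D ?e y))" using F xy by (intro q uplus.mult)
    also have "\<dots> = form x (dw ?Q (D ?o (D ?e y)))"
      using Suc.IH[OF Q True] xy eo kill_step[OF s Suc.prems(1) xy(2) Suc.prems(5)] by (simp add: D_uplus)
    finally have 1: "form (?q * (?F * x)) y = form x (dw ?Q (D ?o (D ?e y)))" .
    have "form (?F * (?q * x)) y = form (?q * x) (dw ?Q y)"
      using Suc.IH[OF Q True] xy gu kill_mono[OF Suc.prems(5)] by (simp add: qbr_uplus uplus.mult)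
    also have "dw ?Q y = 0" using killD[OF Suc.prems(5), of 0 m] True by simp
    finally have 2: "form (?F * (?q * x)) y = 0"
      using gu xy by (simp add: form_zero qbr_uplus uplus.mult)
    show ?thesis using True form_qbr[OF qbr_uplus[OF gu] F xy] by (simp add: 1 2)
  next
    case False
    then show ?thesis using q xy by simp
  qed
qed

lemma prod_list_homogeneous:
  "(\<And>g. g \<in> set gs \<Longrightarrow> \<exists>\<gamma>. g \<in> uplus_comp \<gamma>) \<Longrightarrow> \<exists>\<gamma>. prod_list gs \<in> (uplus_comp \<gamma> :: 'n uq set)"
proof (induction gs)
  case Nil
  then show ?case using comp_one by auto
next
  case (Cons h hs)
  from Cons.prems[of h] obtain a where "h \<in> uplus_comp a" by auto
  moreover from Cons.IH Cons.prems obtain b where "prod_list hs \<in> uplus_comp b" by auto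
  ultimately show ?case using comp_mult[of h a "prod_list hs" b] by auto
qed

text \<open>
  Annihilation passes from the factors to their products because the operators are skew derivations; this
  in turn presupposes annihilation by shorter subpaths, hence the induction on the length. The flag \<open>full\<close>
  tells whether the whole path counts as a subpath.
\<close>

lemma kill_prod:
  assumes s: "\<bar>s\<bar> = 1" and P: "set (path t p s m) \<subseteq> {1..n}"
    and G: "\<And>g. g \<in> set gs \<Longrightarrow> \<exists>\<gamma>. g \<in> uplus_comp \<gamma>"
    and k: "\<And>g j m'. g \<in> set gs \<Longrightarrow> j + m' \<le> m \<Longrightarrow> full \<or> (j, m') \<noteq> (0, m) \<Longrightarrow> t \<or> j > 0 \<or> m' > 0
      \<Longrightarrow> dw (path (t \<or> j > 0) (p + 2 * int j * s) s m') g = 0"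
    and j: "j + m' \<le> m" "full \<or> (j, m') \<noteq> (0, m)" "t \<or> j > 0 \<or> m' > 0"
  shows "dw (path (t \<or> j > 0) (p + 2 * int j * s) s m') (prod_list gs) = 0"
  using j G k
proof (induction m' arbitrary: j gs rule: less_induct)
  case (less m')
  let ?t = "t \<or> j > 0" and ?p = "p + 2 * int j * s"
  let ?Q = "path ?t ?p s m'"
  have Q: "set ?Q \<subseteq> {1..n}" using subpath_subset[of j m' m t p s] less.prems(1) P by auto
  have ne: "?t \<or> m' > 0" using less.prems by auto
  have sub: "path (?t \<or> j2 > 0) (?p + 2 * int j2 * s) s m2 = path (t \<or> j + j2 > 0) (p + 2 * int (j + j2) * s) s m2" for j2 m2
  proof -
    have "?p + 2 * int j2 * s = p + 2 * int (j + j2) * s" by (simp add: algebra_simps)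
    moreover have "(?t \<or> j2 > 0) = (t \<or> j + j2 > 0)" by auto
    ultimately show ?thesis by (simp only:)
  qed
  show ?case using less.prems(4,5)
  proof (induction gs)
    case Nil
    then show ?case using dw_one[OF Q path_nonempty[OF ne]] by simp
  next
    case (Cons g gs)
    obtain \<gamma> where g: "g \<in> uplus_comp \<gamma>" using Cons.prems(1)[of g] by auto
    obtain \<delta> where d: "prod_list gs \<in> uplus_comp \<delta>"
      using prod_list_homogeneous[of gs] Cons.prems(1) by auto
    have k1: "kill ?t ?p s m' g"
      unfolding kill_def sub
    proof (intro allI impI)
      fix j2 m2 assume *: "j2 + m2 \<le> m' \<and> (j2, m2) \<noteq> (0, m') \<and> (?t \<or> j2 > 0 \<or> m2 > 0)"
      show "dw (path (t \<or> j + j2 > 0) (p + 2 * int (j + j2) * s) s m2) g = 0"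
        by (rule Cons.prems(2)) (use * less.prems(1,2) in auto)
    qed
    have k2: "kill ?t ?p s m' (prod_list gs)"
      unfolding kill_def sub
    proof (intro allI impI)
      fix j2 m2 assume *: "j2 + m2 \<le> m' \<and> (j2, m2) \<noteq> (0, m') \<and> (?t \<or> j2 > 0 \<or> m2 > 0)"
      show "dw (path (t \<or> j + j2 > 0) (p + 2 * int (j + j2) * s) s m2) (prod_list gs) = 0"
      proof (rule less.IH)
        show "m2 < m'" using * by auto
        show "\<exists>\<gamma>. g \<in> uplus_comp \<gamma>" if "g \<in> set gs" for g using Cons.prems(1) that by simp
        show "dw (path (t \<or> j > 0) (p + 2 * int j * s) s m') g = 0"
          if "g \<in> set gs" "j + m' \<le> m" "full \<or> (j, m') \<noteq> (0, m)" "t \<or> j > 0 \<or> m' > 0" for g j m'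
          by (rule Cons.prems(2)) (use that in auto)
      qed (use * less.prems(1,2) in auto)
    qed
    have "dw ?Q g = 0" by (rule Cons.prems(2)) (use less.prems(1-3) in auto)
    moreover have "dw ?Q (prod_list gs) = 0" using Cons by simp
    ultimately show ?case using dw_skew_derivation[OF s Q ne g d k1 k2] by simp
  qed
qed

end

section \<open>Norms of the PBW elements\<close>

text \<open>The position in the convex order of the family to which a root vector belongs.\<close>

fun cls :: "rlabel \<Rightarrow> nat" where
  "cls (U i) = 0" | "cls (V i) = 1" | "cls (W i) = 2" | "cls (X i) = 3"

context kashiwara
begin

text \<open>
  Removing the source \<open>e\<close> leaves the sink \<open>e + 1\<close> at the lower end of a fence, where it can only be removed if
  it is all of that fence.
\<close>

lemma delta_up:
  assumes e: "even e" "e \<in> {1..n}" "e + 1 \<in> {1..n}" and cd: "1 \<le> c" "c \<le> d" "d \<le> n"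
  shows "D (e + 1) (D e (R c d)) = (if c \<le> e \<and> d = e + 1 then R c (e - 1) else 0)"
proof (cases "c \<le> e \<and> e \<le> d")
  case True
  have 1: "R c (e - 1) \<in> uplus_comp (rint c (e - 1))" "R (e + 1) d \<in> uplus_comp (rint (e + 1) d)"
    using cd e by (auto intro!: R_comp)
  have 2: "D (e + 1) (R c (e - 1)) = 0"
  proof (cases "c \<le> e - 1")
    case True
    then show ?thesis using D_R[of "e + 1" c "e - 1"] cd e by simp
  next
    case False
    then show ?thesis using D_one[OF e(3)] by (simp add: R_empty)
  qed
  have 3: "D (e + 1) (R (e + 1) d) = (if d = e + 1 then 1 else 0)"
  proof (cases "e + 1 \<le> d")
    case True
    then show ?thesis using D_R[of "e + 1" "e + 1" d] cd e by auto
  next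
    case False
    then show ?thesis using D_one[OF e(3)] by (simp add: R_empty)
  qed
  have 4: "rform (simple_root (e + 1)) (rint c (e - 1)) = 0"
    by (cases "c \<le> e - 1") (auto simp: rform_simple_rint rint_empty)
  show ?thesis using True D_mult[OF e(3) 1] D_R[OF e(2) cd] e by (simp add: 2 3 4)
next
  case False
  then show ?thesis using D_R[OF e(2) cd] D_zero[OF e(3)] by auto
qed

lemma delta_down:
  assumes e: "even e" "e \<in> {1..n}" "e - 1 \<in> {1..n}" and cd: "1 \<le> c" "c \<le> d" "d \<le> n"
  shows "D (e - 1) (D e (R c d)) = (if c = e - 1 \<and> e \<le> d then R (e + 1) d else 0)"
proof (cases "c \<le> e \<and> e \<le> d")
  case True
  have 1: "R c (e - 1) \<in> uplus_comp (rint c (e - 1))" "R (e + 1) d \<in> uplus_comp (rint (e + 1) d)"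
    using cd e by (auto intro!: R_comp)
  have 2: "D (e - 1) (R c (e - 1)) = (if c = e - 1 then 1 else 0)"
  proof (cases "c \<le> e - 1")
    case True
    then show ?thesis using D_R[of "e - 1" c "e - 1"] cd e by auto
  next
    case False
    then show ?thesis using D_one[OF e(3)] by (simp add: R_empty)
  qed
  have 3: "D (e - 1) (R (e + 1) d) = 0"
  proof (cases "e + 1 \<le> d")
    case True
    then show ?thesis using D_R[of "e - 1" "e + 1" d] cd e by auto
  next
    case False
    then show ?thesis using D_one[OF e(3)] by (simp add: R_empty)
  qed
  show ?thesis using True D_mult[OF e(3) 1] D_R[OF e(2) cd] e by (auto simp: 2 3)
next
  case False
  then show ?thesis using D_R[OF e(2) cd] D_zero[OF e(3)] by auto
qed

text \<open>
  The operators along a path detect precisely the fence on this path. For a path that omits \<open>p\<close> this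
  holds among the intervals that start at \<open>p + 1\<close> or later.
\<close>

lemma dw_up_R:
  assumes "odd p" "set (path True p 1 m) \<subseteq> {1..n}" "1 \<le> c" "c \<le> d" "d \<le> n"
  shows "dw (path True p 1 m) (R c d) = (if c = p \<and> d = p + 2 * int m then 1 else 0)"
  using assms(2,4,5)
proof (induction m arbitrary: d)
  case 0
  then show ?case using D_R[of p c d] assms by auto
next
  case (Suc m)
  let ?e = "p + 2 * int m + 1"
  have Q: "set (path True p 1 m) \<subseteq> {1..n}" using Suc.prems by auto
  have "D (?e + 1) (D ?e (R c d)) = (if c \<le> ?e \<and> d = ?e + 1 then R c (?e - 1) else 0)"
    using Suc.prems assms by (intro delta_up) auto
  then have d: "D (p + (2 * int m + 2) * 1) (D (p + (2 * int m + 1) * 1) (R c d))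
      = (if c \<le> ?e \<and> d = ?e + 1 then R c (?e - 1) else 0)" by (simp add: algebra_simps)
  consider "c \<le> ?e - 1" "d = ?e + 1" | "c = ?e" "d = ?e + 1" | "c > ?e \<or> d \<noteq> ?e + 1" by linarith
  then show ?case
  proof cases
    case 1
    then show ?thesis using Suc.IH[OF Q, of "?e - 1"] Suc.prems unfolding path.simps dw.simps d by auto
  next
    case 2
    then show ?thesis using dw_one[OF Q path_nonempty] unfolding path.simps dw.simps d by (auto simp: R_empty)
  next
    case 3
    then show ?thesis using dw_zero[OF Q] Suc.prems unfolding path.simps dw.simps d by auto
  qed
qed

lemma dw_down_R:
  assumes "odd p" "set (path True p (-1) m) \<subseteq> {1..n}" "1 \<le> c" "c \<le> d" "d \<le> n"
  shows "dw (path True p (-1) m) (R c d) = (if d = p \<and> c = p - 2 * int m then 1 else 0)"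
  using assms(2,3,4)
proof (induction m arbitrary: c)
  case 0
  then show ?case using D_R[of p c d] assms by auto
next
  case (Suc m)
  let ?e = "p - 2 * int m - 1"
  have Q: "set (path True p (-1) m) \<subseteq> {1..n}" using Suc.prems by auto
  have "D (?e - 1) (D ?e (R c d)) = (if c = ?e - 1 \<and> ?e \<le> d then R (?e + 1) d else 0)"
    using Suc.prems assms by (intro delta_down) auto
  then have d: "D (p + (2 * int m + 2) * -1) (D (p + (2 * int m + 1) * -1) (R c d))
      = (if c = ?e - 1 \<and> ?e \<le> d then R (?e + 1) d else 0)" by (simp add: algebra_simps)
  consider "c = ?e - 1" "?e + 1 \<le> d" | "c = ?e - 1" "?e = d" | "c \<noteq> ?e - 1 \<or> ?e > d" by linarith
  then show ?case
  proof cases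
    case 1
    then show ?thesis using Suc.IH[OF Q, of "?e + 1"] Suc.prems unfolding path.simps dw.simps d by auto
  next
    case 2
    then show ?thesis using dw_one[OF Q path_nonempty] unfolding path.simps dw.simps d by (auto simp: R_empty)
  next
    case 3
    then show ?thesis using dw_zero[OF Q] Suc.prems unfolding path.simps dw.simps d by auto
  qed
qed

lemma dw_up_R_even:
  assumes "odd p" "set (path False p 1 m) \<subseteq> {1..n}" "m > 0" "1 \<le> c" "c \<le> d" "d \<le> n"
  shows "d \<noteq> p + 2 * int m \<or> c > p + 1 \<Longrightarrow> dw (path False p 1 m) (R c d) = 0"
    and "d = p + 2 * int m \<Longrightarrow> c = p + 1 \<Longrightarrow> dw (path False p 1 m) (R c d) = 1"
proof -
  have "(d \<noteq> p + 2 * int m \<or> c > p + 1 \<longrightarrow> dw (path False p 1 m) (R c d) = 0)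
    \<and> (d = p + 2 * int m \<and> c = p + 1 \<longrightarrow> dw (path False p 1 m) (R c d) = 1)"
    using assms(2,3,5,6)
  proof (induction m arbitrary: d)
    case (Suc m)
    let ?e = "p + 2 * int m + 1"
    have Q: "set (path False p 1 m) \<subseteq> {1..n}" using Suc.prems by auto
    have "D (?e + 1) (D ?e (R c d)) = (if c \<le> ?e \<and> d = ?e + 1 then R c (?e - 1) else 0)"
      using Suc.prems assms by (intro delta_up) auto
    then have d: "D (p + (2 * int m + 2) * 1) (D (p + (2 * int m + 1) * 1) (R c d))
        = (if c \<le> ?e \<and> d = ?e + 1 then R c (?e - 1) else 0)" by (simp add: algebra_simps)
    show ?case
    proof (cases "m = 0")
      case True
      then show ?thesis using d unfolding path.simps dw.simps d by (auto simp: R_empty)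
    next
      case False
      consider "c \<le> ?e - 1" "d = ?e + 1" | "c = ?e" "d = ?e + 1" | "c > ?e \<or> d \<noteq> ?e + 1" by linarith
      then show ?thesis
      proof cases
        case 1
        then show ?thesis using Suc.IH[OF Q, of "?e - 1"] Suc.prems False unfolding path.simps dw.simps d by auto
      next
        case 2
        then show ?thesis using dw_one[OF Q path_nonempty] False unfolding path.simps dw.simps d by (auto simp: R_empty)
      next
        case 3
        then show ?thesis using dw_zero[OF Q] Suc.prems unfolding path.simps dw.simps d by auto
      qed
    qed
  qed simp
  then show "d \<noteq> p + 2 * int m \<or> c > p + 1 \<Longrightarrow> dw (path False p 1 m) (R c d) = 0"
    and "d = p + 2 * int m \<Longrightarrow> c = p + 1 \<Longrightarrow> dw (path False p 1 m) (R c d) = 1" by blast+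
qed

lemma dw_down_R_even:
  assumes "odd p" "set (path False p (-1) m) \<subseteq> {1..n}" "m > 0" "1 \<le> c" "c \<le> d" "d \<le> n"
  shows "c \<noteq> p - 2 * int m \<or> d < p - 1 \<Longrightarrow> dw (path False p (-1) m) (R c d) = 0"
    and "c = p - 2 * int m \<Longrightarrow> d = p - 1 \<Longrightarrow> dw (path False p (-1) m) (R c d) = 1"
proof -
  have "(c \<noteq> p - 2 * int m \<or> d < p - 1 \<longrightarrow> dw (path False p (-1) m) (R c d) = 0)
    \<and> (c = p - 2 * int m \<and> d = p - 1 \<longrightarrow> dw (path False p (-1) m) (R c d) = 1)"
    using assms(2,3,4,5)
  proof (induction m arbitrary: c)
    case (Suc m)
    let ?e = "p - 2 * int m - 1"
    have Q: "set (path False p (-1) m) \<subseteq> {1..n}" using Suc.prems by auto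
    have "D (?e - 1) (D ?e (R c d)) = (if c = ?e - 1 \<and> ?e \<le> d then R (?e + 1) d else 0)"
      using Suc.prems assms by (intro delta_down) auto
    then have d: "D (p + (2 * int m + 2) * -1) (D (p + (2 * int m + 1) * -1) (R c d))
        = (if c = ?e - 1 \<and> ?e \<le> d then R (?e + 1) d else 0)" by (simp add: algebra_simps)
    show ?case
    proof (cases "m = 0")
      case True
      then show ?thesis using d unfolding path.simps dw.simps d by (auto simp: R_empty)
    next
      case False
      consider "c = ?e - 1" "?e + 1 \<le> d" | "c = ?e - 1" "?e = d" | "c \<noteq> ?e - 1 \<or> ?e > d" by linarith
      then show ?thesis
      proof cases
        case 1
        then show ?thesis using Suc.IH[OF Q, of "?e + 1"] Suc.prems False unfolding path.simps dw.simps d by auto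
      next
        case 2
        then show ?thesis using dw_one[OF Q path_nonempty] False unfolding path.simps dw.simps d by (auto simp: R_empty)
      next
        case 3
        then show ?thesis using dw_zero[OF Q] Suc.prems unfolding path.simps dw.simps d by auto
      qed
    qed
  qed simp
  then show "c \<noteq> p - 2 * int m \<or> d < p - 1 \<Longrightarrow> dw (path False p (-1) m) (R c d) = 0"
    and "c = p - 2 * int m \<Longrightarrow> d = p - 1 \<Longrightarrow> dw (path False p (-1) m) (R c d) = 1" by blast+
qed

lemma pfen_up: "odd p \<Longrightarrow> pfen True p 1 m = (fen True p (p + 2 * int m) :: 'n uq)"
proof (induction m)
  case (Suc m)
  have "fen True (p + 2 * int m + 1) (p + 2 * int m + 2)
      = (qbr (gE (p + 2 * int m + 1)) (gE (p + 2 * int m + 2)) :: 'n uq)"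
    using fen_pair[of True "p + 2 * int m + 1"] Suc.prems by (simp add: algebra_simps)
  then show ?case
    using Suc fen_split[of p "p + 2 * int m" "p + 2 * int m + 2" True] by (simp add: algebra_simps)
qed simp

lemma pfen_up_even: "odd p \<Longrightarrow> m > 0 \<Longrightarrow> pfen False p 1 m = (fen True (p + 1) (p + 2 * int m) :: 'n uq)"
proof (induction m)
  case (Suc m)
  have f: "fen True (p + 2 * int m + 1) (p + 2 * int m + 2)
      = (qbr (gE (p + 2 * int m + 1)) (gE (p + 2 * int m + 2)) :: 'n uq)"
    using fen_pair[of True "p + 2 * int m + 1"] Suc.prems by (simp add: algebra_simps)
  show ?case
  proof (cases "m = 0")
    case True
    then show ?thesis using f by (simp add: algebra_simps)
  next
    case False
    then show ?thesis
      using Suc f fen_split[of "p + 1" "p + 2 * int m" "p + 2 * int m + 2" True] by (simp add: algebra_simps)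
  qed
qed simp

lemma pfen_down_even: "odd p \<Longrightarrow> m > 0 \<Longrightarrow> pfen False p (-1) m = (fen True (p - 2 * int m) (p - 1) :: 'n uq)"
proof (induction m)
  case (Suc m)
  have f: "fen True (p - 2 * int m - 2) (p - 2 * int m - 1)
      = (qbr (gE (p - 2 * int m - 1)) (gE (p - 2 * int m - 2)) :: 'n uq)"
    using fen_pair'[of True "p - 2 * int m - 1"] Suc.prems by (simp add: algebra_simps)
  show ?case
  proof (cases "m = 0")
    case True
    then show ?thesis using f by (simp add: algebra_simps)
  next
    case False
    then show ?thesis
      using Suc f fen_split[of "p - 2 * int m - 2" "p - 2 * int m - 1" "p - 1" True] by (simp add: algebra_simps)
  qed
qed simp

lemma sum_path_up: "sum_list (map simple_root (path True p 1 m)) = rint p (p + 2 * int m)"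
proof (induction m)
  case (Suc m)
  then show ?case
    using rint_step[of p "p + 2 * int m"] rint_step[of p "p + 2 * int m + 1"] by (simp add: algebra_simps)
qed simp

lemma sum_path_up_even: "sum_list (map simple_root (path False p 1 m)) = rint (p + 1) (p + 2 * int m)"
proof (induction m)
  case (Suc m)
  then show ?case
    using rint_step[of "p + 1" "p + 2 * int m"] rint_step[of "p + 1" "p + 2 * int m + 1"] by (simp add: algebra_simps)
qed (simp add: rint_empty)

lemma rint_first: "a - 1 \<le> b \<Longrightarrow> rint (a - 1) b = simple_root (a - 1) + rint a b"
proof -
  assume "a - 1 \<le> b"
  then have "{a - 1..b} = insert (a - 1) {a..b}" by auto
  then show ?thesis by (simp add: rint_def)
qed

lemma sum_path_down_even: "sum_list (map simple_root (path False p (-1) m)) = rint (p - 2 * int m) (p - 1)"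
proof (induction m)
  case (Suc m)
  then show ?case
    using rint_first[of "p - 2 * int m" "p - 1"] rint_first[of "p - 2 * int m - 1" "p - 1"] by (simp add: algebra_simps)
qed (simp add: rint_empty)

end

lemma qvar_powi_sum: "qvar powi (sum f A) = (\<Prod>x\<in>A. qvar powi f x)"
  by (induction A rule: infinite_finite_induct) (simp_all add: power_int_add)

context braid
begin

lemma label_bounds:
  assumes "l \<in> set (rlabels n)" shows "1 \<le> rlo l" "rlo l \<le> rhi l" "rhi l \<le> n"
proof -
  have "1 \<le> rlo l \<and> rlo l \<le> rhi l \<and> rhi l \<le> n"
  proof (cases l)
    case (V i)
    then show ?thesis using assms even_range[of i] by (auto simp: in_rlabels)
  next
    case (W i)
    then show ?thesis using assms odd_range[of i] n3 by (auto simp: in_rlabels)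
  next
    case (X i)
    then show ?thesis using assms even_range[of i] n3 by (auto simp: in_rlabels)
  qed (use assms in \<open>auto simp: in_rlabels\<close>)
  then show "1 \<le> rlo l" "rlo l \<le> rhi l" "rhi l \<le> n" by blast+
qed

text \<open>
  Ends that were not reflected at the boundary are odd and reflected ones are even, so if both ends are
  odd, the length of the interval determines the family.
\<close>

lemma label_odd_ends:
  assumes "l \<in> set (rlabels n)" "odd (rlo l)" "odd (rhi l)"
  shows "rhi l = rlo l + 2 * int (cls l)"
proof (cases l)
qed (use assms n_odd in \<open>auto simp: in_rlabels split: if_splits\<close>)

lemma label_determined:
  assumes "l \<in> set (rlabels n)" "l' \<in> set (rlabels n)" "rlo l = rlo l'" "cls l = cls l'"
  shows "l = l'"
proof (cases l)
  case (U i)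
  then show ?thesis using assms(3,4) by (cases l') auto
next
  case (V i)
  then show ?thesis using assms(3,4) by (cases l') auto
next
  case (W i)
  then obtain j where j: "l' = W j" using assms(4) by (cases l') auto
  have "odd i" "odd j" using assms(1,2) W j by (auto simp: in_rlabels)
  then have "i \<noteq> 4" "j \<noteq> 4" by auto
  then show ?thesis using assms(3) W j by (simp split: if_splits)
next
  case (X i)
  then obtain j where j: "l' = X j" using assms(4) by (cases l') auto
  have "even i" "even j" using assms(1,2) X j by (auto simp: in_rlabels)
  then have "i \<noteq> 5" "j \<noteq> 5" by auto
  then show ?thesis using assms(3) X j by (simp split: if_splits)
qed

lemma label_lo_2:
  assumes "l \<in> set (rlabels n)" "rlo l = 2" shows "l = W 1 \<or> l = X 2"
proof -
  have "i \<noteq> 4" if "odd i" for i :: int using that by auto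
  moreover have "i \<noteq> 5" "i \<noteq> 3" if "even i" for i :: int using that by auto
  ultimately show ?thesis
    by (cases l) (use assms in \<open>auto simp: in_rlabels split: if_splits\<close>)
qed

lemma label_hi_last:
  assumes "l \<in> set (rlabels n)" "rhi l = n - 1" shows "l = W n \<or> l = X (n - 1)"
proof -
  have "i \<noteq> n - 1" "i \<noteq> n - 3" if "odd i" for i using that n_odd by auto
  moreover have "i \<noteq> n - 2" "i \<noteq> n - 4" if "even i" for i using that n_odd by auto
  ultimately show ?thesis
    by (cases l) (use assms in \<open>auto simp: in_rlabels split: if_splits\<close>)
qed

end

context kashiwara
begin

definition Rl :: "rlabel \<Rightarrow> 'n uq" where "Rl l = R (rlo l) (rhi l)"

text \<open>
  A path whose operators single out the root vector with label \<open>l\<close> among all root vectors of its own and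
  later families.
\<close>

definition good_path :: "rlabel \<Rightarrow> bool \<Rightarrow> int \<Rightarrow> int \<Rightarrow> nat \<Rightarrow> bool" where
  "good_path l t p s m \<longleftrightarrow> \<bar>s\<bar> = 1 \<and> set (path t p s m) \<subseteq> {1..n} \<and> (t \<or> m > 0) \<and>
     pfen t p s m = root_vector T l \<and> sum_list (map simple_root (path t p s m)) = rint (rlo l) (rhi l) \<and>
     dw (path t p s m) (Rl l) = 1 \<and>
     (\<forall>l' j m'. l' \<in> set (rlabels n) \<and> cls l \<le> cls l' \<and> j + m' \<le> m \<and> (l' \<noteq> l \<or> (j, m') \<noteq> (0, m)) \<and>
        (t \<or> j > 0 \<or> m' > 0) \<longrightarrow> dw (path (t \<or> j > 0) (p + 2 * int j * s) s m') (Rl l') = 0)"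

lemma set_path_up: "1 \<le> p \<Longrightarrow> p + 2 * int m \<le> n \<Longrightarrow> set (path t p 1 m) \<subseteq> {1..n}"
  using set_path[of _ t p 1 m] by (fastforce split: if_splits)

lemma set_path_down: "1 \<le> p - 2 * int m \<Longrightarrow> p \<le> n \<Longrightarrow> set (path t p (-1) m) \<subseteq> {1..n}"
  using set_path[of _ t p "-1" m] by (fastforce split: if_splits)

text \<open>
  A subpath can only detect an interval with odd ends. The length of such an interval determines its
  family, and if this family is not an earlier one, only the whole path is long enough.
\<close>

lemma good_path_unreflected:
  assumes l: "l \<in> set (rlabels n)" and odd: "odd (rlo l)" "odd (rhi l)"
  shows "good_path l True (rlo l) 1 (cls l)"
proof -
  note b = label_bounds[OF l] and len = label_odd_ends[OF l odd]
  have P: "set (path True (rlo l) 1 (cls l)) \<subseteq> {1..n}" using b len by (intro set_path_up) auto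
  have van: "dw (path True (rlo l + 2 * int j * 1) 1 m') (Rl l') = 0"
    if l': "l' \<in> set (rlabels n)" "cls l \<le> cls l'" and jm: "j + m' \<le> cls l" "l' \<noteq> l \<or> (j, m') \<noteq> (0, cls l)" for l' j m'
  proof -
    have S: "set (path True (rlo l + 2 * int j * 1) 1 m') \<subseteq> {1..n}"
      using subpath_subset[OF jm(1), of True "rlo l" 1] P by auto
    have "\<not> (rlo l' = rlo l + 2 * int j \<and> rhi l' = rlo l + 2 * int j + 2 * int m')"
    proof
      assume *: "rlo l' = rlo l + 2 * int j \<and> rhi l' = rlo l + 2 * int j + 2 * int m'"
      then have "cls l' = m'" using label_odd_ends[OF l'(1)] odd by simp
      then have "j = 0" "m' = cls l" "cls l = cls l'" using l' jm by auto
      then show False using label_determined[OF l l'(1)] * jm by auto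
    qed
    then show ?thesis using dw_up_R[OF _ S label_bounds[OF l'(1)]] odd by (auto simp: Rl_def)
  qed
  have "dw (path True (rlo l) 1 (cls l)) (Rl l) = 1"
    using dw_up_R[OF odd(1) P b] len by (simp add: Rl_def)
  moreover have "pfen True (rlo l) 1 (cls l) = root_vector T l"
    using pfen_up[OF odd(1)] root_vector_fen[OF l] len by simp
  ultimately show ?thesis
    unfolding good_path_def using P van sum_path_up[of "rlo l" "cls l"] len by simp
qed

text \<open>
  If the lower end is reflected, the path starts at \<open>1\<close> and omits \<open>1\<close> itself. The case of the upper end is
  the mirror image.
\<close>

lemma good_path_left:
  assumes l: "l = W 1 \<and> m = 1 \<or> l = X 2 \<and> m = 2 \<and> n \<noteq> 3"
  shows "good_path l False 1 1 m"
proof -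
  have "n \<noteq> 4" using n_odd by auto
  then have ll: "l \<in> set (rlabels n)" "rlo l = 2" "rhi l = 1 + 2 * int m" "m > 0" "cls l = m + 1" "1 + 2 * int m \<le> n"
    using l n3 by (auto simp: in_rlabels)
  have P: "set (path False 1 1 m) \<subseteq> {1..n}" using ll by (intro set_path_up) auto
  have van: "dw (path (j > 0) (1 + 2 * int j * 1) 1 m') (Rl l') = 0"
    if l': "l' \<in> set (rlabels n)" "cls l \<le> cls l'" and jm: "j + m' \<le> m" "l' \<noteq> l \<or> (j, m') \<noteq> (0, m)" "j > 0 \<or> m' > 0" for l' j m'
  proof -
    have S: "set (path (j > 0) (1 + 2 * int j * 1) 1 m') \<subseteq> {1..n}"
      using subpath_subset[OF jm(1), of False 1 1] P by auto
    have no: "\<not> (odd (rlo l') \<and> rhi l' = rlo l' + 2 * int m')"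
      using label_odd_ends[OF l'(1)] l' jm ll by auto
    show ?thesis
    proof (cases "j > 0")
      case True
      then show ?thesis using dw_up_R[of "1 + 2 * int j" m', OF _ _ label_bounds[OF l'(1)]] S no by (auto simp: Rl_def)
    next
      case False
      have "rhi l' \<noteq> 1 + 2 * int m' \<or> rlo l' > 2"
      proof (rule ccontr)
        assume *: "\<not> (rhi l' \<noteq> 1 + 2 * int m' \<or> rlo l' > 2)"
        have "rlo l' \<noteq> 1"
        proof
          assume "rlo l' = 1"
          then show False using no * by simp
        qed
        then have "rlo l' = 2" using * label_bounds(1)[OF l'(1)] by simp
        then have "l' = W 1 \<or> l' = X 2" by (rule label_lo_2[OF l'(1)])
        then show False using l l' jm * False n3 by (auto split: if_splits) presburger
      qed
      then show ?thesis using dw_up_R_even(1)[of 1 m', OF _ _ _ label_bounds[OF l'(1)]] S jm False by (auto simp: Rl_def)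
    qed
  qed
  have "dw (path False 1 1 m) (Rl l) = 1"
    using dw_up_R_even(2)[OF _ P ll(4) label_bounds[OF ll(1)]] ll by (simp add: Rl_def)
  moreover have "pfen False 1 1 m = root_vector T l"
    using pfen_up_even[of 1 m] root_vector_fen[OF ll(1)] ll by simp
  ultimately show ?thesis
    unfolding good_path_def using P van sum_path_up_even[of 1 m] ll by simp
qed

lemma good_path_right:
  assumes l: "l = W n \<and> m = 1 \<or> l = X (n - 1) \<and> m = 2 \<and> n \<noteq> 3"
  shows "good_path l False n (-1) m"
proof -
  have "n \<noteq> 4" using n_odd by auto
  then have ll: "l \<in> set (rlabels n)" "rhi l = n - 1" "rlo l = n - 2 * int m" "m > 0" "cls l = m + 1" "1 \<le> n - 2 * int m"
    using l n3 n_odd by (auto simp: in_rlabels)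
  have P: "set (path False n (-1) m) \<subseteq> {1..n}" using ll by (intro set_path_down) auto
  have van: "dw (path (j > 0) (n + 2 * int j * -1) (-1) m') (Rl l') = 0"
    if l': "l' \<in> set (rlabels n)" "cls l \<le> cls l'" and jm: "j + m' \<le> m" "l' \<noteq> l \<or> (j, m') \<noteq> (0, m)" "j > 0 \<or> m' > 0" for l' j m'
  proof -
    have S: "set (path (j > 0) (n + 2 * int j * -1) (-1) m') \<subseteq> {1..n}"
      using subpath_subset[OF jm(1), of False n "-1"] P by auto
    have no: "\<not> (odd (rhi l') \<and> rhi l' = rlo l' + 2 * int m')"
      using label_odd_ends[OF l'(1)] l' jm ll by auto
    show ?thesis
    proof (cases "j > 0")
      case True
      have o: "odd (n - 2 * int j)" using n_odd by simp
      have "\<not> (rhi l' = n - 2 * int j \<and> rlo l' = n - 2 * int j - 2 * int m')" using no o by auto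
      then show ?thesis using dw_down_R[OF o _ label_bounds[OF l'(1)], of m'] S True by (auto simp: Rl_def)
    next
      case False
      have "rlo l' \<noteq> n - 2 * int m' \<or> rhi l' < n - 1"
      proof (rule ccontr)
        assume *: "\<not> (rlo l' \<noteq> n - 2 * int m' \<or> rhi l' < n - 1)"
        have "rhi l' \<noteq> n"
        proof
          assume "rhi l' = n"
          then show False using no * n_odd by simp
        qed
        then have "rhi l' = n - 1" using * label_bounds(3)[OF l'(1)] by simp
        then have "l' = W n \<or> l' = X (n - 1)" by (rule label_hi_last[OF l'(1)])
        then show False using l l' jm * False n3 by (auto split: if_splits) presburger
      qed
      then show ?thesis using dw_down_R_even(1)[OF n_odd _ _ label_bounds[OF l'(1)], of m'] S jm False by (auto simp: Rl_def)
    qed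
  qed
  have "dw (path False n (-1) m) (Rl l) = 1"
    using dw_down_R_even(2)[OF n_odd P ll(4) label_bounds[OF ll(1)]] ll by (simp add: Rl_def)
  moreover have "pfen False n (-1) m = root_vector T l"
    using pfen_down_even[OF n_odd ll(4)] root_vector_fen[OF ll(1)] ll by simp
  ultimately show ?thesis
    unfolding good_path_def using P van sum_path_down_even[of n m] ll by simp
qed

lemma good_path_exists:
  assumes l: "l \<in> set (rlabels n)" shows "\<exists>t p s m. good_path l t p s m"
proof (cases "odd (rlo l) \<and> odd (rhi l)")
  case True
  then show ?thesis using good_path_unreflected[OF l] by blast
next
  case False
  show ?thesis
  proof (cases l)
    case (U i)
    then show ?thesis using False l by (auto simp: in_rlabels)
  next
    case (V i)
    then show ?thesis using False l by (auto simp: in_rlabels)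
  next
    case (W i)
    then have "i = 1 \<or> i = n" using False l by (auto simp: in_rlabels split: if_splits)
    then show ?thesis using good_path_left[of "W 1" 1] good_path_right[of "W n" 1] W by auto
  next
    case (X i)
    then have i: "i = 2 \<or> i = n - 1" using False l by (auto simp: in_rlabels split: if_splits)
    show ?thesis
    proof (cases "n = 3")
      case False
      then show ?thesis using good_path_left[of "X 2" 2] good_path_right[of "X (n - 1)" 2] X i by auto
    next
      case n3': True
      \<comment> \<open>Here both ends are reflected and the root vector is the single letter \<open>E\<^sub>2\<close>.\<close>
      then have X2: "l = X 2" using X i by auto
      have n2: "2 = n - 1" using n3' by simp
      have ends: "rlo l = 2" "rhi l = n - 1" unfolding X2 by (simp_all add: n2[symmetric])
      have only: "l' = l" if l': "l' \<in> set (rlabels n)" "cls l \<le> cls l'" for l'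
      proof -
        obtain i where i: "l' = X i" using l'(2) X2 by (cases l') auto
        have "even i \<and> 1 \<le> i \<and> i \<le> n" using l'(1) i by (auto simp: in_rlabels)
        then have e: "even i" "1 \<le> i" "i \<le> 3" using n3' by auto
        then have "i \<noteq> 1" "i \<noteq> 3" by auto
        then have "i = 2" using e by linarith
        then show ?thesis using i X2 by simp
      qed
      have r: "root_vector T l = gE 2" using root_vector_fen[OF l] ends n3' by simp
      have "good_path l True 2 1 0"
      proof -
        have rr: "rhi l = 2" using ends(2) n2 by simp
        have "Rl l = gE 2" by (simp add: Rl_def ends(1) rr)
        moreover have "D 2 (gE 2) = 1" using D_gE[of 2 2] n3 by simp
        ultimately show ?thesis
          unfolding good_path_def using only n3 by (auto simp: r rr ends(1))
      qed
      then show ?thesis by blast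
    qed
  qed
qed

lemma Rl_comp: "l \<in> set (rlabels n) \<Longrightarrow> Rl l \<in> uplus_comp (rint (rlo l) (rhi l))"
  using label_bounds[of l] by (auto simp: Rl_def intro: R_comp)

lemma Rl_prod_comp: "set ls \<subseteq> set (rlabels n) \<Longrightarrow> \<exists>\<delta>. prod_list (map Rl ls) \<in> uplus_comp \<delta>"
  using Rl_comp by (intro prod_list_homogeneous) auto

text \<open>
  The adjoint of left multiplication by a root vector acts on products of later root vectors as a
  skew derivation that only sees the factors equal to that root vector.
\<close>

lemma root_vector_adjoint:
  assumes l: "l \<in> set (rlabels n)"
  obtains d where
    "\<And>ls x. set ls \<subseteq> {l' \<in> set (rlabels n). cls l \<le> cls l'} \<Longrightarrow> x \<in> uplus \<Longrightarrow>
      form (root_vector T l * x) (prod_list (map Rl ls)) = form x (d (prod_list (map Rl ls)))"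
    "\<And>ls. set ls \<subseteq> {l' \<in> set (rlabels n). cls l \<le> cls l'} \<Longrightarrow>
      d (Rl l * prod_list (map Rl ls)) = prod_list (map Rl ls) + vs 2 (Rl l * d (prod_list (map Rl ls)))"
    "\<And>ls. set ls \<subseteq> {l' \<in> set (rlabels n). cls l \<le> cls l'} \<Longrightarrow> l \<notin> set ls \<Longrightarrow> d (prod_list (map Rl ls)) = 0"
proof -
  obtain t p s m where g: "good_path l t p s m" using good_path_exists[OF l] by blast
  then have s: "\<bar>s\<bar> = 1" and P: "set (path t p s m) \<subseteq> {1..n}" and ne: "t \<or> m > 0"
    and F: "pfen t p s m = root_vector T l" and deg: "sum_list (map simple_root (path t p s m)) = rint (rlo l) (rhi l)"
    and one: "dw (path t p s m) (Rl l) = 1"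
    and van: "\<And>l' j m'. l' \<in> set (rlabels n) \<Longrightarrow> cls l \<le> cls l' \<Longrightarrow> j + m' \<le> m \<Longrightarrow> l' \<noteq> l \<or> (j, m') \<noteq> (0, m) \<Longrightarrow>
        t \<or> j > 0 \<or> m' > 0 \<Longrightarrow> dw (path (t \<or> j > 0) (p + 2 * int j * s) s m') (Rl l') = 0"
    unfolding good_path_def by blast+
  have G: "\<exists>\<gamma>. g \<in> uplus_comp \<gamma>" if "set ls \<subseteq> {l' \<in> set (rlabels n). cls l \<le> cls l'}" "g \<in> set (map Rl ls)" for g ls
    using that Rl_comp by auto
  have k: "kill t p s m (prod_list (map Rl ls))" if ls: "set ls \<subseteq> {l' \<in> set (rlabels n). cls l \<le> cls l'}" for ls
    unfolding kill_def
  proof (intro allI impI, elim conjE)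
    fix j m' assume *: "j + m' \<le> m" "(j, m') \<noteq> (0, m)" "t \<or> j > 0 \<or> m' > 0"
    show "dw (path (t \<or> j > 0) (p + 2 * int j * s) s m') (prod_list (map Rl ls)) = 0"
    proof (rule kill_prod[OF s P, where full = False])
      show "\<exists>\<gamma>. g \<in> uplus_comp \<gamma>" if "g \<in> set (map Rl ls)" for g using G[OF ls that] .
      show "dw (path (t \<or> 0 < j) (p + 2 * int j * s) s m') g = 0"
        if "g \<in> set (map Rl ls)" "j + m' \<le> m" "False \<or> (j, m') \<noteq> (0, m)" "t \<or> 0 < j \<or> 0 < m'" for g j m'
        using that ls van[of _ j m'] by auto
    qed (use * in auto)
  qed
  have kl: "kill t p s m (Rl l)" using k[of "[l]"] l by simp
  have r2: "rform (rint (rlo l) (rhi l)) (rint (rlo l) (rhi l)) = 2"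
    using label_bounds[OF l] by (simp add: rform_rint_rint)
  show thesis
  proof (rule that[of "dw (path t p s m)"])
    fix ls x assume ls: "set ls \<subseteq> {l' \<in> set (rlabels n). cls l \<le> cls l'}" and x: "x \<in> (uplus :: 'n uq set)"
    obtain \<delta> where "prod_list (map Rl ls) \<in> uplus_comp \<delta>" using Rl_prod_comp[of ls] ls by auto
    then show "form (root_vector T l * x) (prod_list (map Rl ls)) = form x (dw (path t p s m) (prod_list (map Rl ls)))"
      using dw_adjoint[OF s P ne x comp_uplus k[OF ls]] F by simp
  next
    fix ls assume ls: "set ls \<subseteq> {l' \<in> set (rlabels n). cls l \<le> cls l'}"
    obtain \<delta> where "prod_list (map Rl ls) \<in> uplus_comp \<delta>" using Rl_prod_comp[of ls] ls by auto
    from dw_skew_derivation[OF s P ne Rl_comp[OF l] this kl k[OF ls]]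
    show "dw (path t p s m) (Rl l * prod_list (map Rl ls))
        = prod_list (map Rl ls) + vs 2 (Rl l * dw (path t p s m) (prod_list (map Rl ls)))"
      by (simp add: one deg r2)
  next
    fix ls assume ls: "set ls \<subseteq> {l' \<in> set (rlabels n). cls l \<le> cls l'}" "l \<notin> set ls"
    have "dw (path (t \<or> 0 < (0::nat)) (p + 2 * int 0 * s) s m) (prod_list (map Rl ls)) = 0"
    proof (rule kill_prod[OF s P, where full = True])
      show "\<exists>\<gamma>. g \<in> uplus_comp \<gamma>" if "g \<in> set (map Rl ls)" for g using G[OF ls(1) that] .
      show "dw (path (t \<or> 0 < j) (p + 2 * int j * s) s m') g = 0"
        if "g \<in> set (map Rl ls)" "j + m' \<le> m" "True \<or> (j, m') \<noteq> (0, m)" "t \<or> 0 < j \<or> 0 < m'" for g j m'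
        using that ls van[of _ j m'] by fastforce
    qed (use ne in auto)
    then show "dw (path t p s m) (prod_list (map Rl ls)) = 0" by simp
  qed
qed

text \<open>The pairing of the \<open>a\<close>-th power of a root vector with the \<open>a\<close>-th power of its dual.\<close>

definition nfact :: "nat \<Rightarrow> qv" where
  "nfact a = (\<Prod>t = 1..a. \<Sum>r<t. qvar powi (2 * int r))"

lemma nfact_Suc: "nfact (Suc a) = nfact a * (\<Sum>r<Suc a. qvar powi (2 * int r))"
  by (simp add: nfact_def del: sum.lessThan_Suc)

text \<open>
  The adjoints of the leftmost root vectors remove the leftmost factors on the other side one by one. The
  skew derivation rule turns \<open>a\<close> equal factors into a geometric sum in \<open>v\<^sup>2\<close>, as roots have norm 2.
\<close>

lemma norm_PBW:
  assumes "set ks \<subseteq> set (rlabels n)" "distinct ks" "sorted (map cls ks)"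
  shows "form (prod_list (map (\<lambda>k. root_vector T k ^ a k) ks)) (prod_list (map (\<lambda>k. Rl k ^ a k) ks))
    = (\<Prod>k\<in>set ks. nfact (a k))"
  using assms
proof (induction ks)
  case Nil
  then show ?case by (simp add: form_one)
next
  case (Cons l ks)
  define ls where "ls = concat (map (\<lambda>k. replicate (a k) k) ks)"
  have P: "prod_list (map (\<lambda>k. Rl k ^ a k) ks) = prod_list (map Rl ls)"
    unfolding ls_def by (induction ks) simp_all
  have ls: "set ls \<subseteq> {l' \<in> set (rlabels n). cls l \<le> cls l'}" "l \<notin> set ls"
    using Cons.prems by (auto simp: ls_def)
  have l: "l \<in> set (rlabels n)" using Cons.prems by simp
  obtain d where d: "\<And>ls x. set ls \<subseteq> {l' \<in> set (rlabels n). cls l \<le> cls l'} \<Longrightarrow> x \<in> uplus \<Longrightarrow>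
      form (root_vector T l * x) (prod_list (map Rl ls)) = form x (d (prod_list (map Rl ls)))"
    "\<And>ls. set ls \<subseteq> {l' \<in> set (rlabels n). cls l \<le> cls l'} \<Longrightarrow>
      d (Rl l * prod_list (map Rl ls)) = prod_list (map Rl ls) + vs 2 (Rl l * d (prod_list (map Rl ls)))"
    "\<And>ls. set ls \<subseteq> {l' \<in> set (rlabels n). cls l \<le> cls l'} \<Longrightarrow> l \<notin> set ls \<Longrightarrow> d (prod_list (map Rl ls)) = 0"
    using root_vector_adjoint[OF l] by blast
  define Q where "Q = prod_list (map (\<lambda>k. root_vector T k ^ a k) ks)"
  define Y where "Y c = Rl l ^ c * prod_list (map Rl ls)" for c
  have Ye: "Y c = prod_list (map Rl (replicate c l @ ls))" for c by (simp add: Y_def)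
  have rl: "set (replicate c l @ ls) \<subseteq> {l' \<in> set (rlabels n). cls l \<le> cls l'}" for c
    using ls l by auto
  have dY: "d (Y (Suc c)) = (\<Sum>r<Suc c. qvar powi (2 * int r)) *\<^sub>q Y c" for c
  proof (induction c)
    case 0
    have "d (Y (Suc 0)) = Y 0 + vs 2 (Rl l * d (Y 0))" using d(2)[OF rl[of 0]] by (simp add: Y_def)
    also have "d (Y 0) = 0" using d(3)[OF ls] by (simp add: Y_def)
    finally show ?case by simp
  next
    case (Suc c)
    have "d (Y (Suc (Suc c))) = Y (Suc c) + vs 2 (Rl l * d (Y (Suc c)))"
      using d(2)[OF rl[of "Suc c"]] by (simp add: Y_def mult.assoc)
    also have "Rl l * d (Y (Suc c)) = (\<Sum>r<Suc c. qvar powi (2 * int r)) *\<^sub>q Y (Suc c)"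
      by (subst Suc.IH) (simp add: Y_def mult.assoc del: sum.lessThan_Suc)
    also have "Y (Suc c) + vs 2 \<dots> = (1 + qvar powi 2 * (\<Sum>r<Suc c. qvar powi (2 * int r))) *\<^sub>q Y (Suc c)"
      by (simp add: vs_def uq.scale_left_distrib del: sum.lessThan_Suc)
    also have "1 + qvar powi 2 * (\<Sum>r<Suc c. qvar powi (2 * int r)) = (\<Sum>r<Suc (Suc c). qvar powi (2 * int r))"
    proof -
      have "qvar powi 2 * qvar powi (2 * int r) = qvar powi (2 * int (Suc r))" for r
        unfolding qvar_powi_add by (simp add: algebra_simps)
      then show ?thesis unfolding sum.lessThan_Suc_shift[of _ "Suc c"] sum_distrib_left
        by (simp del: of_nat_Suc sum.lessThan_Suc)
    qed
    finally show ?case .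
  qed
  have rv: "root_vector T k \<in> uplus" if "k \<in> set (rlabels n)" for k
    using comp_fen[of "rlo k" "rhi k" True, where 'n = 'n] label_bounds[OF that] n
    by (simp add: root_vector_fen[OF that] comp_uplus)
  have pw: "x ^ c \<in> uplus" if "x \<in> uplus" for x :: "'n uq" and c
    using that by (induction c) (simp_all add: uplus.one uplus.mult)
  have Q: "Q \<in> uplus" using Cons.prems(1) unfolding Q_def
    by (induction ks) (auto simp: uplus.one intro!: uplus.mult pw rv)
  have Yu: "Y c \<in> uplus" for c
  proof -
    have "set (replicate c l @ ls) \<subseteq> set (rlabels n)" using rl by blast
    then show ?thesis using Rl_prod_comp comp_uplus unfolding Ye by blast
  qed
  have step: "form (root_vector T l ^ c * Q) (Y c) = nfact c * form Q (Y 0)" for c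
  proof (induction c)
    case 0
    then show ?case by (simp add: nfact_def)
  next
    case (Suc c)
    have u: "root_vector T l ^ c * Q \<in> uplus" using Q rv[OF l] by (intro uplus.mult pw)
    have "form (root_vector T l ^ Suc c * Q) (Y (Suc c)) = form (root_vector T l ^ c * Q) (d (Y (Suc c)))"
      using d(1)[OF rl[of "Suc c"] u] by (simp only: Ye power_Suc mult.assoc)
    also have "\<dots> = (\<Sum>r<Suc c. qvar powi (2 * int r)) * form (root_vector T l ^ c * Q) (Y c)"
      unfolding dY by (rule form_scale_right[OF u Yu])
    finally show ?case unfolding Suc.IH nfact_Suc by (simp only: mult.assoc mult.commute mult.left_commute)
  qed
  have "form Q (Y 0) = (\<Prod>k\<in>set ks. nfact (a k))"
    using Cons by (simp add: Q_def Y_def P)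
  moreover have "form (prod_list (map (\<lambda>k. root_vector T k ^ a k) (l # ks))) (prod_list (map (\<lambda>k. Rl k ^ a k) (l # ks)))
    = form (root_vector T l ^ a l * Q) (Y (a l))" by (simp add: Q_def Y_def P)
  ultimately show ?case using step[of "a l"] Cons.prems(2) by simp
qed

lemma dual_eltI:
  assumes "x \<in> uplus" "y = c *\<^sub>q x" "form x y = 1"
  shows "dual_elt form x = y"
  unfolding dual_elt_def
proof (rule the_equality)
  show "(\<exists>c. y = c *\<^sub>q x) \<and> form x y = 1" using assms by auto
  fix z assume "(\<exists>c. z = c *\<^sub>q x) \<and> form x z = 1"
  then obtain c' where z: "z = c' *\<^sub>q x" "form x z = 1" by blast
  have "c * form x x = 1" "c' * form x x = 1"
    using assms z form_scale_right[OF assms(1,1)] by simp_all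
  then have "c = c'" by (metis mult_cancel_right mult_zero_right zero_neq_one)
  then show "z = y" using z assms by simp
qed

lemma Rl_scale:
  assumes "l \<in> set (rlabels n)"
  shows "Rl l = (1 / (1 - qvar powi (-2))) ^ nat (rhi l - rlo l) *\<^sub>q root_vector T l"
  using label_bounds[OF assms] by (simp add: Rl_def R_def root_vector_fen[OF assms])

lemma sorted_cls_rlabels: "sorted (map cls (rlabels n))"
proof -
  have [simp]: "map cls (map U xs) = replicate (length xs) 0" "map cls (map V xs) = replicate (length xs) 1"
    "map cls (map W xs) = replicate (length xs) 2" "map cls (map X xs) = replicate (length xs) 3" for xs
    by (induction xs) simp_all
  show ?thesis unfolding rlabels_def map_append by (simp add: sorted_append del: map_map)
qed

lemma distinct_rlabels: "distinct (rlabels n)"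
  by (auto simp: rlabels_def distinct_map inj_on_def)

lemma root_vector_uplus: "l \<in> set (rlabels n) \<Longrightarrow> root_vector T l \<in> uplus"
  using comp_fen[of "rlo l" "rhi l" True, where 'n = 'n] label_bounds[of l] n
  by (simp add: root_vector_fen comp_uplus)

lemma dual_root_vector:
  assumes l: "l \<in> set (rlabels n)"
  shows "dual_elt form (root_vector T l) = Rl l"
proof (rule dual_eltI)
  show "Rl l = (1 / (1 - qvar powi (-2))) ^ nat (rhi l - rlo l) *\<^sub>q root_vector T l" by (rule Rl_scale[OF l])
  show "form (root_vector T l) (Rl l) = 1" using norm_PBW[of "[l]" "\<lambda>_. 1"] l by (simp add: nfact_def)
qed (rule root_vector_uplus[OF l])

lemma nfact_qfact: "nfact a = qvar powi (int (a choose 2)) * qfact a"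
proof (induction a)
  case (Suc a)
  have geo: "(\<Sum>r<Suc a. qvar powi (2 * int r)) = qvar powi int a * qint (Suc a)" for a
  proof -
    have "(\<Sum>r<Suc a. qvar powi (2 * int r)) * (qvar - inverse qvar) = qvar powi int a * (qvar ^ Suc a - inverse qvar ^ Suc a)"
    proof (induction a)
      case 0
      then show ?case by simp
    next
      case (Suc a)
      have p: "qvar ^ k = qvar powi int k" "inverse qvar ^ k = qvar powi (- int k)" for k
        by (simp_all add: power_int_minus power_inverse)
      have "(\<Sum>r<Suc (Suc a). qvar powi (2 * int r)) * (qvar - inverse qvar)
        = qvar powi int a * (qvar ^ Suc a - inverse qvar ^ Suc a) + qvar powi (2 * int (Suc a)) * (qvar powi 1 - qvar powi (-1))"
        unfolding sum.lessThan_Suc[of _ "Suc a"] distrib_right Suc.IH by (simp add: power_int_minus)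
      also have "\<dots> = qvar powi int (Suc a) * (qvar ^ Suc (Suc a) - inverse qvar ^ Suc (Suc a))"
        unfolding p right_diff_distrib qvar_powi_add by (simp add: algebra_simps)
      finally show ?case .
    qed
    then show ?thesis using qvar_minus_inverse by (simp add: qint_def field_simps)
  qed
  have "qfact (Suc a) = qfact a * qint (Suc a)" by (simp add: qfact_def)
  moreover have "Suc a choose 2 = (a choose 2) + a" by (simp add: numeral_2_eq_2)
  ultimately show ?case unfolding nfact_Suc Suc.IH geo
    by (simp add: mult.assoc mult.left_commute flip: qvar_powi_add)
qed (simp add: nfact_def qfact_def numeral_2_eq_2)

lemma qfact_nonzero: "qfact a \<noteq> 0"
proof -
  have "qint k \<noteq> 0" if "k > 0" for k
  proof
    assume "qint k = 0"
    then have "qvar ^ k = inverse qvar ^ k" using qvar_minus_inverse by (simp add: qint_def)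
    then have "qvar ^ k * qvar ^ k = 1" by (metis power_mult_distrib qvar_nonzero right_inverse power_one)
    then show False using qvar_power_neq_1[of "k + k"] that by (simp add: power_add)
  qed
  then show ?thesis by (simp add: qfact_def)
qed

text \<open>
  The product is proportional to \<open>E[a]\<close>, and by the norm formula the power of \<open>v\<close> is what makes the
  pairing equal to 1.
\<close>

lemma pbw_dual_eq:
  "pbw_dual T form a = vs (- (\<Sum>k\<in>set (rlabels n). int (a k choose 2)))
    (prod_list (map (\<lambda>k. Rl k ^ a k) (rlabels n)))"
proof (rule dual_eltI)
  let ?P = "\<lambda>ks. prod_list (map (\<lambda>k. Rl k ^ a k) ks)" and ?Q = "\<lambda>ks. prod_list (map (\<lambda>k. root_vector T k ^ a k) ks)"
  let ?L = "rlabels n"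
  have rl: "rlabels (rank TYPE('n)) = rlabels n" using n by simp
  have ps: "(c *\<^sub>q x) ^ k = c ^ k *\<^sub>q x ^ k" for c k and x :: "'n uq"
    by (induction k) simp_all
  have "prod_list (map (\<lambda>k. 1 / qfact (a k) *\<^sub>q root_vector T k ^ a k) ks) = (\<Prod>k\<leftarrow>ks. 1 / qfact (a k)) *\<^sub>q ?Q ks" for ks
    by (induction ks) simp_all
  then have pbw: "pbw T a = (\<Prod>k\<leftarrow>?L. 1 / qfact (a k)) *\<^sub>q ?Q ?L"
    unfolding pbw_def rl .
  have scale: "?P ks = (\<Prod>k\<leftarrow>ks. ((1 / (1 - qvar powi (-2))) ^ nat (rhi k - rlo k)) ^ a k) *\<^sub>q ?Q ks" if "set ks \<subseteq> set ?L" for ks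
    using that by (induction ks) (simp_all add: Rl_scale ps)
  have Qu: "?Q ks \<in> uplus" if "set ks \<subseteq> set ?L" for ks
  proof -
    have pw: "x ^ c \<in> uplus" if "x \<in> uplus" for x :: "'n uq" and c
      using that by (induction c) (simp_all add: uplus.one uplus.mult)
    show ?thesis using that by (induction ks) (auto simp: uplus.one intro!: uplus.mult pw root_vector_uplus)
  qed
  show u: "pbw T a \<in> uplus" unfolding pbw using Qu by (intro uplus.scale) simp
  have nz: "(\<Prod>k\<leftarrow>?L. 1 / qfact (a k)) \<noteq> 0" by (auto simp: prod_list_zero_iff qfact_nonzero)
  have Q: "?Q ?L = (1 / (\<Prod>k\<leftarrow>?L. 1 / qfact (a k))) *\<^sub>q pbw T a" using nz by (simp add: pbw)
  show "vs (- (\<Sum>k\<in>set ?L. int (a k choose 2))) (?P ?L)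
      = (qvar powi (- (\<Sum>k\<in>set ?L. int (a k choose 2))) *
        ((\<Prod>k\<leftarrow>?L. ((1 / (1 - qvar powi (-2))) ^ nat (rhi k - rlo k)) ^ a k) * (1 / (\<Prod>k\<leftarrow>?L. 1 / qfact (a k))))) *\<^sub>q pbw T a"
    unfolding scale[OF order_refl] unfolding Q vs_def uq.scale_scale ..
  have Pu: "?P ?L \<in> uplus" unfolding scale[OF order_refl] using Qu by (intro uplus.scale) simp
  have "form (pbw T a) (vs (- (\<Sum>k\<in>set ?L. int (a k choose 2))) (?P ?L))
    = (\<Prod>k\<leftarrow>?L. 1 / qfact (a k)) * (qvar powi (- (\<Sum>k\<in>set ?L. int (a k choose 2))) * (\<Prod>k\<in>set ?L. nfact (a k)))"
    using norm_PBW[OF order_refl distinct_rlabels sorted_cls_rlabels, of a] Qu[OF order_refl] Pu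
    by (simp add: pbw vs_def form_scale form_scale_right uplus.scale)
  also have "(\<Prod>k\<leftarrow>?L. 1 / qfact (a k)) = (\<Prod>k\<in>set ?L. 1 / qfact (a k))"
    using distinct_rlabels by (simp add: prod.distinct_set_conv_list)
  also have "qvar powi (- (\<Sum>k\<in>set ?L. int (a k choose 2))) = (\<Prod>k\<in>set ?L. qvar powi (- int (a k choose 2)))"
    by (simp add: qvar_powi_sum flip: sum_negf)
  also have "(\<Prod>k\<in>set ?L. 1 / qfact (a k)) * ((\<Prod>k\<in>set ?L. qvar powi (- int (a k choose 2))) * (\<Prod>k\<in>set ?L. nfact (a k)))
    = (\<Prod>k\<in>set ?L. 1 / qfact (a k) * (qvar powi (- int (a k choose 2)) * nfact (a k)))"
    by (simp only: prod.distrib)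
  also have "\<dots> = 1"
  proof (rule prod.neutral, rule ballI)
    fix k
    have "qvar powi (- int (a k choose 2)) * nfact (a k) = qfact (a k)"
      unfolding nfact_qfact mult.assoc[symmetric] qvar_powi_add by simp
    then show "1 / qfact (a k) * (qvar powi (- int (a k choose 2)) * nfact (a k)) = 1"
      using qfact_nonzero by simp
  qed
  finally show "form (pbw T a) (vs (- (\<Sum>k\<in>set ?L. int (a k choose 2))) (?P ?L)) = 1" .
qed

text \<open>The grading is well defined: components of different degrees are orthogonal.\<close>

lemma form_comp_orthogonal:
  assumes "set ws \<subseteq> {1..n}" "y \<in> uplus_comp \<delta>" "sum_list (map simple_root ws) \<noteq> \<delta>"
  shows "form (gEw ws) y = 0"
  using assms
proof (induction ws arbitrary: y \<delta>)
  case Nil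
  have yu: "y \<in> uplus" using Nil comp_uplus by auto
  have "form y 1 = 0" using Nil(2)
  proof (induction rule: comp_induct)
    case zero
    show ?case by (rule form_zero[OF uplus.one])
  next
    case (add x y c)
    then show ?case using comp_uplus[OF add(1)] comp_uplus[OF add(2)] uplus.one[where 'n = 'n]
      by (simp add: form_add form_scale uplus.scale)
  next
    case (word ws)
    then obtain i vs where ws: "ws = i # vs" using Nil(3) by (cases ws) auto
    have "form (gEw ws) 1 = form (gEw vs) (D i 1)"
      using word ws n uplus_word[of vs, where 'n = 'n] uplus.one[where 'n = 'n] by (simp add: form_gE)
    then show ?case using word ws n D_one[of i] uplus_word[of vs, where 'n = 'n] by (simp add: form_zero)
  qed
  then show ?case using form_sym[OF yu uplus.one] by simp
next
  case (Cons i ws)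
  have i: "i \<in> {1..n}" and u: "(gEw ws :: 'n uq) \<in> uplus" using Cons.prems n by (auto intro: uplus_word)
  have "form (gEw (i # ws)) y = form (gEw ws) (D i y)"
    using form_gE[OF i u] comp_uplus[OF Cons.prems(2)] by simp
  also have "\<dots> = 0"
  proof (rule Cons.IH)
    show "D i y \<in> uplus_comp (\<delta> - simple_root i)" using D_comp[OF i] Cons.prems by blast
    show "sum_list (map simple_root ws) \<noteq> \<delta> - simple_root i"
      using Cons.prems(3) by (auto simp: algebra_simps)
  qed (use Cons.prems in auto)
  finally show ?case .
qed

lemma udeg_eq:
  fixes x :: "'n uq"
  assumes x: "x \<in> uplus_comp \<gamma>" "x \<noteq> 0"
  shows "udeg x = \<gamma>"
  unfolding udeg_def
proof (rule the_equality)
  fix \<delta> assume d: "x \<in> uplus_comp \<delta>"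
  show "\<delta> = \<gamma>"
  proof (rule ccontr)
    assume ne: "\<delta> \<noteq> \<gamma>"
    have xu: "x \<in> uplus" using comp_uplus[OF x(1)] .
    have "x = 0"
    proof (rule form_nondeg[OF xu])
      fix y :: "'n uq" assume "y \<in> uplus"
      then have "y \<in> uq.span {gEw is | is. set is \<subseteq> {1..rank TYPE('n)}}" by (rule uplus_span_words)
      then have "y \<in> uplus \<and> form y x = 0"
      proof (induction rule: uq.span_induct_alt)
        case base
        then show ?case using uplus_zero xu by (simp add: form_zero)
      next
        case (step c w y)
        then obtain ws where ws: "w = gEw ws" "set ws \<subseteq> {1..n}" using n by blast
        have "form w x = 0"
          using form_comp_orthogonal[OF ws(2) x(1)] form_comp_orthogonal[OF ws(2) d] ne ws(1) by auto
        moreover have "w \<in> uplus" using ws n by (simp add: uplus_word)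
        ultimately show ?case using step xu by (simp add: form_add form_scale uplus.add uplus.scale)
      qed
      then show "form x y = 0" using xu form_sym[of x y] by simp
    qed
    with x show False by simp
  qed
qed (rule x(1))

lemma udeg_root_vector:
  assumes "l \<in> set (rlabels n)"
  shows "udeg (root_vector T l) = rint (rlo l) (rhi l)" "udeg (Rl l) = rint (rlo l) (rhi l)"
proof -
  have f: "form (root_vector T l) (Rl l) = 1" using norm_PBW[of "[l]" "\<lambda>_. 1"] assms by (simp add: nfact_def)
  have nz: "root_vector T l \<noteq> 0" "Rl l \<noteq> 0"
    using f form_zero root_vector_uplus[OF assms] comp_uplus[OF Rl_comp[OF assms]] by auto
  show "udeg (Rl l) = rint (rlo l) (rhi l)" using udeg_eq[OF Rl_comp[OF assms] nz(2)] .
  have "root_vector T l \<in> uplus_comp (rint (rlo l) (rhi l))"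
    using comp_fen[of "rlo l" "rhi l" True, where 'n = 'n] label_bounds[OF assms] n by (simp add: root_vector_fen[OF assms])
  then show "udeg (root_vector T l) = rint (rlo l) (rhi l)" using udeg_eq nz(1) by blast
qed

end

lemma rform_rint_ends:
  assumes "a \<le> b" "c \<le> d"
  shows "rform (rint a b) (rint c d) = (if a = c then 1 else 0) + (if b = d then 1 else 0)
    - (if c = b + 1 then 1 else 0) - (if a = d + 1 then 1 else 0)"
  unfolding rform_rint_rint[OF assms] using assms by auto

definition sg :: "int \<Rightarrow> int" where "sg i = (if even i then 1 else -1)"

text \<open>
  The exponents of \<open>v\<close> that arise when \<open>z\<^sub>i\<close> is moved past \<open>z\<^sub>j\<close>, \<open>y\<^sub>i\<close> past \<open>y\<^sub>j\<close>, and \<open>y\<^sub>i\<close> past \<open>z\<^sub>j\<close>.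
\<close>

definition zzexp :: "int \<Rightarrow> int \<Rightarrow> int" where "zzexp i j = (if \<bar>i - j\<bar> = 1 then - sg i else 0)"
definition yyexp :: "int \<Rightarrow> int \<Rightarrow> int" where "yyexp i j = (if \<bar>i - j\<bar> = 3 then sg i else 0)"
definition yzexp :: "int \<Rightarrow> int \<Rightarrow> int" where "yzexp i j = (if \<bar>i - j\<bar> = 1 \<or> \<bar>i - j\<bar> = 2 then sg i else 0)"

context kashiwara
begin

section \<open>Straightening relations in dual form\<close>

definition yd :: "int \<Rightarrow> 'n uq" where "yd i = Rl (ylabel i)"
definition zd :: "int \<Rightarrow> 'n uq" where "zd i = (if i = 0 \<or> i = n + 1 then 1 else Rl (zlabel i))"
definition pd :: "int \<Rightarrow> 'n uq" where
  "pd i = (if odd i then yd i * zd i else zd i * yd i) - vs (-1) (zd (i - 1) * zd (i + 1))"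

definition hl :: "rlabel \<Rightarrow> nat" where "hl l = nat (rhi l - rlo l)"

definition cc :: qv where "cc = 1 / (1 - qvar powi (-2))"

lemma Rl_cc: "l \<in> set (rlabels n) \<Longrightarrow> Rl l = cc ^ hl l *\<^sub>q root_vector T l"
  by (simp add: Rl_scale cc_def hl_def)

lemma yd_cc: "i \<in> {1..n} \<Longrightarrow> yd i = cc ^ hl (ylabel i) *\<^sub>q yv i"
  by (simp add: yd_def yv_def Rl_cc yz_labels)

lemma zd_cc: "i \<in> {1..n} \<Longrightarrow> zd i = cc ^ hl (zlabel i) *\<^sub>q zv i"
  by (simp add: zd_def zv_def Rl_cc yz_labels)

lemma zd_outer [simp]: "zd 0 = 1" "zd (n + 1) = 1"
  by (simp_all add: zd_def)

lemma scaled_qcommute: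
  assumes "x * y = vs k (y * x)" shows "(c *\<^sub>q x) * (d *\<^sub>q y) = vs k ((d *\<^sub>q y) * (c *\<^sub>q x))"
  using assms by (simp add: vs_qscale mult.commute)

lemma zd_zd:
  assumes i: "i \<in> {1..n}" and j: "j \<in> {1..n}"
  shows "zd i * zd j = vs (zzexp i j) (zd j * zd i)"
proof -
  have "zv i * zv j = vs (zzexp i j) (zv j * zv i)"
  proof (cases "even i = even j")
    case True
    then have "\<bar>i - j\<bar> \<noteq> 1" by presburger
    then show ?thesis using zv_commute_same[OF i j True] by (simp add: zzexp_def)
  next
    case False
    show ?thesis
    proof (cases "even i")
      case True
      then have "zv j * zv i = vs (near 1 i j) (zv i * zv j)" using False i j by (intro zv_odd_zv_even) auto
      then show ?thesis using True by (auto simp: zzexp_def sg_def near_def)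
    next
      case o: False
      then have "zv i * zv j = vs (near 1 j i) (zv j * zv i)" using False i j by (intro zv_odd_zv_even) auto
      then show ?thesis using o by (auto simp: zzexp_def sg_def near_def abs_minus_commute)
    qed
  qed
  then show ?thesis using i j by (simp only: zd_cc scaled_qcommute)
qed

lemma yd_yd:
  assumes i: "i \<in> {1..n}" and j: "j \<in> {1..n}" and ij: "\<bar>i - j\<bar> \<noteq> 1"
  shows "yd i * yd j = vs (yyexp i j) (yd j * yd i)"
proof -
  have "yv i * yv j = vs (yyexp i j) (yv j * yv i)"
  proof (cases "even i = even j")
    case True
    then have "\<bar>i - j\<bar> \<noteq> 3" by presburger
    then show ?thesis using yv_commute_same[OF i j True] by (simp add: yyexp_def)
  next
    case False
    show ?thesis
    proof (cases "even i")
      case True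
      then have "yv i * yv j = vs (near 3 j i) (yv j * yv i)" using False i j ij by (intro yv_even_yv_odd) auto
      then show ?thesis using True by (auto simp: yyexp_def sg_def near_def abs_minus_commute)
    next
      case o: False
      then have "yv j * yv i = vs (near 3 i j) (yv i * yv j)" using False i j ij by (intro yv_even_yv_odd) auto
      then show ?thesis using o by (auto simp: yyexp_def sg_def near_def)
    qed
  qed
  then show ?thesis using i j by (simp only: yd_cc scaled_qcommute)
qed

lemma yd_zd:
  assumes i: "i \<in> {1..n}" and j: "j \<in> {1..n}" and ij: "i \<noteq> j"
  shows "yd i * zd j = vs (yzexp i j) (zd j * yd i)"
proof -
  have "yv i * zv j = vs (yzexp i j) (zv j * yv i)"
  proof (cases "even i = even j")
    case True
    then have d: "\<bar>i - j\<bar> \<noteq> 1" by presburger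
    show ?thesis
    proof (cases "even i")
      case e: True
      then have "yv i * zv j = vs (near 2 j i) (zv j * yv i)" using True i j ij by (intro yv_even_zv_even) auto
      then show ?thesis using e d by (auto simp: yzexp_def sg_def near_def abs_minus_commute)
    next
      case o: False
      then have "zv j * yv i = vs (near 2 i j) (yv i * zv j)" using True i j ij by (intro zv_odd_yv_odd) auto
      then show ?thesis using o d by (auto simp: yzexp_def sg_def near_def)
    qed
  next
    case False
    then have d: "\<bar>i - j\<bar> \<noteq> 2" by presburger
    show ?thesis
    proof (cases "even i")
      case e: True
      then have "yv i * zv j = vs (near 1 j i) (zv j * yv i)" using False i j ij by (intro yv_even_zv_odd) auto
      then show ?thesis using e d by (auto simp: yzexp_def sg_def near_def abs_minus_commute)
    next
      case o: False
      then have "zv j * yv i = vs (near 1 i j) (yv i * zv j)" using False i j ij by (intro zv_even_yv_odd) auto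
      then show ?thesis using o d by (auto simp: yzexp_def sg_def near_def)
    qed
  qed
  then show ?thesis using i j by (simp only: yd_cc zd_cc scaled_qcommute)
qed

text \<open>
  The two sides of this relation have the same total number of brackets, so that rescaling does not change
  it. At the boundary the correction term has one bracket more, which provides the missing factor
  \<open>v - v\<^sup>-\<^sup>1\<close>.
\<close>

lemma scaled_interior:
  assumes "x * y = y * x + vs 1 (u * w) - vs (-1) (u * w)" "a + b = (c + d :: nat)"
  shows "(cc ^ a *\<^sub>q x) * (cc ^ b *\<^sub>q y) = (cc ^ b *\<^sub>q y) * (cc ^ a *\<^sub>q x)
    + vs 1 ((cc ^ c *\<^sub>q u) * (cc ^ d *\<^sub>q w)) - vs (-1) ((cc ^ c *\<^sub>q u) * (cc ^ d *\<^sub>q w))"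
proof -
  have "cc ^ a * cc ^ b = cc ^ c * cc ^ d" using assms(2) by (simp flip: power_add)
  then show ?thesis using assms(1)
    by (simp add: vs_qscale uq.scale_right_distrib uq.scale_right_diff_distrib mult.commute[of "cc ^ b"] flip: uq.scale_scale)
      (simp add: uq.scale_scale vs_qscale uq.scale_right_distrib uq.scale_right_diff_distrib mult.commute)
qed

lemma scaled_end:
  assumes "x * y = vs (-1) (y * x) + u" "c = Suc (a + b)"
  shows "(cc ^ a *\<^sub>q x) * (cc ^ b *\<^sub>q y) = vs (-1) ((cc ^ b *\<^sub>q y) * (cc ^ a *\<^sub>q x)
    + vs 1 (cc ^ c *\<^sub>q u) - vs (-1) (cc ^ c *\<^sub>q u))"
proof -
  have "cc ^ c *\<^sub>q u - vs (-2) (cc ^ c *\<^sub>q u) = ((1 - qvar powi (-2)) * cc ^ c) *\<^sub>q u"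
    unfolding vm2 by simp
  also have "(1 - qvar powi (-2)) * cc ^ c = cc ^ a * cc ^ b"
    using one_minus_vm2 by (simp add: assms(2) cc_def power_add)
  finally have "cc ^ c *\<^sub>q u - vs (-2) (cc ^ c *\<^sub>q u) = (cc ^ a * cc ^ b) *\<^sub>q u" .
  then show ?thesis using assms(1)
    by (simp add: vs_qscale uq.scale_right_distrib mult.commute add_diff_eq[symmetric])
qed

text \<open>This is \<open>(|y\<^sub>i|, |z\<^sub>i|)\<close>, which vanishes except at the ends of the Dynkin diagram.\<close>

definition kap :: "int \<Rightarrow> int" where "kap i = (if i = 1 \<or> i = n then -1 else 0)"

lemma hl_simps:
  assumes "i \<in> {1..n}"
  shows "odd i \<Longrightarrow> hl (ylabel i) = 0" "even i \<Longrightarrow> hl (zlabel i) = 2"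
    "odd i \<Longrightarrow> hl (zlabel i) = (if i = 1 \<or> i = n then 1 else 4)"
  using assms n3 by (auto simp: hl_def ylabel_def zlabel_def)

lemma hl_x:
  assumes "i \<in> {1..n}" "even i"
  shows "hl (ylabel i) = (if n = 3 then 0 else if i = 2 \<or> i = n - 1 then 3 else 6)"
proof (cases "n = 3")
  case True
  have "i = n - 1" using assms even_range[of i] True by auto
  then have "rhi (ylabel i) = i" using n_odd by (simp add: ylabel_def)
  moreover have "rlo (ylabel i) = 2" using \<open>i = n - 1\<close> True by (simp add: ylabel_def)
  ultimately have "hl (ylabel i) = nat (i - 2)" by (simp add: hl_def)
  then show ?thesis using True \<open>i = n - 1\<close> by simp
next
  case False
  then show ?thesis using assms even_range[of i] n3 by (auto simp: hl_def ylabel_def)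
qed

lemma zd_yd_odd:
  assumes i: "i \<in> {1..n}" "odd i"
  shows "zd i * yd i = vs (kap i) (yd i * zd i + vs 1 (zd (i - 1) * zd (i + 1)) - vs (-1) (zd (i - 1) * zd (i + 1)))"
proof -
  consider "i = 1" | "i = n" | "1 < i" "i < n" using i by fastforce
  then show ?thesis
  proof cases
    case 1
    have "zd 1 * yd 1 = vs (-1) (yd 1 * zd 1 + vs 1 (zd 2) - vs (-1) (zd 2))"
      using scaled_end[OF zv_yv_first, of "hl (zlabel 2)" "hl (zlabel 1)" "hl (ylabel 1)"] n3
      by (simp add: yd_cc zd_cc hl_simps)
    then show ?thesis using 1 by (simp add: kap_def)
  next
    case 2
    have "zd n * yd n = vs (-1) (yd n * zd n + vs 1 (zd (n - 1)) - vs (-1) (zd (n - 1)))"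
      using scaled_end[OF zv_yv_last, of "hl (zlabel (n - 1))" "hl (zlabel n)" "hl (ylabel n)"] n3 n_odd
      by (simp add: yd_cc zd_cc hl_simps)
    then show ?thesis using 2 by (simp add: kap_def)
  next
    case 3
    then show ?thesis
      using scaled_interior[OF zv_yv_odd_interior[OF i(2) 3], of "hl (zlabel i)" "hl (ylabel i)" "hl (zlabel (i - 1))" "hl (zlabel (i + 1))"] i
      by (simp add: yd_cc zd_cc hl_simps kap_def)
  qed
qed

lemma yd_zd_even:
  assumes i: "i \<in> {1..n}" "even i"
  shows "yd i * zd i = zd i * yd i + vs 1 (zd (i - 1) * zd (i + 1)) - vs (-1) (zd (i - 1) * zd (i + 1))"
proof -
  have r: "2 \<le> i" "i \<le> n - 1" "i \<noteq> 3" "i \<noteq> n - 2" using even_range i by auto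
  have "hl (ylabel i) + hl (zlabel i) = hl (zlabel (i - 1)) + hl (zlabel (i + 1))"
    using i r n3 by (auto simp: hl_simps hl_x)
  from scaled_interior[OF yv_zv_even[OF i(2,1)] this] show ?thesis
    using i r by (simp add: yd_cc zd_cc)
qed

lemma yd_yd_adjacent:
  assumes i: "i \<in> {1..n}" "odd i" and j: "j \<in> {1..n}" and ij: "\<bar>i - j\<bar> = 1"
  shows "yd j * yd i = vs (kap i) (yd i * yd j + vs 1 (zd (min i j - 1) * zd (max i j + 1))
    - vs (-1) (zd (min i j - 1) * zd (max i j + 1)))"
proof -
  have ej: "even j" using i ij by presburger
  have r: "2 \<le> j" "j \<le> n - 1" "j \<noteq> 3" "j \<noteq> n - 2" using even_range[OF ej j] by auto
  have n4: "n \<noteq> 4" using n_odd by auto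
  consider "i = 1" | "i = n" "i \<noteq> 1" | "1 < i" "i < n" using i by fastforce
  then show ?thesis
  proof cases
    case 1
    then have j2: "j = 2" using ij r by simp
    have "hl (zlabel 3) = Suc (hl (ylabel 2) + hl (ylabel 1))" using n3 n4 by (simp add: hl_simps hl_x)
    from scaled_end[OF yv_2_yv_1 this]
    have "yd 2 * yd 1 = vs (-1) (yd 1 * yd 2 + vs 1 (zd 3) - vs (-1) (zd 3))"
      using n3 by (simp add: yd_cc zd_cc)
    then show ?thesis using 1 j2 by (simp add: kap_def)
  next
    case 2
    then have j2: "j = n - 1" using ij r by simp
    have e: "odd (n - 2)" "even (n - 1)" using n_odd by auto
    have "n - 1 = 2 \<longleftrightarrow> n = 3" "n - 2 = 1 \<longleftrightarrow> n = 3" by auto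
    then have "hl (zlabel (n - 2)) = Suc (hl (ylabel (n - 1)) + hl (ylabel n))" using n3 n4 n_odd e by (simp add: hl_simps hl_x)
    from scaled_end[OF yv_nm1_yv_n this]
    have "yd (n - 1) * yd n = vs (-1) (yd n * yd (n - 1) + vs 1 (zd (n - 2)) - vs (-1) (zd (n - 2)))"
      using n3 by (simp add: yd_cc zd_cc)
    then show ?thesis using 2 j2 by (simp add: kap_def)
  next
    case 3
    have rng: "min i j - 1 \<in> {1..n}" "max i j + 1 \<in> {1..n}" using 3 r ij by auto
    have "hl (ylabel j) + hl (ylabel i) = hl (zlabel (min i j - 1)) + hl (zlabel (max i j + 1))"
    proof -
      consider "i = j + 1" | "i = j - 1" using ij by linarith
      then show ?thesis
      proof cases
        case 1
        then have "min i j - 1 = j - 1" "max i j + 1 = j + 2" by auto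
        then show ?thesis using 1 3 i j ej r n3 n4 rng by (auto simp: hl_simps hl_x)
      next
        case 2
        then have "min i j - 1 = j - 2" "max i j + 1 = j + 1" by auto
        then show ?thesis using 2 3 i j ej r n3 n4 rng by (auto simp: hl_simps hl_x)
      qed
    qed
    from scaled_interior[OF yv_even_yv_odd_interior[OF i(2) ej j ij 3] this]
    show ?thesis using 3 i j rng by (simp add: yd_cc zd_cc kap_def)
  qed
qed

section \<open>Degrees\<close>

definition dy :: "int \<Rightarrow> root_lattice" where "dy i = rint (rlo (ylabel i)) (rhi (ylabel i))"
definition dz :: "int \<Rightarrow> root_lattice" where
  "dz i = (if i = 0 \<or> i = n + 1 then 0 else rint (rlo (zlabel i)) (rhi (zlabel i)))"

lemma label_in_range:
  assumes "i \<in> {1..n}"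
  shows "1 \<le> rlo (ylabel i)" "rlo (ylabel i) \<le> rhi (ylabel i)" "rhi (ylabel i) \<le> n"
    "1 \<le> rlo (zlabel i)" "rlo (zlabel i) \<le> rhi (zlabel i)" "rhi (zlabel i) \<le> n"
  using label_bounds yz_labels[OF assms] by blast+

lemma rform_dy_odd_even:
  assumes i: "i \<in> {1..n}" "odd i" and j: "j \<in> {1..n}" "even j"
  shows "rform (dy i) (dy j) = (if \<bar>i - j\<bar> = 1 then kap i else if \<bar>i - j\<bar> = 3 then 1 else 0)"
proof -
  have r: "2 \<le> j" "j \<le> n - 1" using even_range j by auto
  define lo hi where "lo = (if j = 2 then 2 else j - 3)" and "hi = (if j = n - 1 then n - 1 else j + 3)"
  have "lo \<le> hi" using r by (auto simp: lo_def hi_def)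
  have e: "rform (dy i) (dy j) = (if i = lo then 1 else 0) + (if i = hi then 1 else 0)
    - (if lo = i + 1 then 1 else 0) - (if i = hi + 1 then 1 else 0)"
    using rform_rint_ends[OF order_refl \<open>lo \<le> hi\<close>, of i] i(2) j(2)
    by (simp add: dy_def ylabel_def lo_def hi_def)
  have p1: "i = lo \<longleftrightarrow> j = i + 3" using i j(2) by (auto simp: lo_def)
  have p2: "i = hi \<longleftrightarrow> i = j + 3" using i j(2) n_odd by (auto simp: hi_def)
  have p3: "lo = i + 1 \<longleftrightarrow> i = 1 \<and> j = 2" using i j(2) by (auto simp: lo_def)
  have p4: "i = hi + 1 \<longleftrightarrow> i = n \<and> j = n - 1" using i j(2) r by (auto simp: hi_def)
  have x: "\<not> (i = 1 \<and> j = 2 \<and> i = n \<and> j = n - 1)" using n3 by auto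
  show ?thesis unfolding e p1 p2 p3 p4
    using x r i n3 by (auto simp: kap_def)
qed

lemma rform_dy_even_even:
  assumes i: "i \<in> {1..n}" "even i" and j: "j \<in> {1..n}" "even j" and ij: "i < j"
  shows "rform (dy i) (dy j) = 0"
proof -
  have r: "2 \<le> i" "j \<le> n - 1" using even_range i j by auto
  have ij2: "i + 2 \<le> j" using i(2) j(2) ij by presburger
  have d: "j \<noteq> i + 3" "j \<noteq> i + 5" "j \<noteq> i + 7" using i(2) j(2) by presburger+
  have e: "rlo (ylabel i) = (if i = 2 then 2 else i - 3)" "rhi (ylabel i) = i + 3"
    "rlo (ylabel j) = j - 3" "rhi (ylabel j) = (if j = n - 1 then n - 1 else j + 3)"
    using i j r ij2 by (auto simp: ylabel_def)
  have le: "(if i = 2 then 2 else i - 3) \<le> i + 3" "j - 3 \<le> (if j = n - 1 then n - 1 else j + 3)" using r by auto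
  show ?thesis
    unfolding dy_def e rform_rint_ends[OF le]
    using r ij2 d i(2) j(2) n_odd by auto
qed

lemma rform_dy_dy:
  assumes i: "i \<in> {1..n}" and j: "j \<in> {1..n}" and ij: "i \<noteq> j"
  shows "rform (dy i) (dy j) = (if \<bar>i - j\<bar> = 1 then kap (if odd i then i else j) else if \<bar>i - j\<bar> = 3 then 1 else 0)"
proof (cases "even i = even j")
  case False
  show ?thesis
  proof (cases "odd i")
    case True
    then show ?thesis using rform_dy_odd_even[OF i _ j] False by simp
  next
    case o: False
    then show ?thesis using rform_dy_odd_even[OF j _ i] False by (simp add: rform_sym[of "dy i"] abs_minus_commute)
  qed
next
  case same: True
  then have d: "\<bar>i - j\<bar> \<noteq> 1" "\<bar>i - j\<bar> \<noteq> 3" "i \<noteq> j + 1" "j \<noteq> i + 1" by presburger+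
  have "rform (dy i) (dy j) = 0"
  proof (cases "odd i")
    case True
    then show ?thesis
      unfolding dy_def rform_rint_ends[OF label_in_range(2)[OF i] label_in_range(2)[OF j]]
      using same ij d i j by (auto simp: ylabel_def)
  next
    case False
    then show ?thesis using rform_dy_even_even[OF i _ j] rform_dy_even_even[OF j _ i] same ij
      by (cases "i < j") (auto simp: rform_sym[of "dy i"])
  qed
  then show ?thesis using d by simp
qed

lemma dz_W: "odd i \<Longrightarrow> i \<in> {1..n} \<Longrightarrow> dz i = rint (if i = 1 then 2 else i - 2) (if i = n then n - 1 else i + 2)"
  by (simp add: dz_def zlabel_def)

lemma dz_V: "even i \<Longrightarrow> i \<in> {1..n} \<Longrightarrow> dz i = rint (i - 1) (i + 1)"
  by (simp add: dz_def zlabel_def)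

lemma dy_U: "odd i \<Longrightarrow> dy i = rint i i"
  by (simp add: dy_def ylabel_def)

lemma dy_X: "even i \<Longrightarrow> dy i = rint (if i = 2 then 2 else i - 3) (if i = n - 1 then n - 1 else i + 3)"
  by (simp add: dy_def ylabel_def)

lemma dz_outer [simp]: "dz 0 = 0" "dz (n + 1) = 0"
  by (simp_all add: dz_def)

lemma rform_dz_dz:
  assumes i: "i \<in> {1..n}" and j: "j \<in> {1..n}" and ij: "i \<noteq> j"
  shows "rform (dz i) (dz j) = (if \<bar>i - j\<bar> = 1 then 1 else 0)"
proof -
  have oe: "rform (dz i) (dz j) = (if \<bar>i - j\<bar> = 1 then 1 else 0)"
    if i: "i \<in> {1..n}" "even i" and j: "j \<in> {1..n}" "odd j" for i j
  proof -
    define lo hi where "lo = (if j = 1 then 2 else j - 2)" and "hi = (if j = n then n - 1 else j + 2)"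
    have r: "2 \<le> i" "i \<le> n - 1" using even_range i by auto
    have jn: "j \<noteq> 2" "j \<noteq> n - 1" using odd_range j by auto
    have "lo \<le> hi" using j n3 jn by (auto simp: lo_def hi_def)
    have e: "rform (dz i) (dz j) = (if i - 1 = lo then 1 else 0) + (if i + 1 = hi then 1 else 0)
      - (if lo = i + 1 + 1 then 1 else 0) - (if i - 1 = hi + 1 then 1 else 0)"
      using rform_rint_ends[OF _ \<open>lo \<le> hi\<close>, of "i - 1" "i + 1"] i j by (simp add: dz_V dz_W lo_def hi_def)
    have p: "i - 1 = lo \<longleftrightarrow> j = i + 1" "i + 1 = hi \<longleftrightarrow> j = i - 1" "lo \<noteq> i + 1 + 1" "i - 1 \<noteq> hi + 1"
      using i j r n_odd by (auto simp: lo_def hi_def)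
    show ?thesis unfolding e using p by auto
  qed
  show ?thesis
  proof (cases "even i = even j")
    case False
    then show ?thesis using oe[OF i _ j] oe[OF j _ i] by (cases "even i") (auto simp: rform_sym[of "dz i"] abs_minus_commute)
  next
    case same: True
    then have d: "\<bar>i - j\<bar> \<noteq> 1" "j \<noteq> i + 3" "i \<noteq> j + 3" by presburger+
    have "rform (dz i) (dz j) = 0"
    proof (cases "even i")
      case True
      then show ?thesis using rform_rint_ends[of "i - 1" "i + 1" "j - 1" "j + 1"] i j ij same d by (auto simp: dz_V)
    next
      case False
      define f g where "f i = (if i = 1 then 2 else i - 2)" and "g i = (if i = n then n - 1 else i + 2)" for i
      have o: "odd i" "odd j" using False same by auto
      have jn: "j \<noteq> 2" "j \<noteq> n - 1" "i \<noteq> 2" "i \<noteq> n - 1" using odd_range o i j by auto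
      have le: "f i \<le> g i" "f j \<le> g j" using i j n3 jn by (auto simp: f_def g_def)
      have n: "f i \<noteq> f j" "g i \<noteq> g j" "f j \<noteq> g i + 1" "f i \<noteq> g j + 1"
        using i j o ij n_odd by (auto simp: f_def g_def)
      have "rform (dz i) (dz j) = rform (rint (f i) (g i)) (rint (f j) (g j))"
        unfolding dz_W[OF o(1) i] dz_W[OF o(2) j] f_def g_def ..
      then show ?thesis unfolding rform_rint_ends[OF le] using n by simp
    qed
    then show ?thesis using d by simp
  qed
qed

lemma rform_dy_dz:
  assumes i: "i \<in> {1..n}" and j: "j \<in> {1..n}"
  shows "rform (dy i) (dz j) = (if \<bar>i - j\<bar> = 1 \<or> \<bar>i - j\<bar> = 2 then 1 else if i = j then kap i else 0)"
proof -
  define f g where "f i = (if i = 1 then 2 else i - 2)" and "g i = (if i = n then n - 1 else i + 2)" for i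
  define f' g' where "f' i = (if i = 2 then 2 else i - 3)" and "g' i = (if i = n - 1 then n - 1 else i + 3)" for i
  have W: "f j \<le> g j" if "odd j" using that odd_range[of j] j n3 by (auto simp: f_def g_def)
  consider "odd i" "even j" | "odd i" "odd j" | "even i" "even j" | "even i" "odd j" by blast
  then show ?thesis
  proof cases
    case 1
    then have "i \<noteq> j" "i \<noteq> j - 2" "i \<noteq> j + 2" by auto
    then show ?thesis using rform_rint_ends[of i i "j - 1" "j + 1"] 1 i j by (auto simp: dy_U dz_V)
  next
    case 2
    have e: "rform (dy i) (dz j) = (if i = f j then 1 else 0) + (if i = g j then 1 else 0)
      - (if f j = i + 1 then 1 else 0) - (if i = g j + 1 then 1 else 0)"
      using rform_rint_ends[OF order_refl W[OF 2(2)], of i] 2 j by (simp add: dy_U dz_W f_def g_def)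
    have p: "i = f j \<longleftrightarrow> j = i + 2" "i = g j \<longleftrightarrow> i = j + 2" "f j = i + 1 \<longleftrightarrow> i = 1 \<and> j = 1" "i = g j + 1 \<longleftrightarrow> i = n \<and> j = n"
      using 2 i j n_odd by (auto simp: f_def g_def)
    have d: "\<bar>i - j\<bar> \<noteq> 1" "n \<noteq> 1" using 2 n3 by presburger+
    show ?thesis
    proof (cases "i = j")
      case True
      then show ?thesis unfolding e p using d by (simp add: kap_def)
    next
      case False
      then have "\<bar>i - j\<bar> = 2 \<longleftrightarrow> j = i + 2 \<or> i = j + 2" "\<not> (i = 1 \<and> j = 1)" "\<not> (i = n \<and> j = n)" by auto
      then show ?thesis unfolding e p using d False by auto
    qed
  next
    case 3
    have r: "2 \<le> i" "i \<le> n - 1" using even_range 3 i by auto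
    have le: "f' i \<le> g' i" "j - 1 \<le> j + 1" using r by (auto simp: f'_def g'_def)
    have e: "rform (dy i) (dz j) = (if f' i = j - 1 then 1 else 0) + (if g' i = j + 1 then 1 else 0)
      - (if j - 1 = g' i + 1 then 1 else 0) - (if f' i = j + 1 + 1 then 1 else 0)"
      using rform_rint_ends[OF le] 3 j by (simp add: dy_X dz_V f'_def g'_def)
    have p: "f' i = j - 1 \<longleftrightarrow> i = j + 2" "g' i = j + 1 \<longleftrightarrow> j = i + 2" "j - 1 \<noteq> g' i + 1" "f' i \<noteq> j + 1 + 1"
      using 3 i j n_odd by (auto simp: f'_def g'_def)
    have "\<bar>i - j\<bar> \<noteq> 1" using 3 by presburger
    moreover have "kap i = 0" using r by (auto simp: kap_def)
    ultimately show ?thesis unfolding e using p by auto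
  next
    case 4
    have r: "2 \<le> i" "i \<le> n - 1" using even_range 4 i by auto
    have le: "f' i \<le> g' i" using r by (auto simp: f'_def g'_def)
    have e: "rform (dy i) (dz j) = (if f' i = f j then 1 else 0) + (if g' i = g j then 1 else 0)
      - (if f j = g' i + 1 then 1 else 0) - (if f' i = g j + 1 then 1 else 0)"
      using rform_rint_ends[OF le W[OF 4(2)]] 4 j by (simp add: dy_X dz_W f'_def g'_def f_def g_def)
    have p1: "f' i = f j \<longleftrightarrow> i = j + 1" using 4 i j by (auto simp: f'_def f_def)
    have p2: "g' i = g j \<longleftrightarrow> j = i + 1" using 4 i j n_odd by (auto simp: g'_def g_def)
    have p3: "f j \<noteq> g' i + 1" using 4 r i j n_odd by (auto simp: f_def g'_def)
    have p4: "f' i \<noteq> g j + 1" using 4 r i j n_odd by (auto simp: f'_def g_def)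
    have "\<bar>i - j\<bar> \<noteq> 2" "i \<noteq> j" using 4 by presburger+
    then show ?thesis unfolding e p1 p2 using p3 p4 by auto
  qed
qed

text \<open>The reason why the exchange relations are homogeneous.\<close>

lemma rint_exchange:
  assumes "a \<le> b + 1" "c \<le> d + 1" "a \<le> d + 1" "c \<le> b + 1"
  shows "rint a b + rint c d = rint a d + rint c b"
proof -
  have *: "rint a b + rint (b + 1) c = rint a c" if "a \<le> b + 1" "b \<le> c" for a b c
  proof -
    have "{a..c} = {a..b} \<union> {b + 1..c}" using that by auto
    then show ?thesis unfolding rint_def by (simp add: sum.union_disjoint)
  qed
  show ?thesis
  proof (cases "b \<le> d")
    case True
    show ?thesis
      unfolding *[OF assms(1) True, symmetric] *[OF assms(4) True, symmetric] by (simp add: add_ac)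
  next
    case False
    then have db: "d \<le> b" by simp
    show ?thesis
      unfolding *[OF assms(3) db, symmetric] *[OF assms(2) db, symmetric] by (simp add: add_ac)
  qed
qed

end

section \<open>Identities for quantum minors\<close>

definition qc :: "int \<Rightarrow> 'n uq \<Rightarrow> 'n uq \<Rightarrow> bool" where
  "qc e x y \<longleftrightarrow> x * y = vs e (y * x)"

lemma qc_one: "qc 0 x 1" by (simp add: qc_def)

lemma qc_mult: "qc e x y \<Longrightarrow> qc f x z \<Longrightarrow> qc (e + f) x (y * z)"
  unfolding qc_def by (metis add.commute mult.assoc vs_mult_left vs_mult_right vs_vs)

lemma qc_diff: "qc e x y \<Longrightarrow> qc e x z \<Longrightarrow> qc e x (y - z)"
  by (simp add: qc_def algebra_simps)

lemma qc_vs: "qc e x y \<Longrightarrow> qc e x (vs k y)"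
  by (simp add: qc_def add.commute)

lemma qc_sym: "qc e x y \<Longrightarrow> qc (- e) y x"
  by (simp add: qc_def)

text \<open>
  Moving a generator \<open>Y\<close> through one recursion step \<open>d = Q y - P z\<close> for minors, up to powers of \<open>v\<close>. The
  corrections from \<open>Y y\<close> and \<open>Y z\<close> combine, because \<open>Q z\<^sub>2\<close> contains \<open>P z\<^sub>3\<close> by the exchange identity.
\<close>

lemma straighten_step:
  assumes d: "d = vs al (Q * y) - vs be (P * z)" and Q: "qc f Y Q" and P: "qc f Y P"
    and y: "Y * y = vs c (y * Y) + vs t (z2 * z1) - vs t' (z2 * z1)"
    and z: "Y * z = vs c (z * Y) + vs t (z3 * z1) - vs t' (z3 * z1)"
    and b: "Q * z2 = vs b1 P' + vs b2 (P * z3)" and e: "al + b2 = be"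
  shows "Y * d = vs (f + c) (d * Y) + vs (f + al + b1 + t) (P' * z1) - vs (f + al + b1 + t') (P' * z1)"
proof -
  have Q': "Y * (Q * u) = vs f (Q * (Y * u))" and P': "Y * (P * u) = vs f (P * (Y * u))" for u
    using Q P unfolding qc_def by (metis mult.assoc vs_mult_left)+
  have b': "Q * (z2 * u) = vs b1 (P' * u) + vs b2 (P * (z3 * u))" for u
    using b by (metis distrib_right mult.assoc vs_mult_left)
  show ?thesis unfolding d e[symmetric]
    by (simp add: algebra_simps Q' P' y z b')
qed

text \<open>
  Multiplying a recursion step by \<open>z\<close>: in \<open>y z = p + \<dots>\<close> the correction term meets the previous exchange
  identity, one term of which cancels against the second term of the recursion.
\<close>

lemma exchange_step:
  assumes d: "d = vs al (Q * y) - vs be (P * z1)" and y: "y * z = p + vs s (z3 * z1)"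
    and b: "Q * z3 = vs b1 P' + vs b2 (P * z)" and z: "z1 * z = vs e (z * z1)" and e: "al + s + b2 = be + e"
  shows "d * z = vs al (Q * p) + vs (al + s + b1) (P' * z1)"
proof -
  have b': "Q * (z3 * u) = vs b1 (P' * u) + vs b2 (P * (z * u))" for u
    using b by (metis distrib_right mult.assoc vs_mult_left)
  have be: "be = al + s + b2 - e" using e by simp
  show ?thesis unfolding d be
    by (simp add: algebra_simps y z b')
qed

context kashiwara
begin

text \<open>
  The first recursion in (a). It also holds for \<open>j = a + 1\<close> if \<open>\<Delta>\<^sub>a\<^sub>,\<^sub>a\<^sub>-\<^sub>2 p\<^sub>a\<^sub>-\<^sub>1\<close> is read as \<open>z\<^sub>a\<^sub>-\<^sub>1\<close>.
\<close>

fun minor_aux :: "int \<Rightarrow> nat \<Rightarrow> 'n uq" where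
  "minor_aux a 0 = 1"
| "minor_aux a (Suc 0) = yd a"
| "minor_aux a (Suc (Suc m)) = (let j = a + int m + 1 in
     if even j then minor_aux a (Suc m) * yd j
       - vs (Aexp a j) ((if m = 0 then zd (a - 1) else minor_aux a (m - 1) * pd (j - 2)) * zd (j + 1))
     else yd j * minor_aux a (Suc m)
       - vs (Aexp a j) (zd (j + 1) * (if m = 0 then zd (a - 1) else pd (j - 2) * minor_aux a (m - 1))))"

definition minor :: "int \<Rightarrow> int \<Rightarrow> 'n uq" where "minor a j = minor_aux a (nat (j - a + 1))"

text \<open>
  \<open>PL a j\<close> is \<open>\<Delta>\<^sub>a\<^sub>,\<^sub>j\<^sub>-\<^sub>2 p\<^sub>j\<^sub>-\<^sub>1\<close>, with the value at \<open>j = a\<close> chosen such that the exchange relation also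
  holds there.
\<close>

definition PL :: "int \<Rightarrow> int \<Rightarrow> 'n uq" where
  "PL a j = (if j = a then zd (a - 1) else minor a (j - 2) * pd (j - 1))"

definition PR :: "int \<Rightarrow> int \<Rightarrow> 'n uq" where
  "PR a j = (if j = a then zd (a - 1) else pd (j - 1) * minor a (j - 2))"

lemma minor_empty [simp]: "minor a (a - 1) = 1" by (simp add: minor_def)
lemma minor_one [simp]: "minor a a = yd a" by (simp add: minor_def)

lemma minor_rec:
  assumes "a < j"
  shows "minor a j = (if even j then minor a (j - 1) * yd j - vs (Aexp a j) (PL a (j - 1) * zd (j + 1))
    else yd j * minor a (j - 1) - vs (Aexp a j) (zd (j + 1) * PR a (j - 1)))"
proof -
  define m where "m = nat (j - a - 1)"
  have m: "a + int m + 1 = j" using assms by (simp add: m_def)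
  have e: "nat (j - a + 1) = Suc (Suc m)" "nat (j - 1 - a + 1) = Suc m" using m by auto
  have P: "(if m = 0 then zd (a - 1) else minor_aux a (m - 1) * pd (j - 2)) = PL a (j - 1)"
    "(if m = 0 then zd (a - 1) else pd (j - 2) * minor_aux a (m - 1)) = PR a (j - 1)"
  proof -
    have i: "nat (j - 1 - 2 - a + 1) = m - 1" "j - 1 - 1 = j - 2" and c: "m = 0 \<longleftrightarrow> j - 1 = a" using m by auto
    show "(if m = 0 then zd (a - 1) else minor_aux a (m - 1) * pd (j - 2)) = PL a (j - 1)"
      "(if m = 0 then zd (a - 1) else pd (j - 2) * minor_aux a (m - 1)) = PR a (j - 1)"
      unfolding PL_def PR_def minor_def i c by (rule refl)+
  qed
  show ?thesis
    unfolding minor_def e minor_aux.simps Let_def m P by (rule refl)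
qed

text \<open>
  The exponents above, extended by \<open>z\<^sub>0 = z\<^sub>n\<^sub>+\<^sub>1 = 1\<close>.
\<close>

definition zx :: "int \<Rightarrow> int \<Rightarrow> int" where
  "zx i j = (if i \<in> {1..n} \<and> j \<in> {1..n} then zzexp i j else 0)"

definition yx :: "int \<Rightarrow> int \<Rightarrow> int" where
  "yx i j = (if j \<in> {1..n} then yzexp i j else 0)"

lemma qc_zz: "i \<in> {0..n + 1} \<Longrightarrow> j \<in> {0..n + 1} \<Longrightarrow> qc (zx i j) (zd i) (zd j)"
proof -
  assume "i \<in> {0..n + 1}" "j \<in> {0..n + 1}"
  then consider "i \<in> {1..n}" "j \<in> {1..n}" | "i = 0" | "i = n + 1" | "j = 0" | "j = n + 1" by fastforce
  then show ?thesis
  proof cases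
    case 1
    then have "zx i j = zzexp i j" by (simp add: zx_def)
    then show ?thesis unfolding qc_def using zd_zd[OF 1] by (simp only:)
  qed (auto simp: qc_def zx_def)
qed

lemma qc_yz: "i \<in> {1..n} \<Longrightarrow> j \<in> {0..n + 1} \<Longrightarrow> i \<noteq> j \<Longrightarrow> qc (yx i j) (yd i) (zd j)"
proof -
  assume "i \<in> {1..n}" "j \<in> {0..n + 1}" "i \<noteq> j"
  then consider "i \<in> {1..n}" "j \<in> {1..n}" "i \<noteq> j" | "j = 0" | "j = n + 1" by fastforce
  then show ?thesis
  proof cases
    case 1
    then have "yx i j = yzexp i j" by (simp add: yx_def)
    then show ?thesis unfolding qc_def using yd_zd[OF 1] by (simp only:)
  qed (auto simp: qc_def yx_def)
qed

lemma qc_yy: "i \<in> {1..n} \<Longrightarrow> j \<in> {1..n} \<Longrightarrow> \<bar>i - j\<bar> \<noteq> 1 \<Longrightarrow> qc (yyexp i j) (yd i) (yd j)"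
  unfolding qc_def by (rule yd_yd)

lemma qc_pd:
  assumes "qc f x (yd s)" "qc g x (zd s)" "qc h x (zd (s - 1))" "qc k x (zd (s + 1))" "f + g = h + k"
  shows "qc (f + g) x (pd s)"
proof -
  have "qc (f + g) x (zd (s - 1) * zd (s + 1))" using qc_mult[OF assms(3,4)] assms(5) by simp
  then show ?thesis using qc_mult[OF assms(1,2)] qc_mult[OF assms(2,1)]
    by (auto simp: pd_def add.commute intro!: qc_diff qc_vs)
qed

text \<open>
  An element that \<open>q\<close>-commutes with all generators, with exponents compatible with the two exchange
  relations, \<open>q\<close>-commutes with the quantum minors.
\<close>

lemma minor_qcommute:
  assumes y: "\<And>s. a \<le> s \<Longrightarrow> s \<le> K \<Longrightarrow> qc (f s) x (yd s)"
    and z: "\<And>s. a - 1 \<le> s \<Longrightarrow> s \<le> K + 1 \<Longrightarrow> qc (g s) x (zd s)"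
    and e1: "\<And>s. a \<le> s \<Longrightarrow> s \<le> K - 2 \<Longrightarrow> f s + g s = g (s - 1) + g (s + 1)"
    and e2: "\<And>k. a + 1 \<le> k \<Longrightarrow> k \<le> K \<Longrightarrow> f (k - 1) + f k = g (k - 2) + g (k + 1)"
    and k: "a - 1 \<le> k" "k \<le> K"
  shows "qc (\<Sum>s\<in>{a..k}. f s) x (minor a k)"
  using k
proof (induction "nat (k - a + 1)" arbitrary: k rule: less_induct)
  case less
  have S: "(\<Sum>s\<in>{a..k}. f s) = (\<Sum>s\<in>{a..k - 1}. f s) + f k" if "a \<le> k" for k
  proof -
    have "{a..k} = insert k {a..k - 1}" using that by auto
    then show ?thesis by (simp add: add.commute)
  qed
  consider "k = a - 1" | "k = a" | "a < k" using less.prems by linarith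
  then show ?case
  proof cases
    case 1
    then show ?thesis using qc_one by simp
  next
    case 2
    then show ?thesis using y[of a] less.prems by simp
  next
    case 3
    have 1: "qc (\<Sum>s\<in>{a..k}. f s) x (minor a (k - 1) * yd k)" "qc (\<Sum>s\<in>{a..k}. f s) x (yd k * minor a (k - 1))"
    proof -
      have "qc (\<Sum>s\<in>{a..k - 1}. f s) x (minor a (k - 1))" using less.prems 3 by (intro less.hyps) auto
      moreover have "qc (f k) x (yd k)" using y 3 less.prems by simp
      ultimately show "qc (\<Sum>s\<in>{a..k}. f s) x (minor a (k - 1) * yd k)" "qc (\<Sum>s\<in>{a..k}. f s) x (yd k * minor a (k - 1))"
        using S[of k] 3 qc_mult[of _ x "minor a (k - 1)"] qc_mult[of "f k" x "yd k"] by (fastforce simp: add.commute)+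
    qed
    have gk: "qc (g (k + 1)) x (zd (k + 1))" using z 3 less.prems by simp
    have 2: "\<exists>c. qc c x (PL a (k - 1)) \<and> qc c x (PR a (k - 1)) \<and> c + g (k + 1) = (\<Sum>s\<in>{a..k}. f s)"
    proof (cases "k - 1 = a")
      case True
      have "k - 2 = a - 1" using True by simp
      with True have "(\<Sum>s\<in>{a..k}. f s) = g (a - 1) + g (k + 1)"
        using S[of k] S[of "k - 1"] e2[of k] less.prems 3 by (simp add: \<open>k - 2 = a - 1\<close>)
      then show ?thesis using z[of "a - 1"] True less.prems by (auto simp: PL_def PR_def)
    next
      case False
      have p: "qc (f (k - 2) + g (k - 2)) x (pd (k - 2))"
        using 3 False less.prems y[of "k - 2"] z[of "k - 2"] z[of "k - 3"] z[of "k - 1"] e1[of "k - 2"]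
        by (intro qc_pd[where h = "g (k - 3)" and k = "g (k - 1)"]) simp_all
      have d: "qc (\<Sum>s\<in>{a..k - 3}. f s) x (minor a (k - 3))"
        using less.prems 3 False by (intro less.hyps) auto
      have "(\<Sum>s\<in>{a..k}. f s) = (\<Sum>s\<in>{a..k - 3}. f s) + (f (k - 2) + g (k - 2)) + g (k + 1)"
        using S[of k] S[of "k - 1"] S[of "k - 2"] e2[of k] less.prems 3 False by simp
      moreover have "PL a (k - 1) = minor a (k - 3) * pd (k - 2)" "PR a (k - 1) = pd (k - 2) * minor a (k - 3)"
        using False by (simp_all add: PL_def PR_def)
      ultimately show ?thesis using qc_mult[OF d p] qc_mult[OF p d] by (metis add.commute)
    qed
    then obtain c where c: "qc c x (PL a (k - 1))" "qc c x (PR a (k - 1))" "c + g (k + 1) = (\<Sum>s\<in>{a..k}. f s)" by blast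
    have "qc (\<Sum>s\<in>{a..k}. f s) x (PL a (k - 1) * zd (k + 1))" "qc (\<Sum>s\<in>{a..k}. f s) x (zd (k + 1) * PR a (k - 1))"
      using qc_mult[OF c(1) gk] qc_mult[OF gk c(2)] c(3) by (simp_all add: add.commute)
    then show ?thesis unfolding minor_rec[OF 3] using 1 by (auto intro!: qc_diff qc_vs)
  qed
qed

lemma sum_indicator: "(\<Sum>s\<in>{a..k}. if s = c then d else 0) = (if a \<le> c \<and> c \<le> k then d else (0 :: int))" for a :: int
  by simp

lemma yd_minor_far:
  assumes "1 \<le> a" "a - 1 \<le> k" "k \<le> t - 2" "t \<le> n"
  shows "qc (if a \<le> t - 3 \<and> t - 3 \<le> k then sg t else 0) (yd t) (minor a k)"
proof -
  have "qc (\<Sum>s\<in>{a..k}. yyexp t s) (yd t) (minor a k)"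
  proof (rule minor_qcommute[where K = "t - 2" and g = "yx t"])
    show "yyexp t s + yx t s = yx t (s - 1) + yx t (s + 1)" if "a \<le> s" "s \<le> t - 2 - 2" for s
      using that assms by (auto simp: yyexp_def yx_def yzexp_def)
    show "yyexp t (k - 1) + yyexp t k = yx t (k - 2) + yx t (k + 1)" if "a + 1 \<le> k" "k \<le> t - 2" for k
      using that assms by (auto simp: yyexp_def yx_def yzexp_def)
  qed (use assms in \<open>auto intro!: qc_yy qc_yz\<close>)
  also have "(\<Sum>s\<in>{a..k}. yyexp t s) = (\<Sum>s\<in>{a..k}. if s = t - 3 then sg t else 0)"
    using assms by (intro sum.cong) (auto simp: yyexp_def)
  finally show ?thesis by (simp add: sum_indicator)
qed

lemma zd_minor_far:
  assumes "1 \<le> a" "a - 1 \<le> k" "k \<le> t - 4" "t \<le> n + 1"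
  shows "qc 0 (zd t) (minor a k)"
proof -
  have "qc (\<Sum>s\<in>{a..k}. 0) (zd t) (minor a k)"
  proof (rule minor_qcommute[where K = k and g = "\<lambda>_. 0"])
    show "qc 0 (zd t) (yd s)" if "a \<le> s" "s \<le> k" for s
    proof -
      have "qc (yx s t) (yd s) (zd t)" using that assms by (intro qc_yz) auto
      moreover have "yx s t = 0" using that assms by (auto simp: yx_def yzexp_def)
      ultimately show ?thesis using qc_sym by fastforce
    qed
    show "qc 0 (zd t) (zd s)" if "a - 1 \<le> s" "s \<le> k + 1" for s
    proof -
      have "qc (zx t s) (zd t) (zd s)" using that assms by (intro qc_zz) auto
      moreover have "zx t s = 0" using that assms by (auto simp: zx_def zzexp_def)
      ultimately show ?thesis by simp
    qed
  qed (use assms in auto)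
  then show ?thesis by simp
qed

section \<open>The elements \<open>p\<^sub>i\<close>\<close>

lemma yd_zd_pd:
  assumes "i \<in> {1..n}"
  shows "yd i * zd i = pd i + vs (sg i) (zd (i - 1) * zd (i + 1))"
  using assms yd_zd_even[of i] by (cases "even i") (simp_all add: pd_def sg_def)

lemma qcD: "qc e x y \<Longrightarrow> x * y = vs e (y * x)" by (simp add: qc_def)

lemma qcD': "qc e x y \<Longrightarrow> x * (y * u) = vs e (y * (x * u))"
  unfolding qc_def by (metis mult.assoc vs_mult_left)

lemma qc_zd_pd_far:
  assumes "1 \<le> s" "s \<le> t - 3" "t \<le> n + 1"
  shows "qc 0 (zd t) (pd s)"
proof -
  have z: "qc 0 (zd t) (zd r)" if "0 \<le> r" "r \<le> t - 2" for r
  proof -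
    have "qc (zx t r) (zd t) (zd r)" using that assms by (intro qc_zz) auto
    moreover have "zx t r = 0" using that assms by (auto simp: zx_def zzexp_def)
    ultimately show ?thesis by simp
  qed
  have "qc (yx s t) (yd s) (zd t)" using assms by (intro qc_yz) auto
  moreover have "yx s t = 0" using assms by (auto simp: yx_def yzexp_def)
  ultimately have y: "qc 0 (zd t) (yd s)" using qc_sym by fastforce
  have "qc (0 + 0) (zd t) (pd s)"
    by (rule qc_pd[OF y z z z]) (use assms in auto)
  then show ?thesis by simp
qed

text \<open>
  For \<open>s = r\<close> the defect of commutation of \<open>y\<^sub>r\<close> and \<open>z\<^sub>r\<close> is compensated by that of \<open>z\<^sub>r\<^sub>-\<^sub>1 z\<^sub>r\<^sub>+\<^sub>1\<close>; in all
  other cases each factor \<open>q\<close>-commutes on its own.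
\<close>

lemma pd_zd:
  assumes r: "2 \<le> r" "r \<le> n - 1" and s: "0 \<le> s" "s \<le> r"
  shows "qc (if s = r - 2 \<and> 1 \<le> s then sg r else 0) (pd r) (zd s)"
proof (cases "s = r")
  case True
  have q: "qc (zx r (r - 1)) (zd r) (zd (r - 1))" "qc (zx r (r + 1)) (zd r) (zd (r + 1))"
    using r by (auto intro!: qc_zz)
  have e: "zx r (r - 1) = - sg r" "zx r (r + 1) = - sg r" using r by (auto simp: zx_def zzexp_def)
  have k: "kap r = 0" using r by (simp add: kap_def)
  define A B Z Y where "A = zd (r - 1)" and "B = zd (r + 1)" and "Z = zd r" and "Y = yd r"
  have qd: "Z * A = vs (- sg r) (A * Z)" "Z * B = vs (- sg r) (B * Z)"
    using q by (simp_all add: qc_def e A_def B_def Z_def)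
  have qd': "Z * (A * u) = vs (- sg r) (A * (Z * u))" "Z * (B * u) = vs (- sg r) (B * (Z * u))" for u
    by (simp_all add: mult.assoc[symmetric] qd)
  have pd: "pd r = (if odd r then Y * Z else Z * Y) - vs (-1) (A * B)"
    by (simp add: pd_def A_def B_def Z_def Y_def)
  have "pd r * Z = Z * pd r"
  proof (cases "even r")
    case True
    then have s1: "sg r = 1" by (simp add: sg_def)
    have y: "Y * Z = Z * Y + vs 1 (A * B) - vs (-1) (A * B)"
      using yd_zd_even[of r] r True by (simp add: A_def B_def Z_def Y_def)
    show ?thesis using True by (simp add: pd algebra_simps y qd qd' s1)
  next
    case False
    then have s1: "sg r = -1" by (simp add: sg_def)
    have y: "Z * Y = Y * Z + vs 1 (A * B) - vs (-1) (A * B)"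
      using zd_yd_odd[of r] r False k by (simp add: A_def B_def Z_def Y_def)
    have y': "Z * (Y * u) = Y * (Z * u) + vs 1 (A * (B * u)) - vs (-1) (A * (B * u))" for u
      by (simp add: mult.assoc[symmetric] y distrib_right left_diff_distrib)
    show ?thesis using False by (simp add: pd algebra_simps y' qd qd' s1)
  qed
  then have "pd r * zd r = zd r * pd r" by (simp add: Z_def)
  then show ?thesis using True by (simp add: qc_def)
next
  case False
  have y: "qc (yx r s) (yd r) (zd s)" using r s False by (intro qc_yz) auto
  have z: "qc (zx r s) (zd r) (zd s)" "qc (zx (r - 1) s) (zd (r - 1)) (zd s)" "qc (zx (r + 1) s) (zd (r + 1)) (zd s)"
    using r s by (auto intro!: qc_zz)
  have e: "(- yx r s) + (- zx r s) = (- zx (r - 1) s) + (- zx (r + 1) s)"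
    using r s False by (auto simp: yx_def yzexp_def zx_def zzexp_def sg_def)
  have "qc ((- yx r s) + (- zx r s)) (zd s) (pd r)"
    by (rule qc_pd[OF qc_sym[OF y] qc_sym[OF z(1)] qc_sym[OF z(2)] qc_sym[OF z(3)] e])
  from qc_sym[OF this] have "qc (yx r s + zx r s) (pd r) (zd s)" by (simp add: algebra_simps)
  moreover have "yx r s + zx r s = (if s = r - 2 \<and> 1 \<le> s then sg r else 0)"
    using r s False by (auto simp: yx_def yzexp_def zx_def zzexp_def)
  ultimately show ?thesis by simp
qed

text \<open>
  The exponents for \<open>p\<^sub>r\<close> past \<open>y\<^sub>s\<close> with \<open>s < r\<close>, and below their sum over \<open>a \<le> s < r\<close>.
\<close>

definition pyexp :: "int \<Rightarrow> int \<Rightarrow> int" where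
  "pyexp r s = (if s = r - 1 then sg r + (if r = 2 then -1 else 0) else if s = r - 2 then - sg r
     else if s = r - 3 then sg r else 0)"

text \<open>
  For \<open>s = r - 1\<close> the correction terms of \<open>y\<^sub>r y\<^sub>r\<^sub>-\<^sub>1\<close> and \<open>z\<^sub>r\<^sub>-\<^sub>1 y\<^sub>r\<^sub>-\<^sub>1\<close> are both multiples of
  \<open>z\<^sub>r\<^sub>-\<^sub>2 z\<^sub>r z\<^sub>r\<^sub>+\<^sub>1\<close> and cancel.
\<close>

lemma pd_yd:
  assumes r: "2 \<le> r" "r \<le> n - 1" and s: "1 \<le> s" "s < r"
  shows "qc (pyexp r s) (pd r) (yd s)"
proof (cases "s = r - 1")
  case True
  have x1: "qc (yx s r) (yd s) (zd r)" "qc (yx s (r + 1)) (yd s) (zd (r + 1))" using r s True by (auto intro!: qc_yz)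
  have x2: "yx s r = - sg r" "yx s (r + 1) = - sg r" using r s True by (auto simp: yx_def yzexp_def sg_def)
  have q0: "zd r * zd (r + 1) = vs (- sg r) (zd (r + 1) * zd r)"
    "zd (r - 1 - 1) * zd (r + 1) = zd (r + 1) * zd (r - 1 - 1)" "zd (r - 1 - 1) * zd r = zd r * zd (r - 1 - 1)"
  proof -
    have "zx r (r + 1) = - sg r" "zx (r - 1 - 1) (r + 1) = 0" "zx (r - 1 - 1) r = 0"
      using r by (auto simp: zx_def zzexp_def)
    moreover have "qc (zx r (r + 1)) (zd r) (zd (r + 1))" "qc (zx (r - 1 - 1) (r + 1)) (zd (r - 1 - 1)) (zd (r + 1))"
      "qc (zx (r - 1 - 1) r) (zd (r - 1 - 1)) (zd r)" using r by (auto intro!: qc_zz)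
    ultimately show "zd r * zd (r + 1) = vs (- sg r) (zd (r + 1) * zd r)"
      "zd (r - 1 - 1) * zd (r + 1) = zd (r + 1) * zd (r - 1 - 1)" "zd (r - 1 - 1) * zd r = zd r * zd (r - 1 - 1)"
      by (simp_all add: qc_def)
  qed
  define S A B C Z Y where "S = yd s" and "A = zd (r - 1 - 1)" and "B = zd (r + 1)"
    and "C = zd (r - 1)" and "Z = zd r" and "Y = yd r"
  note defs = S_def A_def B_def C_def Z_def Y_def
  have zS: "Z * S = vs (sg r) (S * Z)" "B * S = vs (sg r) (S * B)"
    using qcD[OF qc_sym[OF x1(1)]] qcD[OF qc_sym[OF x1(2)]] by (simp_all add: x2 defs)
  have zS': "Z * (S * u) = vs (sg r) (S * (Z * u))" "B * (S * u) = vs (sg r) (S * (B * u))" for u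
    by (simp_all add: mult.assoc[symmetric] zS)
  note q1 = q0[folded defs]
  have q1': "A * (B * u) = B * (A * u)" "A * (Z * u) = Z * (A * u)" "Z * (B * u) = vs (- sg r) (B * (Z * u))" for u
    by (simp_all add: mult.assoc[symmetric] q1)
  have mm: "min (r - 1) r = r - 1" "max (r - 1) r = r" "min r (r - 1) = r - 1" "max r (r - 1) = r" by auto
  have pd: "pd r = (if odd r then Y * Z else Z * Y) - vs (-1) (C * B)" by (simp add: pd_def defs)
  show ?thesis
  proof (cases "even r")
    case e: True
    have s1: "sg r = 1" using e by (simp add: sg_def)
    define k where "k = kap (r - 1)"
    have "yd r * yd (r - 1) = vs k (yd (r - 1) * yd r + vs 1 (zd (r - 1 - 1) * zd (r + 1)) - vs (-1) (zd (r - 1 - 1) * zd (r + 1)))"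
      using yd_yd_adjacent[of "r - 1" r] r s True e unfolding mm k_def by simp
    then have yS: "Y * S = vs k (S * Y + vs 1 (A * B) - vs (-1) (A * B))" using True by (simp only: defs)
    have "zd (r - 1) * yd (r - 1) = vs k (yd (r - 1) * zd (r - 1) + vs 1 (zd (r - 1 - 1) * zd (r - 1 + 1)) - vs (-1) (zd (r - 1 - 1) * zd (r - 1 + 1)))"
      using zd_yd_odd[of "r - 1"] r s True e unfolding k_def by simp
    moreover have "r - 1 + 1 = r" by simp
    ultimately have zz: "C * S = vs k (S * C + vs 1 (A * Z) - vs (-1) (A * Z))" using True by (simp only: defs)
    have zz': "C * (S * u) = vs k (S * (C * u) + vs 1 (A * (Z * u)) - vs (-1) (A * (Z * u)))" for u
      by (simp add: mult.assoc[symmetric] zz distrib_right left_diff_distrib)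
    have "pd r * S = vs (1 + k) (S * pd r)"
      using e by (simp add: pd algebra_simps yS zS zz zz' zS' s1 q1 q1')
    moreover have "1 + k = pyexp r s" using r s True s1 by (auto simp: pyexp_def k_def kap_def)
    ultimately show ?thesis by (simp add: qc_def S_def)
  next
    case o: False
    have s1: "sg r = -1" using o by (simp add: sg_def)
    have k: "kap r = 0" using r by (simp add: kap_def)
    have "yd (r - 1) * yd r = yd r * yd (r - 1) + vs 1 (zd (r - 1 - 1) * zd (r + 1)) - vs (-1) (zd (r - 1 - 1) * zd (r + 1))"
      using yd_yd_adjacent[of r "r - 1"] r s True o k unfolding mm by simp
    then have "yd r * yd (r - 1) = yd (r - 1) * yd r - vs 1 (zd (r - 1 - 1) * zd (r + 1)) + vs (-1) (zd (r - 1 - 1) * zd (r + 1))"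
      by simp
    then have yS: "Y * S = S * Y - vs 1 (A * B) + vs (-1) (A * B)" using True by (simp only: defs)
    have yS': "Y * (S * u) = S * (Y * u) - vs 1 (A * (B * u)) + vs (-1) (A * (B * u))" for u
      by (simp add: mult.assoc[symmetric] yS distrib_right left_diff_distrib)
    have "yd (r - 1) * zd (r - 1) = zd (r - 1) * yd (r - 1) + vs 1 (zd (r - 1 - 1) * zd (r - 1 + 1)) - vs (-1) (zd (r - 1 - 1) * zd (r - 1 + 1))"
      using yd_zd_even[of "r - 1"] r s True o by simp
    moreover have "r - 1 + 1 = r" by simp
    ultimately have "S * C = C * S + vs 1 (A * Z) - vs (-1) (A * Z)" using True by (simp only: defs)
    then have zz: "C * S = S * C - vs 1 (A * Z) + vs (-1) (A * Z)" by simp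
    have zz': "C * (S * u) = S * (C * u) - vs 1 (A * (Z * u)) + vs (-1) (A * (Z * u))" for u
      by (simp add: mult.assoc[symmetric] zz distrib_right left_diff_distrib)
    have "pd r * S = vs (-1) (S * pd r)"
      using o by (simp add: pd algebra_simps yS yS' zS zz zz' zS' s1 q1 q1')
    moreover have "-1 = pyexp r s" using r s True s1 o by (auto simp: pyexp_def)
    ultimately show ?thesis by (simp add: qc_def S_def)
  qed
next
  case False
  have y: "qc (yyexp s r) (yd s) (yd r)" using r s False by (intro qc_yy) auto
  have z: "qc (yx s r) (yd s) (zd r)" "qc (yx s (r - 1)) (yd s) (zd (r - 1))" "qc (yx s (r + 1)) (yd s) (zd (r + 1))"
    using r s False by (auto intro!: qc_yz)
  have e: "yyexp s r + yx s r = yx s (r - 1) + yx s (r + 1)"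
    using r s False by (auto simp: yx_def yzexp_def yyexp_def)
  have "qc (- (yyexp s r + yx s r)) (pd r) (yd s)"
    by (rule qc_sym[OF qc_pd[OF y z e]])
  moreover have "- (yyexp s r + yx s r) = pyexp r s"
    using r s False by (auto simp: yx_def yzexp_def yyexp_def pyexp_def sg_def)
  ultimately show ?thesis by simp
qed

definition piexp :: "int \<Rightarrow> int \<Rightarrow> int" where
  "piexp a r = sg r * (1 - (if a \<le> r - 2 then 1 else 0) + (if a \<le> r - 3 then 1 else 0)) + (if r = 2 then -1 else 0)"

lemma pd_minor:
  assumes "1 \<le> a" "a < r" "r \<le> n - 1"
  shows "qc (piexp a r) (pd r) (minor a (r - 1))"
proof -
  have "qc (\<Sum>s\<in>{a..r - 1}. pyexp r s) (pd r) (minor a (r - 1))"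
  proof (rule minor_qcommute[where K = "r - 1" and g = "\<lambda>s. if s = r - 2 \<and> 1 \<le> s then sg r else 0"])
    show "pyexp r s + (if s = r - 2 \<and> 1 \<le> s then sg r else 0)
        = (if s - 1 = r - 2 \<and> 1 \<le> s - 1 then sg r else 0) + (if s + 1 = r - 2 \<and> 1 \<le> s + 1 then sg r else 0)"
      if "a \<le> s" "s \<le> r - 1 - 2" for s
      using that assms by (auto simp: pyexp_def)
    show "pyexp r (k - 1) + pyexp r k
        = (if k - 2 = r - 2 \<and> 1 \<le> k - 2 then sg r else 0) + (if k + 1 = r - 2 \<and> 1 \<le> k + 1 then sg r else 0)"
      if "a + 1 \<le> k" "k \<le> r - 1" for k
      using that assms by (auto simp: pyexp_def)
    show "qc (if s = r - 2 \<and> 1 \<le> s then sg r else 0) (pd r) (zd s)" if "a - 1 \<le> s" "s \<le> r - 1 + 1" for s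
      by (rule pd_zd) (use that assms in auto)
  qed (use assms in \<open>auto intro!: pd_yd\<close>)
  also have "(\<Sum>s\<in>{a..r - 1}. pyexp r s) = (\<Sum>s\<in>{a..r - 1}. (if s = r - 1 then sg r + (if r = 2 then -1 else 0) else 0)
      + (if s = r - 2 then - sg r else 0) + (if s = r - 3 then sg r else 0))"
    by (intro sum.cong) (auto simp: pyexp_def)
  also have "\<dots> = piexp a r"
    unfolding sum.distrib sum_indicator using assms by (auto simp: piexp_def)
  finally show ?thesis .
qed

definition pip :: "int \<Rightarrow> int \<Rightarrow> int" where "pip a j = (if a + 3 \<le> j then piexp a (j - 2) else 0)"

lemma PR_PL:
  assumes "1 \<le> a" "a < j" "j \<le> n"
  shows "zd (j + 1) * PR a (j - 1) = vs (pip a j) (PL a (j - 1) * zd (j + 1))"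
proof -
  consider "j = a + 1" | "j = a + 2" | "a + 3 \<le> j" using assms by linarith
  then show ?thesis
  proof cases
    case 1
    have "qc (zx (j + 1) (a - 1)) (zd (j + 1)) (zd (a - 1))" using assms 1 by (intro qc_zz) auto
    moreover have "zx (j + 1) (a - 1) = 0" using 1 by (auto simp: zx_def zzexp_def)
    ultimately show ?thesis using 1 by (simp add: PR_def PL_def pip_def qc_def)
  next
    case 2
    have "qc 0 (zd (j + 1)) (pd a)" using assms 2 by (intro qc_zd_pd_far) auto
    moreover have "j - 1 - 2 = a - 1" "j - 1 - 1 = a" using 2 by auto
    ultimately show ?thesis using 2 by (simp add: PR_def PL_def pip_def qc_def)
  next
    case 3
    have e: "j - 1 - 2 = j - 3" "j - 1 - 1 = j - 2" by auto
    have z1: "qc 0 (zd (j + 1)) (pd (j - 2))" using assms 3 by (intro qc_zd_pd_far) auto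
    have z2: "qc 0 (zd (j + 1)) (minor a (j - 3))" using assms 3 by (intro zd_minor_far) auto
    have "j - 2 - 1 = j - 3" by simp
    then have p: "qc (piexp a (j - 2)) (pd (j - 2)) (minor a (j - 3))" using pd_minor[of a "j - 2"] assms 3 by simp
    have "zd (j + 1) * (pd (j - 2) * minor a (j - 3)) = pd (j - 2) * minor a (j - 3) * zd (j + 1)"
      using qcD'[OF z1, of "minor a (j - 3)"] qcD[OF z2] by (simp add: mult.assoc)
    then show ?thesis using 3 qcD[OF p] by (simp add: PR_def PL_def pip_def e mult.assoc)
  qed
qed

section \<open>Recursion, exchange and commutation identities\<close>

text \<open>
  Closed forms of the exponents of \<open>v\<close> in the identities for minors: \<open>alx\<close> and \<open>bex\<close> in the recursion with
  \<open>y\<^sub>j\<close> on the right, \<open>cx\<close> and \<open>tx\<close> in the commutation of \<open>y\<^sub>k\<close> with \<open>\<Delta>\<^sub>a\<^sub>,\<^sub>k\<^sub>-\<^sub>1\<close>. They come from pairings of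
  degrees, which are evaluated here so that comparing exponents is a case distinction.
\<close>

definition alx :: "int \<Rightarrow> int \<Rightarrow> int" where
  "alx a j = (if even j \<or> j \<le> a then 0 else (if j = n then 1 else 0) - (if a + 3 \<le> j then 1 else 0))"

definition bex :: "int \<Rightarrow> int \<Rightarrow> int" where
  "bex a j = (if even j then Aexp a j else 1 - (if a + 3 \<le> j then 1 else 0) - (if a + 5 \<le> j then 1 else 0))"

definition cx :: "int \<Rightarrow> int \<Rightarrow> int" where
  "cx a k = (if a + 3 \<le> k then sg k else 0) + (if odd k then (if k = n then 1 else 0) else (if k = 2 then -1 else 0))"

definition tx :: "int \<Rightarrow> int \<Rightarrow> int" where
  "tx a k = (if a + 3 \<le> k then sg k else 0) + alx a (k - 1) + alx a (k - 2) + (if k = 2 then -1 else 0)"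

definition left_rec :: "int \<Rightarrow> int \<Rightarrow> bool" where
  "left_rec a j \<longleftrightarrow> minor a j = vs (alx a j) (minor a (j - 1) * yd j) - vs (bex a j) (PL a (j - 1) * zd (j + 1))"

definition exch :: "int \<Rightarrow> int \<Rightarrow> bool" where
  "exch a j \<longleftrightarrow> minor a j * zd j = vs (alx a j) (PL a (j + 1)) + vs (sg j + alx a j + alx a (j - 1)) (PL a j * zd (j + 1))"

definition commutation :: "int \<Rightarrow> int \<Rightarrow> bool" where
  "commutation a k \<longleftrightarrow> yd k * minor a (k - 1) = vs (cx a k) (minor a (k - 1) * yd k)
     + vs (tx a k + sg k) (PL a (k - 1) * zd (k + 1)) - vs (tx a k - sg k) (PL a (k - 1) * zd (k + 1))"

lemma PL_Suc: "a \<le> j \<Longrightarrow> PL a (j + 1) = minor a (j - 1) * pd j"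
proof -
  assume "a \<le> j"
  then have "j + 1 \<noteq> a" "j + 1 - 2 = j - 1" "j + 1 - 1 = j" by auto
  then show ?thesis unfolding PL_def by (simp only: if_False)
qed

lemma exch_base:
  assumes "a \<in> {1..n}" shows "exch a a"
  using yd_zd_pd[OF assms] PL_Suc[of a a] by (simp add: exch_def alx_def PL_def)

lemma exch_step:
  assumes a: "1 \<le> a" "a < j" "j \<le> n" and L: "left_rec a j" and b: "exch a (j - 1)"
  shows "exch a j"
proof -
  have 1: "zd (j + 1) * zd j = vs (if j = n then 0 else sg j) (zd j * zd (j + 1))"
  proof -
    have "qc (zx (j + 1) j) (zd (j + 1)) (zd j)" using a by (intro qc_zz) auto
    moreover have "zx (j + 1) j = (if j = n then 0 else sg j)" using a by (auto simp: zx_def zzexp_def sg_def)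
    ultimately show ?thesis by (simp add: qc_def)
  qed
  have e: "alx a j + sg j + (sg (j - 1) + alx a (j - 1) + alx a (j - 1 - 1)) = bex a j + (if j = n then 0 else sg j)"
  proof (cases "even j")
    case True
    then have "j \<noteq> n" using n_odd by auto
    with True show ?thesis using a n_odd by (auto simp: alx_def bex_def Aexp_def sg_def)
  next
    case False
    then show ?thesis using a by (auto simp: alx_def bex_def sg_def)
  qed
  have b': "minor a (j - 1) * zd (j - 1) = vs (alx a (j - 1)) (PL a j) + vs (sg (j - 1) + alx a (j - 1) + alx a (j - 1 - 1)) (PL a (j - 1) * zd j)"
    using b unfolding exch_def by simp
  from exchange_step[OF L[unfolded left_rec_def] yd_zd_pd b' 1 e] a
  show ?thesis using PL_Suc[of a j] by (simp add: exch_def add.commute add.left_commute)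
qed

lemma commutation_base:
  assumes a: "1 \<le> a" "a + 1 \<le> n"
  shows "commutation a (a + 1)"
proof -
  have mm: "min a (a + 1) = a" "max a (a + 1) = a + 1" "min (a + 1) a = a" "max (a + 1) a = a + 1" by auto
  have P: "PL a (a + 1 - 1) = zd (a - 1)" by (simp add: PL_def)
  have w: "minor a (a + 1 - 1) = yd a" by simp
  show ?thesis
  proof (cases "even a")
    case True
    have "yd a * yd (a + 1) = vs (kap (a + 1)) (yd (a + 1) * yd a + vs 1 (zd (a - 1) * zd (a + 1 + 1)) - vs (-1) (zd (a - 1) * zd (a + 1 + 1)))"
      using yd_yd_adjacent[of "a + 1" a] a True unfolding mm by simp
    then have "yd (a + 1) * yd a = vs (- kap (a + 1)) (yd a * yd (a + 1)) - vs 1 (zd (a - 1) * zd (a + 1 + 1)) + vs (-1) (zd (a - 1) * zd (a + 1 + 1))"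
      by simp
    moreover have "cx a (a + 1) = - kap (a + 1)" "tx a (a + 1) = 0" "sg (a + 1) = -1"
      using True a by (auto simp: cx_def kap_def tx_def alx_def sg_def)
    ultimately show ?thesis unfolding commutation_def P w by simp
  next
    case False
    have "yd (a + 1) * yd a = vs (kap a) (yd a * yd (a + 1) + vs 1 (zd (a - 1) * zd (a + 1 + 1)) - vs (-1) (zd (a - 1) * zd (a + 1 + 1)))"
      using yd_yd_adjacent[of a "a + 1"] a False unfolding mm by simp
    moreover have "cx a (a + 1) = kap a" "tx a (a + 1) = kap a" "sg (a + 1) = 1"
      using False a by (auto simp: cx_def kap_def tx_def alx_def sg_def)
    ultimately show ?thesis unfolding commutation_def P w by simp
  qed
qed

lemma commutation_step:
  assumes a: "1 \<le> a" "a + 2 \<le> k" "k \<le> n" and L: "left_rec a (k - 1)" and b: "exch a (k - 2)"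
  shows "commutation a k"
proof -
  have mm: "min (k - 1) k = k - 1" "max (k - 1) k = k" "min k (k - 1) = k - 1" "max k (k - 1) = k" by auto
  define f where "f = (if a + 3 \<le> k then sg k else 0)"
  define c where "c = (if odd k \<and> k = n then 1 else 0 :: int)"
  have Q: "qc f (yd k) (minor a (k - 2))"
  proof -
    have "(if a \<le> k - 3 \<and> k - 3 \<le> k - 2 then sg k else 0) = f" by (auto simp: f_def)
    then show ?thesis using yd_minor_far[of a "k - 2" k] a by simp
  qed
  have P: "qc f (yd k) (PL a (k - 2))"
  proof (cases "k = a + 2")
    case True
    have "qc (yx k (a - 1)) (yd k) (zd (a - 1))" using a True by (intro qc_yz) auto
    moreover have "yx k (a - 1) = f" using True by (auto simp: yx_def yzexp_def f_def)
    ultimately show ?thesis using True by (simp add: PL_def)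
  next
    case False
    have e: "k - 2 - 2 = k - 4" "k - 2 - 1 = k - 3" by auto
    have 1: "qc 0 (yd k) (minor a (k - 4))"
      using yd_minor_far[of a "k - 4" k] a False by simp
    have y: "qc (yyexp k (k - 3)) (yd k) (yd (k - 3))" using a False by (intro qc_yy) auto
    have z: "qc (yx k (k - 3)) (yd k) (zd (k - 3))" "qc (yx k (k - 3 - 1)) (yd k) (zd (k - 3 - 1))" "qc (yx k (k - 3 + 1)) (yd k) (zd (k - 3 + 1))"
      using a False by (auto intro!: qc_yz)
    have e2: "yyexp k (k - 3) + yx k (k - 3) = yx k (k - 3 - 1) + yx k (k - 3 + 1)"
      using a False by (auto simp: yyexp_def yx_def yzexp_def)
    have "qc (yyexp k (k - 3) + yx k (k - 3)) (yd k) (pd (k - 3))" by (rule qc_pd[OF y z e2])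
    moreover have "yyexp k (k - 3) + yx k (k - 3) = f" using a False by (auto simp: yyexp_def yx_def yzexp_def f_def)
    ultimately have "qc (0 + f) (yd k) (minor a (k - 4) * pd (k - 3))" using qc_mult[OF 1] by simp
    then show ?thesis using False by (simp add: PL_def e)
  qed
  have y: "yd k * yd (k - 1) = vs c (yd (k - 1) * yd k) + vs (sg k) (zd (k - 2) * zd (k + 1)) - vs (- sg k) (zd (k - 2) * zd (k + 1))"
  proof (cases "even k")
    case True
    have "k - 1 - 1 = k - 2" "kap (k - 1) = 0" "odd (k - 1)" using a True n_odd by (auto simp: kap_def)
    then show ?thesis using yd_yd_adjacent[of "k - 1" k] a True by (simp add: mm sg_def c_def)
  next
    case False
    have e: "k - 1 - 1 = k - 2" by simp
    have "yd (k - 1) * yd k = vs (- c) (yd k * yd (k - 1) + vs 1 (zd (k - 2) * zd (k + 1)) - vs (-1) (zd (k - 2) * zd (k + 1)))"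
      using yd_yd_adjacent[of k "k - 1"] a False by (simp add: mm e kap_def c_def)
    then have "vs c (yd (k - 1) * yd k) = yd k * yd (k - 1) + vs 1 (zd (k - 2) * zd (k + 1)) - vs (-1) (zd (k - 2) * zd (k + 1))"
      by (simp only: vs_vs) simp
    then show ?thesis using False by (simp add: sg_def)
  qed
  have z: "yd k * zd k = vs c (zd k * yd k) + vs (sg k) (zd (k - 1) * zd (k + 1)) - vs (- sg k) (zd (k - 1) * zd (k + 1))"
  proof (cases "even k")
    case True
    then show ?thesis using yd_zd_even[of k] a by (simp add: sg_def c_def)
  next
    case False
    have "zd k * yd k = vs (- c) (yd k * zd k + vs 1 (zd (k - 1) * zd (k + 1)) - vs (-1) (zd (k - 1) * zd (k + 1)))"
      using zd_yd_odd[of k] a False by (simp add: kap_def c_def)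
    then have "vs c (zd k * yd k) = yd k * zd k + vs 1 (zd (k - 1) * zd (k + 1)) - vs (-1) (zd (k - 1) * zd (k + 1))"
      by (simp only: vs_vs) simp
    then show ?thesis using False by (simp add: sg_def)
  qed
  have b': "minor a (k - 2) * zd (k - 2) = vs (alx a (k - 2)) (PL a (k - 1)) + vs (sg (k - 2) + alx a (k - 2) + alx a (k - 2 - 1)) (PL a (k - 2) * zd (k - 1))"
  proof -
    have "k - 2 + 1 = k - 1" by simp
    then show ?thesis using b unfolding exch_def by (simp only:)
  qed
  have L': "minor a (k - 1) = vs (alx a (k - 1)) (minor a (k - 2) * yd (k - 1)) - vs (bex a (k - 1)) (PL a (k - 2) * zd k)"
  proof -
    have "k - 1 - 1 = k - 2" "k - 1 + 1 = k" by simp_all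
    then show ?thesis using L unfolding left_rec_def by (simp only:)
  qed
  have e: "alx a (k - 1) + (sg (k - 2) + alx a (k - 2) + alx a (k - 2 - 1)) = bex a (k - 1)"
    using a by (auto simp: alx_def bex_def Aexp_def sg_def)
  have "yd k * minor a (k - 1) = vs (f + c) (minor a (k - 1) * yd k)
      + vs (f + alx a (k - 1) + alx a (k - 2) + sg k) (PL a (k - 1) * zd (k + 1))
      - vs (f + alx a (k - 1) + alx a (k - 2) + - sg k) (PL a (k - 1) * zd (k + 1))"
    by (rule straighten_step[OF L' Q P y z b' e])
  moreover have "f + c = cx a k" "f + alx a (k - 1) + alx a (k - 2) = tx a k"
    using a by (auto simp: f_def c_def cx_def tx_def)
  ultimately show ?thesis by (simp add: commutation_def)
qed

lemma left_rec_from_commutation: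
  assumes a: "1 \<le> a" "a < j" "j \<le> n" and c: "commutation a j"
  shows "left_rec a j"
proof (cases "even j")
  case True
  then show ?thesis using minor_rec[OF a(2)] by (simp add: left_rec_def alx_def bex_def)
next
  case False
  then have minor: "minor a j = yd j * minor a (j - 1) - vs (Aexp a j) (zd (j + 1) * PR a (j - 1))"
    using minor_rec[OF a(2)] by simp
  have e: "Aexp a j + pip a j = tx a j - 1" "bex a j = tx a j + 1" "cx a j = alx a j" "sg j = -1"
    using False a by (auto simp: Aexp_def pip_def piexp_def tx_def alx_def bex_def cx_def sg_def)
  show ?thesis
    unfolding left_rec_def minor PR_PL[OF a] using c[unfolded commutation_def] by (simp add: e)
qed

text \<open>
  The order of the induction: the commutation for \<open>j\<close> needs the recursion for \<open>j - 1\<close> and the exchange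
  identity for \<open>j - 2\<close>; the recursion for \<open>j\<close> needs the commutation for \<open>j\<close>; the exchange identity for
  \<open>j\<close> needs the recursion for \<open>j\<close> and the exchange identity for \<open>j - 1\<close>.
\<close>

lemma minor_identities:
  assumes a: "1 \<le> a" and j: "a \<le> j" "j \<le> n"
  shows "exch a j" "a < j \<Longrightarrow> left_rec a j" "a < j \<Longrightarrow> commutation a j"
proof -
  have "exch a j \<and> (a < j \<longrightarrow> left_rec a j \<and> commutation a j)"
    using j
  proof (induction "nat (j - a)" arbitrary: j rule: less_induct)
    case less
    show ?case
    proof (cases "j = a")
      case True
      then show ?thesis using exch_base[of a] a less.prems by simp
    next
      case False
      then have aj: "a < j" using less.prems by simp
      have c: "commutation a j"
      proof (cases "j = a + 1")
        case True
        then show ?thesis using commutation_base[of a] a less.prems by simp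
      next
        case False
        then show ?thesis using less.hyps[of "j - 1"] less.hyps[of "j - 2"] aj less.prems a
          by (intro commutation_step) auto
      qed
      have L: "left_rec a j" by (rule left_rec_from_commutation[OF a aj less.prems(2) c])
      have "exch a j"
        by (rule exch_step[OF a aj less.prems(2) L]) (use less.hyps[of "j - 1"] aj less.prems in auto)
      then show ?thesis using c L by simp
    qed
  qed
  then show "exch a j" "a < j \<Longrightarrow> left_rec a j" "a < j \<Longrightarrow> commutation a j" by blast+
qed

definition arx :: "int \<Rightarrow> int \<Rightarrow> int" where "arx a j = (if even j then - cx a j else 0)"
definition brx :: "int \<Rightarrow> int \<Rightarrow> int" where "brx a j = (if even j then Aexp a j + 2 - pip a j else Aexp a j)"

lemma right_rec:
  assumes a: "1 \<le> a" "a < j" "j \<le> n"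
  shows "minor a j = vs (arx a j) (yd j * minor a (j - 1)) - vs (brx a j) (zd (j + 1) * PR a (j - 1))"
proof (cases "even j")
  case True
  have minor: "minor a j = minor a (j - 1) * yd j - vs (Aexp a j) (PL a (j - 1) * zd (j + 1))"
    using minor_rec[OF a(2)] True by simp
  have c: "yd j * minor a (j - 1) = vs (cx a j) (minor a (j - 1) * yd j)
     + vs (tx a j + sg j) (PL a (j - 1) * zd (j + 1)) - vs (tx a j - sg j) (PL a (j - 1) * zd (j + 1))"
    using minor_identities(3)[of a j] a by (simp add: commutation_def)
  have e: "tx a j = cx a j + Aexp a j + 1" "sg j = 1"
    using True a n_odd by (auto simp: Aexp_def tx_def alx_def cx_def sg_def)
  show ?thesis unfolding minor PR_PL[OF a] c using True by (simp add: arx_def brx_def e add.commute)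
next
  case False
  then show ?thesis using minor_rec[OF a(2)] by (simp add: arx_def brx_def)
qed

end

section \<open>The antiautomorphism\<close>

lemma height_rint: "a \<le> b \<Longrightarrow> height (rint a b) = b - a + 1"
proof (induction rule: fen_induct)
  case base
  then show ?case by (simp add: height_def simple_root_def)
next
  case (step b)
  then show ?case by (simp add: rint_step height_add) (simp add: height_def simple_root_def)
qed

lemma Nweight_rint: "a \<le> b \<Longrightarrow> Nweight (rint a b) = - (b - a)"
  by (simp add: Nweight_def height_rint rform_rint_ends)

locale sigma_setup = kashiwara T n D form
  for T :: "int \<Rightarrow> 'n uq \<Rightarrow> 'n uq" and n D form +
  fixes \<sigma> :: "'n uq \<Rightarrow> 'n uq"
  assumes sigma: "is_sigma \<sigma>"
begin

lemma sigma_simps: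
  assumes "x \<in> uplus" "y \<in> uplus"
  shows "\<sigma> 1 = 1" "\<sigma> (x + y) = \<sigma> x + \<sigma> y" "\<sigma> (x * y) = \<sigma> y * \<sigma> x" "\<sigma> x \<in> uplus"
    "\<sigma> (qvar *\<^sub>q 1) = inverse qvar *\<^sub>q 1"
  using sigma assms unfolding is_sigma_def by (auto dest: bij_betwE)

lemma sigma_gE: "i \<in> {1..n} \<Longrightarrow> \<sigma> (gE i) = gE i"
  using sigma n unfolding is_sigma_def by auto

lemma sigma_qvar: "x \<in> uplus \<Longrightarrow> \<sigma> (qvar *\<^sub>q x) = inverse qvar *\<^sub>q \<sigma> x"
  using sigma_simps(3)[OF uplus.scale[OF uplus.one], of x qvar] sigma_simps(5)[of x x] by simp

lemma sigma_vs:
  assumes x: "x \<in> uplus" shows "\<sigma> (vs a x) = vs (- a) (\<sigma> x)"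
proof -
  have up: "\<sigma> (vs (int k) x) = vs (- int k) (\<sigma> x)" if "x \<in> uplus" for k x
  proof (induction k)
    case (Suc k)
    have "vs (int (Suc k)) x = qvar *\<^sub>q vs (int k) x" by (simp add: vs_def power_int_add)
    then have "\<sigma> (vs (int (Suc k)) x) = inverse qvar *\<^sub>q vs (- int k) (\<sigma> x)"
      using sigma_qvar[OF uplus_vs[OF that]] Suc by simp
    also have "\<dots> = vs (-1) (vs (- int k) (\<sigma> x))" by (simp only: vs_def power_int_minus power_int_1_right)
    finally show ?case by (simp add: algebra_simps)
  qed simp
  show ?thesis
  proof (cases "a \<ge> 0")
    case True
    then show ?thesis using up[OF x, of "nat a"] by simp
  next
    case False
    have i: "int (nat (- a)) = - a" using False by simp
    have "\<sigma> (vs (int (nat (- a))) (vs a x)) = vs (- int (nat (- a))) (\<sigma> (vs a x))"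
      by (rule up[OF uplus_vs[OF x]])
    then have "\<sigma> x = vs a (\<sigma> (vs a x))" unfolding i by simp
    then show ?thesis by simp
  qed
qed

lemma sigma_diff: "x \<in> uplus \<Longrightarrow> y \<in> uplus \<Longrightarrow> \<sigma> (x - y) = \<sigma> x - \<sigma> y"
  using sigma_simps(2)[OF uplus_diff[of x y], of y] by simp

text \<open>
  As \<open>\<sigma>\<close> is only semilinear, the scalar \<open>1 / (1 - v\<^sup>-\<^sup>2)\<close> becomes \<open>1 / (1 - v\<^sup>2)\<close>.
\<close>

lemma sigma_cc:
  assumes x: "x \<in> uplus" shows "\<sigma> (cc *\<^sub>q x) = - vs (-2) (cc *\<^sub>q \<sigma> x)"
proof -
  define w where "w = cc *\<^sub>q x"
  have w: "w \<in> uplus" unfolding w_def by (rule uplus.scale[OF x])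
  have "w - vs (-2) w = x" unfolding vm2 w_def using one_minus_vm2 by (simp add: cc_def)
  then have "\<sigma> x = \<sigma> (w - vs (-2) w)" by simp
  also have "\<dots> = \<sigma> w - vs 2 (\<sigma> w)" unfolding sigma_diff[OF w uplus_vs[OF w]] sigma_vs[OF w] by simp
  finally have "\<sigma> x = \<sigma> w - vs 2 (\<sigma> w)" .
  then have "- vs (-2) (\<sigma> x) = \<sigma> w - vs (-2) (\<sigma> w)" by simp
  also have "\<dots> = (1 - qvar powi (-2)) *\<^sub>q \<sigma> w" by (rule vm2)
  finally have "cc *\<^sub>q (- vs (-2) (\<sigma> x)) = cc *\<^sub>q ((1 - qvar powi (-2)) *\<^sub>q \<sigma> w)" by (rule arg_cong)
  also have "\<dots> = \<sigma> w" unfolding uq.scale_scale using one_minus_vm2 by (simp add: cc_def)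
  finally show ?thesis by (simp add: w_def vs_qscale)
qed

lemma R_uplus: "1 \<le> a \<Longrightarrow> b \<le> n \<Longrightarrow> R a b \<in> uplus"
  using comp_uplus[OF R_comp] by blast

text \<open>
  Each bracket is reversed by \<open>\<sigma>\<close>, which costs a factor \<open>- v\<close> for the bracket and \<open>- v\<^sup>-\<^sup>2\<close> for its
  normalisation.
\<close>

lemma sigma_R:
  assumes "1 \<le> a" "a \<le> b" "b \<le> n"
  shows "\<sigma> (R a b) = vs (- (b - a)) (R a b)"
  using assms(2,3)
proof (induction rule: fen_induct)
  case base
  then show ?case using assms by (simp add: sigma_gE)
next
  case (step b)
  let ?E = "gE (b + 1) :: 'n uq"
  have E: "?E \<in> uplus" "\<sigma> ?E = ?E" using step assms by (auto intro!: gE_uplus sigma_gE)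
  have R: "R a b \<in> uplus" using assms step by (intro R_uplus) auto
  have IH: "\<sigma> (R a b) = vs (- (b - a)) (R a b)" using step by simp
  have q: "\<sigma> (qbr x y) = - vs 1 (vs k (qbr x y))"
    if "x \<in> uplus" "y \<in> uplus" "\<sigma> x * \<sigma> y = vs k (x * y)" "\<sigma> y * \<sigma> x = vs k (y * x)" for x y k
    using that by (simp add: qbr_def sigma_diff sigma_vs sigma_simps uplus.mult uplus_vs)
  have c: "\<sigma> ?E * \<sigma> (R a b) = vs (- (b - a)) (?E * R a b)" "\<sigma> (R a b) * \<sigma> ?E = vs (- (b - a)) (R a b * ?E)"
    unfolding E(2) IH by simp_all
  have s: "\<sigma> (cc *\<^sub>q Q) = vs (- (b + 1 - a)) (cc *\<^sub>q Q)"
    if "Q \<in> uplus" "\<sigma> Q = - vs 1 (vs (- (b - a)) Q)" for Q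
    unfolding sigma_cc[OF that(1)] that(2) by (simp add: vs_qscale algebra_simps)
  show ?case unfolding R_step[OF step(1)] cc_def[symmetric]
    using s[OF qbr_uplus[OF E(1) R] q[OF E(1) R c]] s[OF qbr_uplus[OF R E(1)] q[OF R E(1) c(2,1)]] by simp
qed

text \<open>
  The condition under \<open>\<sigma>\<close> that the dual canonical basis elements of degree \<open>\<gamma>\<close> satisfy.
\<close>

definition eig :: "root_lattice \<Rightarrow> 'n uq \<Rightarrow> bool" where
  "eig \<gamma> x \<longleftrightarrow> x \<in> uplus_comp \<gamma> \<and> \<sigma> x = vs (Nweight \<gamma>) x"

lemma eig_Rl: "l \<in> set (rlabels n) \<Longrightarrow> eig (rint (rlo l) (rhi l)) (Rl l)"
  using label_bounds[of l] Rl_comp[of l] by (simp add: eig_def Rl_def sigma_R Nweight_rint)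

lemma eig_yd: "i \<in> {1..n} \<Longrightarrow> eig (dy i) (yd i)"
  by (simp add: yd_def dy_def eig_Rl yz_labels)

lemma eig_one: "eig 0 1"
  using sigma_simps(1)[OF uplus.one uplus.one] comp_one by (simp add: eig_def)

lemma eig_zd: "i \<in> {0..n + 1} \<Longrightarrow> eig (dz i) (zd i)"
proof -
  assume "i \<in> {0..n + 1}"
  then consider "i \<in> {1..n}" | "i = 0" | "i = n + 1" by fastforce
  then show ?thesis by cases (use eig_one in \<open>auto simp: zd_def dz_def eig_Rl yz_labels\<close>)
qed

lemma sigma_eig_mult:
  assumes "eig \<gamma> x" "eig \<delta> y"
  shows "\<sigma> (x * y) = vs (Nweight (\<gamma> + \<delta>) - rform \<gamma> \<delta>) (y * x)"
proof -
  have u: "x \<in> uplus" "y \<in> uplus" using assms comp_uplus by (auto simp: eig_def)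
  have e: "\<sigma> x = vs (Nweight \<gamma>) x" "\<sigma> y = vs (Nweight \<delta>) y" using assms by (simp_all add: eig_def)
  show ?thesis unfolding sigma_simps(3)[OF u] e Nweight_add by (simp add: add.commute)
qed

lemma dy_dz:
  assumes i: "i \<in> {1..n}"
  shows "dy i + dz i = dz (i - 1) + dz (i + 1)"
proof (cases "even i")
  case True
  have r: "2 \<le> i" "i \<le> n - 1" "i - 1 \<in> {1..n}" "i + 1 \<in> {1..n}" "odd (i - 1)" "odd (i + 1)"
    using even_range[OF True i] True by auto
  define lo hi where "lo = (if i = 2 then 2 else i - 3)" and "hi = (if i = n - 1 then n - 1 else i + 3)"
  have "dz (i - 1) = rint lo (i + 1)"
    unfolding dz_W[OF r(5,3)] using r by (auto simp: lo_def intro!: arg_cong2[of _ _ _ _ rint])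
  moreover have "dz (i + 1) = rint (i - 1) hi"
    unfolding dz_W[OF r(6,4)] using r by (auto simp: hi_def intro!: arg_cong2[of _ _ _ _ rint])
  moreover have "lo \<le> i" "i \<le> hi" using r by (auto simp: lo_def hi_def)
  ultimately show ?thesis using True i rint_exchange[of lo hi "i - 1" "i + 1"]
    by (simp add: dy_X dz_V lo_def[symmetric] hi_def[symmetric])
next
  case False
  consider "i = 1" | "i = n" "i \<noteq> 1" | "1 < i" "i < n" using i by fastforce
  then show ?thesis
  proof cases
    case 1
    then show ?thesis using rint_exchange[of 1 1 2 3] n3 by (simp add: dy_U dz_W dz_V rint_empty)
  next
    case 2
    have "dz (n - 1) = rint (n - 2) n" using n3 n_odd by (simp add: dz_V)
    moreover have "dz n = rint (n - 2) (n - 1)" using n3 n_odd by (simp add: dz_W)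
    moreover have "dy n = rint n n" using n_odd by (rule dy_U)
    ultimately show ?thesis using rint_exchange[of "n - 2" "n - 1" n n] unfolding 2
      by (simp add: rint_empty add.commute[of "dy n"] del: One_nat_def) (simp add: add.commute)
  next
    case 3
    then show ?thesis using rint_exchange[of i i "i - 2" "i + 2"] False i
      by (simp add: dy_U dz_W dz_V add.commute)
  qed
qed

lemma dy_dy:
  assumes j: "2 \<le> j" "j \<le> n"
  shows "dy (j - 1) + dy j = dz (j - 2) + dz (j + 1)"
proof (cases "even j")
  case True
  have r: "j \<le> n - 1" "odd (j + 1)" "j + 1 \<in> {1..n}" "odd (j - 1)" using even_range[of j] True j by auto
  define hi where "hi = (if j = n - 1 then n - 1 else j + 3)"
  have z: "dz (j + 1) = rint (j - 1) hi"
    unfolding dz_W[OF r(2,3)] using j by (auto simp: hi_def intro!: arg_cong2[of _ _ _ _ rint])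
  have h: "j \<le> hi" using r by (auto simp: hi_def)
  show ?thesis
  proof (cases "j = 2")
    case True
    have "dy 2 = rint 2 hi" using dy_X[of 2] unfolding hi_def True by simp
    then show ?thesis using rint_exchange[of 1 1 2 hi] h z True by (simp add: dy_U rint_empty)
  next
    case False
    then have "dz (j - 2) = rint (j - 3) (j - 1)" using True j by (simp add: dz_V)
    then show ?thesis using rint_exchange[of "j - 1" "j - 1" "j - 3" hi] h z False True r
      by (simp add: dy_U dy_X hi_def[symmetric] add.commute)
  qed
next
  case False
  have r3: "3 \<le> j" using False j by (cases "j = 2") auto
  then have r: "3 \<le> j" "even (j - 1)" "odd (j - 2)" "j - 2 \<in> {1..n}" using False j by auto
  define lo where "lo = (if j - 1 = 2 then 2 else j - 4)"
  have z: "dz (j - 2) = rint lo j" using dz_W[OF r(3,4)] j by (auto simp: lo_def)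
  have h: "lo \<le> j - 1" using r by (auto simp: lo_def)
  show ?thesis
  proof (cases "j = n")
    case True
    have "dy (j - 1) = rint lo (n - 1)" using dy_X[OF r(2)] unfolding lo_def True by simp
    then show ?thesis using rint_exchange[of lo "n - 1" n n] h z False r True
      by (simp add: dy_U rint_empty)
  next
    case ne: False
    then have "dz (j + 1) = rint j (j + 2)" using False j by (simp add: dz_V add.commute)
    moreover have "dy (j - 1) = rint lo (j + 2)" unfolding dy_X[OF r(2)] lo_def
      using r ne by (auto intro!: arg_cong2[of _ _ _ _ rint])
    ultimately show ?thesis using rint_exchange[of lo "j + 2" j j] h z False by (simp add: dy_U)
  qed
qed

definition Dg :: "int \<Rightarrow> int \<Rightarrow> root_lattice" where "Dg a k = (\<Sum>s\<in>{a..k}. dy s)"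

lemma Dg_empty [simp]: "Dg a (a - 1) = 0" by (simp add: Dg_def)
lemma Dg_Suc: "a \<le> k \<Longrightarrow> Dg a k = Dg a (k - 1) + dy k"
proof -
  assume "a \<le> k"
  then have "{a..k} = insert k {a..k - 1}" by auto
  then show ?thesis by (simp add: Dg_def add.commute)
qed

lemma eig_diff:
  assumes "x \<in> uplus_comp \<gamma>" "y \<in> uplus_comp \<gamma>" "\<sigma> x - \<sigma> y = vs (Nweight \<gamma>) (x - y)"
  shows "eig \<gamma> (x - y)"
  unfolding eig_def sigma_diff[OF comp_uplus[OF assms(1)] comp_uplus[OF assms(2)]] assms(3)
  using comp_diff[OF assms(1,2)] by simp

text \<open>The factors commute and their degrees are orthogonal.\<close>

lemma zz_eig:
  assumes i: "i \<in> {1..n}"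
  shows "eig (dz (i - 1) + dz (i + 1)) (zd (i - 1) * zd (i + 1))"
    "zd (i + 1) * zd (i - 1) = zd (i - 1) * zd (i + 1)"
proof -
  have r: "rform (dz (i - 1)) (dz (i + 1)) = 0"
  proof (cases "i = 1 \<or> i = n")
    case True
    then show ?thesis by auto
  next
    case False
    then show ?thesis using i by (subst rform_dz_dz) auto
  qed
  have "qc (zx (i + 1) (i - 1)) (zd (i + 1)) (zd (i - 1))" using i by (intro qc_zz) auto
  moreover have "zx (i + 1) (i - 1) = 0" by (simp add: zx_def zzexp_def)
  ultimately show c: "zd (i + 1) * zd (i - 1) = zd (i - 1) * zd (i + 1)" by (simp add: qc_def)
  have e: "eig (dz (i - 1)) (zd (i - 1))" "eig (dz (i + 1)) (zd (i + 1))" using i by (auto intro!: eig_zd)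
  show "eig (dz (i - 1) + dz (i + 1)) (zd (i - 1) * zd (i + 1))"
    using sigma_eig_mult[OF e] e comp_mult by (auto simp: eig_def r c)
qed

text \<open>
  The exchange relation between \<open>y\<^sub>i\<close> and \<open>z\<^sub>i\<close> expresses the product in the reversed order, and subtracting
  \<open>v\<^sup>-\<^sup>1 z\<^sub>i\<^sub>-\<^sub>1 z\<^sub>i\<^sub>+\<^sub>1\<close> makes it symmetric.
\<close>

lemma eig_pd:
  assumes i: "i \<in> {1..n}" shows "eig (dy i + dz i) (pd i)"
proof -
  have e: "eig (dy i) (yd i)" "eig (dz i) (zd i)" using i by (auto intro!: eig_yd eig_zd)
  define Z where "Z = zd (i - 1) * zd (i + 1)"
  have Z: "Z \<in> uplus_comp (dy i + dz i)" "\<sigma> Z = vs (Nweight (dy i + dz i)) Z"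
    using zz_eig(1)[OF i] by (simp_all add: Z_def eig_def dy_dz[OF i])
  have Zu: "\<sigma> (vs (-1) Z) = vs 1 (\<sigma> Z)" using sigma_vs comp_uplus[OF Z(1)] by simp
  have c: "yd i * zd i \<in> uplus_comp (dy i + dz i)" "zd i * yd i \<in> uplus_comp (dy i + dz i)"
    using comp_mult[of "yd i" "dy i" "zd i" "dz i"] comp_mult[of "zd i" "dz i" "yd i" "dy i"] e
    by (auto simp: eig_def add.commute[of "dz i"])
  have r: "rform (dy i) (dz i) = kap i" using rform_dy_dz[OF i i] by simp
  show ?thesis
  proof (cases "odd i")
    case True
    have s: "\<sigma> (yd i * zd i) = vs (Nweight (dy i + dz i) - kap i) (zd i * yd i)" using sigma_eig_mult[OF e] r by simp
    have k: "zd i * yd i = vs (kap i) (yd i * zd i + vs 1 Z - vs (-1) Z)" using zd_yd_odd[OF i True] by (simp add: Z_def)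
    have "eig (dy i + dz i) (yd i * zd i - vs (-1) Z)"
      using c Z by (intro eig_diff comp_vs) (simp_all add: s k Zu Z(2) add.commute[of 1])
    then show ?thesis using True by (simp add: pd_def Z_def)
  next
    case False
    then have "kap i = 0" using n_odd by (auto simp: kap_def)
    then have s: "\<sigma> (zd i * yd i) = vs (Nweight (dy i + dz i)) (yd i * zd i)"
      using sigma_eig_mult[OF e(2,1)] r by (simp add: rform_sym[of "dz i"] add.commute)
    have k: "yd i * zd i = zd i * yd i + vs 1 Z - vs (-1) Z" using yd_zd_even[OF i] False by (simp add: Z_def)
    have "eig (dy i + dz i) (zd i * yd i - vs (-1) Z)"
      using c Z by (intro eig_diff comp_vs) (simp_all add: s k Zu Z(2) add.commute[of 1])
    then show ?thesis using False by (simp add: pd_def Z_def)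
  qed
qed

lemma rform_Dg:
  assumes "\<And>s. a \<le> s \<Longrightarrow> s \<le> k \<Longrightarrow> rform \<delta> (dy s) = f s"
  shows "rform (Dg a k) \<delta> = (\<Sum>s\<in>{a..k}. f s)"
  unfolding Dg_def rform_sum_left by (intro sum.cong) (use assms in \<open>auto simp: rform_sym[of _ \<delta>]\<close>)

lemma rform_Dg_dy:
  assumes "1 \<le> a" "a < j" "j \<le> n"
  shows "rform (Dg a (j - 1)) (dy j) = (if a + 3 \<le> j then 1 else 0) + kap (if odd j then j else j - 1)"
proof -
  have "rform (Dg a (j - 1)) (dy j) = (\<Sum>s\<in>{a..j - 1}. (if s = j - 1 then kap (if odd j then j else j - 1) else 0) + (if s = j - 3 then 1 else 0))"
  proof (rule rform_Dg)
    fix s assume "a \<le> s" "s \<le> j - 1"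
    then show "rform (dy j) (dy s) = (if s = j - 1 then kap (if odd j then j else j - 1) else 0) + (if s = j - 3 then 1 else 0)"
      using assms by (cases "s = j - 1") (auto simp: rform_dy_dy)
  qed
  also have "\<dots> = (if a + 3 \<le> j then 1 else 0) + kap (if odd j then j else j - 1)"
    unfolding sum.distrib sum_indicator using assms by auto
  finally show ?thesis .
qed

text \<open>The sum of the pairings between the degrees of \<open>\<Delta>\<^sub>a\<^sub>,\<^sub>j\<^sub>-\<^sub>3\<close>, \<open>p\<^sub>j\<^sub>-\<^sub>2\<close> and \<open>z\<^sub>j\<^sub>+\<^sub>1\<close>.\<close>

definition Sx :: "int \<Rightarrow> int \<Rightarrow> int" where
  "Sx a j = (if a + 3 \<le> j then 1 + kap (if odd j then j - 2 else j - 3) else 0) + (if a + 4 \<le> j then 1 else 0) + (if a + 5 \<le> j then 1 else 0)"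

lemma rform_PL:
  assumes "1 \<le> a" "a + 2 \<le> j" "j \<le> n"
  shows "rform (Dg a (j - 3)) (dy (j - 2) + dz (j - 2)) + rform (Dg a (j - 3)) (dz (j + 1))
    + rform (dy (j - 2) + dz (j - 2)) (dz (j + 1)) = Sx a j"
proof -
  have 1: "rform (Dg a (j - 3)) (dy (j - 2)) = (if a + 3 \<le> j then kap (if odd j then j - 2 else j - 3) else 0) + (if a + 5 \<le> j then 1 else 0)"
  proof (cases "a + 3 \<le> j")
    case True
    have "j - 2 - 1 = j - 3" by simp
    then show ?thesis using rform_Dg_dy[of a "j - 2"] assms True by (simp split: if_splits)
  next
    case False
    then have "j - 3 = a - 1" using assms by simp
    then show ?thesis using False by simp
  qed
  have 2: "rform (Dg a (j - 3)) (dz (j - 2)) = (if a + 3 \<le> j then 1 else 0) + (if a + 4 \<le> j then 1 else 0)"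
  proof -
    have "rform (Dg a (j - 3)) (dz (j - 2)) = (\<Sum>s\<in>{a..j - 3}. (if s = j - 3 then 1 else 0) + (if s = j - 4 then 1 else 0))"
      by (rule rform_Dg) (use assms in \<open>auto simp: rform_sym[of "dz _"] rform_dy_dz\<close>)
    then show ?thesis unfolding sum.distrib sum_indicator using assms by auto
  qed
  have 3: "rform (Dg a (j - 3)) (dz (j + 1)) = 0"
  proof (cases "j = n")
    case False
    have "rform (Dg a (j - 3)) (dz (j + 1)) = (\<Sum>s\<in>{a..j - 3}. 0)"
      by (rule rform_Dg) (use assms False in \<open>auto simp: rform_sym[of "dz _"] rform_dy_dz\<close>)
    then show ?thesis by simp
  qed simp
  have 4: "rform (dy (j - 2)) (dz (j + 1)) = 0" "rform (dz (j - 2)) (dz (j + 1)) = 0"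
    using assms by (cases "j = n"; simp add: rform_dy_dz rform_dz_dz)+
  show ?thesis by (simp add: rform_add_right rform_add_left 1 2 3 4 Sx_def)
qed

text \<open>
  The antiautomorphism reverses all products, so it maps the recursion with \<open>y\<^sub>j\<close> on one side to the one
  with \<open>y\<^sub>j\<close> on the other side. The exponents of \<open>v\<close> agree by the pairings of the
  degrees of the factors.
\<close>

lemma eig_minor:
  assumes a: "1 \<le> a" and j: "a - 1 \<le> j" "j \<le> n"
  shows "eig (Dg a j) (minor a j)"
  using j
proof (induction "nat (j - a + 1)" arbitrary: j rule: less_induct)
  case less
  consider "j = a - 1" | "j = a" | "a < j" using less.prems by linarith
  then show ?case
  proof cases
    case 1
    then show ?thesis using eig_one by simp
  next
    case 2
    then show ?thesis using eig_yd[of a] less.prems a by (simp add: Dg_def)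
  next
    case 3
    have jn: "j \<in> {1..n}" using 3 a less.prems by simp
    have IH: "eig (Dg a (j - 1)) (minor a (j - 1))" using less.hyps[of "j - 1"] 3 less.prems by simp
    have ey: "eig (dy j) (yd j)" using jn by (rule eig_yd)
    have ez: "eig (dz (j + 1)) (zd (j + 1))" using jn by (intro eig_zd) auto
    define N where "N = Nweight (Dg a j)"
    have Dg: "Dg a j = Dg a (j - 1) + dy j" using 3 by (intro Dg_Suc) simp
    have fy: "rform (Dg a (j - 1)) (dy j) = (if a + 3 \<le> j then 1 else 0) + kap (if odd j then j else j - 1)"
      using a 3 less.prems by (intro rform_Dg_dy) auto
    have sy: "\<sigma> (minor a (j - 1) * yd j) = vs (N - rform (Dg a (j - 1)) (dy j)) (yd j * minor a (j - 1))"
      "\<sigma> (yd j * minor a (j - 1)) = vs (N - rform (Dg a (j - 1)) (dy j)) (minor a (j - 1) * yd j)"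
      using sigma_eig_mult[OF IH ey] sigma_eig_mult[OF ey IH]
      by (simp_all add: N_def Dg rform_sym[of "dy j"] add.commute)
    have cy: "minor a (j - 1) * yd j \<in> uplus_comp (Dg a j)" "yd j * minor a (j - 1) \<in> uplus_comp (Dg a j)"
      using comp_mult[of "minor a (j - 1)" "Dg a (j - 1)" "yd j" "dy j"]
        comp_mult[of "yd j" "dy j" "minor a (j - 1)" "Dg a (j - 1)"] IH ey
      unfolding eig_def Dg add.commute[of "dy j"] by auto
    have P: "PL a (j - 1) * zd (j + 1) \<in> uplus_comp (Dg a j) \<and> zd (j + 1) * PR a (j - 1) \<in> uplus_comp (Dg a j) \<and>
      \<sigma> (PL a (j - 1) * zd (j + 1)) = vs (N - Sx a j) (zd (j + 1) * PR a (j - 1)) \<and>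
      \<sigma> (zd (j + 1) * PR a (j - 1)) = vs (N - Sx a j) (PL a (j - 1) * zd (j + 1))"
    proof (cases "j = a + 1")
      case True
      have e: "eig (dz (a - 1)) (zd (a - 1))" using a jn True by (intro eig_zd) auto
      have d: "Dg a j = dz (a - 1) + dz (j + 1)"
        using dy_dy[of j] True a less.prems Dg_Suc[of a a] Dg unfolding True by simp
      have r: "rform (dz (a - 1)) (dz (j + 1)) = 0"
      proof (cases "a = 1 \<or> j = n")
        case False
        then show ?thesis using True a less.prems by (subst rform_dz_dz) auto
      qed auto
      have S: "Sx a j = 0" using True by (simp add: Sx_def)
      have PLR: "PL a (j - 1) = zd (a - 1)" "PR a (j - 1) = zd (a - 1)" using True by (simp_all add: PL_def PR_def)
      have c: "zd (a - 1) \<in> uplus_comp (dz (a - 1))" "zd (j + 1) \<in> uplus_comp (dz (j + 1))"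
        using e ez by (simp_all add: eig_def)
      have m: "zd (a - 1) * zd (j + 1) \<in> uplus_comp (Dg a j)" "zd (j + 1) * zd (a - 1) \<in> uplus_comp (Dg a j)"
        using comp_mult[OF c] comp_mult[OF c(2,1)] by (simp_all add: d add.commute)
      have "\<sigma> (zd (a - 1) * zd (j + 1)) = vs N (zd (j + 1) * zd (a - 1))"
        using sigma_eig_mult[OF e ez] by (simp add: N_def d r)
      moreover have "\<sigma> (zd (j + 1) * zd (a - 1)) = vs N (zd (a - 1) * zd (j + 1))"
        using sigma_eig_mult[OF ez e]
        unfolding N_def d rform_sym[of "dz (j + 1)"] add.commute[of "dz (j + 1)"] r by simp
      ultimately show ?thesis unfolding PLR S using m by simp
    next
      case False
      have e3: "eig (Dg a (j - 3)) (minor a (j - 3))" using less.hyps[of "j - 3"] 3 False less.prems by simp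
      have ep: "eig (dy (j - 2) + dz (j - 2)) (pd (j - 2))" using a 3 False less.prems by (intro eig_pd) auto
      define \<alpha> \<beta> \<gamma> where "\<alpha> = Dg a (j - 3)" and "\<beta> = dy (j - 2) + dz (j - 2)" and "\<gamma> = dz (j + 1)"
      have d: "Dg a j = \<alpha> + \<beta> + \<gamma>"
      proof -
        have e: "j - 1 - 1 = j - 2" "j - 2 - 1 = j - 3" by auto
        have "Dg a j = Dg a (j - 3) + dy (j - 2) + (dy (j - 1) + dy j)"
          using Dg_Suc[of a "j - 1"] Dg_Suc[of a "j - 2"] 3 False unfolding e by (simp add: Dg add.assoc)
        then show ?thesis using dy_dy[of j] a 3 less.prems by (simp add: \<alpha>_def \<beta>_def \<gamma>_def add.assoc)
      qed
      have S: "rform \<alpha> \<beta> + rform \<alpha> \<gamma> + rform \<beta> \<gamma> = Sx a j"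
        unfolding \<alpha>_def \<beta>_def \<gamma>_def using a 3 False less.prems by (intro rform_PL) auto
      have PLR: "PL a (j - 1) = minor a (j - 3) * pd (j - 2)" "PR a (j - 1) = pd (j - 2) * minor a (j - 3)"
        using False by (simp_all add: PL_def PR_def)
      have u: "minor a (j - 3) \<in> uplus" "pd (j - 2) \<in> uplus" "zd (j + 1) \<in> uplus"
        using e3 ep ez comp_uplus by (auto simp: eig_def)
      have sg: "\<sigma> (minor a (j - 3)) = vs (Nweight \<alpha>) (minor a (j - 3))" "\<sigma> (pd (j - 2)) = vs (Nweight \<beta>) (pd (j - 2))"
        "\<sigma> (zd (j + 1)) = vs (Nweight \<gamma>) (zd (j + 1))"
        using e3 ep ez by (simp_all add: eig_def \<alpha>_def \<beta>_def \<gamma>_def)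
      have NN: "N = Nweight \<alpha> + Nweight \<beta> + Nweight \<gamma> + Sx a j"
        using S by (simp add: N_def d Nweight_add rform_add_left)
      have c: "minor a (j - 3) * pd (j - 2) * zd (j + 1) \<in> uplus_comp (Dg a j)" "zd (j + 1) * (pd (j - 2) * minor a (j - 3)) \<in> uplus_comp (Dg a j)"
      proof -
        have c: "minor a (j - 3) \<in> uplus_comp \<alpha>" "pd (j - 2) \<in> uplus_comp \<beta>" "zd (j + 1) \<in> uplus_comp \<gamma>"
          using e3 ep ez by (simp_all add: eig_def \<alpha>_def \<beta>_def \<gamma>_def)
        show "minor a (j - 3) * pd (j - 2) * zd (j + 1) \<in> uplus_comp (Dg a j)"
          using comp_mult[OF comp_mult[OF c(1,2)] c(3)] by (simp add: d)
        show "zd (j + 1) * (pd (j - 2) * minor a (j - 3)) \<in> uplus_comp (Dg a j)"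
          using comp_mult[OF c(3) comp_mult[OF c(2,1)]] by (simp add: d add_ac)
      qed
      obtain z where z: "zd (j + 1) = z" by simp
      show ?thesis using c u sg unfolding PLR z
        by (simp add: sigma_simps uplus.mult NN mult.assoc add_ac)
    qed
    note P1 = P[THEN conjunct1] P[THEN conjunct2, THEN conjunct1] P[THEN conjunct2, THEN conjunct2, THEN conjunct1]
      P[THEN conjunct2, THEN conjunct2, THEN conjunct2]
    have su: "\<sigma> (vs k (PL a (j - 1) * zd (j + 1))) = vs (- k) (\<sigma> (PL a (j - 1) * zd (j + 1)))"
      "\<sigma> (vs k (zd (j + 1) * PR a (j - 1))) = vs (- k) (\<sigma> (zd (j + 1) * PR a (j - 1)))" for k
      using sigma_vs comp_uplus P1(1,2) by blast+
    show ?thesis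
    proof (cases "even j")
      case True
      have x: "arx a j = - rform (Dg a (j - 1)) (dy j)" "brx a j = - Aexp a j - Sx a j"
        using True 3 a less.prems n_odd unfolding fy
        by (auto simp: arx_def cx_def kap_def brx_def Aexp_def pip_def piexp_def sg_def Sx_def)
      have minor: "minor a j = minor a (j - 1) * yd j - vs (Aexp a j) (PL a (j - 1) * zd (j + 1))"
        using minor_rec[OF 3] True by simp
      have "vs N (minor a j) = vs (N - rform (Dg a (j - 1)) (dy j)) (yd j * minor a (j - 1)) - vs (N - Aexp a j - Sx a j) (zd (j + 1) * PR a (j - 1))"
        unfolding right_rec[OF a 3 less.prems(2)] x by (simp add: algebra_simps)
      then show ?thesis unfolding minor N_def
        using cy P1 by (intro eig_diff comp_vs) (simp_all only: minor[symmetric] sy su P1 vs_vs N_def, simp add: algebra_simps)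
    next
      case False
      have x: "alx a j = - rform (Dg a (j - 1)) (dy j)" "bex a j = - Aexp a j - Sx a j"
        using False 3 a less.prems n_odd unfolding fy
        by (auto simp: alx_def bex_def kap_def Aexp_def Sx_def)
      have minor: "minor a j = yd j * minor a (j - 1) - vs (Aexp a j) (zd (j + 1) * PR a (j - 1))"
        using minor_rec[OF 3] False by simp
      have L: "minor a j = vs (alx a j) (minor a (j - 1) * yd j) - vs (bex a j) (PL a (j - 1) * zd (j + 1))"
        using minor_identities(2)[of a j] a 3 less.prems by (simp add: left_rec_def)
      have "vs N (minor a j) = vs (N - rform (Dg a (j - 1)) (dy j)) (minor a (j - 1) * yd j) - vs (N - Aexp a j - Sx a j) (PL a (j - 1) * zd (j + 1))"
        unfolding L x by (simp add: algebra_simps)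
      then show ?thesis unfolding minor N_def
        using cy P1 by (intro eig_diff comp_vs) (simp_all only: minor[symmetric] sy su P1 vs_vs N_def, simp add: algebra_simps)
    qed
  qed
qed

end

section \<open>Expansion of the quantum minors in the dual PBW basis\<close>

lemma inv_v_int_polys_closed:
  assumes "x \<in> inv_v_int_polys" "y \<in> inv_v_int_polys"
  shows "x + y \<in> inv_v_int_polys" "- x \<in> inv_v_int_polys" "inverse qvar * x \<in> inv_v_int_polys"
proof -
  obtain p q :: "int poly" where p: "x = inverse qvar * poly (map_poly of_int p) (inverse qvar)"
    "y = inverse qvar * poly (map_poly of_int q) (inverse qvar)"
    using assms by (auto simp: inv_v_int_polys_def)
  have "map_poly of_int (p + q) = (map_poly of_int p + map_poly of_int q :: qv poly)"
    by (intro poly_eqI) (simp add: coeff_map_poly)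
  then have "x + y = inverse qvar * poly (map_poly of_int (p + q)) (inverse qvar)"
    by (simp add: p algebra_simps)
  then show "x + y \<in> inv_v_int_polys" unfolding inv_v_int_polys_def by blast
  have "map_poly of_int (- p) = (- map_poly of_int p :: qv poly)"
    by (intro poly_eqI) (simp add: coeff_map_poly)
  then have "- x = inverse qvar * poly (map_poly of_int (- p)) (inverse qvar)" by (simp add: p)
  then show "- x \<in> inv_v_int_polys" unfolding inv_v_int_polys_def by blast
  have "inverse qvar * x = inverse qvar * poly (map_poly of_int (pCons 0 p)) (inverse qvar)"
    by (simp add: p map_poly_pCons)
  then show "inverse qvar * x \<in> inv_v_int_polys" unfolding inv_v_int_polys_def by blast
qed

lemma inv_v_int_polys_0: "0 \<in> inv_v_int_polys"
  unfolding inv_v_int_polys_def by (force intro!: exI[of _ 0])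

lemma inv_v_int_polys_power_mult:
  assumes "x \<in> inv_v_int_polys" "e \<le> 0" shows "qvar powi e * x \<in> inv_v_int_polys"
proof -
  have "inverse qvar ^ m * x \<in> inv_v_int_polys" for m
    by (induction m) (use assms inv_v_int_polys_closed(3) in \<open>auto simp: mult.assoc\<close>)
  moreover have "qvar powi e = inverse qvar ^ nat (- e)" using assms(2) by (auto simp: power_int_def)
  ultimately show ?thesis by simp
qed

lemma inv_v_int_polys_power:
  assumes "e < 0" shows "qvar powi e \<in> inv_v_int_polys"
proof -
  have "inverse qvar \<in> inv_v_int_polys"
    unfolding inv_v_int_polys_def by (force intro!: exI[of _ 1])
  then have "qvar powi (e + 1) * inverse qvar \<in> inv_v_int_polys"
    using assms by (intro inv_v_int_polys_power_mult) auto
  moreover have "qvar powi (e + 1) * inverse qvar = qvar powi e"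
    by (subst power_int_add) auto
  ultimately show ?thesis by simp
qed

lemma ylabel_inject [simp]: "ylabel s = ylabel t \<longleftrightarrow> s = t" by (auto simp: ylabel_def split: if_splits)
lemma zlabel_inject [simp]: "zlabel s = zlabel t \<longleftrightarrow> s = t" by (auto simp: zlabel_def split: if_splits)
lemma ylabel_zlabel [simp]: "ylabel s \<noteq> zlabel t" "zlabel s \<noteq> ylabel t" by (auto simp: ylabel_def zlabel_def)

definition addy :: "int \<Rightarrow> (rlabel \<Rightarrow> nat) \<Rightarrow> rlabel \<Rightarrow> nat" where
  "addy s b = b(ylabel s := Suc (b (ylabel s)))"

lemma addy_simps [simp]:
  "addy s b (ylabel t) = b (ylabel t) + (if t = s then 1 else 0)" "addy s b (zlabel t) = b (zlabel t)"
  by (auto simp: addy_def)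

context sigma_setup
begin

lemma rlabels_yz: "set (rlabels n) = ylabel ` {1..n} \<union> zlabel ` {1..n}"
  by (auto simp: rlabels_def ylabel_def zlabel_def)

lemma zlabel_in: "zlabel t \<in> set (rlabels n) \<longleftrightarrow> t \<in> {1..n}"
  by (auto simp: zlabel_def in_rlabels)
lemma ylabel_in: "ylabel t \<in> set (rlabels n) \<longleftrightarrow> t \<in> {1..n}"
  by (auto simp: ylabel_def in_rlabels)

definition addz :: "int \<Rightarrow> (rlabel \<Rightarrow> nat) \<Rightarrow> rlabel \<Rightarrow> nat" where
  "addz s b = (if s \<in> {1..n} then b(zlabel s := Suc (b (zlabel s))) else b)"

lemma addz_simps [simp]:
  "addz s b (zlabel t) = b (zlabel t) + (if t = s \<and> s \<in> {1..n} then 1 else 0)" "addz s b (ylabel t) = b (ylabel t)"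
  by (auto simp: addz_def)

lemma sum_labels:
  "(\<Sum>k\<in>set (rlabels n). f k) = (\<Sum>t\<in>{1..n}. f (ylabel t)) + (\<Sum>t\<in>{1..n}. f (zlabel t))"
  unfolding rlabels_yz
  by (subst sum.union_disjoint) (auto simp: sum.reindex inj_on_def)

definition Edual :: "(rlabel \<Rightarrow> nat) \<Rightarrow> 'n uq" where "Edual b = pbw_dual T form b"

lemma qc_power: "qc e x y \<Longrightarrow> qc (int m * e) x (y ^ m)"
proof (induction m)
  case (Suc m)
  then show ?case using qc_mult[OF Suc.prems Suc.IH[OF Suc.prems]] by (simp add: algebra_simps)
qed (simp add: qc_one)

lemma qc_prod:
  assumes "\<And>k. k \<in> set ks \<Longrightarrow> b k \<noteq> 0 \<Longrightarrow> qc (\<psi> k) x (Rl k)"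
  shows "qc (\<Sum>k\<leftarrow>ks. int (b k) * \<psi> k) x (prod_list (map (\<lambda>k. Rl k ^ b k) ks))"
  using assms
proof (induction ks)
  case (Cons k ks)
  have "qc (int (b k) * \<psi> k) x (Rl k ^ b k)"
    using Cons.prems[of k] qc_power[of "\<psi> k" x "Rl k" "b k"] qc_one[of x] by (cases "b k = 0") auto
  then show ?case using Cons by (auto intro!: qc_mult)
qed (simp add: qc_one)

text \<open>
  On the right the new factor passes later families only, on the left earlier ones only; with its own family
  it commutes. The summand \<open>b l\<close> comes from the binomial coefficients in the normalisation.
\<close>

lemma Edual_insert:
  assumes l: "l \<in> set (rlabels n)"
  shows "(\<And>k. k \<in> set (rlabels n) \<Longrightarrow> cls l \<le> cls k \<Longrightarrow> k \<noteq> l \<Longrightarrow> b k \<noteq> 0 \<Longrightarrow> qc (\<psi> k) (Rl l) (Rl k)) \<Longrightarrow>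
      (\<And>k. k \<in> set (rlabels n) \<Longrightarrow> cls k \<le> cls l \<Longrightarrow> \<psi> k = 0) \<Longrightarrow>
      Edual b * Rl l = vs (int (b l) - (\<Sum>k\<in>set (rlabels n). int (b k) * \<psi> k)) (Edual (b(l := Suc (b l))))"
    "(\<And>k. k \<in> set (rlabels n) \<Longrightarrow> cls k \<le> cls l \<Longrightarrow> k \<noteq> l \<Longrightarrow> b k \<noteq> 0 \<Longrightarrow> qc (\<psi> k) (Rl l) (Rl k)) \<Longrightarrow>
      (\<And>k. k \<in> set (rlabels n) \<Longrightarrow> cls l \<le> cls k \<Longrightarrow> \<psi> k = 0) \<Longrightarrow>
      Rl l * Edual b = vs (int (b l) + (\<Sum>k\<in>set (rlabels n). int (b k) * \<psi> k)) (Edual (b(l := Suc (b l))))"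
proof -
  obtain pre post where L: "rlabels n = pre @ l # post" using split_list[OF l] by blast
  have nl: "l \<notin> set pre" "l \<notin> set post" and dis: "set pre \<inter> set post = {}"
    using distinct_rlabels unfolding L by auto
  have srt: "cls k \<le> cls l" if "k \<in> set pre" for k
    using sorted_cls_rlabels that unfolding L by (auto simp: sorted_append)
  have srt2: "cls l \<le> cls k" if "k \<in> set post" for k
    using sorted_cls_rlabels that unfolding L by (auto simp: sorted_append)
  define M where "M b ks = prod_list (map (\<lambda>k. Rl k ^ b k) ks)" for b :: "rlabel \<Rightarrow> nat" and ks
  define c where "c b = - (\<Sum>k\<in>set (rlabels n). int (b k choose 2))" for b :: "rlabel \<Rightarrow> nat"
  let ?b = "b(l := Suc (b l))"
  have Edual: "Edual b = vs (c b) (M b pre * (Rl l ^ b l * M b post))" for b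
    unfolding Edual_def pbw_dual_eq c_def M_def L by simp
  have M: "M ?b pre = M b pre" "M ?b post = M b post"
    unfolding M_def using nl by (auto intro!: arg_cong[of _ _ prod_list] map_cong)
  have "(\<Sum>k\<in>set (rlabels n). int (?b k choose 2)) = int (?b l choose 2) + (\<Sum>k\<in>set (rlabels n) - {l}. int (?b k choose 2))"
    using l by (intro sum.remove) auto
  also have "(\<Sum>k\<in>set (rlabels n) - {l}. int (?b k choose 2)) = (\<Sum>k\<in>set (rlabels n) - {l}. int (b k choose 2))"
    by (intro sum.cong) auto
  also have "int (?b l choose 2) = int (b l choose 2) + int (b l)" by (simp add: numeral_2_eq_2)
  also have "int (b l choose 2) + int (b l) + (\<Sum>k\<in>set (rlabels n) - {l}. int (b k choose 2))
    = int (b l) + (\<Sum>k\<in>set (rlabels n). int (b k choose 2))"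
    using l by (subst (2) sum.remove[of _ l]) auto
  finally have c: "c b = int (b l) + c ?b" unfolding c_def by linarith
  have sums: "(\<Sum>k\<in>set (rlabels n). int (b k) * \<psi> k) =
      (\<Sum>k\<leftarrow>pre. int (b k) * \<psi> k) + int (b l) * \<psi> l + (\<Sum>k\<leftarrow>post. int (b k) * \<psi> k)"
    using sum.distinct_set_conv_list[OF distinct_rlabels, of "\<lambda>k. int (b k) * \<psi> k"] by (simp add: L)
  have neutral: "(\<Sum>k\<leftarrow>ks. int (b k) * \<psi> k) = 0" if "\<And>k. k \<in> set ks \<Longrightarrow> \<psi> k = 0" for ks
    using that by (induction ks) auto
  {
    assume h: "\<And>k. k \<in> set (rlabels n) \<Longrightarrow> cls l \<le> cls k \<Longrightarrow> k \<noteq> l \<Longrightarrow> b k \<noteq> 0 \<Longrightarrow> qc (\<psi> k) (Rl l) (Rl k)"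
      and h0: "\<And>k. k \<in> set (rlabels n) \<Longrightarrow> cls k \<le> cls l \<Longrightarrow> \<psi> k = 0"
    have z: "(\<Sum>k\<leftarrow>pre. int (b k) * \<psi> k) = 0" "\<psi> l = 0"
      using h0 srt l by (auto simp: L intro!: neutral)
    have "qc (\<Sum>k\<leftarrow>post. int (b k) * \<psi> k) (Rl l) (M b post)"
      unfolding M_def using h srt2 nl by (intro qc_prod) (auto simp: L)
    then have "M b post * Rl l = vs (- (\<Sum>k\<leftarrow>post. int (b k) * \<psi> k)) (Rl l * M b post)" by (simp add: qc_def)
    then show "Edual b * Rl l = vs (int (b l) - (\<Sum>k\<in>set (rlabels n). int (b k) * \<psi> k)) (Edual ?b)"
      unfolding sums z Edual[of b] Edual[of ?b] M c by (simp add: mult.assoc power_commutes algebra_simps)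
        (simp add: power_commutes flip: mult.assoc)
  }
  {
    assume h: "\<And>k. k \<in> set (rlabels n) \<Longrightarrow> cls k \<le> cls l \<Longrightarrow> k \<noteq> l \<Longrightarrow> b k \<noteq> 0 \<Longrightarrow> qc (\<psi> k) (Rl l) (Rl k)"
      and h0: "\<And>k. k \<in> set (rlabels n) \<Longrightarrow> cls l \<le> cls k \<Longrightarrow> \<psi> k = 0"
    have z: "(\<Sum>k\<leftarrow>post. int (b k) * \<psi> k) = 0" "\<psi> l = 0"
      using h0 srt2 l by (auto simp: L intro!: neutral)
    have "qc (\<Sum>k\<leftarrow>pre. int (b k) * \<psi> k) (Rl l) (M b pre)"
      unfolding M_def using h srt nl by (intro qc_prod) (auto simp: L)
    then have "Rl l * (M b pre * X) = vs (\<Sum>k\<leftarrow>pre. int (b k) * \<psi> k) (M b pre * (Rl l * X))" for X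
      by (simp add: qc_def flip: mult.assoc)
    then show "Rl l * Edual b = vs (int (b l) + (\<Sum>k\<in>set (rlabels n). int (b k) * \<psi> k)) (Edual ?b)"
      unfolding sums z Edual[of b] Edual[of ?b] M c by (simp add: mult.assoc algebra_simps)
  }
qed

text \<open>
  Multiplication by the second factor on the side on which the generator \<open>y\<^sub>j\<close> enters the defining
  recursion: on the right for even \<open>j\<close>, on the left for odd \<open>j\<close>. The parities then need no separate
  treatment.
\<close>

definition mul :: "int \<Rightarrow> 'n uq \<Rightarrow> 'n uq \<Rightarrow> 'n uq" where
  "mul j x y = (if even j then x * y else y * x)"

lemma mul_simps [simp]:
  "mul j (x + y) z = mul j x z + mul j y z" "mul j (c *\<^sub>q x) z = c *\<^sub>q mul j x z"
  "mul j (x - y) z = mul j x z - mul j y z" "mul j (vs e x) z = vs e (mul j x z)" "mul j 1 x = x" "mul j 0 x = 0" "mul j x 1 = x"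
  by (simp_all add: mul_def algebra_simps)

lemma Edual_yd:
  assumes s: "s \<in> {1..n}" and p: "even s = even j"
  shows "mul j (Edual b) (yd s) = vs (int (b (ylabel s))) (Edual (addy s b))"
proof -
  have c: "qc 0 (Rl (ylabel s)) (Rl k)" if "k \<in> set (rlabels n)" "cls k = cls (ylabel s)" for k
  proof -
    have "k \<notin> zlabel ` {1..n}" using that(2) by (auto simp: ylabel_def zlabel_def split: if_splits)
    then have "k \<in> ylabel ` {1..n}" using that(1) unfolding rlabels_yz by blast
    then obtain t where t: "k = ylabel t" "t \<in> {1..n}" by blast
    then have "even t = even s" using that(2) by (auto simp: ylabel_def split: if_splits)
    then have "\<bar>s - t\<bar> \<noteq> 1" "\<bar>s - t\<bar> \<noteq> 3" by presburger+
    then show ?thesis using qc_yy[OF s t(2)] by (simp add: yyexp_def yd_def t)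
  qed
  have l: "ylabel s \<in> set (rlabels n)" using s by (rule yz_labels)
  show ?thesis
  proof (cases "even j")
    case True
    have "cls k = cls (ylabel s)" if "cls (ylabel s) \<le> cls k" for k
      using that True p by (cases k) (auto simp: ylabel_def)
    then show ?thesis using Edual_insert(1)[OF l, of b "\<lambda>_. 0"] c True by (simp add: mul_def yd_def addy_def)
  next
    case False
    have "cls k = cls (ylabel s)" if "cls k \<le> cls (ylabel s)" for k
      using that False p by (cases k) (auto simp: ylabel_def)
    then show ?thesis using Edual_insert(2)[OF l, of b "\<lambda>_. 0"] c False by (simp add: mul_def yd_def addy_def)
  qed
qed

text \<open>
  The exponent of \<open>v\<close> that arises when \<open>z\<^sub>s\<close> is absorbed into \<open>E[b]\<^sup>*\<close>. The flag tells whether \<open>z\<^sub>s\<close> enters on the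
  side where the other \<open>z\<close>'s of adjacent index are in its way.
\<close>

definition zd_exponent :: "bool \<Rightarrow> (rlabel \<Rightarrow> nat) \<Rightarrow> int \<Rightarrow> nat" where
  "zd_exponent f b s = (if s \<in> {1..n} then b (zlabel s) +
     (if f then b (zlabel (s - 1)) + b (zlabel (s + 1)) + b (ylabel (s - 2)) + b (ylabel (s + 2))
      else b (ylabel (s - 1)) + b (ylabel (s + 1))) else 0)"

lemma sum_near:
  assumes "\<And>t. t \<notin> {1..n} \<Longrightarrow> g t = 0" "0 < d"
  shows "(\<Sum>t\<in>{1..n}. int (g t) * (if \<bar>s - t\<bar> = d then 1 else 0)) = int (g (s - d) + g (s + d))"
proof -
  have "(\<Sum>t\<in>{1..n}. int (g t) * (if \<bar>s - t\<bar> = d then 1 else 0))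
    = (\<Sum>t\<in>{1..n}. (if t = s - d then int (g (s - d)) else 0) + (if t = s + d then int (g (s + d)) else 0))"
    by (intro sum.cong) (use assms(2) in auto)
  also have "\<dots> = int (g (s - d) + g (s + d))"
    using assms(1)[of "s - d"] assms(1)[of "s + d"] by (auto simp: sum.distrib)
  finally show ?thesis .
qed

lemma Edual_zd:
  assumes s: "s \<in> {0..n + 1}" and b: "b \<in> exponents n" and y: "even j = even s \<Longrightarrow> b (ylabel s) = 0"
  shows "mul j (Edual b) (zd s) = vs (int (zd_exponent (even j = even s) b s)) (Edual (addz s b))"
proof (cases "s \<in> {1..n}")
  case False
  then have "s = 0 \<or> s = n + 1" using s by auto
  then show ?thesis using False by (auto simp: zd_def zd_exponent_def addz_def)
next
  case True
  define f where "f \<longleftrightarrow> even j = even s"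
  define \<chi> where "\<chi> k = (case k of U t \<Rightarrow> if \<bar>s - t\<bar> = (if f then 2 else 1) then 1 else 0
    | X t \<Rightarrow> if \<bar>s - t\<bar> = (if f then 2 else 1) then 1 else 0
    | V t \<Rightarrow> if f \<and> \<bar>s - t\<bar> = 1 then 1 else 0 | W t \<Rightarrow> if f \<and> \<bar>s - t\<bar> = 1 then 1 else (0::int))" for k
  have \<chi>: "\<chi> (ylabel t) = (if \<bar>s - t\<bar> = (if f then 2 else 1) then 1 else 0)"
    "\<chi> (zlabel t) = (if f \<and> \<bar>s - t\<bar> = 1 then 1 else 0)" for t
    by (auto simp: \<chi>_def ylabel_def zlabel_def)
  have out: "b (ylabel t) = 0" "b (zlabel t) = 0" if "t \<notin> {1..n}" for t
    using that b zlabel_in[of t] ylabel_in[of t] by (auto simp: exponents_def)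
  have sum: "(\<Sum>k\<in>set (rlabels n). int (b k) * \<chi> k) + int (b (zlabel s)) = int (zd_exponent f b s)"
    unfolding sum_labels \<chi>
    using sum_near[of "\<lambda>t. b (ylabel t)" "if f then 2 else 1" s] sum_near[of "\<lambda>t. b (zlabel t)" 1 s] out True
    by (auto simp: zd_exponent_def)
  have l: "zlabel s \<in> set (rlabels n)" using True by (rule yz_labels)
  have z: "zd s = Rl (zlabel s)" using True by (simp add: zd_def)
  have qz: "qc (zzexp s t) (Rl (zlabel s)) (Rl (zlabel t))" if "t \<in> {1..n}" for t
    using zd_zd[OF True that] that True by (simp add: qc_def zd_def)
  have qy: "qc (- yzexp t s) (Rl (zlabel s)) (Rl (ylabel t))" if "t \<in> {1..n}" "t \<noteq> s" for t
    using yd_zd[OF that(1) True that(2)] True qc_sym[of "yzexp t s" "yd t" "zd s"] by (simp add: qc_def zd_def yd_def)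
  show ?thesis
  proof (cases "even j")
    case j: True
    have q: "qc (- \<chi> k) (Rl (zlabel s)) (Rl k)"
      if k: "k \<in> set (rlabels n)" "cls (zlabel s) \<le> cls k" "k \<noteq> zlabel s" "b k \<noteq> 0" for k
    proof -
      from k(1) consider t where "t \<in> {1..n}" "k = ylabel t" | t where "t \<in> {1..n}" "k = zlabel t"
        unfolding rlabels_yz by auto
      then show ?thesis
      proof cases
        case 1
        have "even t" using k(2) 1 by (auto simp: ylabel_def zlabel_def split: if_splits)
        moreover have "t \<noteq> s" using y k(4) 1 \<open>even t\<close> j by auto
        moreover have "yzexp t s = \<chi> k"
          using \<open>even t\<close> j unfolding 1 \<chi> by (auto simp: yzexp_def sg_def f_def abs_minus_commute; presburger)
        ultimately show ?thesis using qy[OF 1(1)] 1 by simp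
      next
        case 2
        have "\<not> (odd s \<and> even t)" using k(2) 2 by (auto simp: zlabel_def split: if_splits)
        then have "zzexp s t = - \<chi> k"
          using j unfolding 2 \<chi> by (auto simp: zzexp_def sg_def f_def; presburger)
        then show ?thesis using qz[OF 2(1)] 2 by simp
      qed
    qed
    have q0: "- \<chi> k = 0" if k: "k \<in> set (rlabels n)" "cls k \<le> cls (zlabel s)" for k
    proof -
      from k(1) consider t where "t \<in> {1..n}" "k = ylabel t" | t where "t \<in> {1..n}" "k = zlabel t"
        unfolding rlabels_yz by auto
      then show ?thesis
      proof cases
        case 1
        then have "odd t" using k(2) by (auto simp: ylabel_def zlabel_def split: if_splits)
        then show ?thesis unfolding 1 \<chi> using j by (auto simp: f_def; presburger)
      next
        case 2
        then have "\<not> (even s \<and> odd t)" using k(2) by (auto simp: zlabel_def split: if_splits)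
        then show ?thesis unfolding 2 \<chi> using j by (auto simp: f_def; presburger)
      qed
    qed
    have "Edual b * Rl (zlabel s) = vs (int (b (zlabel s)) - (\<Sum>k\<in>set (rlabels n). int (b k) * (- \<chi> k))) (Edual (addz s b))"
      using Edual_insert(1)[OF l, of b "\<lambda>k. - \<chi> k"] q q0 True by (simp add: addz_def)
    also have "int (b (zlabel s)) - (\<Sum>k\<in>set (rlabels n). int (b k) * (- \<chi> k)) = int (zd_exponent f b s)"
      using sum by (simp add: sum_negf)
    finally show ?thesis using j by (simp add: mul_def z f_def)
  next
    case j: False
    have q: "qc (\<chi> k) (Rl (zlabel s)) (Rl k)"
      if k: "k \<in> set (rlabels n)" "cls k \<le> cls (zlabel s)" "k \<noteq> zlabel s" "b k \<noteq> 0" for k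
    proof -
      from k(1) consider t where "t \<in> {1..n}" "k = ylabel t" | t where "t \<in> {1..n}" "k = zlabel t"
        unfolding rlabels_yz by auto
      then show ?thesis
      proof cases
        case 1
        have "odd t" using k(2) 1 by (auto simp: ylabel_def zlabel_def split: if_splits)
        moreover have "t \<noteq> s" using y k(4) 1 \<open>odd t\<close> j by auto
        moreover have "- yzexp t s = \<chi> k"
          using \<open>odd t\<close> j unfolding 1 \<chi> by (auto simp: yzexp_def sg_def f_def abs_minus_commute; presburger)
        ultimately show ?thesis using qy[OF 1(1)] 1 by simp
      next
        case 2
        have "\<not> (even s \<and> odd t)" using k(2) 2 by (auto simp: zlabel_def split: if_splits)
        then have "zzexp s t = \<chi> k"
          using j unfolding 2 \<chi> by (auto simp: zzexp_def sg_def f_def; presburger)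
        then show ?thesis using qz[OF 2(1)] 2 by simp
      qed
    qed
    have q0: "\<chi> k = 0" if k: "k \<in> set (rlabels n)" "cls (zlabel s) \<le> cls k" for k
    proof -
      from k(1) consider t where "t \<in> {1..n}" "k = ylabel t" | t where "t \<in> {1..n}" "k = zlabel t"
        unfolding rlabels_yz by auto
      then show ?thesis
      proof cases
        case 1
        then have "even t" using k(2) by (auto simp: ylabel_def zlabel_def split: if_splits)
        then show ?thesis unfolding 1 \<chi> using j by (auto simp: f_def; presburger)
      next
        case 2
        then have "\<not> (odd s \<and> even t)" using k(2) by (auto simp: zlabel_def split: if_splits)
        then show ?thesis unfolding 2 \<chi> using j by (auto simp: f_def; presburger)
      qed
    qed
    have "Rl (zlabel s) * Edual b = vs (int (b (zlabel s)) + (\<Sum>k\<in>set (rlabels n). int (b k) * \<chi> k)) (Edual (addz s b))"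
      using Edual_insert(2)[OF l, of b \<chi>] q q0 True by (simp add: addz_def)
    then show ?thesis using j sum by (simp add: mul_def z f_def add.commute)
  qed
qed

inductive_set inv_v_comb :: "(rlabel \<Rightarrow> nat) set \<Rightarrow> 'n uq set" for S where
  zero: "0 \<in> inv_v_comb S"
| step: "x \<in> inv_v_comb S \<Longrightarrow> c \<in> inv_v_int_polys \<Longrightarrow> b \<in> S \<Longrightarrow> x + (c *\<^sub>q Edual b) \<in> inv_v_comb S"

lemma inv_v_comb_add: "y \<in> inv_v_comb S \<Longrightarrow> x \<in> inv_v_comb S \<Longrightarrow> x + y \<in> inv_v_comb S"
proof (induction rule: inv_v_comb.induct)
  case (step y c b)
  then show ?case using inv_v_comb.step[of "x + y" S c b] by (simp add: add.assoc)
qed simp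

lemma inv_v_comb_uminus: "x \<in> inv_v_comb S \<Longrightarrow> - x \<in> inv_v_comb S"
proof (induction rule: inv_v_comb.induct)
  case (step x c b)
  then show ?case using inv_v_comb.step[of "- x" S "- c" b] inv_v_int_polys_closed(2) by simp
qed (simp add: inv_v_comb.zero)

lemma inv_v_comb_diff: "x \<in> inv_v_comb S \<Longrightarrow> y \<in> inv_v_comb S \<Longrightarrow> x - y \<in> inv_v_comb S"
  using inv_v_comb_add[of "- y" S x] inv_v_comb_uminus[of y S] by simp

lemma inv_v_comb_vs: "b \<in> S \<Longrightarrow> e < 0 \<Longrightarrow> vs e (Edual b) \<in> inv_v_comb S"
  using inv_v_comb.step[OF inv_v_comb.zero inv_v_int_polys_power[of e], of b S] by (simp add: vs_def)

lemma inv_v_comb_map: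
  assumes x: "x \<in> inv_v_comb S" and f: "\<And>x y. f (x + y) = f x + f y" "\<And>c x. f (c *\<^sub>q x) = c *\<^sub>q f x"
    and Edual: "\<And>b. b \<in> S \<Longrightarrow> \<exists>e b'. e \<le> 0 \<and> b' \<in> S' \<and> f (Edual b) = vs e (Edual b')"
  shows "f x \<in> inv_v_comb S'"
  using x
proof (induction rule: inv_v_comb.induct)
  case zero
  have "f 0 = 0" using f(2)[of 0 0] by simp
  then show ?case by (simp add: inv_v_comb.zero)
next
  case (step x c b)
  obtain e b' where e: "e \<le> 0" "b' \<in> S'" "f (Edual b) = vs e (Edual b')" using Edual[OF step.hyps(3)] by blast
  have "f x + ((qvar powi e * c) *\<^sub>q Edual b') \<in> inv_v_comb S'"
    using step e by (intro inv_v_comb.step inv_v_int_polys_power_mult) auto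
  then show ?case by (simp add: f e vs_def mult.commute)
qed

lemma inv_v_comb_map_leading:
  assumes x: "x - Edual l \<in> inv_v_comb S" and f: "\<And>x y. f (x + y) = f x + f y" "\<And>c x. f (c *\<^sub>q x) = c *\<^sub>q f x"
    and Edual: "\<And>b. b \<in> insert l S \<Longrightarrow> \<exists>e b'. e < 0 \<and> b' \<in> S' \<and> f (Edual b) = vs e (Edual b')"
  shows "f x \<in> inv_v_comb S'"
proof -
  have "f (x - Edual l) \<in> inv_v_comb S'" using x f
  proof (rule inv_v_comb_map)
    show "\<exists>e b'. e \<le> 0 \<and> b' \<in> S' \<and> f (Edual b) = vs e (Edual b')" if "b \<in> S" for b
      using Edual[of b] that by (meson insertI2 less_imp_le)
  qed
  moreover have "f (Edual l) \<in> inv_v_comb S'" using Edual[of l] inv_v_comb_vs by auto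
  ultimately have "f (x - Edual l) + f (Edual l) \<in> inv_v_comb S'" using inv_v_comb_add by blast
  then show ?thesis by (simp flip: f(1))
qed

lemma inv_v_comb_coefficients:
  assumes "x \<in> inv_v_comb S"
  shows "\<exists>c. finite {b. c b \<noteq> 0} \<and> {b. c b \<noteq> 0} \<subseteq> S \<and> range c \<subseteq> inv_v_int_polys \<and> x = (\<Sum>b | c b \<noteq> 0. c b *\<^sub>q Edual b)"
  using assms
proof (induction rule: inv_v_comb.induct)
  case zero
  show ?case by (rule exI[of _ "\<lambda>_. 0"]) (auto simp: inv_v_int_polys_0)
next
  case (step x d b)
  then obtain c where c: "finite {b. c b \<noteq> 0}" "{b. c b \<noteq> 0} \<subseteq> S" "range c \<subseteq> inv_v_int_polys"
    "x = (\<Sum>b | c b \<noteq> 0. c b *\<^sub>q Edual b)" by blast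
  define c' where "c' = c(b := c b + d)"
  let ?A = "insert b {b. c b \<noteq> 0}"
  have A: "finite ?A" using c by simp
  have sub: "{b. c' b \<noteq> 0} \<subseteq> ?A" by (auto simp: c'_def)
  have "(\<Sum>b | c' b \<noteq> 0. c' b *\<^sub>q Edual b) = (\<Sum>k\<in>?A. c' k *\<^sub>q Edual k)"
    using A sub by (intro sum.mono_neutral_left) auto
  also have "\<dots> = (\<Sum>k\<in>?A. (c k *\<^sub>q Edual k) + (if k = b then d *\<^sub>q Edual b else 0))"
    by (intro sum.cong) (auto simp: c'_def uq.scale_left_distrib)
  also have "\<dots> = (\<Sum>k\<in>?A. c k *\<^sub>q Edual k) + (d *\<^sub>q Edual b)" unfolding sum.distrib using A by simp
  also have "(\<Sum>k\<in>?A. c k *\<^sub>q Edual k) = x" unfolding c(4)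
    using A by (intro sum.mono_neutral_right) auto
  finally have "x + (d *\<^sub>q Edual b) = (\<Sum>b | c' b \<noteq> 0. c' b *\<^sub>q Edual b)" by simp
  moreover have "finite {b. c' b \<noteq> 0}" "{b. c' b \<noteq> 0} \<subseteq> S" using finite_subset[OF sub A] sub c step by auto
  moreover have "range c' \<subseteq> inv_v_int_polys" using c step inv_v_int_polys_closed(1) by (auto simp: c'_def)
  ultimately show ?case by blast
qed

definition cone :: "(rlabel \<Rightarrow> int) set" where
  "cone = {f. \<exists>c :: int \<Rightarrow> nat. \<forall>k. f k = (\<Sum>i = 1..n. int (c i) * vvec n i k)}"

lemma cone_zero: "(\<lambda>_. 0) \<in> cone" unfolding cone_def by (auto intro!: exI[of _ "\<lambda>_. 0"])

lemma cone_add: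
  assumes "f \<in> cone" "s \<in> {1..n}" "\<And>k. g k = f k + vvec n s k"
  shows "g \<in> cone"
proof -
  obtain c :: "int \<Rightarrow> nat" where c: "\<And>k. f k = (\<Sum>i = 1..n. int (c i) * vvec n i k)"
    using assms(1) by (auto simp: cone_def)
  have "g k = (\<Sum>i = 1..n. int ((c(s := Suc (c s))) i) * vvec n i k)" for k
  proof -
    have "(\<Sum>i = 1..n. int ((c(s := Suc (c s))) i) * vvec n i k)
      = (\<Sum>i = 1..n. int (c i) * vvec n i k + (if i = s then vvec n s k else 0))"
      by (intro sum.cong) (auto simp: algebra_simps)
    then show ?thesis using assms(2,3) by (simp add: sum.distrib c)
  qed
  then show ?thesis unfolding cone_def by blast
qed

definition zind :: "int \<Rightarrow> int \<Rightarrow> int" where "zind s t = (if t = s \<and> s \<in> {1..n} then 1 else 0)"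

lemma vvec_labels:
  "vvec n s (ylabel t) = (if t = s then 1 else 0)"
  "s \<in> {1..n} \<Longrightarrow> vvec n s (zlabel t) = zind s t - zind (s - 1) t - zind (s + 1) t"
  by (auto simp: vvec_def zlabel_in zind_def)

lemma vvec_other: "k \<notin> range ylabel \<Longrightarrow> k \<notin> range zlabel \<Longrightarrow> vvec n s k = 0"
  by (auto simp: vvec_def)

lemma label_cases:
  obtains t where "k = ylabel t" | t where "k = zlabel t" | "k \<notin> range ylabel" "k \<notin> range zlabel"
  by blast

definition lead :: "int \<Rightarrow> int \<Rightarrow> rlabel \<Rightarrow> nat" where
  "lead a j = (\<lambda>k. if k \<in> ylabel ` {a..j} then 1 else 0)"

lemma lead_labels: "lead a j (ylabel t) = (if a \<le> t \<and> t \<le> j then 1 else 0)" "lead a j (zlabel t) = 0"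
  "k \<notin> range ylabel \<Longrightarrow> lead a j k = 0"
  by (auto simp: lead_def)

lemma other_labels:
  assumes "k \<notin> range ylabel" "k \<notin> range zlabel"
  shows "addy s b k = b k" "addz s b k = b k"
  using assms by (auto simp: addy_def addz_def)

lemma lead_addy: "a \<le> j \<Longrightarrow> lead a j = addy j (lead a (j - 1))"
  by (rule ext, rule_tac k = x in label_cases) (auto simp: lead_labels other_labels)

lemma addy_inject:
  assumes "addy s b = addy s c" shows "b = c"
proof
  show "b k = c k" for k using fun_cong[OF assms, of k] by (cases "k = ylabel s") (simp_all add: addy_def)
qed

text \<open>
  A property of all exponents in the expansion of \<open>\<Delta>\<^sub>a\<^sub>,\<^sub>j\<close>. Besides the range of the indices and the condition
  in the definition of \<open>S(a)\<close> it contains two bounds for the uppermost entries, which are what makes the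
  exponents of \<open>v\<close> in the next recursion steps negative.
\<close>

definition admissible :: "int \<Rightarrow> int \<Rightarrow> (rlabel \<Rightarrow> nat) \<Rightarrow> bool" where
  "admissible a j b \<longleftrightarrow> b \<in> exponents n \<and>
    (\<forall>s. b (ylabel s) \<noteq> 0 \<longrightarrow> a \<le> s \<and> s \<le> j) \<and> (\<forall>s. b (zlabel s) \<noteq> 0 \<longrightarrow> a - 1 \<le> s \<and> s \<le> j + 1) \<and>
    b (ylabel j) + b (zlabel (j + 1)) \<le> 1 \<and>
    b (ylabel (j - 1)) + b (zlabel j) + b (zlabel (j + 1)) \<le> (if a < j then 1 else 0) \<and>
    (\<lambda>k. int (lead a j k) - int (b k)) \<in> cone"

lemma exponents_add:
  assumes "b \<in> exponents n"
  shows "s \<in> {1..n} \<Longrightarrow> addy s b \<in> exponents n" "addz s b \<in> exponents n"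
  using assms ylabel_in[of s] zlabel_in[of s] by (auto simp: exponents_def addy_def addz_def)

lemma admissible_lead: "1 \<le> a \<Longrightarrow> j \<le> n \<Longrightarrow> admissible a j (lead a j)"
proof -
  assume a: "1 \<le> a" "j \<le> n"
  have "ylabel ` {a..j} \<subseteq> set (rlabels n)" using a by (auto intro!: yz_labels)
  then have "lead a j \<in> exponents n" unfolding exponents_def lead_def by fastforce
  then show ?thesis using cone_zero by (simp add: admissible_def lead_labels)
qed

text \<open>
  The terms of the expanded recursion take the difference to the leading exponent and add \<open>0\<close> to it,
  \<open>v\<^sub>j\<^sub>-\<^sub>1 + v\<^sub>j\<close> (this for the second term, also if \<open>j = a + 1\<close>) or \<open>v\<^sub>j\<^sub>-\<^sub>2 + v\<^sub>j\<^sub>-\<^sub>1 + v\<^sub>j\<close>.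
\<close>

lemma admissible_addy:
  assumes "admissible a (j - 1) b" "a < j" "1 \<le> a" "j \<le> n"
  shows "admissible a j (addy j b)"
proof -
  have s: "\<And>s. b (ylabel s) \<noteq> 0 \<Longrightarrow> a \<le> s \<and> s \<le> j - 1" "\<And>s. b (zlabel s) \<noteq> 0 \<Longrightarrow> a - 1 \<le> s \<and> s \<le> j"
    using assms(1) by (auto simp: admissible_def)
  have 0: "b (ylabel j) = 0" "b (zlabel (j + 1)) = 0" using s(1)[of j] s(2)[of "j + 1"] by auto
  have "(\<lambda>k. int (lead a j k) - int (addy j b k)) = (\<lambda>k. int (lead a (j - 1) k) - int (b k))"
    unfolding lead_addy[OF less_imp_le[OF assms(2)]] by (auto simp: addy_def)
  moreover have "addy j b \<in> exponents n" using assms by (intro exponents_add) (auto simp: admissible_def)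
  moreover have "a \<le> t \<and> t \<le> j" if "addy j b (ylabel t) \<noteq> 0" for t using that s(1)[of t] assms(2) by (auto split: if_splits)
  moreover have "a - 1 \<le> t \<and> t \<le> j + 1" if "addy j b (zlabel t) \<noteq> 0" for t using that s(2)[of t] by auto
  ultimately show ?thesis using assms 0 by (auto simp: admissible_def)
qed

lemma admissible_two:
  assumes "1 \<le> a" "j = a + 1" "j \<le> n"
  shows "admissible a j (addz (j + 1) (addz (a - 1) (lead a (a - 1))))"
proof -
  let ?b = "addz (j + 1) (addz (a - 1) (lead a (a - 1)))"
  have 0: "lead a (a - 1) = (\<lambda>_. 0)" by (simp add: lead_def)
  have c: "(\<lambda>k. 0 + vvec n a k) \<in> cone"
    by (rule cone_add[OF cone_zero, of a]) (use assms in auto)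
  have "(\<lambda>k. int (lead a j k) - int (?b k)) \<in> cone"
  proof (rule cone_add[OF c, of j])
    show "int (lead a j k) - int (?b k) = 0 + vvec n a k + vvec n j k" for k
      by (rule label_cases[of k])
        (use assms in \<open>auto simp: lead_labels other_labels vvec_other vvec_labels zind_def 0\<close>)
  qed (use assms in auto)
  moreover have "?b \<in> exponents n" by (intro exponents_add) (simp add: exponents_def 0)
  ultimately show ?thesis using assms by (auto simp: admissible_def 0)
qed

lemma admissible_y:
  assumes "admissible a (j - 3) b" "1 \<le> a" "a + 2 \<le> j" "j \<le> n"
  shows "admissible a j (addz (j + 1) (addy (j - 2) (addz (j - 2) b)))"
proof -
  let ?b = "addz (j + 1) (addy (j - 2) (addz (j - 2) b))"
  have s: "\<And>s. b (ylabel s) \<noteq> 0 \<Longrightarrow> a \<le> s \<and> s \<le> j - 3" "\<And>s. b (zlabel s) \<noteq> 0 \<Longrightarrow> a - 1 \<le> s \<and> s \<le> j - 2"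
    using assms(1) by (auto simp: admissible_def)
  have 0: "b (ylabel (j - 2)) = 0" "b (ylabel (j - 1)) = 0" "b (ylabel j) = 0" "b (zlabel j) = 0" "b (zlabel (j + 1)) = 0"
    using s(1)[of "j - 2"] s(1)[of "j - 1"] s(1)[of j] s(2)[of j] s(2)[of "j + 1"] by auto
  have c1: "(\<lambda>k. (int (lead a (j - 3) k) - int (b k)) + vvec n (j - 1) k) \<in> cone"
    by (rule cone_add[of _ "j - 1"]) (use assms in \<open>auto simp: admissible_def\<close>)
  have "(\<lambda>k. int (lead a j k) - int (?b k)) \<in> cone"
  proof (rule cone_add[OF c1, of j])
    show "int (lead a j k) - int (?b k) = int (lead a (j - 3) k) - int (b k) + vvec n (j - 1) k + vvec n j k" for k
      by (rule label_cases[of k])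
        (use assms(2-) in \<open>auto simp: lead_labels other_labels vvec_other vvec_labels zind_def\<close>)
  qed (use assms in auto)
  moreover have "?b \<in> exponents n" using assms by (intro exponents_add) (auto simp: admissible_def)
  moreover have "a \<le> t \<and> t \<le> j" if "?b (ylabel t) \<noteq> 0" for t using that s(1)[of t] assms(3) by (auto split: if_splits)
  moreover have "a - 1 \<le> t \<and> t \<le> j + 1" if "?b (zlabel t) \<noteq> 0" for t using that s(2)[of t] assms(3) by (auto split: if_splits)
  ultimately show ?thesis using assms(2-) 0 by (auto simp: admissible_def)
qed

lemma admissible_z:
  assumes "admissible a (j - 3) b" "1 \<le> a" "a + 2 \<le> j" "j \<le> n"
  shows "admissible a j (addz (j + 1) (addz (j - 1) (addz (j - 3) b)))"
proof -
  let ?b = "addz (j + 1) (addz (j - 1) (addz (j - 3) b))"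
  have s: "\<And>s. b (ylabel s) \<noteq> 0 \<Longrightarrow> a \<le> s \<and> s \<le> j - 3" "\<And>s. b (zlabel s) \<noteq> 0 \<Longrightarrow> a - 1 \<le> s \<and> s \<le> j - 2"
    using assms(1) by (auto simp: admissible_def)
  have 0: "b (ylabel (j - 2)) = 0" "b (ylabel (j - 1)) = 0" "b (ylabel j) = 0" "b (zlabel j) = 0" "b (zlabel (j + 1)) = 0"
    using s(1)[of "j - 2"] s(1)[of "j - 1"] s(1)[of j] s(2)[of j] s(2)[of "j + 1"] by auto
  have c1: "(\<lambda>k. (int (lead a (j - 3) k) - int (b k)) + vvec n (j - 2) k) \<in> cone"
    by (rule cone_add[of _ "j - 2"]) (use assms in \<open>auto simp: admissible_def\<close>)
  have c2: "(\<lambda>k. (int (lead a (j - 3) k) - int (b k)) + vvec n (j - 2) k + vvec n (j - 1) k) \<in> cone"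
    by (rule cone_add[OF c1, of "j - 1"]) (use assms in auto)
  have "(\<lambda>k. int (lead a j k) - int (?b k)) \<in> cone"
  proof (rule cone_add[OF c2, of j])
    show "int (lead a j k) - int (?b k) = int (lead a (j - 3) k) - int (b k) + vvec n (j - 2) k + vvec n (j - 1) k + vvec n j k" for k
      by (rule label_cases[of k])
        (use assms(2-) in \<open>auto simp: lead_labels other_labels vvec_other vvec_labels zind_def\<close>)
  qed (use assms in auto)
  moreover have "?b \<in> exponents n" using assms by (intro exponents_add) (auto simp: admissible_def)
  moreover have "a \<le> t \<and> t \<le> j" if "?b (ylabel t) \<noteq> 0" for t using that s(1)[of t] assms(3) by (auto split: if_splits)
  moreover have "a - 1 \<le> t \<and> t \<le> j + 1" if "?b (zlabel t) \<noteq> 0" for t using that s(2)[of t] assms(3) by (auto split: if_splits)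
  ultimately show ?thesis using assms(2-) 0 by (auto simp: admissible_def)
qed

lemma mul_assoc: "mul j (mul j x y) z = mul j x (mul j y z)"
  by (simp add: mul_def mult.assoc)

lemma pd_mul: "i \<in> {1..n} \<Longrightarrow> even i = even j \<Longrightarrow> pd i = mul j (zd i) (yd i) - vs (-1) (mul j (zd (i - 1)) (zd (i + 1)))"
  using zz_eig(2)[of i] by (simp add: pd_def mul_def)

text \<open>
  The defining recursion with \<open>p\<^sub>j\<^sub>-\<^sub>2\<close> written out and the generators multiplied one at a time.
\<close>

lemma minor_mul:
  "j = a + 1 \<Longrightarrow> minor a j = mul j (yd a) (yd j) - vs (-1) (mul j (zd (a - 1)) (zd (j + 1)))"
  "1 \<le> a \<Longrightarrow> a + 2 \<le> j \<Longrightarrow> j \<le> n \<Longrightarrow> minor a j = mul j (minor a (j - 1)) (yd j)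
    - vs (Aexp a j) (mul j (mul j (mul j (minor a (j - 3)) (zd (j - 2))) (yd (j - 2))) (zd (j + 1)))
    + vs (Aexp a j - 1) (mul j (mul j (mul j (minor a (j - 3)) (zd (j - 3))) (zd (j - 1))) (zd (j + 1)))"
proof -
  show "minor a j = mul j (yd a) (yd j) - vs (-1) (mul j (zd (a - 1)) (zd (j + 1)))" if "j = a + 1"
    using minor_rec[of a j] that by (simp add: mul_def PL_def PR_def Aexp_def)
  assume a: "1 \<le> a" "a + 2 \<le> j" "j \<le> n"
  have p: "pd (j - 2) = mul j (zd (j - 2)) (yd (j - 2)) - vs (-1) (mul j (zd (j - 3)) (zd (j - 1)))"
    using pd_mul[of "j - 2" j] a by simp
  have "minor a j = mul j (minor a (j - 1)) (yd j) - vs (Aexp a j) (mul j (mul j (minor a (j - 3)) (pd (j - 2))) (zd (j + 1)))"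
    using minor_rec[of a j] a by (simp add: mul_def PL_def PR_def mult.assoc)
  also have "mul j (minor a (j - 3)) (pd (j - 2)) = mul j (mul j (minor a (j - 3)) (zd (j - 2))) (yd (j - 2))
    - vs (-1) (mul j (mul j (minor a (j - 3)) (zd (j - 3))) (zd (j - 1)))"
    unfolding p mul_assoc by (simp add: mul_def algebra_simps)
  finally show "minor a j = mul j (minor a (j - 1)) (yd j)
    - vs (Aexp a j) (mul j (mul j (mul j (minor a (j - 3)) (zd (j - 2))) (yd (j - 2))) (zd (j + 1)))
    + vs (Aexp a j - 1) (mul j (mul j (mul j (minor a (j - 3)) (zd (j - 3))) (zd (j - 1))) (zd (j + 1)))"
    by (simp add: algebra_simps)
qed

lemma Edual_zero: "Edual (lead a (a - 1)) = 1"
proof -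
  have "lead a (a - 1) = (\<lambda>_. 0)" by (simp add: lead_def)
  moreover have "prod_list (map (\<lambda>k. 1 :: 'n uq) ks) = 1" for ks :: "rlabel list" by (induction ks) auto
  ultimately show ?thesis by (simp add: Edual_def pbw_dual_eq numeral_2_eq_2)
qed

lemma Edual_term_y:
  assumes "admissible a (j - 3) b" "1 \<le> a" "a + 2 \<le> j" "j \<le> n"
  shows "\<exists>e. e \<le> (if a < j - 3 then 1 else 0) \<and>
    mul j (mul j (mul j (Edual b) (zd (j - 2))) (yd (j - 2))) (zd (j + 1)) = vs e (Edual (addz (j + 1) (addy (j - 2) (addz (j - 2) b))))"
proof -
  have s: "\<And>s. b (ylabel s) \<noteq> 0 \<Longrightarrow> a \<le> s \<and> s \<le> j - 3" "\<And>s. b (zlabel s) \<noteq> 0 \<Longrightarrow> a - 1 \<le> s \<and> s \<le> j - 2"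
    using assms(1) by (auto simp: admissible_def)
  have 0: "b (ylabel (j - 2)) = 0" "b (ylabel j) = 0" "b (ylabel (j + 2)) = 0" "b (zlabel (j - 1)) = 0" "b (zlabel (j + 1)) = 0"
    using s(1)[of "j - 2"] s(1)[of j] s(1)[of "j + 2"] s(2)[of "j - 1"] s(2)[of "j + 1"] by auto
  have b: "b \<in> exponents n" using assms(1) by (simp add: admissible_def)
  let ?b1 = "addz (j - 2) b" and ?b2 = "addy (j - 2) (addz (j - 2) b)"
  have b1: "?b1 \<in> exponents n" using exponents_add(2)[OF b] .
  have b2: "?b2 \<in> exponents n" using exponents_add(1)[OF b1] assms by auto
  have "mul j (Edual b) (zd (j - 2)) = vs (int (zd_exponent True b (j - 2))) (Edual ?b1)"
    using Edual_zd[of "j - 2" b j] assms b 0 by simp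
  moreover have "mul j (Edual ?b1) (yd (j - 2)) = Edual ?b2" using Edual_yd[of "j - 2" j ?b1] assms 0 by simp
  moreover have "mul j (Edual ?b2) (zd (j + 1)) = Edual (addz (j + 1) ?b2)"
  proof -
    have "zd_exponent False ?b2 (j + 1) = 0" using 0 assms by (simp add: zd_exponent_def add.commute)
    then show ?thesis using Edual_zd[of "j + 1" ?b2 j] assms b2 0 by simp
  qed
  moreover have "int (zd_exponent True b (j - 2)) \<le> (if a < j - 3 then 1 else 0)"
    using assms 0 by (auto simp: zd_exponent_def admissible_def)
  ultimately show ?thesis by (intro exI[of _ "int (zd_exponent True b (j - 2))"]) simp
qed

lemma Edual_term_z:
  assumes "admissible a (j - 3) b" "1 \<le> a" "a + 2 \<le> j" "j \<le> n"
  shows "\<exists>e. e \<le> (if a < j - 3 then 1 else 0) \<and>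
    mul j (mul j (mul j (Edual b) (zd (j - 3))) (zd (j - 1))) (zd (j + 1)) = vs e (Edual (addz (j + 1) (addz (j - 1) (addz (j - 3) b))))"
proof -
  have s: "\<And>s. b (ylabel s) \<noteq> 0 \<Longrightarrow> a \<le> s \<and> s \<le> j - 3" "\<And>s. b (zlabel s) \<noteq> 0 \<Longrightarrow> a - 1 \<le> s \<and> s \<le> j - 2"
    using assms(1) by (auto simp: admissible_def)
  have 0: "b (ylabel (j - 2)) = 0" "b (ylabel j) = 0" "b (ylabel (j + 2)) = 0" "b (zlabel (j - 1)) = 0" "b (zlabel (j + 1)) = 0"
    using s(1)[of "j - 2"] s(1)[of j] s(1)[of "j + 2"] s(2)[of "j - 1"] s(2)[of "j + 1"] by auto
  have b: "b \<in> exponents n" using assms(1) by (simp add: admissible_def)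
  let ?b1 = "addz (j - 3) b" and ?b2 = "addz (j - 1) (addz (j - 3) b)"
  have b1: "?b1 \<in> exponents n" using exponents_add(2)[OF b] .
  have b2: "?b2 \<in> exponents n" using exponents_add(2)[OF b1] .
  have "mul j (Edual b) (zd (j - 3)) = vs (int (zd_exponent False b (j - 3))) (Edual ?b1)"
    using Edual_zd[of "j - 3" b j] assms b by simp
  moreover have "mul j (Edual ?b1) (zd (j - 1)) = Edual ?b2"
  proof -
    have "zd_exponent False ?b1 (j - 1) = 0" using 0 assms by (simp add: zd_exponent_def)
    then show ?thesis using Edual_zd[of "j - 1" ?b1 j] assms b1 by simp
  qed
  moreover have "mul j (Edual ?b2) (zd (j + 1)) = Edual (addz (j + 1) ?b2)"
  proof -
    have "zd_exponent False ?b2 (j + 1) = 0" using 0 assms by (simp add: zd_exponent_def add.commute)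
    then show ?thesis using Edual_zd[of "j + 1" ?b2 j] assms b2 by simp
  qed
  moreover have "int (zd_exponent False b (j - 3)) \<le> (if a < j - 3 then 1 else 0)"
    using assms 0 by (auto simp: zd_exponent_def admissible_def)
  ultimately show ?thesis by (intro exI[of _ "int (zd_exponent False b (j - 3))"]) simp
qed

text \<open>
  By \<open>Edual_yd\<close> and \<open>Edual_zd\<close> the three terms of the expanded recursion map dual PBW elements to dual PBW elements
  up to powers of \<open>v\<close>. The first term carries no power of \<open>v\<close> and yields the leading term. In the other two
  the degree bounds limit the new exponent to 1, and to 0 for \<open>j - a \<le> 3\<close>; this is why \<open>Aexp\<close> is \<open>-2\<close>
  in general and \<open>-1\<close> for \<open>j - a \<le> 3\<close>.
\<close>

lemma minor_expansion:
  assumes a: "1 \<le> a" and j: "a - 1 \<le> j" "j \<le> n"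
  shows "minor a j - Edual (lead a j) \<in> inv_v_comb {b. admissible a j b \<and> b \<noteq> lead a j}"
  using j
proof (induction "nat (j - a + 1)" arbitrary: j rule: less_induct)
  case less
  have one: "Edual (lead a a) = yd a" if "a \<le> n"
    using Edual_yd[of a a "lead a (a - 1)"] a that by (simp add: Edual_zero lead_addy[of a a] lead_labels)
  consider "j = a - 1" | "j = a" | "j = a + 1" | "a + 2 \<le> j" using less.prems by linarith
  then show ?case
  proof cases
    case 1
    then show ?thesis by (simp add: Edual_zero inv_v_comb.zero)
  next
    case 2
    then show ?thesis using one less.prems by (simp add: inv_v_comb.zero)
  next
    case 3
    let ?b0 = "lead a (a - 1)"
    let ?b1 = "addz (a - 1) ?b0"
    have b0: "?b0 \<in> exponents n" by (simp add: lead_def exponents_def)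
    have b1: "?b1 \<in> exponents n" using b0 by (intro exponents_add)
    have y: "mul j (yd a) (yd j) = Edual (lead a j)"
      using Edual_yd[of j j "lead a a"] 3 a less.prems one lead_addy[of a j] by (simp add: lead_labels)
    have z1: "zd (a - 1) = Edual ?b1"
    proof -
      have "zd_exponent True ?b0 (a - 1) = 0" by (simp add: zd_exponent_def lead_labels)
      then show ?thesis using Edual_zd[of "a - 1" ?b0 "a - 1"] a 3 less.prems b0 by (simp add: Edual_zero lead_labels)
    qed
    have z2: "mul j (Edual ?b1) (zd (j + 1)) = Edual (addz (j + 1) ?b1)"
    proof -
      have "zd_exponent False ?b1 (j + 1) = 0" using 3 by (simp add: zd_exponent_def lead_labels)
      then show ?thesis using Edual_zd[of "j + 1" ?b1 j] a 3 less.prems b1 by simp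
    qed
    have "addz (j + 1) ?b1 (ylabel j) \<noteq> lead a j (ylabel j)" using 3 by (simp add: lead_labels)
    then have "addz (j + 1) ?b1 \<noteq> lead a j" by metis
    then have "vs (-1) (Edual (addz (j + 1) ?b1)) \<in> inv_v_comb {b. admissible a j b \<and> b \<noteq> lead a j}"
      using admissible_two[OF a 3 less.prems(2)] by (intro inv_v_comb_vs) auto
    then have "- vs (-1) (Edual (addz (j + 1) ?b1)) \<in> inv_v_comb {b. admissible a j b \<and> b \<noteq> lead a j}" by (rule inv_v_comb_uminus)
    moreover have "minor a j - Edual (lead a j) = - vs (-1) (Edual (addz (j + 1) ?b1))"
      unfolding minor_mul(1)[OF 3] y unfolding z1 z2 by simp
    ultimately show ?thesis by simp
  next
    case 4
    let ?S = "{b. admissible a j b \<and> b \<noteq> lead a j}"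
    have A: "Aexp a j + (if a < j - 3 then 1 else 0) = -1" by (simp add: Aexp_def)
    have jn: "j \<in> {1..n}" using 4 a less.prems by simp
    have IH: "minor a (j - 1) - Edual (lead a (j - 1)) \<in> inv_v_comb {b. admissible a (j - 1) b \<and> b \<noteq> lead a (j - 1)}"
      "minor a (j - 3) - Edual (lead a (j - 3)) \<in> inv_v_comb {b. admissible a (j - 3) b \<and> b \<noteq> lead a (j - 3)}"
      using less.hyps[of "j - 1"] less.hyps[of "j - 3"] 4 less.prems by simp_all
    have t1: "mul j (minor a (j - 1) - Edual (lead a (j - 1))) (yd j) \<in> inv_v_comb ?S"
    proof (rule inv_v_comb_map[OF IH(1)])
      fix b assume b: "b \<in> {b. admissible a (j - 1) b \<and> b \<noteq> lead a (j - 1)}"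
      then have "b (ylabel j) = 0" by (auto simp: admissible_def)
      then have "mul j (Edual b) (yd j) = vs 0 (Edual (addy j b))" using Edual_yd[OF jn, of j b] by simp
      moreover have "addy j b \<noteq> lead a j"
      proof
        assume "addy j b = lead a j"
        then have "addy j b = addy j (lead a (j - 1))" using 4 by (simp add: lead_addy[of a j])
        then show False using b addy_inject by auto
      qed
      moreover have "admissible a j (addy j b)" using b 4 a less.prems by (intro admissible_addy) auto
      ultimately show "\<exists>e b'. e \<le> 0 \<and> b' \<in> ?S \<and> mul j (Edual b) (yd j) = vs e (Edual b')" by blast
    qed simp_all
    have le: "mul j (Edual (lead a (j - 1))) (yd j) = Edual (lead a j)"
      using Edual_yd[OF jn, of j "lead a (j - 1)"] 4 lead_addy[of a j] by (simp add: lead_labels)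
    have lead3: "admissible a (j - 3) (lead a (j - 3))" using a less.prems by (intro admissible_lead) auto
    have y0: "b (ylabel j) = 0" if "admissible a (j - 3) b" for b using that by (auto simp: admissible_def)
    have t2: "vs (Aexp a j) (mul j (mul j (mul j (minor a (j - 3)) (zd (j - 2))) (yd (j - 2))) (zd (j + 1))) \<in> inv_v_comb ?S"
    proof (rule inv_v_comb_map_leading[OF IH(2)])
      fix b assume "b \<in> insert (lead a (j - 3)) {b. admissible a (j - 3) b \<and> b \<noteq> lead a (j - 3)}"
      then have b: "admissible a (j - 3) b" using lead3 by auto
      let ?b = "addz (j + 1) (addy (j - 2) (addz (j - 2) b))"
      obtain e where e: "e \<le> (if a < j - 3 then 1 else 0)"
        "mul j (mul j (mul j (Edual b) (zd (j - 2))) (yd (j - 2))) (zd (j + 1)) = vs e (Edual ?b)"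
        using Edual_term_y[OF b a 4 less.prems(2)] by blast
      have "?b (ylabel j) \<noteq> lead a j (ylabel j)" using y0[OF b] 4 by (simp add: lead_labels)
      then have "?b \<noteq> lead a j" by metis
      then have "?b \<in> ?S" using admissible_y[OF b a 4 less.prems(2)] by simp
      moreover have "Aexp a j + e < 0" using e(1) A by linarith
      ultimately show "\<exists>e b'. e < 0 \<and> b' \<in> ?S \<and>
        vs (Aexp a j) (mul j (mul j (mul j (Edual b) (zd (j - 2))) (yd (j - 2))) (zd (j + 1))) = vs e (Edual b')"
        unfolding e(2) vs_vs by blast
    qed (simp_all add: vs_qscale)
    have t3: "vs (Aexp a j - 1) (mul j (mul j (mul j (minor a (j - 3)) (zd (j - 3))) (zd (j - 1))) (zd (j + 1))) \<in> inv_v_comb ?S"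
    proof (rule inv_v_comb_map_leading[OF IH(2)])
      fix b assume "b \<in> insert (lead a (j - 3)) {b. admissible a (j - 3) b \<and> b \<noteq> lead a (j - 3)}"
      then have b: "admissible a (j - 3) b" using lead3 by auto
      let ?b = "addz (j + 1) (addz (j - 1) (addz (j - 3) b))"
      obtain e where e: "e \<le> (if a < j - 3 then 1 else 0)"
        "mul j (mul j (mul j (Edual b) (zd (j - 3))) (zd (j - 1))) (zd (j + 1)) = vs e (Edual ?b)"
        using Edual_term_z[OF b a 4 less.prems(2)] by blast
      have "?b (ylabel j) \<noteq> lead a j (ylabel j)" using y0[OF b] 4 by (simp add: lead_labels)
      then have "?b \<noteq> lead a j" by metis
      then have "?b \<in> ?S" using admissible_z[OF b a 4 less.prems(2)] by simp
      moreover have "Aexp a j - 1 + e < 0" using e(1) A by linarith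
      ultimately show "\<exists>e b'. e < 0 \<and> b' \<in> ?S \<and>
        vs (Aexp a j - 1) (mul j (mul j (mul j (Edual b) (zd (j - 3))) (zd (j - 1))) (zd (j + 1))) = vs e (Edual b')"
        unfolding e(2) vs_vs by blast
    qed (simp_all add: vs_qscale)
    have "minor a j - Edual (lead a j) = mul j (minor a (j - 1) - Edual (lead a (j - 1))) (yd j)
      - vs (Aexp a j) (mul j (mul j (mul j (minor a (j - 3)) (zd (j - 2))) (yd (j - 2))) (zd (j + 1)))
      + vs (Aexp a j - 1) (mul j (mul j (mul j (minor a (j - 3)) (zd (j - 3))) (zd (j - 1))) (zd (j + 1)))"
      unfolding minor_mul(2)[OF a 4 less.prems(2)] mul_simps(3) le by (simp add: algebra_simps)
    then show ?thesis using inv_v_comb_add[OF t3 inv_v_comb_diff[OF t1 t2]] by simp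
  qed
qed

section \<open>Identification with the dual canonical basis\<close>

lemma yelt_yd: "s \<in> {1..n} \<Longrightarrow> yelt T form s = yd s"
  by (simp add: yelt_def yd_def dual_root_vector yz_labels)

lemma zelt_zd: "s \<in> {0..n + 1} \<Longrightarrow> zelt T form s = zd s"
  using dual_root_vector[of "zlabel s"] yz_labels(2)[of s] unfolding zelt_def zd_def n[symmetric] by auto

lemma pelt_pd: "s \<in> {1..n} \<Longrightarrow> pelt T form s = pd s"
  by (simp add: pelt_def pd_def yelt_yd zelt_zd vs_def)

lemma udeg_yd: "s \<in> {1..n} \<Longrightarrow> udeg (yd s) = dy s"
  by (simp add: yd_def dy_def udeg_root_vector yz_labels)

lemma exp_degree_lead:
  assumes "1 \<le> a" "j \<le> n" shows "exp_degree T (lead a j) = Dg a j"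
proof -
  have "exp_degree T (lead a j) = (\<Sum>t\<in>{1..n}. frag_cmul (int (lead a j (ylabel t))) (dy t))
    + (\<Sum>t\<in>{1..n}. frag_cmul (int (lead a j (zlabel t))) (dz t))"
    unfolding exp_degree_def n[symmetric] sum_labels
    by (intro arg_cong2[of _ _ _ _ "(+)"] sum.cong) (auto simp: udeg_root_vector yz_labels dy_def dz_def)
  also have "\<dots> = (\<Sum>t\<in>{1..n}. if t \<in> {a..j} then dy t else 0)"
    by (simp add: lead_labels) (intro sum.cong, auto)
  also have "\<dots> = Dg a j"
    unfolding Dg_def using assms by (subst sum.inter_restrict[symmetric]) (auto intro!: sum.cong)
  finally show ?thesis .
qed

lemma Delta_eq_minor:
  assumes B: "is_dual_canonical_basis T \<sigma> form B" and a: "1 \<le> a" and j: "a - 1 \<le> j" "j \<le> n"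
  shows "Delta B a j = minor a j"
proof -
  have inv: "admissible a j (lead a j)" using a j by (intro admissible_lead) auto
  then have l: "lead a j \<in> exponents (rank TYPE('n))" unfolding n[symmetric] by (simp add: admissible_def)
  obtain c where c: "finite {b. c b \<noteq> 0}" "{b. c b \<noteq> 0} \<subseteq> {b. admissible a j b \<and> b \<noteq> lead a j}"
    "range c \<subseteq> inv_v_int_polys" "minor a j - Edual (lead a j) = (\<Sum>b | c b \<noteq> 0. c b *\<^sub>q Edual b)"
    using inv_v_comb_coefficients[OF minor_expansion[OF a j]] by blast
  have "{b. admissible a j b \<and> b \<noteq> lead a j} \<subseteq> Sset (rank TYPE('n)) (lead a j)"
    unfolding n[symmetric] by (auto simp: Sset_def admissible_def cone_def)
  then have "\<exists>c. finite {b. c b \<noteq> 0} \<and> {b. c b \<noteq> 0} \<subseteq> Sset (rank TYPE('n)) (lead a j) \<and> range c \<subseteq> inv_v_int_polys \<and>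
      minor a j - pbw_dual T form (lead a j) = (\<Sum>b | c b \<noteq> 0. c b *\<^sub>q pbw_dual T form b)"
    using c unfolding Edual_def by (intro exI[of _ c]) blast
  moreover have "\<sigma> (minor a j) = (qvar powi Nweight (exp_degree T (lead a j)) *\<^sub>q minor a j)"
    using eig_minor[OF a j] a j by (simp add: exp_degree_lead eig_def vs_def)
  ultimately have "minor a j = B (lead a j)"
    using B l unfolding is_dual_canonical_basis_def by blast
  then show ?thesis by (cases "j = a - 1") (simp_all add: Delta_def lead_def)
qed

text \<open>
  Among the \<open>y\<^sub>s\<close> with \<open>s < t\<close> of the other parity only \<open>y\<^sub>t\<^sub>-\<^sub>1\<close> and \<open>y\<^sub>t\<^sub>-\<^sub>3\<close> pair nontrivially with \<open>y\<^sub>t\<close>.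
\<close>

lemma rform_opposite_parity:
  assumes "1 \<le> a" "1 \<le> t" "k < t" "t \<le> n"
  shows "rform (dy t) (if odd t then even_degree_sum T form a k else odd_degree_sum T form a k) =
    (if a \<le> t - 1 \<and> t - 1 \<le> k then kap (if odd t then t else t - 1) else 0) + (if a \<le> t - 3 \<and> t - 3 \<le> k then 1 else 0)"
proof -
  let ?S = "{s. s \<in> {a..k} \<and> odd s \<noteq> odd t}"
  have "(if odd t then even_degree_sum T form a k else odd_degree_sum T form a k) = (\<Sum>s\<in>?S. dy s)"
    unfolding even_degree_sum_def odd_degree_sum_def
    using assms by (auto simp: yelt_yd udeg_yd intro!: sum.cong)
  then have "rform (dy t) (if odd t then even_degree_sum T form a k else odd_degree_sum T form a k) = (\<Sum>s\<in>?S. rform (dy t) (dy s))"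
    by (simp add: rform_sum_right)
  also have "\<dots> = (\<Sum>s\<in>{a..k}. (if s = t - 1 then kap (if odd t then t else t - 1) else 0) + (if s = t - 3 then 1 else 0))"
  proof (intro sum.mono_neutral_cong_left ballI)
    show "(if s = t - 1 then kap (if odd t then t else t - 1) else 0) + (if s = t - 3 then 1 else 0) = 0"
      if "s \<in> {a..k} - ?S" for s using that by auto
    show "rform (dy t) (dy s) = (if s = t - 1 then kap (if odd t then t else t - 1) else 0) + (if s = t - 3 then 1 else 0)"
      if "s \<in> ?S" for s
      using that assms by (subst rform_dy_dy) (auto intro: arg_cong[of _ _ kap])
  qed auto
  finally show ?thesis unfolding sum.distrib sum_indicator .
qed

lemma rform_even_degree_sum:
  assumes "1 \<le> a" "1 \<le> t" "k < t" "t \<le> n" "odd t"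
  shows "rform (dy t) (even_degree_sum T form a k) =
    (if a \<le> t - 1 \<and> t - 1 \<le> k then kap t else 0) + (if a \<le> t - 3 \<and> t - 3 \<le> k then 1 else 0)"
  using rform_opposite_parity[OF assms(1-4)] assms(5) by simp

lemma rform_odd_degree_sum:
  assumes "1 \<le> a" "1 \<le> t" "k < t" "t \<le> n" "even t"
  shows "rform (dy t) (odd_degree_sum T form a k) =
    (if a \<le> t - 1 \<and> t - 1 \<le> k then kap (t - 1) else 0) + (if a \<le> t - 3 \<and> t - 3 \<le> k then 1 else 0)"
  using rform_opposite_parity[OF assms(1-4)] assms(5) by simp

end

theorem theorem4p11:
  fixes T :: "int \<Rightarrow> 'n uq \<Rightarrow> 'n uq"
    and \<sigma> :: "'n uq \<Rightarrow> 'n uq"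
    and D :: "int \<Rightarrow> 'n uq \<Rightarrow> 'n uq"
    and form :: "'n uq \<Rightarrow> 'n uq \<Rightarrow> qv"
    and B :: "(rlabel \<Rightarrow> nat) \<Rightarrow> 'n uq"
    and n i j :: int
  assumes n: "n = int CARD('n)" "n \<ge> 3" "odd n"
    and T: "is_braid_automorphisms T"
    and sigma: "is_sigma \<sigma>"
    and D: "is_skew_derivations D"
    and form: "is_kashiwara_form D form"
    and B: "is_dual_canonical_basis T \<sigma> form B"
    and ij: "1 \<le> i" "i \<le> n" "1 \<le> j" "j \<le> n" "j - i \<ge> 2"
  shows
    "let y = yelt T form; z = zelt T form; p = pelt T form; \<Delta> = Delta B; A = Aexp i j;
         d = (\<lambda>s. udeg (y s)); od = odd_degree_sum T form; ev = even_degree_sum T form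
     in
      ((even j \<longrightarrow>
          \<Delta> i j = \<Delta> i (j - 1) * y j
                   - (qvar powi A *\<^sub>q (\<Delta> i (j - 3) * p (j - 2) * z (j + 1))) \<and>
          \<Delta> i j = (qvar powi (- rform (d j) (od i (j - 1))) *\<^sub>q (y j * \<Delta> i (j - 1)))
                   - (qvar powi (- A - rform (d j + d (j - 2)) (od i (j - 3))
                                     - rform (d (j - 1)) (ev i (j - 4)))
                        *\<^sub>q (z (j + 1) * p (j - 2) * \<Delta> i (j - 3)))) \<and>
       (odd j \<longrightarrow>
          \<Delta> i j = y j * \<Delta> i (j - 1)
                   - (qvar powi A *\<^sub>q (z (j + 1) * p (j - 2) * \<Delta> i (j - 3))) \<and>
          \<Delta> i j = (qvar powi (- rform (d j) (ev i (j - 1))) *\<^sub>q (\<Delta> i (j - 1) * y j))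
                   - (qvar powi (- A - rform (d j + d (j - 2)) (ev i (j - 3))
                                     - rform (d (j - 1)) (od i (j - 4)))
                        *\<^sub>q (\<Delta> i (j - 3) * p (j - 2) * z (j + 1))))) \<and>
      ((even j \<longrightarrow>
          \<Delta> i j * z j = \<Delta> i (j - 1) * p j
                   + (qvar powi (1 - rform (d (j - 1)) (ev i (j - 2)))
                        *\<^sub>q (\<Delta> i (j - 2) * p (j - 1) * z (j + 1)))) \<and>
       (odd j \<longrightarrow>
          \<Delta> i j * z j = (qvar powi (- rform (d j) (ev i (j - 1))) *\<^sub>q (\<Delta> i (j - 1) * p j))
                   + (qvar powi (- 1 - rform (d j) (ev i (j - 1)))
                        *\<^sub>q (\<Delta> i (j - 2) * p (j - 1) * z (j + 1))))) \<and>
      (j + 1 \<le> n \<longrightarrow>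
       (even j \<longrightarrow>
          y (j + 1) * \<Delta> i j = (qvar powi (- rform (d (j + 1)) (ev i j)) *\<^sub>q (\<Delta> i j * y (j + 1)))
                   + (qvar powi (- 1 - rform (d (j - 1)) (ev i (j - 2))) * (inverse qvar - qvar)
                        *\<^sub>q (\<Delta> i (j - 2) * p (j - 1) * z (j + 2)))) \<and>
       (odd j \<longrightarrow>
          y (j + 1) * \<Delta> i j = (qvar *\<^sub>q (\<Delta> i j * y (j + 1)))
                   + (qvar powi (1 - rform (d j) (ev i (j - 3))) * (qvar - inverse qvar)
                        *\<^sub>q (\<Delta> i (j - 2) * p (j - 1) * z (j + 2))))) \<and>
      (j + 2 \<le> n \<longrightarrow>
       (even j \<longrightarrow> \<Delta> i j * y (j + 2) = inverse qvar *\<^sub>q (y (j + 2) * \<Delta> i j)) \<and>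
       (odd j \<longrightarrow> \<Delta> i j * y (j + 2) = qvar *\<^sub>q (y (j + 2) * \<Delta> i j)))"
proof -
  interpret sigma_setup T n D form \<sigma>
    using n T sigma D form by unfold_locales auto
  define od ev where "od = odd_degree_sum T form" and "ev = even_degree_sum T form"
  have jn: "j \<in> {1..n}" "j - 1 \<in> {1..n}" "j - 2 \<in> {1..n}" "1 \<le> i" "i + 2 \<le> j" using ij by auto
  have minor: "Delta B i k = minor i k" if "i - 1 \<le> k" "k \<le> j" for k
    using Delta_eq_minor[OF B] that ij by simp
  have Dj: "Delta B i j = minor i j" "Delta B i (j - 1) = minor i (j - 1)" "Delta B i (j - 2) = minor i (j - 2)"
    "Delta B i (j - 3) = minor i (j - 3)" using minor jn by simp_all
  have y: "yelt T form j = yd j" "yelt T form (j - 1) = yd (j - 1)" "yelt T form (j - 2) = yd (j - 2)"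
    and z: "zelt T form j = zd j" "zelt T form (j + 1) = zd (j + 1)"
    and p: "pelt T form j = pd j" "pelt T form (j - 1) = pd (j - 1)" "pelt T form (j - 2) = pd (j - 2)"
    using jn by (simp_all add: yelt_yd zelt_zd pelt_pd)
  have d: "udeg (yd j) = dy j" "udeg (yd (j - 1)) = dy (j - 1)" "udeg (yd (j - 2)) = dy (j - 2)"
    using jn by (simp_all only: udeg_yd)
  have PL: "PL i (j - 1) = minor i (j - 3) * pd (j - 2)" "PL i j = minor i (j - 2) * pd (j - 1)"
    "PL i (j + 1) = minor i (j - 1) * pd j" and PR: "PR i (j - 1) = pd (j - 2) * minor i (j - 3)"
    using jn by (simp_all add: PL_def PR_def)
  have recursions:
    "(even j \<longrightarrow> minor i j = minor i (j - 1) * yd j - vs (Aexp i j) (minor i (j - 3) * pd (j - 2) * zd (j + 1)) \<and>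
       minor i j = vs (- rform (dy j) (od i (j - 1))) (yd j * minor i (j - 1))
         - vs (- Aexp i j - rform (dy j + dy (j - 2)) (od i (j - 3)) - rform (dy (j - 1)) (ev i (j - 4)))
             (zd (j + 1) * pd (j - 2) * minor i (j - 3))) \<and>
     (odd j \<longrightarrow> minor i j = yd j * minor i (j - 1) - vs (Aexp i j) (zd (j + 1) * pd (j - 2) * minor i (j - 3)) \<and>
       minor i j = vs (- rform (dy j) (ev i (j - 1))) (minor i (j - 1) * yd j)
         - vs (- Aexp i j - rform (dy j + dy (j - 2)) (ev i (j - 3)) - rform (dy (j - 1)) (od i (j - 4)))
             (minor i (j - 3) * pd (j - 2) * zd (j + 1)))"
  proof (cases "even j")
    case True
    have "- rform (dy j) (od i (j - 1)) = arx i j"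
      using True jn even_range[of j] unfolding od_def
      by (subst rform_odd_degree_sum) (auto simp: arx_def cx_def kap_def sg_def)
    moreover have "- Aexp i j - rform (dy j + dy (j - 2)) (od i (j - 3)) - rform (dy (j - 1)) (ev i (j - 4)) = brx i j"
      using True jn even_range[of j] unfolding od_def ev_def
      by (auto simp: rform_add_left rform_odd_degree_sum rform_even_degree_sum
          brx_def Aexp_def pip_def piexp_def sg_def kap_def)
    ultimately show ?thesis
      using True jn minor_rec[of i j] right_rec[of i j] by (simp add: PL PR mult.assoc)
  next
    case False
    have "- rform (dy j) (ev i (j - 1)) = alx i j"
      using False jn unfolding ev_def
      by (subst rform_even_degree_sum) (auto simp: alx_def kap_def)
    moreover have "- Aexp i j - rform (dy j + dy (j - 2)) (ev i (j - 3)) - rform (dy (j - 1)) (od i (j - 4)) = bex i j"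
      using False jn unfolding od_def ev_def
      by (auto simp: rform_add_left rform_odd_degree_sum rform_even_degree_sum bex_def Aexp_def kap_def)
    moreover have "left_rec i j" using minor_identities(2)[of i j] jn by simp
    ultimately show ?thesis
      using False jn minor_rec[of i j] by (simp add: PL PR mult.assoc left_rec_def)
  qed
  have exchange:
    "(even j \<longrightarrow> minor i j * zd j = minor i (j - 1) * pd j
       + vs (1 - rform (dy (j - 1)) (ev i (j - 2))) (minor i (j - 2) * pd (j - 1) * zd (j + 1))) \<and>
     (odd j \<longrightarrow> minor i j * zd j = vs (- rform (dy j) (ev i (j - 1))) (minor i (j - 1) * pd j)
       + vs (- 1 - rform (dy j) (ev i (j - 1))) (minor i (j - 2) * pd (j - 1) * zd (j + 1)))"
  proof (cases "even j")
    case True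
    have "1 - rform (dy (j - 1)) (ev i (j - 2)) = sg j + alx i j + alx i (j - 1)"
      using True jn unfolding ev_def
      by (subst rform_even_degree_sum) (auto simp: alx_def kap_def sg_def)
    then show ?thesis
      using minor_identities(1)[of i j] True jn by (simp add: exch_def PL) (simp add: alx_def)
  next
    case False
    have "rform (dy j) (ev i (j - 1)) = - alx i j"
      using False jn unfolding ev_def by (subst rform_even_degree_sum) (auto simp: alx_def kap_def)
    moreover have "alx i (j - 1) = 0" "sg j = -1" using False by (simp_all add: alx_def sg_def)
    ultimately show ?thesis
      using minor_identities(1)[of i j] False jn by (simp add: exch_def PL)
  qed
  have commute:
    "(even j \<longrightarrow> yd (j + 1) * minor i j = vs (- rform (dy (j + 1)) (ev i j)) (minor i j * yd (j + 1))
       + (qvar powi (- 1 - rform (dy (j - 1)) (ev i (j - 2))) * (inverse qvar - qvar)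
            *\<^sub>q (minor i (j - 2) * pd (j - 1) * zd (j + 2)))) \<and>
     (odd j \<longrightarrow> yd (j + 1) * minor i j = vs 1 (minor i j * yd (j + 1))
       + (qvar powi (1 - rform (dy j) (ev i (j - 3))) * (qvar - inverse qvar)
            *\<^sub>q (minor i (j - 2) * pd (j - 1) * zd (j + 2))))"
    if j1: "j + 1 \<le> n"
  proof -
    have e: "j + 1 - 1 = j" "j + 1 + 1 = j + 2" by auto
    have c: "yd (j + 1) * minor i j = vs (cx i (j + 1)) (minor i j * yd (j + 1))
        + (vs (tx i (j + 1) + sg (j + 1)) (minor i (j - 2) * pd (j - 1) * zd (j + 2))
        - vs (tx i (j + 1) - sg (j + 1)) (minor i (j - 2) * pd (j - 1) * zd (j + 2)))"
      using minor_identities(3)[of i "j + 1"] jn j1 unfolding commutation_def e PL(2) by simp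
    have v: "vs (e + 1) x - vs (e - 1) x = (qvar powi e * (qvar - inverse qvar)) *\<^sub>q x"
      "vs (e - 1) x - vs (e + 1) x = (qvar powi e * (inverse qvar - qvar)) *\<^sub>q x" for e and x :: "'n uq"
      by (simp_all add: vs_def power_int_add power_int_diff right_diff_distrib divide_inverse uq.scale_left_diff_distrib)
    show ?thesis
    proof (cases "even j")
      case True
      have "- rform (dy (j + 1)) (ev i j) = cx i (j + 1)"
        using True jn j1 unfolding ev_def
        by (subst rform_even_degree_sum) (auto simp: cx_def kap_def sg_def)
      moreover have "- 1 - rform (dy (j - 1)) (ev i (j - 2)) = tx i (j + 1)"
        using True jn j1 unfolding ev_def
        by (subst rform_even_degree_sum) (auto simp: tx_def alx_def kap_def sg_def)
      moreover have "sg (j + 1) = -1" using True by (simp add: sg_def)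
      ultimately show ?thesis using c True v(2)[of "tx i (j + 1)"] by simp
    next
      case False
      have "1 - rform (dy j) (ev i (j - 3)) = tx i (j + 1)"
        using False jn j1 unfolding ev_def
        by (subst rform_even_degree_sum) (auto simp: tx_def alx_def kap_def sg_def)
      moreover have "cx i (j + 1) = 1" using False jn by (auto simp: cx_def sg_def)
      moreover have "sg (j + 1) = 1" using False by (simp add: sg_def)
      ultimately show ?thesis using c False v(1)[of "tx i (j + 1)"] by simp
    qed
  qed
  have far: "minor i j * yd (j + 2) = vs (- sg j) (yd (j + 2) * minor i j)" if "j + 2 \<le> n"
    using yd_minor_far[of i j "j + 2"] that jn by (simp add: qc_def sg_def)
  have next_y: "yelt T form (j + 1) = yd (j + 1)" "udeg (yd (j + 1)) = dy (j + 1)" "zelt T form (j + 2) = zd (j + 2)"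
    if "j + 1 \<le> n" using that jn by (simp_all add: yelt_yd zelt_zd udeg_yd)
  have next2_y: "yelt T form (j + 2) = yd (j + 2)" if "j + 2 \<le> n" using that jn by (simp add: yelt_yd)
  have scal: "qvar powi e *\<^sub>q x = vs e x" "qvar *\<^sub>q x = vs 1 x" "inverse qvar *\<^sub>q x = vs (- 1) x" for e and x :: "'n uq"
    by (simp_all add: vs_def)
  show ?thesis
    unfolding Let_def Dj y z p d scal od_def[symmetric] ev_def[symmetric]
  proof (intro conjI)
    show "j + 1 \<le> n \<longrightarrow> (even j \<longrightarrow> yelt T form (j + 1) * minor i j
        = vs (- rform (udeg (yelt T form (j + 1))) (ev i j)) (minor i j * yelt T form (j + 1))
          + (qvar powi (- 1 - rform (dy (j - 1)) (ev i (j - 2))) * (inverse qvar - qvar)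
            *\<^sub>q (minor i (j - 2) * pd (j - 1) * zelt T form (j + 2)))) \<and>
      (odd j \<longrightarrow> yelt T form (j + 1) * minor i j = vs 1 (minor i j * yelt T form (j + 1))
          + (qvar powi (1 - rform (dy j) (ev i (j - 3))) * (qvar - inverse qvar)
            *\<^sub>q (minor i (j - 2) * pd (j - 1) * zelt T form (j + 2))))"
      using commute next_y by simp
    show "j + 2 \<le> n \<longrightarrow> (even j \<longrightarrow> minor i j * yelt T form (j + 2) = vs (- 1) (yelt T form (j + 2) * minor i j)) \<and>
      (odd j \<longrightarrow> minor i j * yelt T form (j + 2) = vs 1 (yelt T form (j + 2) * minor i j))"
      using far next2_y by (simp add: sg_def)
  qed (use recursions exchange in \<open>(fold od_def ev_def)?; blast\<close>)+
qed

end
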